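(* Let $\kappa\colon \mathbb{R}^n\to\mathbb{R}^n$ be a bounded smooth diffeomorphism, let $X_0,X_1$ be Banach spaces, let $m\in\mathbb{R}$, $\tau>0$, $\tau\notin\mathbb{N}$, and let $p\in C^\tau S^m_{1,0}(\mathbb{R}^n\times\mathbb{R}^n;\mathcal{L}(X_0,X_1))$. Then there is a $\widetilde p\in C^\tau S^m_{1,0}(\mathbb{R}^n\times\mathbb{R}^n;\mathcal{L}(X_0,X_1))$ such that $$\widetilde p(x,D_x)f(x)=\big(\kappa^{-1,*}\circ p(x,D_x)\circ\kappa^* f\big)(x)\qquad\text{for all }x\in\mathbb{R}^n,\ f\in\mathcal{S}(\mathbb{R}^n;X_0),$$ where $\kappa^*f:=f\circ\kappa$ and $\kappa^{-1,*}g:=g\circ\kappa^{-1}$.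
   Context: A smooth diffeomorphism $\kappa\colon\mathbb{R}^n\to\mathbb{R}^n$ is a bounded smooth diffeomorphism if all derivatives (of order at least one) of $\kappa$ and of $\kappa^{-1}$ are bounded. For a Banach space $X$ and $\tau>0$ with integer part $[\tau]$, $C^\tau(\mathbb{R}^n;X)$ is the space of $f\colon\mathbb{R}^n\to X$ whose derivatives $\partial^\beta f$, $|\beta|\le[\tau]$, are Hölder continuous of degree $\tau-[\tau]$, with norm $\|f\|_{C^\tau}=\sum_{|\beta|\le[\tau]}\|\partial^\beta f\|_{L^\infty}+\sum_{|\beta|=[\tau]}\sup_{z\ne y}\frac{\|\partial^\beta f(z)-\partial^\beta f(y)\|_X}{|z-y|^{\tau-[\tau]}}<\infty$. $\langle\xi\rangle:=(1+|\xi|^2)^{1/2}$. $C^\tau S^m_{1,0}(\mathbb{R}^n\times\mathbb{R}^n;X)$ is the set of all $p\colon\mathbb{R}^n\times\mathbb{R}^n\to X$, $(x,\xi)\mapsto p(x,\xi)$, smooth in $\xi$ and $C^\tau$ in $x$, such that for every multi-index $\alpha$ there is $C_\alpha$ with $\|\partial_\xi^\alpha p(\cdot,\xi)\|_{C^\tau(\mathbb{R}^n;X)}\le C_\alpha\langle\xi\rangle^{m-|\alpha|}$ for all $\xi\in\mathbb{R}^n$. $\mathcal{L}(X_0,X_1)$ is the space of bounded linear operators, $\mathcal{S}(\mathbb{R}^n;X_0)$ the $X_0$-valued Schwartz space. For $p\in C^\tau S^m_{1,0}(\mathbb{R}^n\times\mathbb{R}^n;\mathcal{L}(X_0,X_1))$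 and $u\in\mathcal{S}(\mathbb{R}^n;X_0)$, $(p(x,D_x)u)(x):=(2\pi)^{-n}\int_{\mathbb{R}^n}e^{ix\cdot\xi}p(x,\xi)\widehat u(\xi)\,d\xi$ with $\widehat u(\xi)=\int e^{-iy\cdot\xi}u(y)\,dy$. (For $f\in\mathcal{S}(\mathbb{R}^n;X_0)$ one has $f\circ\kappa\in\mathcal{S}(\mathbb{R}^n;X_0)$.) *)

theory Defs
  imports "HOL-Analysis.Analysis"
begin

section \<open>Complex Banach spaces and bounded complex-linear operators\<close>

text \<open>The distribution only has real Banach spaces; the Fourier transform needs complex scalars.\<close>

class complex_banach = banach +
  fixes scaleC :: "complex \<Rightarrow> 'a \<Rightarrow> 'a"  (infixr "*\<^sub>C" 75)
  assumes scaleC_add_right: "c *\<^sub>C (x + y) = c *\<^sub>C x + c *\<^sub>C y"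
    and scaleC_add_left: "(c + d) *\<^sub>C x = c *\<^sub>C x + d *\<^sub>C x"
    and scaleC_scaleC: "c *\<^sub>C d *\<^sub>C x = (c * d) *\<^sub>C x"
    and scaleC_of_real: "complex_of_real r *\<^sub>C x = r *\<^sub>R x"
    and norm_scaleC: "norm (c *\<^sub>C x) = cmod c * norm x"

instantiation complex :: complex_banach
begin

definition scaleC_complex :: "complex \<Rightarrow> complex \<Rightarrow> complex"
  where "scaleC_complex = (*)"

instance
  by standard
    (simp_all add: scaleC_complex_def algebra_simps norm_mult scaleR_conv_of_real)

end

text \<open>The space \<open>L(X\<^sub>0, X\<^sub>1)\<close>, as a closed subspace of the real Banach space of bounded
  real-linear maps; the operator norm is the same.\<close>

definition clinear_ops :: "('a::complex_banach \<Rightarrow>\<^sub>L 'b::complex_banach) set"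
  where "clinear_ops = {T. \<forall>c x. blinfun_apply T (c *\<^sub>C x) = c *\<^sub>C blinfun_apply T x}"

section \<open>Partial derivatives\<close>

definition partial_deriv ::
    "'n::finite \<Rightarrow> (real^'n \<Rightarrow> 'x::real_normed_vector) \<Rightarrow> real^'n \<Rightarrow> 'x"
  where "partial_deriv i f x = vector_derivative (\<lambda>t. f (x + t *\<^sub>R axis i 1)) (at 0)"

primrec iter_partial ::
    "'n::finite list \<Rightarrow> (real^'n \<Rightarrow> 'x::real_normed_vector) \<Rightarrow> real^'n \<Rightarrow> 'x"
  where
    "iter_partial [] f = f"
  | "iter_partial (i # is) f = partial_deriv i (iter_partial is f)"

text \<open>\<open>C\<^sup>k\<close>: all iterated partial derivatives up to order \<open>k\<close>, in every order, exist and are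
  continuous.\<close>

definition C_k :: "nat \<Rightarrow> (real^'n::finite \<Rightarrow> 'x::real_normed_vector) \<Rightarrow> bool"
  where "C_k k f \<longleftrightarrow>
    (\<forall>is i x. length is < k \<longrightarrow>
       (\<lambda>t. iter_partial is f (x + t *\<^sub>R axis i 1)) differentiable (at 0)) \<and>
    (\<forall>is. length is \<le> k \<longrightarrow> continuous_on UNIV (iter_partial is f))"

definition smooth :: "(real^'n::finite \<Rightarrow> 'x::real_normed_vector) \<Rightarrow> bool"
  where "smooth f \<longleftrightarrow> (\<forall>k. C_k k f)"

type_synonym 'n multi_index = "'n \<Rightarrow> nat"

definition mi_order :: "'n::finite multi_index \<Rightarrow> nat"
  where "mi_order \<beta> = (\<Sum>i\<in>UNIV. \<beta> i)"

text \<open>\<open>\<partial>\<^sup>\<beta>\<close> differentiates \<open>\<beta> i\<close> times in direction \<open>i\<close>. The index type carries no order, so some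
  order of differentiation is chosen; the choice is irrelevant for functions of class \<open>C\<^sup>k\<close> with
  \<open>k \<ge> |\<beta>|\<close>, and \<open>\<partial>\<^sup>\<beta>\<close> is only applied to these.\<close>

definition mderiv ::
    "'n::finite multi_index \<Rightarrow> (real^'n \<Rightarrow> 'x::real_normed_vector) \<Rightarrow> real^'n \<Rightarrow> 'x"
  where "mderiv \<beta> = iter_partial (SOME is. \<forall>i. count_list is i = \<beta> i)"

lemma ex_list_of_multi_index:
  fixes \<beta> :: "'n::finite multi_index"
  shows "\<exists>is. \<forall>i. count_list is i = \<beta> i"
proof -
  have "finite {i. \<beta> i > 0}" by simp
  then obtain "is" where "mset is = Abs_multiset \<beta>"
    using ex_mset by blast
  then have "count (mset is) i = \<beta> i" for i
    by (simp add: Abs_multiset_inverse)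
  then show ?thesis
    by (metis count_mset)
qed

lemma finite_multi_indices: "finite {\<beta> :: 'n::finite multi_index. mi_order \<beta> \<le> k}"
proof (rule finite_subset)
  show "{\<beta> :: 'n multi_index. mi_order \<beta> \<le> k} \<subseteq> UNIV \<rightarrow>\<^sub>E {..k}"
  proof
    fix \<beta> :: "'n multi_index"
    assume "\<beta> \<in> {\<beta>. mi_order \<beta> \<le> k}"
    moreover have "\<beta> i \<le> mi_order \<beta>" for i
      unfolding mi_order_def by (rule member_le_sum) auto
    ultimately have "\<beta> i \<le> k" for i
      using le_trans by blast
    then show "\<beta> \<in> UNIV \<rightarrow>\<^sub>E {..k}"
      by (simp add: PiE_iff)
  qed
  show "finite ((UNIV :: 'n set) \<rightarrow>\<^sub>E {..k})"
    by (intro finite_PiE) auto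
qed

section \<open>Bounded smooth diffeomorphisms\<close>

definition bounded_smooth_diffeo :: "(real^'n::finite \<Rightarrow> real^'n) \<Rightarrow> bool"
  where "bounded_smooth_diffeo \<kappa> \<longleftrightarrow>
    bij \<kappa> \<and> smooth \<kappa> \<and> smooth (inv \<kappa>) \<and>
    (\<forall>\<beta>. mi_order \<beta> \<ge> 1 \<longrightarrow>
       bounded (range (mderiv \<beta> \<kappa>)) \<and> bounded (range (mderiv \<beta> (inv \<kappa>))))"

definition pullback :: "('a \<Rightarrow> 'b) \<Rightarrow> ('b \<Rightarrow> 'c) \<Rightarrow> 'a \<Rightarrow> 'c"
  where "pullback \<kappa> f = f \<circ> \<kappa>"

section \<open>Hoelder spaces\<close>

definition holder_continuous ::
    "real \<Rightarrow> (real^'n::finite \<Rightarrow> 'x::real_normed_vector) \<Rightarrow> bool"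
  where "holder_continuous \<theta> g \<longleftrightarrow>
    (\<exists>C. \<forall>z y. z \<noteq> y \<longrightarrow> norm (g z - g y) \<le> C * norm (z - y) powr \<theta>)"

text \<open>The norm takes the value \<open>\<infinity>\<close> when one of the suprema is infinite.\<close>

definition holder_norm ::
    "real \<Rightarrow> (real^'n::finite \<Rightarrow> 'x::real_normed_vector) \<Rightarrow> ennreal"
  where "holder_norm \<tau> f =
    (\<Sum>\<beta> | mi_order \<beta> \<le> nat \<lfloor>\<tau>\<rfloor>. SUP x. ennreal (norm (mderiv \<beta> f x))) +
    (\<Sum>\<beta> | mi_order \<beta> = nat \<lfloor>\<tau>\<rfloor>. SUP (z, y) \<in> {(z, y). z \<noteq> y}.
       ennreal (norm (mderiv \<beta> f z - mderiv \<beta> f y) / norm (z - y) powr (\<tau> - \<lfloor>\<tau>\<rfloor>)))"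

definition holder_space :: "real \<Rightarrow> (real^'n::finite \<Rightarrow> 'x::real_normed_vector) set"
  where "holder_space \<tau> = {f.
    C_k (nat \<lfloor>\<tau>\<rfloor>) f \<and>
    (\<forall>\<beta>. mi_order \<beta> \<le> nat \<lfloor>\<tau>\<rfloor> \<longrightarrow> holder_continuous (\<tau> - \<lfloor>\<tau>\<rfloor>) (mderiv \<beta> f)) \<and>
    holder_norm \<tau> f < \<infinity>}"

section \<open>Symbols and pseudodifferential operators\<close>

definition japanese_bracket :: "real^'n::finite \<Rightarrow> real"
  where "japanese_bracket \<xi> = sqrt (1 + (norm \<xi>)\<^sup>2)"

text \<open>\<open>C\<^sup>\<tau> S\<^sup>m\<^bsub>1,0\<^esub>\<close> with values in a (closed) subspace \<open>X\<close> of a normed space.\<close>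

definition holder_symbols ::
    "real \<Rightarrow> real \<Rightarrow> 'x::real_normed_vector set \<Rightarrow> (real^'n::finite \<Rightarrow> real^'n \<Rightarrow> 'x) set"
  where "holder_symbols \<tau> m X = {p.
    (\<forall>x \<xi>. p x \<xi> \<in> X) \<and>
    (\<forall>x. smooth (p x)) \<and>
    (\<forall>\<alpha> \<xi>. (\<lambda>x. mderiv \<alpha> (p x) \<xi>) \<in> holder_space \<tau>) \<and>
    (\<forall>\<alpha>. \<exists>C. \<forall>\<xi>. holder_norm \<tau> (\<lambda>x. mderiv \<alpha> (p x) \<xi>)
       \<le> ennreal (C * japanese_bracket \<xi> powr (m - mi_order \<alpha>)))}"

definition schwartz_space :: "(real^'n::finite \<Rightarrow> 'x::real_normed_vector) set"
  where "schwartz_space = {u. smooth u \<and>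
    (\<forall>k \<beta>. bounded (range (\<lambda>x. japanese_bracket x ^ k *\<^sub>R mderiv \<beta> u x)))}"

text \<open>The Bochner integral of the library is restricted to separable spaces; the integrals below
  are therefore Henstock--Kurzweil integrals. They agree with the Bochner integrals, because for
  Schwartz functions and symbols the integrands are continuous and rapidly decreasing.\<close>

definition fourier :: "(real^'n::finite \<Rightarrow> 'x::complex_banach) \<Rightarrow> real^'n \<Rightarrow> 'x"
  where "fourier u \<xi> = integral UNIV (\<lambda>y. cis (- (y \<bullet> \<xi>)) *\<^sub>C u y)"

definition pdo ::
    "(real^'n::finite \<Rightarrow> real^'n \<Rightarrow> 'a::complex_banach \<Rightarrow>\<^sub>L 'b::complex_banach) \<Rightarrow>
     (real^'n \<Rightarrow> 'a) \<Rightarrow> real^'n \<Rightarrow> 'b"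
  where "pdo p u x = inverse ((2 * pi) ^ CARD('n)) *\<^sub>R
    integral UNIV (\<lambda>\<xi>. cis (x \<bullet> \<xi>) *\<^sub>C blinfun_apply (p x \<xi>) (fourier u \<xi>))"

end

theory Submission
  imports Defs "HOL-Probability.Sinc_Integral"
begin

text \<open>With \<open>y = \<kappa>\<^sup>-\<^sup>1(x)\<close>, Fourier inversion gives the transformed symbol as the oscillatory integral
  \<open>q(x, \<xi>) = (2\<pi>)\<^sup>-\<^sup>n \<integral>\<integral> exp (i (\<kappa>(y + w) - \<kappa>(y)) \<cdot> \<xi> - i w \<cdot> \<eta>) p(y, \<eta>) dw d\<eta>\<close>. No asymptotic expansion is needed:
  a \<open>\<xi>\<close>-derivative of such an integral brings down \<open>\<kappa>(y + w) - \<kappa>(y) = \<Sum> w\<^sub>j g\<^sub>j(y, w)\<close>, and \<open>w\<^sub>j\<close> turns into a derivative of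
  \<open>p\<close> in \<open>\<eta>\<close>, so that the integrals with an additional bounded amplitude \<open>\<rho>(y, w)\<close> are stable under differentiation and
  only their size has to be estimated. For large \<open>m\<close> a crude estimate, regularised at the scale \<open>1 / \<langle>\<xi>\<rangle>\<close>, yields
  \<open>\<langle>\<xi>\<rangle>\<^sup>m\<close>; writing \<open>\<xi>\<^sub>j exp (i \<kappa>(y + w) \<cdot> \<xi>)\<close> as a combination of \<open>w\<close>-derivatives shows that the estimate for the order
  \<open>m + 1\<close> implies that for \<open>m\<close>. The regularity in \<open>x\<close> follows in the same way, since a \<open>y\<close>-derivative of the phase costs a factor
  \<open>\<xi>\<^sub>j\<close> and gains a factor \<open>w\<^sub>i\<close>.\<close>

section \<open>Integrals over Euclidean spaces\<close>

text \<open>The integral does not converge absolutely: the symbol may grow in \<eta>, and the phase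
  factor does not decay in \<open>w\<close>. Four factors \<open>1 / (1 + i R w_b)\<close> per
  coordinate give decay in \<open>w\<close>; smoothness in \<open>w\<close> gives decay in \<eta>.
  For \<open>R\<close> equal to the bracket of \<xi>, a \<open>w\<close>-derivative costs
  \<open>R\<close> both in the phase factor and in these factors. The regularised amplitude thus
  lives on \<open>|w|\<close> of size \<open>1 / R\<close>, its Fourier transform has size
  \<open>R^-n\<close> on \<open>|\<eta>|\<close> up to \<open>R\<close> (\<open>n\<close> the
  dimension), and integrating a symbol of order \<open>m\<close> against it gives
  \<open>R^m\<close>. The compensating operators \<open>1 + R \<partial>_b\<close> produce terms
  \<open>R^j \<langle>\<eta>\<rangle>^(m-j)\<close>, which stay below
  \<open>(R + |\<eta>|)^m\<close> only for \<open>j \<le> m\<close>. With \<open>4 n\<close>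
  operators this forces \<open>m \<ge> 4 n\<close>, hence the descent in the order. All estimates
  are made for families and are uniform up to a weight of each member. A difference
  \<open>a(y) - a(y')\<close> is a member with weight \<open>|y - y'|^\<theta>\<close>, so Hoelder
  seminorms are instances of the same estimates. The variable \<open>y\<close>, in which the symbol
  is merely Hoelder, is always a parameter and never integrated.\<close>

lemma has_integral_affinity_UNIV:
  fixes f :: "'a::euclidean_space \<Rightarrow> 'b::banach"
  assumes f: "(f has_integral i) UNIV" and m: "m > 0"
  shows "((\<lambda>x. f (m *\<^sub>R x + c)) has_integral (i /\<^sub>R m ^ DIM('a))) UNIV"
  unfolding has_integral_alt'
proof (intro conjI allI impI)
  have box: "((\<lambda>x. f (m *\<^sub>R x + c)) has_integral
      (integral (cbox (m *\<^sub>R a + c) (m *\<^sub>R b + c)) f /\<^sub>R m ^ DIM('a))) (cbox a b)" for a b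
  proof -
    have "f integrable_on cbox (m *\<^sub>R a + c) (m *\<^sub>R b + c)"
      using f by (meson has_integral_alt' has_integral_integrable integrable_on_subcbox subset_UNIV)
    from has_integral_affinity'[OF integrable_integral[OF this] m, of c]
    show ?thesis using m by (simp add: algebra_simps)
  qed
  show "(\<lambda>x. if x \<in> UNIV then f (m *\<^sub>R x + c) else 0) integrable_on cbox a b" for a b
    using box by auto
  fix e :: real assume e: "e > 0"
  then have "e * m ^ DIM('a) > 0" using m by simp
  with f obtain B where B: "B > 0" "\<And>a b. ball 0 B \<subseteq> cbox a b \<Longrightarrow>
     norm (integral (cbox a b) f - i) < e * m ^ DIM('a)"
    unfolding has_integral_alt' by force
  show "\<exists>B>0. \<forall>a b. ball 0 B \<subseteq> cbox a b \<longrightarrow>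
      norm (integral (cbox a b) (\<lambda>x. if x \<in> UNIV then f (m *\<^sub>R x + c) else 0) - i /\<^sub>R m ^ DIM('a)) < e"
  proof (intro exI conjI allI impI)
    \<comment> \<open>The map \<open>x \<mapsto> m x + c\<close> sends the ball of this radius onto
      a ball about \<open>c\<close> of radius \<open>B + |c|\<close>, which contains
      \<open>ball 0 B\<close>.\<close>
    show "(B + norm c) / m > 0" using B m by (simp add: add_pos_nonneg)
    fix a b :: 'a assume sub: "ball 0 ((B + norm c) / m) \<subseteq> cbox a b"
    have "ball 0 B \<subseteq> cbox (m *\<^sub>R a + c) (m *\<^sub>R b + c)"
    proof
      fix x :: 'a assume "x \<in> ball 0 B"
      then have "norm (x - c) < B + norm c"
        by (metis add.commute add_less_cancel_left dist_0_norm mem_ball norm_minus_commute norm_triangle_ineq4 order_le_less_trans)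
      then have "(x - c) /\<^sub>R m \<in> ball 0 ((B + norm c) / m)"
        using m by (simp add: divide_inverse mult.commute)
      with sub have "(x - c) /\<^sub>R m \<in> cbox a b" by blast
      then have "a \<bullet> k \<le> (x - c) \<bullet> k / m \<and> (x - c) \<bullet> k / m \<le> b \<bullet> k" if "k \<in> Basis" for k
        using that by (auto simp: mem_box divide_inverse mult.commute)
      then show "x \<in> cbox (m *\<^sub>R a + c) (m *\<^sub>R b + c)"
        using m by (auto simp: mem_box field_simps inner_diff_left inner_add_left)
    qed
    from B(2)[OF this] have "norm ((integral (cbox (m *\<^sub>R a + c) (m *\<^sub>R b + c)) f - i) /\<^sub>R m ^ DIM('a)) < e"
      using m by (simp add: divide_inverse[symmetric] pos_divide_less_eq mult.commute[of "inverse _"])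
    then show "norm (integral (cbox a b) (\<lambda>x. if x \<in> UNIV then f (m *\<^sub>R x + c) else 0) - i /\<^sub>R m ^ DIM('a)) < e"
      using box[of a b] by (simp add: integral_unique algebra_simps)
  qed
qed

lemma integral_translate:
  fixes f :: "'a::euclidean_space \<Rightarrow> 'b::banach"
  assumes f: "f integrable_on UNIV"
  shows "(\<lambda>x. f (x + c)) integrable_on UNIV" "integral UNIV (\<lambda>x. f (x + c)) = integral UNIV f"
  using has_integral_affinity_UNIV[OF integrable_integral[OF f], of 1 c]
  by (auto simp: integral_unique)

lemma integrable_dominated:
  fixes f :: "'a::euclidean_space \<Rightarrow> 'b::banach"
  assumes "continuous_on UNIV f" "\<And>x. norm (f x) \<le> g x" "g integrable_on UNIV"
  shows "f integrable_on UNIV"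
  using assms integrable_on_all_intervals_UNIV[of f g]
  by (meson continuous_on_subset integrable_continuous subset_UNIV)

lemma norm_integral_le:
  fixes f :: "'a::euclidean_space \<Rightarrow> 'b::banach"
  assumes "continuous_on UNIV f" "\<And>x. norm (f x) \<le> g x" "g integrable_on UNIV"
  shows "norm (integral UNIV f) \<le> integral UNIV g"
  using assms by (intro integral_norm_bound_integral integrable_dominated[OF assms]) auto

text \<open>Reduces to real-valued functions: \<open>norm (f k x - l x)\<close> is dominated by
  \<open>2 * g x\<close> and tends to \<open>0\<close>, and its integral bounds the norm of the
  difference of the integrals. Continuity supplies the integrability on boxes.\<close>

lemma dominated_convergence_banach:
  fixes f :: "nat \<Rightarrow> 'a::euclidean_space \<Rightarrow> 'b::banach"
  assumes c: "\<And>k. continuous_on UNIV (f k)" "continuous_on UNIV l"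
    and b: "\<And>k x. norm (f k x) \<le> g x" and g: "g integrable_on UNIV"
    and lim: "\<And>x. (\<lambda>k. f k x) \<longlonglongrightarrow> l x"
  shows "(\<lambda>k. integral UNIV (f k)) \<longlonglongrightarrow> integral UNIV l"
proof -
  have bl: "norm (l x) \<le> g x" for x
    using Lim_bounded[OF tendsto_norm[OF lim[of x]], of 0 "g x"] b by auto
  have i: "f k integrable_on UNIV" "l integrable_on UNIV" for k
    using integrable_dominated[OF c(1) b g] integrable_dominated[OF c(2) bl g] by auto
  have ci: "continuous_on UNIV (\<lambda>x. norm (f k x - l x))" for k
    by (intro continuous_intros c)
  have b2: "norm (norm (f k x - l x)) \<le> 2 * g x" for k x
    using norm_triangle_ineq4[of "f k x" "l x"] b[of k x] bl[of x] by simp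
  have g2: "(\<lambda>x. 2 * g x) integrable_on UNIV"
    using g by (rule integrable_on_mult_right)
  have in2: "(\<lambda>x. norm (f k x - l x)) integrable_on UNIV" for k
    by (rule integrable_dominated[OF ci b2 g2])
  have "(\<lambda>k. integral UNIV (\<lambda>x. norm (f k x - l x))) \<longlonglongrightarrow> integral UNIV (\<lambda>x::'a. 0::real)"
  proof (rule dominated_convergence(2)[OF in2 g2 b2])
    show "(\<lambda>k. norm (f k x - l x)) \<longlonglongrightarrow> 0" for x
      using tendsto_norm_zero[OF Lim_transform_eq[THEN iffD1, OF _ tendsto_const]] lim[of x]
      by (metis LIM_zero tendsto_norm_zero)
  qed
  then have "(\<lambda>k. integral UNIV (\<lambda>x. norm (f k x - l x))) \<longlonglongrightarrow> 0" by simp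
  then have z: "(\<lambda>k. integral UNIV (\<lambda>x. norm (f k x - l x))) \<longlonglongrightarrow> 0" .
  have le: "norm (integral UNIV (f k) - integral UNIV l) \<le> integral UNIV (\<lambda>x. norm (f k x - l x))" for k
    using integral_norm_bound_integral[OF integrable_diff[OF i] in2, of k k] integral_diff[OF i, of k] by simp
  have "(\<lambda>k. integral UNIV (f k) - integral UNIV l) \<longlonglongrightarrow> 0"
    by (rule Lim_null_comparison[OF always_eventually z]) (use le in blast)
  then show ?thesis by (simp add: LIM_zero_cancel)
qed

lemma continuous_on_integral_param:
  fixes f :: "'s::metric_space \<Rightarrow> 'a::euclidean_space \<Rightarrow> 'b::banach"
  assumes c: "\<And>s. s \<in> S \<Longrightarrow> continuous_on UNIV (f s)"
    and cs: "\<And>x. continuous_on S (\<lambda>s. f s x)"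
    and b: "\<And>s x. s \<in> S \<Longrightarrow> norm (f s x) \<le> g x" and g: "g integrable_on UNIV"
  shows "continuous_on S (\<lambda>s. integral UNIV (f s))"
  unfolding continuous_on_sequentially
proof (intro allI impI ballI, elim conjE)
  fix u a assume a: "a \<in> S" "\<forall>n. u n \<in> S" "u \<longlonglongrightarrow> a"
  have "(\<lambda>k. integral UNIV (f (u k))) \<longlonglongrightarrow> integral UNIV (f a)"
  proof (rule dominated_convergence_banach[OF _ _ _ g])
    show "(\<lambda>k. f (u k) x) \<longlonglongrightarrow> f a x" for x
      using cs[of x] a unfolding continuous_on_sequentially comp_def by blast
  qed (use a c b in auto)
  then show "((\<lambda>s. integral UNIV (f s)) \<circ> u) \<longlonglongrightarrow> integral UNIV (f a)" by (simp add: o_def)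
qed

lemma has_vector_derivative_at0_iff:
  fixes f :: "real \<Rightarrow> 'b::real_normed_vector"
  shows "(f has_vector_derivative D) (at 0) \<longleftrightarrow> ((\<lambda>s. (f s - f 0) /\<^sub>R s) \<longlongrightarrow> D) (at 0)"
proof -
  have *: "norm (f h - f 0 - h *\<^sub>R D) / norm h = norm ((f h - f 0) /\<^sub>R h - D)" if "h \<noteq> 0" for h :: real
  proof -
    have "(f h - f 0) /\<^sub>R h - D = (f h - f 0 - h *\<^sub>R D) /\<^sub>R h"
      using that by (simp add: scaleR_diff_right)
    then show ?thesis by (simp add: divide_inverse mult.commute)
  qed
  have "(f has_vector_derivative D) (at 0) \<longleftrightarrow> (\<lambda>h. norm (f h - f 0 - h *\<^sub>R D) / norm h) \<midarrow>0\<rightarrow> 0"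
    by (simp add: has_vector_derivative_def has_derivative_at bounded_linear_scaleR_left)
  also have "\<dots> \<longleftrightarrow> (\<lambda>h. norm ((f h - f 0) /\<^sub>R h - D)) \<midarrow>0\<rightarrow> 0"
    by (rule filterlim_cong) (simp_all add: eventually_at * [simplified real_norm_def] exI[of _ 1])
  also have "\<dots> \<longleftrightarrow> ((\<lambda>s. (f s - f 0) /\<^sub>R s) \<longlongrightarrow> D) (at 0)"
    unfolding tendsto_norm_zero_iff LIM_zero_iff by simp
  finally show ?thesis .
qed

text \<open>Directional derivatives are given at parameter \<open>0\<close> and for every base
  point; moving the base point transfers them to any other parameter.\<close>

lemma has_vector_derivative_line:
  fixes F :: "'a::real_normed_vector \<Rightarrow> 'b::real_normed_vector"
  assumes "((\<lambda>t. F (x + s *\<^sub>R b + t *\<^sub>R b)) has_vector_derivative D) (at 0)"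
  shows "((\<lambda>t. F (x + t *\<^sub>R b)) has_vector_derivative D) (at s)"
proof -
  have "((\<lambda>t. t - s) has_vector_derivative 1) (at s)"
    by (auto intro!: derivative_eq_intros)
  from vector_diff_chain_at[OF this, of "\<lambda>t. F (x + s *\<^sub>R b + t *\<^sub>R b)" D] assms
  show ?thesis by (simp add: o_def algebra_simps)
qed

text \<open>By the mean value inequality the difference quotients inherit the bound \<open>g\<close>
  of the derivative, and dominated convergence applies along every sequence of increments.\<close>

lemma integral_vector_derivative:
  fixes F :: "real \<Rightarrow> 'a::euclidean_space \<Rightarrow> 'b::banach"
  assumes e: "e > 0"
    and d: "\<And>s x. \<bar>s\<bar> < e \<Longrightarrow> ((\<lambda>s. F s x) has_vector_derivative F' s x) (at s)"
    and c: "\<And>s. \<bar>s\<bar> < e \<Longrightarrow> continuous_on UNIV (F s)" "continuous_on UNIV (F' 0)"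
    and i: "\<And>s. \<bar>s\<bar> < e \<Longrightarrow> F s integrable_on UNIV"
    and b: "\<And>s x. \<bar>s\<bar> < e \<Longrightarrow> norm (F' s x) \<le> g x" and g: "g integrable_on UNIV"
  shows "((\<lambda>s. integral UNIV (F s)) has_vector_derivative integral UNIV (F' 0)) (at 0)"
proof -
  define Q where "Q s x = (F s x - F 0 x) /\<^sub>R s" for s x
  have q: "norm (Q s x) \<le> g x" if "\<bar>s\<bar> < e" for s x
  proof -
    have "norm (F s x - F 0 x) \<le> g x * norm (s - 0)"
    proof (rule differentiable_bound[of "{-e<..<e}" "\<lambda>s. F s x" "\<lambda>s h. h *\<^sub>R F' s x"])
      show "((\<lambda>s. F s x) has_derivative (\<lambda>h. h *\<^sub>R F' t x)) (at t within {- e<..<e})"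
        if "t \<in> {-e<..<e}" for t
        using d[of t x] that unfolding has_vector_derivative_def
        by (auto intro: has_derivative_at_withinI)
      show "onorm (\<lambda>h. h *\<^sub>R F' t x) \<le> g x" if "t \<in> {-e<..<e}" for t
        using b[of t x] that by (intro onorm_le) (auto simp: mult.commute intro: mult_left_mono)
    qed (use that e in auto)
    moreover have "g x \<ge> 0" using order_trans[OF norm_ge_zero b[of 0 x]] e by simp
    ultimately show ?thesis unfolding Q_def
      by (cases "s = 0") (simp_all add: pos_divide_le_eq divide_inverse[symmetric] mult.commute[of "inverse _"])
  qed
  have lim: "((\<lambda>s. integral UNIV (Q s)) \<longlongrightarrow> integral UNIV (F' 0)) (at 0)"
    unfolding tendsto_at_iff_sequentially
  proof (intro allI impI)
    fix u :: "nat \<Rightarrow> real" assume u: "\<forall>i. u i \<in> UNIV - {0}" "u \<longlonglongrightarrow> 0"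
    then obtain N where N: "\<And>n. n \<ge> N \<Longrightarrow> \<bar>u n\<bar> < e"
      using e LIMSEQ_D[OF u(2) e] by (metis diff_zero real_norm_def)
    \<comment> \<open>The quotients are controlled only for increments below \<open>e\<close>; the
      shift by \<open>N\<close> discards the earlier ones.\<close>
    have "(\<lambda>k. integral UNIV (Q (u (k + N)))) \<longlonglongrightarrow> integral UNIV (F' 0)"
    proof (rule dominated_convergence_banach[OF _ c(2) _ g])
      show "continuous_on UNIV (Q (u (k + N)))" for k
        unfolding Q_def using N[of "k + N"] e by (intro continuous_intros c) auto
      show "norm (Q (u (k + N)) x) \<le> g x" for k x using q N by auto
      show "(\<lambda>k. Q (u (k + N)) x) \<longlonglongrightarrow> F' 0 x" for x
      proof -
        have "((\<lambda>s. Q s x) \<longlongrightarrow> F' 0 x) (at 0)"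
          using d[of 0 x] e by (simp add: has_vector_derivative_at0_iff Q_def)
        moreover have "(\<lambda>k. u (k + N)) \<longlonglongrightarrow> 0" using u(2) by (rule LIMSEQ_ignore_initial_segment)
        ultimately show ?thesis
          using u(1) unfolding tendsto_at_iff_sequentially comp_def by auto
      qed
    qed
    then show "((\<lambda>s. integral UNIV (Q s)) \<circ> u) \<longlonglongrightarrow> integral UNIV (F' 0)"
      unfolding comp_def by (rule LIMSEQ_offset)
  qed
  have eq: "\<forall>\<^sub>F s in at 0. integral UNIV (Q s) = (integral UNIV (F s) - integral UNIV (F 0)) /\<^sub>R s"
  proof -
    have "\<forall>\<^sub>F s::real in at 0. \<bar>s\<bar> < e" using e
      by (auto simp: eventually_at intro!: exI[of _ e])
    then show ?thesis
      by eventually_elim (use e integral_diff[OF i i[of 0]] in \<open>simp add: Q_def[abs_def]\<close>)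
  qed
  show ?thesis
    using Lim_transform_eventually[OF lim eq] by (simp add: has_vector_derivative_at0_iff)
qed

section \<open>An integrable product weight; vanishing integrals of derivatives and Fubini's theorem
  on the whole space\<close>

lemma nonneg_of_mult: "0 \<le> c * w \<Longrightarrow> 0 < w \<Longrightarrow> 0 \<le> (c::real)"
  by (simp add: zero_le_mult_iff)

text \<open>A product over the coordinates, so that its integral factors into one-dimensional ones.
  It is also the modulus of the product of the \<open>1 / (1 + i x_b)^2\<close>, which ties it to
  the regularising factors used for oscillatory integrals.\<close>

definition wt :: "'e::euclidean_space \<Rightarrow> real"
  where "wt x = (\<Prod>b\<in>Basis. inverse (1 + (x \<bullet> b)\<^sup>2))"

lemma one_plus_square_pos [simp]: "0 < 1 + (t::real)\<^sup>2"
  by (simp add: add_pos_nonneg)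

lemma wt_pos [simp]: "0 < wt x" and wt_nonneg [simp]: "0 \<le> wt x"
  unfolding wt_def by (auto intro!: prod_pos prod_nonneg simp: less_imp_le)

lemma wt_le_1 [simp]: "wt x \<le> 1"
  unfolding wt_def by (rule prod_le_1) (auto intro: inverse_le_1_iff[THEN iffD2] simp: less_imp_le)

lemma continuous_on_wt: "continuous_on S wt"
  unfolding wt_def[abs_def] by (intro continuous_intros) (simp add: less_imp_neq[symmetric])

lemma integrable_wt: "(wt :: 'e::euclidean_space \<Rightarrow> real) integrable_on UNIV"
proof (rule nn_integral_integrable_on)
  show "wt \<in> borel_measurable borel"
    by (rule borel_measurable_continuous_onI[OF continuous_on_wt])
  have "integrable lborel (\<lambda>x::real. inverse (1 + x\<^sup>2))"
    using integrable_inverse_1_plus_square by (simp add: set_integrable_def)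
  then have "(\<integral>\<^sup>+x. ennreal (inverse (1 + x\<^sup>2)) \<partial>lborel) < \<infinity>"
    by (simp add: integrable_iff_bounded)
  moreover have "(\<integral>\<^sup>+x. ennreal (wt x) \<partial>(lborel :: 'e measure)) = (\<Prod>b\<in>(Basis::'e set). (\<integral>\<^sup>+x. ennreal (inverse (1 + x\<^sup>2)) \<partial>lborel))"
    unfolding wt_def by (subst nn_integral_lborel_prod[symmetric])
      (auto simp: prod_ennreal less_imp_le)
  ultimately show "(\<integral>\<^sup>+x. ennreal (wt x) \<partial>(lborel :: 'e measure)) < \<infinity>"
    by (simp add: prod_constant power_less_top_ennreal)
qed simp

lemma integrable_wt_scaled:
  assumes "r > 0"
  shows "(\<lambda>x::'e::euclidean_space. wt (r *\<^sub>R x)) integrable_on UNIV"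
    "integral UNIV (\<lambda>x::'e. wt (r *\<^sub>R x)) = integral UNIV (wt :: 'e \<Rightarrow> real) / r ^ DIM('e)"
  using has_integral_affinity_UNIV[OF integrable_integral[OF integrable_wt[where 'e='e]] assms, of 0]
  by (auto simp: integral_unique divide_inverse mult.commute)

text \<open>Lets a multiple of the weight dominate all translates by at most \<open>1\<close> along
  an axis. The constant comes from \<open>x^2 \<le> 2 (x + t)^2 + 2 t^2\<close> together with
  \<open>t^2 \<le> 1\<close>.\<close>

lemma wt_shift:
  fixes x :: "'e::euclidean_space"
  assumes b: "b \<in> Basis" and t: "\<bar>t\<bar> \<le> 1"
  shows "wt (x + t *\<^sub>R b) \<le> 3 * wt x"
proof -
  have eq: "wt y = inverse (1 + (y \<bullet> b)\<^sup>2) * (\<Prod>c\<in>Basis - {b}. inverse (1 + (y \<bullet> c)\<^sup>2))" for y :: 'e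
    unfolding wt_def using b by (simp add: prod.remove)
  have same: "(\<Prod>c\<in>Basis - {b}. inverse (1 + ((x + t *\<^sub>R b) \<bullet> c)\<^sup>2)) = (\<Prod>c\<in>Basis - {b}. inverse (1 + (x \<bullet> c)\<^sup>2))"
    using b by (intro prod.cong refl) (auto simp: inner_add_left inner_not_same_Basis)
  have "1 + (x \<bullet> b)\<^sup>2 \<le> 3 * (1 + (x \<bullet> b + t)\<^sup>2)"
  proof -
    have "0 \<le> (x \<bullet> b + 2 * t)\<^sup>2" "t\<^sup>2 \<le> 1" using t by (simp_all add: abs_square_le_1)
    then have "(x \<bullet> b)\<^sup>2 \<le> 2 * (x \<bullet> b + t)\<^sup>2 + 2 * t\<^sup>2" by (simp add: power2_eq_square algebra_simps)
    moreover have "2 * (x \<bullet> b + t)\<^sup>2 \<le> 3 * (x \<bullet> b + t)\<^sup>2" by simp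
    ultimately show ?thesis using \<open>t\<^sup>2 \<le> 1\<close> unfolding distrib_left by linarith
  qed
  then have "inverse (1 + ((x + t *\<^sub>R b) \<bullet> b)\<^sup>2) \<le> 3 * inverse (1 + (x \<bullet> b)\<^sup>2)"
    using b by (simp add: inner_add_left inner_same_Basis field_simps)
  then show ?thesis unfolding eq[of x] eq[of "x + t *\<^sub>R b"] same mult.assoc[symmetric]
    by (rule mult_right_mono) (intro prod_nonneg ballI, simp add: less_imp_le)
qed

text \<open>The integral of the translate \<open>F (x + s b)\<close> does not depend on
  \<open>s\<close>, and differentiating it under the integral sign at \<open>s = 0\<close> yields
  the integral of \<open>F'\<close>. All integrations by parts below rest on this.\<close>

lemma integral_partial_derivative_zero:
  fixes F :: "'e::euclidean_space \<Rightarrow> 'b::banach"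
  assumes b: "b \<in> Basis"
    and d: "\<And>x. ((\<lambda>t. F (x + t *\<^sub>R b)) has_vector_derivative F' x) (at 0)"
    and c: "continuous_on UNIV F" "continuous_on UNIV F'"
    and B: "\<And>x. norm (F x) \<le> C * wt x" "\<And>x. norm (F' x) \<le> C * wt x"
  shows "integral UNIV F' = 0"
proof -
  have C: "C \<ge> 0" by (rule nonneg_of_mult[OF order_trans[OF norm_ge_zero B(1)[of 0]] wt_pos])
  have i: "F integrable_on UNIV"
    by (rule integrable_dominated[OF c(1) B(1)]) (intro integrable_on_mult_right integrable_wt)
  have "((\<lambda>s. integral UNIV (\<lambda>x. F (x + s *\<^sub>R b))) has_vector_derivative integral UNIV (\<lambda>x. F' (x + 0 *\<^sub>R b))) (at 0)"
  proof (rule integral_vector_derivative[where e=1 and F' = "\<lambda>s x. F' (x + s *\<^sub>R b)" and g="\<lambda>x. 3 * C * wt x"])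
    fix s :: real assume s: "\<bar>s\<bar> < 1"
    show "((\<lambda>s. F (x + s *\<^sub>R b)) has_vector_derivative F' (x + s *\<^sub>R b)) (at s)" for x
      by (rule has_vector_derivative_line[OF d])
    show "continuous_on UNIV (\<lambda>x. F (x + s *\<^sub>R b))"
      by (intro continuous_on_compose2[OF c(1)] continuous_intros) auto
    show "(\<lambda>x. F (x + s *\<^sub>R b)) integrable_on UNIV"
      by (rule integral_translate[OF i])
    show "norm (F' (x + s *\<^sub>R b)) \<le> 3 * C * wt x" for x
      using order_trans[OF B(2)[of "x + s *\<^sub>R b"] mult_left_mono[OF wt_shift[OF b, of s x] C]] s by simp
  next
    show "continuous_on UNIV (\<lambda>x. F' (x + 0 *\<^sub>R b))" using c(2) by simp
    show "(\<lambda>x::'e. 3 * C * wt x) integrable_on UNIV"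
      by (intro integrable_on_mult_right integrable_wt)
  qed auto
  then have "((\<lambda>s::real. integral UNIV F) has_vector_derivative integral UNIV F') (at 0)"
    by (simp add: integral_translate(2)[OF i])
  then show ?thesis
    by (rule vector_derivative_unique_at) (rule has_vector_derivative_const)
qed

lemma integral_cbox_tendsto:
  fixes f :: "'e::euclidean_space \<Rightarrow> 'b::banach"
  assumes "f integrable_on UNIV"
  shows "(\<lambda>k. integral (cbox (- real k *\<^sub>R One) (real k *\<^sub>R One)) f) \<longlonglongrightarrow> integral UNIV f"
proof (rule LIMSEQ_I)
  fix e :: real assume "e > 0"
  then obtain B where B: "B > 0" "\<And>a b. ball 0 B \<subseteq> cbox a b \<Longrightarrow> norm (integral (cbox a b) f - integral UNIV f) < e"
    using integrable_integral[OF assms] unfolding has_integral_alt' by (auto simp only: UNIV_I if_True)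
  obtain N where N: "real N > B" using reals_Archimedean2 by blast
  show "\<exists>N. \<forall>k\<ge>N. norm (integral (cbox (- real k *\<^sub>R One) (real k *\<^sub>R One)) f - integral UNIV f) < e"
  proof (intro exI allI impI B(2))
    fix k assume "N \<le> k"
    show "ball (0::'e) B \<subseteq> cbox (- real k *\<^sub>R One) (real k *\<^sub>R One)"
    proof
      fix x :: 'e assume "x \<in> ball 0 B"
      then have "\<bar>x \<bullet> i\<bar> \<le> real k" if "i \<in> Basis" for i
        using Basis_le_norm[OF that, of x] N \<open>N \<le> k\<close> by simp
      then show "x \<in> cbox (- real k *\<^sub>R One) (real k *\<^sub>R One)"
        by (auto simp: mem_box abs_le_iff minus_le_iff)
    qed
  qed
qed

text \<open>On boxes the swap is the one for continuous integrands. What remains is that iterated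
  integrals over growing boxes tend to the iterated integral over the whole space;
  \<open>main\<close> proves this for a generic integrand because it is used for both orders of
  integration.\<close>

lemma integral_swap_UNIV:
  fixes F :: "'e::euclidean_space \<Rightarrow> 'f::euclidean_space \<Rightarrow> 'b::banach"
  assumes c: "continuous_on UNIV (\<lambda>(x, y). F x y)"
    and b: "\<And>x y. norm (F x y) \<le> C * wt x * wt y"
  shows "integral UNIV (\<lambda>x. integral UNIV (\<lambda>y. F x y)) = integral UNIV (\<lambda>y. integral UNIV (\<lambda>x. F x y))"
    (is "?l = ?r")
proof -
  have main: "(\<lambda>k. integral (cbox (- real k *\<^sub>R One) (real k *\<^sub>R One)) (\<lambda>x. integral (cbox (- real k *\<^sub>R One) (real k *\<^sub>R One)) (G x)))
     \<longlonglongrightarrow> integral UNIV (\<lambda>x. integral UNIV (G x))"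
    if c: "continuous_on UNIV (\<lambda>(x, y). G x y)" and b: "\<And>x y. norm (G x y) \<le> C * wt x * wt y"
    for G :: "'g::euclidean_space \<Rightarrow> 'h::euclidean_space \<Rightarrow> 'b"
  proof -
    define Q :: "nat \<Rightarrow> 'g set" where "Q k = cbox (- real k *\<^sub>R One) (real k *\<^sub>R One)" for k
    define Q' :: "nat \<Rightarrow> 'h set" where "Q' k = cbox (- real k *\<^sub>R One) (real k *\<^sub>R One)" for k
    have C: "C \<ge> 0" by (rule nonneg_of_mult[OF nonneg_of_mult[OF order_trans[OF norm_ge_zero b[of 0 0]] wt_pos] wt_pos])
    define W where "W = integral UNIV (wt :: 'h \<Rightarrow> real)"
    have cx: "continuous_on UNIV (G x)" for x
      using continuous_on_compose2[OF c continuous_on_Pair[OF continuous_on_const[of UNIV x] continuous_on_id]] by auto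
    have cy: "continuous_on UNIV (\<lambda>x. G x y)" for y
      using continuous_on_compose2[OF c continuous_on_Pair[OF continuous_on_id continuous_on_const[of UNIV y]]] by auto
    have iw: "(\<lambda>y::'h. C * wt y) integrable_on UNIV" "(\<lambda>y::'h. C * wt x * wt y) integrable_on UNIV" for x :: 'g
      by (intro integrable_on_mult_right integrable_wt)+
    have i: "G x integrable_on UNIV" for x
      by (rule integrable_dominated[OF cx b iw(2)])
    have iQ: "G x integrable_on Q' k" for x k
      unfolding Q'_def by (rule integrable_continuous) (rule continuous_on_subset[OF cx], simp)
    have b': "norm (G x y) \<le> C * wt y" for x y
      using b[of x y] mult_right_mono[OF mult_left_mono[OF wt_le_1 C], of "wt y" x] by simp
    have ci: "continuous_on UNIV (\<lambda>x. integral UNIV (G x))"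
      by (rule continuous_on_integral_param[OF cx cy b' iw(1)])
    have bi: "norm (integral UNIV (G x)) \<le> C * W * wt x" for x
      using norm_integral_le[OF cx b iw(2)] by (simp add: W_def mult_ac)
    have iwg: "(\<lambda>x::'g. C * W * wt x) integrable_on UNIV"
      by (intro integrable_on_mult_right integrable_wt)
    have ii: "(\<lambda>x. integral UNIV (G x)) integrable_on UNIV"
      by (rule integrable_dominated[OF ci bi iwg])
    have cQ: "continuous_on UNIV (\<lambda>x. integral (Q' k) (G x))" for k
      unfolding Q'_def by (rule integral_continuous_on_param, rule continuous_on_subset[OF c]) simp
    have iiQ: "(\<lambda>x. integral (Q' k) (G x)) integrable_on Q j" for k j
      unfolding Q_def by (rule integrable_continuous) (rule continuous_on_subset[OF cQ], simp)
    have wQ: "wt integrable_on Q' k" for k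
      using integrable_wt integrable_on_subcbox unfolding Q'_def by blast
    \<comment> \<open>The error of the inner integral is a null sequence times \<open>wt x\<close>,
      and this remains small after integration over \<open>x\<close>.\<close>
    have tail: "norm (integral UNIV (G x) - integral (Q' k) (G x)) \<le> C * (W - integral (Q' k) wt) * wt x" for x k
    proof -
      have s: "integral UNIV h - integral (Q' k) h = integral (UNIV - Q' k) h" "h integrable_on (UNIV - Q' k)"
        if "h integrable_on UNIV" "h integrable_on Q' k" for h :: "'h \<Rightarrow> 'z::banach"
        using integral_setdiff[OF that] integrable_setdiff[OF that[THEN integrable_integral]] by simp_all
      have "norm (integral (UNIV - Q' k) (G x)) \<le> integral (UNIV - Q' k) (\<lambda>y. C * wt x * wt y)"
        by (rule integral_norm_bound_integral[OF s(2)[OF i iQ] _ b]) (intro integrable_on_mult_right s(2) integrable_wt wQ)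
      also have "\<dots> = C * (W - integral (Q' k) wt) * wt x"
        using s(1)[OF integrable_wt wQ] by (simp add: W_def mult_ac)
      finally show ?thesis using s(1)[OF i[of x] iQ[of x]] by simp
    qed
    have wlim: "(\<lambda>k. W - integral (Q' k) wt) \<longlonglongrightarrow> 0"
      using tendsto_diff[OF tendsto_const integral_cbox_tendsto[OF integrable_wt[where 'e='h]], of W] unfolding Q'_def W_def by simp
    have "(\<lambda>k. integral (Q k) (\<lambda>x. integral UNIV (G x)) - integral (Q k) (\<lambda>x. integral (Q' k) (G x))) \<longlonglongrightarrow> 0"
    proof (rule Lim_null_comparison[OF always_eventually], rule allI)
      fix k
      have iq: "(\<lambda>x. integral UNIV (G x)) integrable_on Q k"
        unfolding Q_def by (rule integrable_on_subcbox[OF ii]) simp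
      have wq: "(wt :: 'g \<Rightarrow> real) integrable_on Q k"
        unfolding Q_def by (rule integrable_on_subcbox[OF integrable_wt]) simp
      have pos: "0 \<le> C * (W - integral (Q' k) wt)"
        by (rule nonneg_of_mult[OF order_trans[OF norm_ge_zero tail[of 0 k]] wt_pos])
      have "norm (integral (Q k) (\<lambda>x. integral UNIV (G x)) - integral (Q k) (\<lambda>x. integral (Q' k) (G x)))
        \<le> integral (Q k) (\<lambda>x. C * (W - integral (Q' k) wt) * wt x)"
        unfolding integral_diff[OF iq iiQ, symmetric]
        by (rule integral_norm_bound_integral[OF integrable_diff[OF iq iiQ] _ tail]) (intro integrable_on_mult_right wq)
      also have "\<dots> \<le> C * (W - integral (Q' k) wt) * integral UNIV (wt :: 'g \<Rightarrow> real)"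
        using integral_subset_le[OF _ wq integrable_wt] pos by (simp add: mult_left_mono)
      finally show "norm (integral (Q k) (\<lambda>x. integral UNIV (G x)) - integral (Q k) (\<lambda>x. integral (Q' k) (G x)))
        \<le> C * (W - integral (Q' k) wt) * integral UNIV (wt :: 'g \<Rightarrow> real)" .
    next
      show "(\<lambda>k. C * (W - integral (Q' k) wt) * integral UNIV (wt :: 'g \<Rightarrow> real)) \<longlonglongrightarrow> 0"
        using tendsto_mult[OF tendsto_mult[OF tendsto_const wlim] tendsto_const] by simp
    qed
    from tendsto_diff[OF integral_cbox_tendsto[OF ii] this[unfolded Q_def]]
    show ?thesis unfolding Q'_def by simp
  qed
  have c': "continuous_on UNIV (\<lambda>(y, x). F x y)"
    using continuous_on_compose2[OF c continuous_on_Pair[OF continuous_on_snd[OF continuous_on_id] continuous_on_fst[OF continuous_on_id]]]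
    by (simp add: case_prod_unfold)
  have b': "norm (F x y) \<le> C * wt y * wt x" for y x
    using b[of x y] by (simp add: mult_ac)
  show "?l = ?r"
  proof (rule LIMSEQ_unique[OF main[OF c b]])
    show "(\<lambda>k. integral (cbox (- real k *\<^sub>R One) (real k *\<^sub>R One)) (\<lambda>x. integral (cbox (- real k *\<^sub>R One) (real k *\<^sub>R One)) (F x))) \<longlonglongrightarrow> ?r"
      using main[OF c' b'] integral_swap_continuous[OF continuous_on_subset[OF c subset_UNIV]] by simp
  qed
qed

section \<open>Families of functions with bounded derivatives\<close>

text \<open>Indexed by a direction vector instead of a coordinate, so that it also applies on
  products such as the space of pairs \<open>(y, w)\<close>.\<close>

definition dd :: "'e::real_normed_vector \<Rightarrow> ('e \<Rightarrow> 'x::real_normed_vector) \<Rightarrow> 'e \<Rightarrow> 'x"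
  where "dd b f x = vector_derivative (\<lambda>t. f (x + t *\<^sub>R b)) (at 0)"

definition partials :: "('e::euclidean_space \<Rightarrow> 'x::real_normed_vector) \<Rightarrow> ('e \<Rightarrow> 'e \<Rightarrow> 'x) \<Rightarrow> bool"
  where "partials f f' \<longleftrightarrow> (\<forall>x. (f has_derivative (\<lambda>v. \<Sum>b\<in>Basis. (v \<bullet> b) *\<^sub>R f' b x)) (at x))"

lemma ddI: "((\<lambda>t. f (x + t *\<^sub>R b)) has_vector_derivative D) (at 0) \<Longrightarrow> dd b f x = D"
  unfolding dd_def by (rule vector_derivative_at)

lemma partials_direction:
  assumes "partials f f'"
  shows "((\<lambda>t. f (x + t *\<^sub>R v)) has_vector_derivative (\<Sum>b\<in>Basis. (v \<bullet> b) *\<^sub>R f' b (x + s *\<^sub>R v))) (at s)"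
proof -
  have "((\<lambda>t. x + t *\<^sub>R v) has_derivative (\<lambda>h. h *\<^sub>R v)) (at s)"
    by (auto intro!: derivative_eq_intros)
  from diff_chain_at[OF this assms[unfolded partials_def, rule_format]]
  show ?thesis
    by (simp add: has_vector_derivative_def o_def scaleR_sum_right)
qed

lemma partials_Basis:
  assumes "partials f f'" "b \<in> Basis"
  shows "((\<lambda>t. f (x + t *\<^sub>R b)) has_vector_derivative f' b (x + s *\<^sub>R b)) (at s)"
proof -
  have "(\<Sum>c\<in>Basis. (b \<bullet> c) *\<^sub>R f' c (x + s *\<^sub>R b)) = (\<Sum>c\<in>Basis. if c = b then f' b (x + s *\<^sub>R b) else 0)"
    using assms(2) by (intro sum.cong) (auto simp: inner_Basis)
  with partials_direction[OF assms(1), of x b s] assms(2) show ?thesis by simp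
qed

lemma partials_dd: "partials f f' \<Longrightarrow> b \<in> Basis \<Longrightarrow> dd b f = f' b"
  using partials_Basis[of f f' b _ 0] by (auto intro!: ext ddI)

lemma partials_cong: "partials f f' \<Longrightarrow> (\<And>b x. b \<in> Basis \<Longrightarrow> f' b x = g' b x) \<Longrightarrow> partials f g'"
  unfolding partials_def by (simp cong: sum.cong)

lemma partials_continuous: "partials f f' \<Longrightarrow> continuous_on S f"
  unfolding partials_def
  by (meson continuous_at_imp_continuous_on has_derivative_continuous)

lemma norm_diff_le_of_derivative:
  fixes g :: "real \<Rightarrow> 'x::real_normed_vector"
  assumes d: "\<And>s. s \<in> closed_segment a c \<Longrightarrow> (g has_vector_derivative g' s) (at s)"
    and b: "\<And>s. s \<in> closed_segment a c \<Longrightarrow> norm (g' s) \<le> B"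
  shows "norm (g c - g a) \<le> B * \<bar>c - a\<bar>"
proof -
  have "norm (g c - g a) \<le> B * norm (c - a)"
  proof (rule differentiable_bound[of "closed_segment a c" g "\<lambda>s h. h *\<^sub>R g' s"])
    show "(g has_derivative (\<lambda>h. h *\<^sub>R g' t)) (at t within closed_segment a c)"
      if "t \<in> closed_segment a c" for t
      using d[OF that] unfolding has_vector_derivative_def by (rule has_derivative_at_withinI)
    show "onorm (\<lambda>h. h *\<^sub>R g' t) \<le> B" if "t \<in> closed_segment a c" for t
      using b[OF that] by (intro onorm_le) (simp add: mult.commute[of B] mult_left_mono)
  qed auto
  then show ?thesis by simp
qed

text \<open>Goes from \<open>x\<close> to \<open>x + v\<close> one coordinate at a time: along each
  axis the mean value inequality compares the increment with the partial derivative at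
  \<open>x\<close>, which is allowed by continuity of the partial derivatives.\<close>

lemma partialsI:
  fixes f :: "'e::euclidean_space \<Rightarrow> 'x::real_normed_vector"
  assumes d: "\<And>b x. b \<in> Basis \<Longrightarrow> ((\<lambda>t. f (x + t *\<^sub>R b)) has_vector_derivative f' b x) (at 0)"
    and c: "\<And>b. b \<in> Basis \<Longrightarrow> continuous_on UNIV (f' b)"
  shows "partials f f'"
  unfolding partials_def
proof
  fix x :: 'e
  \<comment> \<open>\<open>pr B v\<close> is the part of \<open>v\<close> in the coordinates of
    \<open>B\<close> and \<open>R B v\<close> the remainder after moving along these only; for
    \<open>B = Basis\<close> it is the remainder in the definition of the derivative.\<close>
  define pr where "pr B v = (\<Sum>b\<in>B. (v \<bullet> b) *\<^sub>R b)" for B and v :: 'e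
  define R where "R B v = f (x + pr B v) - f x - (\<Sum>b\<in>B. (v \<bullet> b) *\<^sub>R f' b x)" for B v
  have prn: "norm (pr B v) \<le> real (card B) * norm v" if "B \<subseteq> Basis" for B v
    unfolding pr_def using that
    by (intro sum_norm_bound) (auto simp: Basis_le_norm subset_iff norm_Basis)
  have claim: "\<exists>d>0. \<forall>v. norm v < d \<longrightarrow> norm (R B v) \<le> e * norm v"
    if "finite B" "B \<subseteq> Basis" "e > 0" for B e
    using that
  proof (induction B arbitrary: e rule: finite_induct)
    case empty
    then show ?case by (intro exI[of _ 1]) (simp add: R_def pr_def)
  next
    case (insert b B)
    then have b: "b \<in> Basis" and B: "B \<subseteq> Basis" and "e / 2 > 0" by auto
    from insert.IH[OF B \<open>e / 2 > 0\<close>] obtain d1 where d1: "d1 > 0" "\<And>v. norm v < d1 \<Longrightarrow> norm (R B v) \<le> e / 2 * norm v" by blast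
    have "continuous (at x) (f' b)"
      using c[OF b] by (simp add: continuous_on_eq_continuous_at)
    then obtain d2 where d2: "d2 > 0" "\<And>y. norm (y - x) < d2 \<Longrightarrow> norm (f' b y - f' b x) < e / 2"
      using \<open>e / 2 > 0\<close> unfolding continuous_at_eps_delta dist_norm by blast
    \<comment> \<open>One summand per coordinate already travelled and one for the current axis:
      every intermediate point lies within \<open>K * norm v\<close> of \<open>x\<close>.\<close>
    define K where "K = real (card B) + 1"
    have K: "K > 0" unfolding K_def by simp
    show ?case
    proof (intro exI[of _ "min d1 (d2 / K)"] conjI allI impI)
      show "min d1 (d2 / K) > 0" using d1 d2 K by simp
      fix v :: 'e assume v: "norm v < min d1 (d2 / K)"
      define z where "z = x + pr B v"
      define c where "c = v \<bullet> b"
      have cv: "\<bar>c\<bar> \<le> norm v" unfolding c_def by (rule Basis_le_norm[OF b])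
      have "norm ((f (z + c *\<^sub>R b) - c *\<^sub>R f' b x) - (f (z + 0 *\<^sub>R b) - 0 *\<^sub>R f' b x)) \<le> e / 2 * \<bar>c\<bar>"
      proof (rule norm_diff_le_of_derivative[where a=0, simplified diff_0_right])
        fix t assume "t \<in> closed_segment 0 c"
        then have t: "\<bar>t\<bar> \<le> \<bar>c\<bar>" by (auto simp: closed_segment_eq_real_ivl split: if_splits)
        show "((\<lambda>t. f (z + t *\<^sub>R b) - t *\<^sub>R f' b x) has_vector_derivative f' b (z + t *\<^sub>R b) - f' b x) (at t)"
        proof (rule has_vector_derivative_diff[OF has_vector_derivative_line[OF d[OF b]]])
          show "((\<lambda>t. t *\<^sub>R f' b x) has_vector_derivative f' b x) (at t)"
            by (auto intro!: derivative_eq_intros)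
        qed
        have "norm (z + t *\<^sub>R b - x) \<le> norm (pr B v) + norm (t *\<^sub>R b)"
          unfolding z_def by (metis add_diff_cancel_left' add.assoc norm_triangle_ineq)
        also have "\<dots> \<le> K * norm v"
          using prn[OF B, of v] t cv b by (simp add: K_def algebra_simps norm_Basis)
        also have "\<dots> < d2" using v K by (simp add: field_simps)
        finally show "norm (f' b (z + t *\<^sub>R b) - f' b x) \<le> e / 2" using d2(2) by (simp add: less_imp_le)
      qed
      also have "\<dots> \<le> e / 2 * norm v"
        using cv \<open>e > 0\<close> by (intro mult_left_mono) auto
      finally have 1: "norm (f (z + c *\<^sub>R b) - f z - c *\<^sub>R f' b x) \<le> e / 2 * norm v"
        by (simp add: algebra_simps)
      have "R (insert b B) v = R B v + (f (z + c *\<^sub>R b) - f z - c *\<^sub>R f' b x)"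
        using insert.hyps by (simp add: R_def pr_def z_def c_def algebra_simps)
      then have "norm (R (insert b B) v) \<le> e / 2 * norm v + e / 2 * norm v"
        using norm_triangle_mono[OF d1(2) 1, of v] v by simp
      then show "norm (R (insert b B) v) \<le> e * norm v" by simp
    qed
  qed
  have pB: "pr Basis v = v" for v by (simp add: pr_def euclidean_representation)
  show "(f has_derivative (\<lambda>v. \<Sum>b\<in>Basis. (v \<bullet> b) *\<^sub>R f' b x)) (at x)"
    unfolding has_derivative_at_alt
  proof (intro conjI allI impI)
    show "bounded_linear (\<lambda>v. \<Sum>b\<in>Basis. (v \<bullet> b) *\<^sub>R f' b x)"
      by (intro bounded_linear_sum bounded_linear_scaleR_const bounded_linear_inner_left)
    fix e :: real assume "e > 0"
    from claim[OF finite_Basis subset_refl this] obtain d where "d > 0" "\<And>v. norm v < d \<Longrightarrow> norm (R Basis v) \<le> e * norm v" by blast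
    then have "d > 0" "\<And>y. norm (y - x) < d \<Longrightarrow> norm (R Basis (y - x)) \<le> e * norm (y - x)" by auto
    then show "\<exists>d>0. \<forall>y. norm (y - x) < d \<longrightarrow>
       norm (f y - f x - (\<Sum>b\<in>Basis. ((y - x) \<bullet> b) *\<^sub>R f' b x)) \<le> e * norm (y - x)"
      by (intro exI[of _ d]) (auto simp: R_def pB)
  qed
qed

text \<open>\<open>\<omega> j p\<close> is the weight that bounds the derivatives of order \<open>j\<close> of the member \<open>f p\<close> of a family,
  uniformly in \<open>p \<in> P\<close>.\<close>

primrec bdiff :: "nat \<Rightarrow> 'p set \<Rightarrow> (nat \<Rightarrow> 'p \<Rightarrow> 'e \<Rightarrow> real) \<Rightarrow>
    ('p \<Rightarrow> 'e::euclidean_space \<Rightarrow> 'x::real_normed_vector) \<Rightarrow> bool" where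
  "bdiff 0 P \<omega> f \<longleftrightarrow> (\<forall>p\<in>P. continuous_on UNIV (f p)) \<and> (\<exists>C\<ge>0. \<forall>p\<in>P. \<forall>x. norm (f p x) \<le> C * \<omega> 0 p x)"
| "bdiff (Suc k) P \<omega> f \<longleftrightarrow> (\<exists>C\<ge>0. \<forall>p\<in>P. \<forall>x. norm (f p x) \<le> C * \<omega> 0 p x) \<and>
    (\<forall>p\<in>P. partials (f p) (\<lambda>b. dd b (f p))) \<and>
    (\<forall>b\<in>Basis. bdiff k P (\<lambda>j. \<omega> (Suc j)) (\<lambda>p. dd b (f p)))"

lemma bdiff_bound: "bdiff k P \<omega> f \<Longrightarrow> \<exists>C\<ge>0. \<forall>p\<in>P. \<forall>x. norm (f p x) \<le> C * \<omega> 0 p x"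
  by (cases k) auto

lemma bdiff_boundE:
  assumes "bdiff k P \<omega> f"
  obtains C where "C \<ge> 0" "\<And>p x. p \<in> P \<Longrightarrow> norm (f p x) \<le> C * \<omega> 0 p x"
  using bdiff_bound[OF assms] by blast

lemma bdiff_continuous: "bdiff k P \<omega> f \<Longrightarrow> p \<in> P \<Longrightarrow> continuous_on S (f p)"
  by (cases k) (auto intro: partials_continuous continuous_on_subset)

lemma bdiff_Suc_D: "bdiff (Suc k) P \<omega> f \<Longrightarrow> bdiff k P \<omega> f"
proof (induction k arbitrary: \<omega> f)
  case 0
  then show ?case using bdiff_continuous[OF 0] by auto
next
  case (Suc k)
  then show ?case by (subst bdiff.simps) (simp del: bdiff.simps add: bdiff.simps(2)[of "Suc k"])
qed

lemma bdiff_partials: "bdiff (Suc k) P \<omega> f \<Longrightarrow> p \<in> P \<Longrightarrow> partials (f p) (\<lambda>b. dd b (f p))"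
  by simp

lemma bdiff_dd: "bdiff (Suc k) P \<omega> f \<Longrightarrow> b \<in> Basis \<Longrightarrow> bdiff k P (\<lambda>j. \<omega> (Suc j)) (\<lambda>p. dd b (f p))"
  by simp

lemma bdiff_cong_imp:
  "bdiff k P \<omega> f \<Longrightarrow> (\<And>p. p \<in> P \<Longrightarrow> f p = g p) \<Longrightarrow>
   (\<And>j p x. j \<le> k \<Longrightarrow> p \<in> P \<Longrightarrow> \<omega> j p x = \<omega>' j p x) \<Longrightarrow> bdiff k P \<omega>' g"
proof (induction k arbitrary: \<omega> \<omega>' f g)
  case (Suc k)
  have "bdiff k P (\<lambda>j. \<omega>' (Suc j)) (\<lambda>p. dd b (g p))" if "b \<in> Basis" for b
    by (rule Suc.IH[OF bdiff_dd[OF Suc.prems(1) that]]) (simp_all add: Suc.prems)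
  with Suc.prems show ?case by simp
qed simp

lemma bdiff_SucI_partials:
  assumes "\<exists>C\<ge>0. \<forall>p\<in>P. \<forall>x. norm (f p x) \<le> C * \<omega> 0 p x"
    and "\<And>p. p \<in> P \<Longrightarrow> partials (f p) (\<lambda>b. f' b p)"
    and "\<And>b. b \<in> Basis \<Longrightarrow> bdiff k P (\<lambda>j. \<omega> (Suc j)) (f' b)"
  shows "bdiff (Suc k) P \<omega> f"
proof -
  have "dd b (f p) = f' b p" if "p \<in> P" "b \<in> Basis" for b p
    using partials_dd[OF assms(2)] that by auto
  note eq = this
  have "partials (f p) (\<lambda>b. dd b (f p))" if "p \<in> P" for p
    by (rule partials_cong[OF assms(2)[OF that]]) (simp add: eq that)
  moreover have "bdiff k P (\<lambda>j. \<omega> (Suc j)) (\<lambda>p. dd b (f p))" if "b \<in> Basis" for b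
    by (rule bdiff_cong_imp[OF assms(3)[OF that]]) (simp_all add: eq that)
  ultimately show ?thesis using assms(1) by simp
qed

lemma bdiff_SucI:
  assumes "\<exists>C\<ge>0. \<forall>p\<in>P. \<forall>x. norm (f p x) \<le> C * \<omega> 0 p x"
    and "\<And>p b x. p \<in> P \<Longrightarrow> b \<in> Basis \<Longrightarrow> ((\<lambda>t. f p (x + t *\<^sub>R b)) has_vector_derivative f' b p x) (at 0)"
    and "\<And>b. b \<in> Basis \<Longrightarrow> bdiff k P (\<lambda>j. \<omega> (Suc j)) (f' b)"
  shows "bdiff (Suc k) P \<omega> f"
proof (rule bdiff_SucI_partials[OF assms(1) _ assms(3)])
  show "partials (f p) (\<lambda>b. f' b p)" if "p \<in> P" for p
    by (rule partialsI[OF assms(2)[OF that]]) (assumption, rule bdiff_continuous[OF assms(3) that])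
qed

lemma bdiff_weaken:
  assumes "bdiff k P \<omega> f"
    and "\<And>j. j \<le> k \<Longrightarrow> \<exists>D\<ge>0. \<forall>p\<in>P. \<forall>x. \<omega> j p x \<le> D * \<omega>' j p x"
  shows "bdiff k P \<omega>' f"
  using assms
proof (induction k arbitrary: \<omega> \<omega>' f)
  have bd: "\<exists>C\<ge>0. \<forall>p\<in>P. \<forall>x. norm (f p x) \<le> C * \<omega>' 0 p x"
    if f: "bdiff k P \<omega> f" and w: "\<exists>D\<ge>0. \<forall>p\<in>P. \<forall>x. \<omega> 0 p x \<le> D * \<omega>' 0 p x"
    for \<omega> \<omega>' k and f :: "'a \<Rightarrow> 'b \<Rightarrow> 'c"
  proof -
    obtain C D where C: "C \<ge> 0" "\<And>p x. p \<in> P \<Longrightarrow> norm (f p x) \<le> C * \<omega> 0 p x"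
      and D: "D \<ge> 0" "\<And>p x. p \<in> P \<Longrightarrow> \<omega> 0 p x \<le> D * \<omega>' 0 p x"
      using bdiff_bound[OF f] w by metis
    have "norm (f p x) \<le> (C * D) * \<omega>' 0 p x" if "p \<in> P" for p x
      using order_trans[OF C(2)[OF that] mult_left_mono[OF D(2)[OF that] C(1)]] by (simp add: mult.assoc)
    then show ?thesis using C(1) D(1) by (intro exI[of _ "C * D"]) simp
  qed
  {
    case 0
    then show ?case using bd[OF 0(1), of \<omega>'] 0(2)[of 0] by simp
  next
    case (Suc k)
    have "bdiff k P (\<lambda>j. \<omega>' (Suc j)) (\<lambda>p. dd b (f p))" if "b \<in> Basis" for b
      using Suc.IH[OF bdiff_dd[OF Suc.prems(1) that]] Suc.prems(2) by auto
    with bd[OF Suc.prems(1), of \<omega>'] Suc.prems(2)[of 0] Suc.prems(1) show ?case by simp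
  }
qed

lemma bdiff_reparam:
  "bdiff k P \<omega> f \<Longrightarrow> (\<And>q. q \<in> Q \<Longrightarrow> \<phi> q \<in> P) \<Longrightarrow>
    bdiff k Q (\<lambda>j q. \<omega> j (\<phi> q)) (\<lambda>q. f (\<phi> q))"
  by (induction k arbitrary: \<omega> f) (simp, blast, simp, blast)

lemma partials_add: "partials f f' \<Longrightarrow> partials g g' \<Longrightarrow> partials (\<lambda>x. f x + g x) (\<lambda>b x. f' b x + g' b x)"
  unfolding partials_def by (auto simp: scaleR_add_right sum.distrib intro: has_derivative_add)

lemma partials_linear:
  assumes "bounded_linear h" "partials f f'"
  shows "partials (\<lambda>x. h (f x)) (\<lambda>b x. h (f' b x))"
  unfolding partials_def
proof
  fix x
  show "((\<lambda>x. h (f x)) has_derivative (\<lambda>v. \<Sum>b\<in>Basis. (v \<bullet> b) *\<^sub>R h (f' b x))) (at x)"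
    using bounded_linear.has_derivative[OF assms(1) assms(2)[unfolded partials_def, rule_format, of x]]
    by (simp add: linear_sum linear_cmul bounded_linear.linear[OF assms(1)])
qed

lemma partials_bilinear:
  assumes "bounded_bilinear h" "partials f f'" "partials g g'"
  shows "partials (\<lambda>x. h (f x) (g x)) (\<lambda>b x. h (f' b x) (g x) + h (f x) (g' b x))"
proof -
  interpret bounded_bilinear h by fact
  show ?thesis
    unfolding partials_def
  proof
    fix x
    show "((\<lambda>x. h (f x) (g x)) has_derivative
        (\<lambda>v. \<Sum>b\<in>Basis. (v \<bullet> b) *\<^sub>R (h (f' b x) (g x) + h (f x) (g' b x)))) (at x)"
      using FDERIV[OF assms(2,3)[unfolded partials_def, rule_format, of x]]
      by (simp add: sum_left sum_right scaleR_left scaleR_right scaleR_add_right sum.distrib add.commute)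
  qed
qed

lemma bdiff_zero: "bdiff k P \<omega> (\<lambda>p x. 0)"
proof (induction k arbitrary: \<omega>)
  case (Suc k)
  show ?case
    by (rule bdiff_SucI_partials[where f' = "\<lambda>b p x. 0"]) (auto simp: partials_def Suc intro!: exI[of _ 0])
qed (auto intro: exI[of _ 0])

lemma bdiff_const:
  assumes "C \<ge> 0" "\<And>p x. p \<in> P \<Longrightarrow> norm (c p) \<le> C * \<omega> 0 p x"
  shows "bdiff k P \<omega> (\<lambda>p x. c p)"
proof (cases k)
  case (Suc j)
  show ?thesis unfolding Suc
    by (rule bdiff_SucI_partials[where f' = "\<lambda>b p x. 0"])
      (use assms in \<open>auto simp: partials_def bdiff_zero\<close>)
qed (use assms in auto)

lemma bdiff_add:
  "bdiff k P \<omega> f \<Longrightarrow> bdiff k P \<omega> g \<Longrightarrow> bdiff k P \<omega> (\<lambda>p x. f p x + g p x)"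
proof (induction k arbitrary: \<omega> f g)
  have bd: "\<exists>C\<ge>0. \<forall>p\<in>P. \<forall>x. norm (f p x + g p x) \<le> C * \<omega> 0 p x"
    if f: "bdiff k P \<omega> f" and g: "bdiff k P \<omega> g" for k \<omega> and f g :: "'a \<Rightarrow> 'b \<Rightarrow> 'c"
  proof -
    obtain C D where C: "C \<ge> 0" "\<And>p x. p \<in> P \<Longrightarrow> norm (f p x) \<le> C * \<omega> 0 p x"
      and D: "D \<ge> 0" "\<And>p x. p \<in> P \<Longrightarrow> norm (g p x) \<le> D * \<omega> 0 p x"
      using bdiff_bound[OF f] bdiff_bound[OF g] by metis
    then show ?thesis
      by (intro exI[of _ "C + D"]) (simp add: distrib_right norm_triangle_mono)
  qed
  {
    case 0
    then show ?case using bd[OF 0] by (auto intro: continuous_on_add)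
  next
    case (Suc k)
    show ?case
    proof (rule bdiff_SucI_partials)
      show "\<exists>C\<ge>0. \<forall>p\<in>P. \<forall>x. norm (f p x + g p x) \<le> C * \<omega> 0 p x"
        by (rule bd[OF Suc.prems])
      show "partials (\<lambda>x. f p x + g p x) (\<lambda>b x. dd b (f p) x + dd b (g p) x)" if "p \<in> P" for p
        by (rule partials_add[OF bdiff_partials[OF Suc.prems(1) that] bdiff_partials[OF Suc.prems(2) that]])
      show "bdiff k P (\<lambda>j. \<omega> (Suc j)) (\<lambda>p x. dd b (f p) x + dd b (g p) x)" if "b \<in> Basis" for b
        by (rule Suc.IH[OF bdiff_dd[OF Suc.prems(1) that] bdiff_dd[OF Suc.prems(2) that]])
    qed
  }
qed

lemma bdiff_sum:
  "(\<And>i. i \<in> I \<Longrightarrow> bdiff k P \<omega> (f i)) \<Longrightarrow> bdiff k P \<omega> (\<lambda>p x. \<Sum>i\<in>I. f i p x)"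
  by (induction I rule: infinite_finite_induct) (auto intro: bdiff_add bdiff_zero)

lemma bdiff_linear:
  assumes h: "bounded_linear h"
  shows "bdiff k P \<omega> f \<Longrightarrow> bdiff k P \<omega> (\<lambda>p x. h (f p x))"
proof (induction k arbitrary: \<omega> f)
  obtain K where K: "K \<ge> 0" "\<And>x. norm (h x) \<le> norm x * K"
    using bounded_linear.nonneg_bounded[OF h] by blast
  have bd: "\<exists>C\<ge>0. \<forall>p\<in>P. \<forall>x. norm (h (f p x)) \<le> C * \<omega> 0 p x"
    if f: "bdiff k P \<omega> f" for k \<omega> and f :: "'c \<Rightarrow> 'd \<Rightarrow> 'a"
  proof -
    obtain C where C: "C \<ge> 0" "\<And>p x. p \<in> P \<Longrightarrow> norm (f p x) \<le> C * \<omega> 0 p x"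
      using bdiff_bound[OF f] by metis
    have "norm (h (f p x)) \<le> (K * C) * \<omega> 0 p x" if "p \<in> P" for p x
      using order_trans[OF K(2) mult_right_mono[OF C(2)[OF that] K(1)]] by (simp add: mult_ac)
    then show ?thesis using K(1) C(1) by (intro exI[of _ "K * C"]) auto
  qed
  {
    case 0
    then show ?case using bd[OF 0] bounded_linear.continuous_on[OF h] by auto
  next
    case (Suc k)
    show ?case
    proof (rule bdiff_SucI_partials)
      show "\<exists>C\<ge>0. \<forall>p\<in>P. \<forall>x. norm (h (f p x)) \<le> C * \<omega> 0 p x"
        by (rule bd[OF Suc.prems])
      show "partials (\<lambda>x. h (f p x)) (\<lambda>b x. h (dd b (f p) x))" if "p \<in> P" for p
        by (rule partials_linear[OF h bdiff_partials[OF Suc.prems that]])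
      show "bdiff k P (\<lambda>j. \<omega> (Suc j)) (\<lambda>p x. h (dd b (f p) x))" if "b \<in> Basis" for b
        by (rule Suc.IH[OF bdiff_dd[OF Suc.prems that]])
    qed
  }
qed

text \<open>The condition on the weights mirrors Leibniz' rule: a derivative of order
  \<open>i + j\<close> distributes \<open>i\<close> derivatives to \<open>f\<close> and
  \<open>j\<close> to \<open>g\<close>.\<close>

lemma bdiff_bilinear:
  assumes h: "bounded_bilinear h"
  shows "bdiff k P \<omega> f \<Longrightarrow> bdiff k P \<omega>' g \<Longrightarrow>
    (\<And>i j p x. i + j \<le> k \<Longrightarrow> p \<in> P \<Longrightarrow> \<omega> i p x * \<omega>' j p x \<le> \<Omega> (i + j) p x) \<Longrightarrow>
    bdiff k P \<Omega> (\<lambda>p x. h (f p x) (g p x))"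
proof (induction k arbitrary: \<omega> \<omega>' \<Omega> f g)
  interpret bounded_bilinear h by fact
  obtain K where K: "K \<ge> 0" "\<And>x y. norm (h x y) \<le> norm x * norm y * K"
    using nonneg_bounded by blast
  have bd: "\<exists>C\<ge>0. \<forall>p\<in>P. \<forall>x. norm (h (f p x) (g p x)) \<le> C * \<Omega> 0 p x"
    if f: "bdiff k P \<omega> f" and g: "bdiff k P \<omega>' g"
      and w: "\<And>p x. p \<in> P \<Longrightarrow> \<omega> 0 p x * \<omega>' 0 p x \<le> \<Omega> 0 p x"
    for k \<omega> \<omega>' \<Omega> and f :: "'d \<Rightarrow> 'e \<Rightarrow> 'a" and g :: "'d \<Rightarrow> 'e \<Rightarrow> 'b"
  proof -
    obtain C D where C: "C \<ge> 0" "\<And>p x. p \<in> P \<Longrightarrow> norm (f p x) \<le> C * \<omega> 0 p x"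
      and D: "D \<ge> 0" "\<And>p x. p \<in> P \<Longrightarrow> norm (g p x) \<le> D * \<omega>' 0 p x"
      using bdiff_bound[OF f] bdiff_bound[OF g] by metis
    have "norm (h (f p x) (g p x)) \<le> (K * (C * D)) * \<Omega> 0 p x" if p: "p \<in> P" for p x
    proof -
      have "norm (f p x) * norm (g p x) \<le> (C * \<omega> 0 p x) * (D * \<omega>' 0 p x)"
        using C(2)[OF p] D(2)[OF p] order_trans[OF norm_ge_zero C(2)[OF p]] by (intro mult_mono) auto
      also have "\<dots> = (C * D) * (\<omega> 0 p x * \<omega>' 0 p x)" by simp
      also have "\<dots> \<le> (C * D) * \<Omega> 0 p x"
        using w[OF p] C(1) D(1) by (intro mult_left_mono) auto
      finally have "norm (f p x) * norm (g p x) \<le> (C * D) * \<Omega> 0 p x" .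
      from order_trans[OF K(2) mult_right_mono[OF this K(1)]]
      show ?thesis by (simp add: mult_ac)
    qed
    then show ?thesis using K(1) C(1) D(1) by (intro exI[of _ "K * (C * D)"]) auto
  qed
  {
    case 0
    have "\<exists>C\<ge>0. \<forall>p\<in>P. \<forall>x. norm (h (f p x) (g p x)) \<le> C * \<Omega> 0 p x"
      by (rule bd[OF 0(1,2)]) (use 0(3)[of 0 0] in simp)
    moreover have "continuous_on UNIV (\<lambda>x. h (f p x) (g p x))" if "p \<in> P" for p
      by (rule continuous_on[OF bdiff_continuous[OF 0(1) that] bdiff_continuous[OF 0(2) that]])
    ultimately show ?case by simp
  next
    case (Suc k)
    have w0: "\<omega> 0 p x * \<omega>' 0 p x \<le> \<Omega> 0 p x" if "p \<in> P" for p x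
      using Suc.prems(3)[of 0 0] that by simp
    show ?case
    proof (rule bdiff_SucI_partials)
      show "\<exists>C\<ge>0. \<forall>p\<in>P. \<forall>x. norm (h (f p x) (g p x)) \<le> C * \<Omega> 0 p x"
        by (rule bd[OF Suc.prems(1,2)]) (rule w0)
      show "partials (\<lambda>x. h (f p x) (g p x)) (\<lambda>b x. h (dd b (f p) x) (g p x) + h (f p x) (dd b (g p) x))"
        if "p \<in> P" for p
        using Suc.prems that by (intro partials_bilinear[OF h]) auto
      fix b :: 'e assume b: "b \<in> Basis"
      show "bdiff k P (\<lambda>j. \<Omega> (Suc j)) (\<lambda>p x. h (dd b (f p) x) (g p x) + h (f p x) (dd b (g p) x))"
      proof (rule bdiff_add)
        show "bdiff k P (\<lambda>j. \<Omega> (Suc j)) (\<lambda>p x. h (dd b (f p) x) (g p x))"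
          using Suc.prems(3)[of "Suc _"]
          by (intro Suc.IH[OF bdiff_dd[OF Suc.prems(1) b] bdiff_Suc_D[OF Suc.prems(2)]]) auto
        show "bdiff k P (\<lambda>j. \<Omega> (Suc j)) (\<lambda>p x. h (f p x) (dd b (g p) x))"
          using Suc.prems(3)[of _ "Suc _"]
          by (intro Suc.IH[OF bdiff_Suc_D[OF Suc.prems(1)] bdiff_dd[OF Suc.prems(2) b]]) auto
      qed
    qed
  }
qed

text \<open>The weight does not depend on the order of differentiation, because the chain rule mixes
  derivatives of \<open>f\<close> of several orders. Only the derivatives of \<open>g\<close> are
  bounded, not \<open>g\<close> itself, as for a diffeomorphism of the whole space.\<close>

lemma bdiff_compose:
  fixes f :: "'p \<Rightarrow> 'f::euclidean_space \<Rightarrow> 'x::real_normed_vector" and g :: "'p \<Rightarrow> 'e::euclidean_space \<Rightarrow> 'f"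
  assumes g: "\<And>p. p \<in> P \<Longrightarrow> partials (g p) (\<lambda>b. dd b (g p))"
    and g': "\<And>b. b \<in> Basis \<Longrightarrow> bdiff k P (\<lambda>_ _ _. 1) (\<lambda>p. dd b (g p))"
    and w: "\<And>p x. p \<in> P \<Longrightarrow> \<omega> p (g p x) \<le> \<Omega> p x"
  shows "bdiff k P (\<lambda>_. \<omega>) f \<Longrightarrow> bdiff k P (\<lambda>_. \<Omega>) (\<lambda>p x. f p (g p x))"
  using g'
proof (induction k arbitrary: f)
  have bd: "\<exists>C\<ge>0. \<forall>p\<in>P. \<forall>x. norm (f p (g p x)) \<le> C * \<Omega> p x"
    if f: "bdiff k P (\<lambda>_. \<omega>) f" for k f
  proof -
    obtain C where C: "C \<ge> 0" "\<And>p x. p \<in> P \<Longrightarrow> norm (f p x) \<le> C * \<omega> p x"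
      using bdiff_bound[OF f] by metis
    have "norm (f p (g p x)) \<le> C * \<Omega> p x" if "p \<in> P" for p x
      using order_trans[OF C(2)[OF that] mult_left_mono[OF w[OF that] C(1)]] .
    then show ?thesis using C(1) by blast
  qed
  {
    case 0
    then show ?case using bd[OF 0(1)] partials_continuous[OF g]
      by (auto intro: continuous_on_compose2[of UNIV])
  next
    case (Suc k)
    show ?case
    proof (rule bdiff_SucI_partials[OF bd[OF Suc.prems(1)]])
      show "partials (\<lambda>x. f p (g p x)) (\<lambda>b x. \<Sum>c\<in>Basis. (dd b (g p) x \<bullet> c) *\<^sub>R dd c (f p) (g p x))"
        if p: "p \<in> P" for p
        unfolding partials_def
      proof
        fix x
        have f1: "(f p has_derivative (\<lambda>v. \<Sum>c\<in>Basis. (v \<bullet> c) *\<^sub>R dd c (f p) (g p x))) (at (g p x))"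
          using bdiff_partials[OF Suc.prems(1) p] unfolding partials_def by blast
        have "(g p has_derivative (\<lambda>v. \<Sum>b\<in>Basis. (v \<bullet> b) *\<^sub>R dd b (g p) x)) (at x)"
          using g[OF p] unfolding partials_def by blast
        from diff_chain_at[OF this f1]
        show "((\<lambda>x. f p (g p x)) has_derivative
          (\<lambda>v. \<Sum>b\<in>Basis. (v \<bullet> b) *\<^sub>R (\<Sum>c\<in>Basis. (dd b (g p) x \<bullet> c) *\<^sub>R dd c (f p) (g p x)))) (at x)"
          by (simp add: o_def inner_sum_left scaleR_sum_left scaleR_sum_right) (subst sum.swap, simp)
      qed
      fix b :: 'e assume b: "b \<in> Basis"
      have "bdiff k P (\<lambda>_. \<Omega>) (\<lambda>p x. (dd b (g p) x \<bullet> c) *\<^sub>R dd c (f p) (g p x))" if c: "c \<in> Basis" for c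
      proof (rule bdiff_bilinear[OF bounded_bilinear_scaleR])
        show "bdiff k P (\<lambda>_ _ _. 1) (\<lambda>p x. dd b (g p) x \<bullet> c)"
          by (rule bdiff_linear[OF bounded_linear_inner_left bdiff_Suc_D[OF Suc.prems(2)[OF b]]])
        show "bdiff k P (\<lambda>_. \<Omega>) (\<lambda>p x. dd c (f p) (g p x))"
          by (rule Suc.IH[OF bdiff_dd[OF Suc.prems(1) c]]) (rule bdiff_Suc_D[OF Suc.prems(2)])
      qed simp
      then show "bdiff k P (\<lambda>_. \<Omega>) (\<lambda>p x. \<Sum>c\<in>Basis. (dd b (g p) x \<bullet> c) *\<^sub>R dd c (f p) (g p x))"
        by (rule bdiff_sum)
    qed
  }
qed

text \<open>Schwarz's theorem, with continuity of the mixed derivative required only in the first variable (but uniformly):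
  Hoelder symbols are continuous in \<open>x\<close> locally uniformly in \<open>\<xi>\<close>.\<close>

lemma mixed_partial:
  fixes F :: "real \<Rightarrow> real \<Rightarrow> 'x::real_normed_vector"
  assumes e: "e > 0"
    and Fs: "\<And>t. \<bar>t\<bar> < e \<Longrightarrow> ((\<lambda>s. F s t) has_vector_derivative Fs t) (at 0)"
    and Ft: "\<And>s t. \<bar>s\<bar> < e \<Longrightarrow> \<bar>t\<bar> < e \<Longrightarrow> ((\<lambda>t. F s t) has_vector_derivative Ft s t) (at t)"
    and H: "\<And>s t. \<bar>s\<bar> < e \<Longrightarrow> \<bar>t\<bar> < e \<Longrightarrow> ((\<lambda>s. Ft s t) has_vector_derivative H s t) (at s)"
    and Hc: "\<And>\<epsilon>. \<epsilon> > 0 \<Longrightarrow> \<exists>d>0. \<forall>s t. \<bar>s\<bar> < d \<longrightarrow> \<bar>t\<bar> < e \<longrightarrow> norm (H s t - H 0 t) \<le> \<epsilon>"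
  shows "(Fs has_vector_derivative H 0 0) (at 0)"
  unfolding has_vector_derivative_def has_derivative_at_alt
proof (intro conjI allI impI)
  show "bounded_linear (\<lambda>x. x *\<^sub>R H 0 0)" by (rule bounded_linear_scaleR_left)
  fix \<epsilon>0 :: real assume "\<epsilon>0 > 0"
  define \<epsilon> where "\<epsilon> = \<epsilon>0 / 4"
  have \<epsilon>: "\<epsilon> > 0" using \<open>\<epsilon>0 > 0\<close> by (simp add: \<epsilon>_def)
  obtain d0 where d0: "d0 > 0" "\<And>s t. \<bar>s\<bar> < d0 \<Longrightarrow> \<bar>t\<bar> < e \<Longrightarrow> norm (H s t - H 0 t) \<le> \<epsilon>"
    using Hc[OF \<epsilon>] by blast
  define d where "d = min d0 e"
  have d: "d > 0" "d \<le> e" "d \<le> d0" using d0(1) e by (auto simp: d_def)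
  define D where "D h t = (F h t - F 0 t) /\<^sub>R h" for h t
  define D' where "D' h t = (Ft h t - Ft 0 t) /\<^sub>R h" for h t
  have DD': "((\<lambda>t. D h t) has_vector_derivative D' h t) (at t)" if "\<bar>h\<bar> < e" "\<bar>t\<bar> < e" for h t
    unfolding D_def D'_def using e that
    by (intro bounded_linear.has_vector_derivative[OF bounded_linear_scaleR_right] has_vector_derivative_diff Ft) auto
  have near: "norm (D' h t - H 0 t) \<le> \<epsilon>" if h: "h \<noteq> 0" "\<bar>h\<bar> < d" and t: "\<bar>t\<bar> < e" for h t
  proof -
    have "norm (Ft h t - Ft 0 t - (h - 0) *\<^sub>R H 0 t) \<le> norm (h - 0) * \<epsilon>"
    proof (rule vector_differentiable_bound_linearization[where S="closed_segment 0 h" and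
          f="\<lambda>s. Ft s t" and f'="\<lambda>s. H s t"])
      fix s assume "s \<in> closed_segment 0 h"
      then have s: "\<bar>s\<bar> \<le> \<bar>h\<bar>" by (auto simp: closed_segment_eq_real_ivl split: if_splits)
      show "((\<lambda>s. Ft s t) has_vector_derivative H s t) (at s within closed_segment 0 h)"
        using s h d t by (intro has_vector_derivative_at_within[OF H]) auto
      show "norm (H s t - H 0 t) \<le> \<epsilon>" using s h d t by (intro d0) auto
    qed auto
    then have le: "norm (Ft h t - Ft 0 t - h *\<^sub>R H 0 t) \<le> \<bar>h\<bar> * \<epsilon>" by simp
    have "norm ((Ft h t - Ft 0 t - h *\<^sub>R H 0 t) /\<^sub>R h) \<le> \<bar>inverse h\<bar> * (\<bar>h\<bar> * \<epsilon>)"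
      unfolding norm_scaleR using le by (rule mult_left_mono) simp
    also have "\<dots> = \<epsilon>" using h(1) by simp
    finally have "norm ((Ft h t - Ft 0 t - h *\<^sub>R H 0 t) /\<^sub>R h) \<le> \<epsilon>" .
    moreover have "(Ft h t - Ft 0 t - h *\<^sub>R H 0 t) /\<^sub>R h = D' h t - H 0 t"
      using h by (simp add: D'_def scaleR_diff_right)
    ultimately show ?thesis by simp
  qed
  have lim: "((\<lambda>h. D h t) \<longlongrightarrow> Fs t) (at 0)" if "\<bar>t\<bar> < e" for t
    using Fs[OF that] unfolding has_vector_derivative_at0_iff D_def .
  define h where "h = d / 2"
  have h: "h \<noteq> 0" "\<bar>h\<bar> < d" using d by (auto simp: h_def)
  have 1: "norm ((D h t - D h 0) - (Fs t - Fs 0)) \<le> 2 * \<epsilon> * \<bar>t\<bar>" if t: "\<bar>t\<bar> < e" for t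
  proof (rule tendsto_upperbound[of "\<lambda>h'. norm ((D h t - D h 0) - (D h' t - D h' 0))" _ "at 0"])
    show "((\<lambda>h'. norm (D h t - D h 0 - (D h' t - D h' 0))) \<longlongrightarrow> norm (D h t - D h 0 - (Fs t - Fs 0))) (at 0)"
      using e by (intro tendsto_intros lim t) auto
    have "norm (D h t - D h 0 - (D h' t - D h' 0)) \<le> 2 * \<epsilon> * \<bar>t\<bar>" if h': "h' \<noteq> 0" "\<bar>h'\<bar> < d" for h'
    proof -
      have "norm ((D h t - D h' t) - (D h 0 - D h' 0)) \<le> 2 * \<epsilon> * \<bar>t - 0\<bar>"
      proof (rule norm_diff_le_of_derivative[where g="\<lambda>t. D h t - D h' t" and g'="\<lambda>t. D' h t - D' h' t"])
        fix s assume "s \<in> closed_segment 0 t"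
        then have s: "\<bar>s\<bar> < e" using t by (auto simp: closed_segment_eq_real_ivl split: if_splits)
        show "((\<lambda>t. D h t - D h' t) has_vector_derivative D' h s - D' h' s) (at s)"
          using s h h' d by (intro has_vector_derivative_diff DD') auto
        show "norm (D' h s - D' h' s) \<le> 2 * \<epsilon>"
          using norm_triangle_ineq4[of "D' h s - H 0 s" "D' h' s - H 0 s"] near[OF h s] near[OF h' s] by simp
      qed
      then show ?thesis by (simp add: algebra_simps)
    qed
    then show "\<forall>\<^sub>F h' in at 0. norm (D h t - D h 0 - (D h' t - D h' 0)) \<le> 2 * \<epsilon> * \<bar>t\<bar>"
      unfolding eventually_at using d(1) by (intro exI[of _ d]) auto
  qed simp
  have "\<bar>h\<bar> < e" using h d by simp
  from DD'[OF this, of 0] e obtain r where r: "r > 0"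
    "\<And>t. \<bar>t\<bar> < r \<Longrightarrow> norm (D h t - D h 0 - t *\<^sub>R D' h 0) \<le> \<epsilon> * \<bar>t\<bar>"
    unfolding has_vector_derivative_def has_derivative_at_alt using \<epsilon> by auto
  show "\<exists>d>0. \<forall>y. norm (y - 0) < d \<longrightarrow> norm (Fs y - Fs 0 - (y - 0) *\<^sub>R H 0 0) \<le> \<epsilon>0 * norm (y - 0)"
  proof (intro exI[of _ "min r e"] conjI allI impI)
    show "min r e > 0" using r(1) e by simp
    fix t :: real assume "norm (t - 0) < min r e"
    then have t: "\<bar>t\<bar> < r" "\<bar>t\<bar> < e" by auto
    have "Fs t - Fs 0 - t *\<^sub>R H 0 0 = (D h t - D h 0 - t *\<^sub>R D' h 0) - ((D h t - D h 0) - (Fs t - Fs 0))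
        + t *\<^sub>R (D' h 0 - H 0 0)" by (simp add: algebra_simps)
    also have "norm \<dots> \<le> (\<epsilon> * \<bar>t\<bar> + 2 * \<epsilon> * \<bar>t\<bar>) + \<bar>t\<bar> * \<epsilon>"
    proof (intro norm_triangle_mono order_trans[OF norm_triangle_ineq4 add_mono] r 1 t)
      show "norm (t *\<^sub>R (D' h 0 - H 0 0)) \<le> \<bar>t\<bar> * \<epsilon>"
        using near[OF h, of 0] e by (simp add: mult_left_mono)
    qed
    finally show "norm (Fs t - Fs 0 - (t - 0) *\<^sub>R H 0 0) \<le> \<epsilon>0 * norm (t - 0)"
      by (simp add: \<epsilon>_def algebra_simps)
  qed
qed

lemma has_vector_derivative_line_zero:
  fixes F :: "'a::real_normed_vector \<Rightarrow> 'b::real_normed_vector"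
  assumes "\<And>x. ((\<lambda>t. F (x + t *\<^sub>R b)) has_vector_derivative D x) (at 0)"
  shows "((\<lambda>t. F (x + t *\<^sub>R b)) has_vector_derivative D (x + s *\<^sub>R b)) (at s)"
  by (rule has_vector_derivative_line[OF assms])

text \<open>Jointly continuous mixed derivatives satisfy the uniformity condition of
  \<open>mixed_partial\<close> by uniform continuity on a compact square.\<close>

lemma mixed_directional:
  fixes f :: "'e::real_normed_vector \<Rightarrow> 'x::real_normed_vector"
  assumes fb: "\<And>x. ((\<lambda>s. f (x + s *\<^sub>R b)) has_vector_derivative fb x) (at 0)"
    and fc: "\<And>x. ((\<lambda>s. f (x + s *\<^sub>R c)) has_vector_derivative fc x) (at 0)"
    and fcb: "\<And>x. ((\<lambda>s. fc (x + s *\<^sub>R b)) has_vector_derivative fcb x) (at 0)"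
    and cont: "continuous_on UNIV fcb"
  shows "((\<lambda>t. fb (x + t *\<^sub>R c)) has_vector_derivative fcb x) (at 0)"
proof -
  define H where "H s t = fcb (x + s *\<^sub>R b + t *\<^sub>R c)" for s t
  have "((\<lambda>t. fb (x + t *\<^sub>R c)) has_vector_derivative H 0 0) (at 0)"
  proof (rule mixed_partial[where e=1 and F="\<lambda>s t. f (x + s *\<^sub>R b + t *\<^sub>R c)" and Ft="\<lambda>s t. fc (x + s *\<^sub>R b + t *\<^sub>R c)" and H=H])
    show "((\<lambda>s. f (x + s *\<^sub>R b + t *\<^sub>R c)) has_vector_derivative fb (x + t *\<^sub>R c)) (at 0)" for t
      using fb[of "x + t *\<^sub>R c"] by (simp add: algebra_simps)
    show "((\<lambda>t. f (x + s *\<^sub>R b + t *\<^sub>R c)) has_vector_derivative fc (x + s *\<^sub>R b + t *\<^sub>R c)) (at t)" for s t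
      by (rule has_vector_derivative_line_zero[OF fc])
    show "((\<lambda>s. fc (x + s *\<^sub>R b + t *\<^sub>R c)) has_vector_derivative H s t) (at s)" for s t
      using has_vector_derivative_line_zero[OF fcb, of "x + t *\<^sub>R c" s] by (simp add: algebra_simps H_def)
    fix \<epsilon> :: real assume \<epsilon>: "\<epsilon> > 0"
    have "continuous_on ({-1..1} \<times> {-1..1}) (\<lambda>(s, t). H s t)"
      unfolding H_def case_prod_unfold by (intro continuous_on_compose2[OF cont] continuous_intros) auto
    then have "uniformly_continuous_on ({-1..1} \<times> {-1..1}) (\<lambda>(s, t). H s t)"
      by (intro compact_uniformly_continuous compact_Times compact_Icc)
    then obtain d where d: "d > 0" "\<And>z z'. z \<in> {-1..1} \<times> {-1..1} \<Longrightarrow> z' \<in> {-1..1} \<times> {-1..1} \<Longrightarrow>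
        dist z' z < d \<Longrightarrow> dist (case z' of (s, t) \<Rightarrow> H s t) (case z of (s, t) \<Rightarrow> H s t) < \<epsilon>"
      unfolding uniformly_continuous_on_def using \<epsilon> by meson
    show "\<exists>d>0. \<forall>s t. \<bar>s\<bar> < d \<longrightarrow> \<bar>t\<bar> < 1 \<longrightarrow> norm (H s t - H 0 t) \<le> \<epsilon>"
    proof (intro exI[of _ "min d 1"] conjI allI impI)
      fix s t :: real assume "\<bar>s\<bar> < min d 1" "\<bar>t\<bar> < 1"
      then show "norm (H s t - H 0 t) \<le> \<epsilon>"
        using d(2)[of "(0, t)" "(s, t)"] by (simp add: dist_norm norm_Pair abs_less_iff)
    qed (use d in simp)
  qed simp
  then show ?thesis by (simp add: H_def)
qed

lemma dd_commute:
  assumes "bdiff (Suc (Suc k)) P \<omega> f" "p \<in> P" "b \<in> Basis" "c \<in> Basis"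
  shows "dd c (dd b (f p)) = dd b (dd c (f p))"
proof
  fix x
  note A = partials_Basis[OF bdiff_partials[OF assms(1,2)], of _ _ 0, simplified]
  note B = partials_Basis[OF bdiff_partials[OF bdiff_dd[OF assms(1)] assms(2)], of _ _ _ 0, simplified]
  show "dd c (dd b (f p)) x = dd b (dd c (f p)) x"
    by (rule ddI[OF mixed_directional[OF A A B]])
      (use assms in \<open>auto intro: bdiff_continuous[OF bdiff_dd[OF bdiff_dd[OF assms(1)]]]\<close>)
qed

text \<open>Locally bounded partial derivatives make \<open>f\<close> locally Lipschitz, again by
  moving one coordinate at a time. The continuity of the partial derivatives is not at hand in the
  applications, where only bounds of the next order are known.\<close>

lemma continuous_of_bounded_partials:
  fixes f :: "'e::euclidean_space \<Rightarrow> 'x::real_normed_vector"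
  assumes d: "\<And>b x. b \<in> Basis \<Longrightarrow> ((\<lambda>t. f (x + t *\<^sub>R b)) has_vector_derivative f' b x) (at 0)"
    and g: "\<And>b x. b \<in> Basis \<Longrightarrow> norm (f' b x) \<le> g x" "continuous_on UNIV g"
  shows "continuous_on UNIV f"
proof (rule continuous_at_imp_continuous_on, rule ballI)
  fix x :: 'e
  define pr where "pr B v = (\<Sum>b\<in>B. (v \<bullet> b) *\<^sub>R b)" for B and v :: 'e
  have prn: "norm (pr B v) \<le> real (card B) * norm v" if "B \<subseteq> Basis" for B v
    unfolding pr_def using that
    by (intro sum_norm_bound) (auto simp: Basis_le_norm subset_iff norm_Basis)
  \<comment> \<open>For \<open>norm v < 1\<close> all intermediate points lie in the closed ball of
    this radius, on which \<open>g\<close> is bounded by compactness.\<close>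
  define K where "K = real DIM('e) + 1"
  have K: "K > 0" unfolding K_def by simp
  have "bounded (g ` cball x K)"
    by (intro compact_imp_bounded compact_continuous_image continuous_on_subset[OF g(2)]) auto
  then obtain M where M: "M > 0" "\<And>y. dist x y \<le> K \<Longrightarrow> g y \<le> M"
    unfolding bounded_pos by (force simp: abs_le_iff)
  have claim: "norm (f (x + pr B v) - f x) \<le> real (card B) * (M * norm v)"
    if "finite B" "B \<subseteq> Basis" "norm v < 1" for B v
    using that
  proof (induction B rule: finite_induct)
    case empty
    then show ?case by (simp add: pr_def)
  next
    case (insert b B)
    then have b: "b \<in> Basis" and B: "B \<subseteq> Basis" by auto
    define z where "z = x + pr B v"
    define c where "c = v \<bullet> b"
    have cv: "\<bar>c\<bar> \<le> norm v" unfolding c_def by (rule Basis_le_norm[OF b])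
    have "norm (f (z + c *\<^sub>R b) - f (z + 0 *\<^sub>R b)) \<le> M * \<bar>c - 0\<bar>"
    proof (rule norm_diff_le_of_derivative[where g="\<lambda>t. f (z + t *\<^sub>R b)"])
      fix t assume "t \<in> closed_segment 0 c"
      then have t: "\<bar>t\<bar> \<le> \<bar>c\<bar>" by (auto simp: closed_segment_eq_real_ivl split: if_splits)
      show "((\<lambda>t. f (z + t *\<^sub>R b)) has_vector_derivative f' b (z + t *\<^sub>R b)) (at t)"
        by (rule has_vector_derivative_line[OF d[OF b]])
      have "real (card B) \<le> real DIM('e)" using B by (simp add: card_mono)
      then have cB: "real (card B) * norm v \<le> real DIM('e)"
        using \<open>norm v < 1\<close> mult_mono[of "real (card B)" "real DIM('e)" "norm v" 1] by simp
      have "norm (pr B v + t *\<^sub>R b) \<le> norm (pr B v) + norm (t *\<^sub>R b)"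
        by (rule norm_triangle_ineq)
      also have "\<dots> \<le> K"
        using prn[OF B, of v] t cv b cB \<open>norm v < 1\<close> by (simp add: K_def norm_Basis)
      finally have "dist x (z + t *\<^sub>R b) \<le> K"
        unfolding z_def by (metis add.assoc add_diff_cancel_left' dist_norm norm_minus_commute)
      then show "norm (f' b (z + t *\<^sub>R b)) \<le> M"
        using M(2) g(1)[OF b] order_trans by blast
    qed
    also have "\<dots> \<le> M * norm v" using cv M(1) by simp
    finally have 1: "norm (f (z + c *\<^sub>R b) - f z) \<le> M * norm v" by simp
    have "f (x + pr (insert b B) v) - f x = (f (x + pr B v) - f x) + (f (z + c *\<^sub>R b) - f z)"
      using insert.hyps by (simp add: pr_def z_def c_def algebra_simps)
    also have "norm \<dots> \<le> real (card B) * (M * norm v) + M * norm v"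
      by (rule norm_triangle_mono[OF insert.IH[OF B insert.prems(2)] 1])
    finally show ?case
      using insert.hyps by (simp add: distrib_right add.commute)
  qed
  have pB: "pr Basis v = v" for v by (simp add: pr_def euclidean_representation)
  have le: "norm (f y - f x) \<le> real DIM('e) * M * norm (y - x)" if "norm (y - x) < 1" for y
    using claim[OF finite_Basis subset_refl that] by (simp add: pB mult.assoc)
  show "continuous (at x) f"
    unfolding continuous_at_eps_delta dist_norm
  proof (intro allI impI)
    fix e :: real assume "e > 0"
    define L where "L = real DIM('e) * M + 1"
    have L: "L > 0" using M(1) by (simp add: L_def add_nonneg_pos)
    show "\<exists>d>0. \<forall>y. norm (y - x) < d \<longrightarrow> norm (f y - f x) < e"
    proof (intro exI[of _ "min 1 (e / L)"] conjI allI impI)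
      show "min 1 (e / L) > 0" using \<open>e > 0\<close> L by simp
      fix y assume y: "norm (y - x) < min 1 (e / L)"
      then have "norm (f y - f x) \<le> L * norm (y - x)"
        using le[of y] mult_right_mono[of "real DIM('e) * M" L "norm (y - x)"] by (simp add: L_def)
      also have "\<dots> < e" using y L by (simp add: field_simps)
      finally show "norm (f y - f x) < e" .
    qed
  qed
qed

text \<open>For functions indexed by lists of directions, with a further direction acting as a
  derivative, bounds are enough: the continuity of each level follows from the bound on the next
  one.\<close>

lemma bdiff_tower:
  fixes G :: "'e::euclidean_space list \<Rightarrow> 'p \<Rightarrow> 'e \<Rightarrow> 'x::real_normed_vector"
  assumes d: "\<And>b bs p x. b \<in> Basis \<Longrightarrow> set bs \<subseteq> Basis \<Longrightarrow> p \<in> P \<Longrightarrow>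
      ((\<lambda>t. G bs p (x + t *\<^sub>R b)) has_vector_derivative G (b # bs) p x) (at 0)"
    and bd: "\<And>bs. set bs \<subseteq> Basis \<Longrightarrow> \<exists>C\<ge>0. \<forall>p\<in>P. \<forall>x. norm (G bs p x) \<le> C * \<omega> (length bs) p x"
    and c: "\<And>j p. p \<in> P \<Longrightarrow> continuous_on UNIV (\<omega> j p)"
  shows "set bs \<subseteq> Basis \<Longrightarrow> bdiff k P (\<lambda>j. \<omega> (j + length bs)) (G bs)"
proof (induction k arbitrary: bs)
  case 0
  have "continuous_on UNIV (G bs p)" if p: "p \<in> P" for p
  proof -
    have "\<forall>b\<in>Basis. \<exists>C\<ge>0. \<forall>x. norm (G (b # bs) p x) \<le> C * \<omega> (Suc (length bs)) p x"
      using bd[of "_ # bs"] 0 p by force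
    then obtain C where C: "\<And>b. b \<in> Basis \<Longrightarrow> C b \<ge> 0"
      "\<And>b x. b \<in> Basis \<Longrightarrow> norm (G (b # bs) p x) \<le> C b * \<omega> (Suc (length bs)) p x"
      by (metis (no_types, lifting))
    show ?thesis
    proof (rule continuous_of_bounded_partials[OF d[OF _ 0 p]])
      fix b x assume b: "(b::'e) \<in> Basis"
      have "norm (G (b # bs) p x) \<le> C b * \<bar>\<omega> (Suc (length bs)) p x\<bar>"
        using order_trans[OF C(2)[OF b] mult_left_mono[OF abs_ge_self C(1)[OF b]]] .
      also have "\<dots> \<le> (\<Sum>b\<in>Basis. C b) * \<bar>\<omega> (Suc (length bs)) p x\<bar>"
        using C(1) b by (intro mult_right_mono member_le_sum) auto
      finally show "norm (G (b # bs) p x) \<le> (\<Sum>b\<in>Basis. C b) * \<bar>\<omega> (Suc (length bs)) p x\<bar>" .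
    qed (auto intro!: continuous_intros c p)
  qed
  then show ?case using bd[OF 0] by simp
next
  case (Suc k)
  show ?case
  proof (rule bdiff_SucI[where f' = "\<lambda>b. G (b # bs)"])
    show "\<exists>C\<ge>0. \<forall>p\<in>P. \<forall>x. norm (G bs p x) \<le> C * \<omega> (0 + length bs) p x"
      using bd[OF Suc.prems] by simp
    show "bdiff k P (\<lambda>j. \<omega> (Suc j + length bs)) (G (b # bs))" if "b \<in> Basis" for b
      using Suc.IH[of "b # bs"] Suc.prems that by simp
  qed (use d Suc.prems in blast)
qed

section \<open>Fourier transforms and oscillatory integrals\<close>

lemma scaleC_scaleR: "c *\<^sub>C (r *\<^sub>R x) = r *\<^sub>R (c *\<^sub>C (x::'a::complex_banach))"
  by (simp add: scaleC_of_real[symmetric] scaleC_scaleC mult.commute)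

lemma bounded_bilinear_scaleC: "bounded_bilinear (scaleC :: complex \<Rightarrow> 'a::complex_banach \<Rightarrow> 'a)"
proof
  show "(r *\<^sub>R c) *\<^sub>C x = r *\<^sub>R c *\<^sub>C x" for r c and x :: 'a
    by (simp add: scaleC_of_real[of r "c *\<^sub>C x", symmetric] scaleC_scaleC scaleR_conv_of_real)
  show "\<exists>K. \<forall>a b. norm (a *\<^sub>C (b::'a)) \<le> norm a * norm b * K"
    by (intro exI[of _ 1]) (simp add: norm_scaleC)
qed (simp_all add: scaleC_add_left scaleC_add_right scaleC_scaleR)

interpretation scaleC: bounded_bilinear "scaleC :: complex \<Rightarrow> 'a::complex_banach \<Rightarrow> 'a"
  by (rule bounded_bilinear_scaleC)

lemma scaleC_one [simp]: "1 *\<^sub>C (x::'a::complex_banach) = x"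
  using scaleC_of_real[of 1 x] by simp

lemmas continuous_on_scaleC [continuous_intros] = scaleC.continuous_on

text \<open>Single functions are families over the one-element type, so that the calculus for
  families is available; one weight serves for derivatives of all orders.\<close>

definition sbd :: "('e::euclidean_space \<Rightarrow> real) \<Rightarrow> ('e \<Rightarrow> 'x::real_normed_vector) \<Rightarrow> bool"
  where "sbd \<omega> f \<longleftrightarrow> (\<forall>k. bdiff k (UNIV::unit set) (\<lambda>_ _. \<omega>) (\<lambda>_. f))"

lemma sbd_of_bdiff:
  assumes "\<And>k. bdiff k P \<omega> f" "p \<in> P"
    and "\<And>j. \<exists>D\<ge>0. \<forall>x. \<omega> j p x \<le> D * \<omega>' x"
  shows "sbd \<omega>' (f p)"
  unfolding sbd_def
proof
  fix k
  have "bdiff k (UNIV::unit set) (\<lambda>j _. \<omega> j p) (\<lambda>_. f p)"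
    by (rule bdiff_reparam[OF assms(1), of _ "\<lambda>_. p"]) (rule assms(2))
  then show "bdiff k (UNIV::unit set) (\<lambda>_ _. \<omega>') (\<lambda>_. f p)"
    by (rule bdiff_weaken) (use assms(3) in simp)
qed

lemma sbd_boundE:
  assumes "sbd \<omega> f" obtains C where "C \<ge> 0" "\<And>x. norm (f x) \<le> C * \<omega> x"
  using bdiff_bound[OF assms[unfolded sbd_def, rule_format, of 0]] that by blast

lemma sbd_continuous: "sbd \<omega> f \<Longrightarrow> continuous_on S f"
  by (rule bdiff_continuous[OF sbd_def[THEN iffD1, rule_format] UNIV_I])

lemma sbd_dd: "sbd \<omega> f \<Longrightarrow> b \<in> Basis \<Longrightarrow> sbd \<omega> (dd b f)"
  unfolding sbd_def by (rule allI, rule bdiff_dd[of _ UNIV "\<lambda>_ _. \<omega>" "\<lambda>_. f"]) (rule spec)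

lemma sbd_partials: "sbd \<omega> f \<Longrightarrow> partials f (\<lambda>b. dd b f)"
  using bdiff_partials[of 0 UNIV "\<lambda>_ _. \<omega>" "\<lambda>_. f" "()"] by (simp only: sbd_def UNIV_I simp_thms)

lemma sbd_derivative:
  "sbd \<omega> f \<Longrightarrow> b \<in> Basis \<Longrightarrow> ((\<lambda>t. f (x + t *\<^sub>R b)) has_vector_derivative dd b f x) (at 0)"
  using partials_Basis[OF sbd_partials, of \<omega> f b x 0] by simp

lemma sbd_dd_commute: "sbd \<omega> f \<Longrightarrow> b \<in> Basis \<Longrightarrow> c \<in> Basis \<Longrightarrow> dd c (dd b f) = dd b (dd c f)"
  using dd_commute[of 0 UNIV "\<lambda>_ _. \<omega>" "\<lambda>_. f" "()"] by (simp only: sbd_def UNIV_I simp_thms)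

lemma sbd_weaken: "sbd \<omega> f \<Longrightarrow> D \<ge> 0 \<Longrightarrow> (\<And>x. \<omega> x \<le> D * \<omega>' x) \<Longrightarrow> sbd \<omega>' f"
  unfolding sbd_def by (rule allI, rule bdiff_weaken[of _ _ "\<lambda>_ _. \<omega>"]) (rule spec, assumption, blast)

lemma sbd_add: "sbd \<omega> f \<Longrightarrow> sbd \<omega> g \<Longrightarrow> sbd \<omega> (\<lambda>x. f x + g x)"
  unfolding sbd_def by (auto intro: bdiff_add)

lemma sbd_sum: "(\<And>i. i \<in> I \<Longrightarrow> sbd \<omega> (f i)) \<Longrightarrow> sbd \<omega> (\<lambda>x. \<Sum>i\<in>I. f i x)"
  unfolding sbd_def by (auto intro: bdiff_sum)

lemma sbd_linear: "bounded_linear h \<Longrightarrow> sbd \<omega> f \<Longrightarrow> sbd \<omega> (\<lambda>x. h (f x))"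
  unfolding sbd_def by (auto intro: bdiff_linear)

lemma sbd_bilinear:
  "bounded_bilinear h \<Longrightarrow> sbd \<omega> f \<Longrightarrow> sbd \<omega>' g \<Longrightarrow> D \<ge> 0 \<Longrightarrow> (\<And>x. \<omega> x * \<omega>' x \<le> D * \<Omega> x) \<Longrightarrow>
    sbd \<Omega> (\<lambda>x. h (f x) (g x))"
proof (rule sbd_weaken[of "\<lambda>x. \<omega> x * \<omega>' x"])
  assume h: "bounded_bilinear h" and f: "sbd \<omega> f" and g: "sbd \<omega>' g"
  show "sbd (\<lambda>x. \<omega> x * \<omega>' x) (\<lambda>x. h (f x) (g x))"
    unfolding sbd_def
    by (rule allI, rule bdiff_bilinear[OF h f[unfolded sbd_def, rule_format] g[unfolded sbd_def, rule_format]]) simp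
qed

lemma sbd_const: "C \<ge> 0 \<Longrightarrow> (\<And>x. norm c \<le> C * \<omega> x) \<Longrightarrow> sbd \<omega> (\<lambda>x. c)"
  unfolding sbd_def by (auto intro: bdiff_const)

lemma sbd_coord:
  fixes b :: "'e::euclidean_space"
  shows "sbd (\<lambda>x. 1 + \<bar>x \<bullet> b\<bar>) (\<lambda>x. x \<bullet> b)"
  unfolding sbd_def
proof
  fix k
  show "bdiff k (UNIV::unit set) (\<lambda>_ _ x. 1 + \<bar>x \<bullet> b\<bar>) (\<lambda>_ x. x \<bullet> b)"
  proof (cases k)
    case 0
    then show ?thesis by (auto intro!: exI[of _ 1] continuous_intros)
  next
    case (Suc j)
    show ?thesis unfolding Suc
    proof (rule bdiff_SucI[where f' = "\<lambda>c _ x. c \<bullet> b"])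
      show "((\<lambda>t. (x + t *\<^sub>R c) \<bullet> b) has_vector_derivative c \<bullet> b) (at 0)" for x c
        by (auto simp: inner_add_left intro!: derivative_eq_intros)
      show "bdiff j (UNIV::unit set) (\<lambda>_ _ x. 1 + \<bar>x \<bullet> b\<bar>) (\<lambda>_ _. c \<bullet> b)" for c
        by (rule bdiff_const[of "\<bar>c \<bullet> b\<bar>"]) (auto simp: distrib_left)
    qed (auto intro!: exI[of _ 1])
  qed
qed

lemma dd_add: "sbd \<omega> f \<Longrightarrow> sbd \<omega>' g \<Longrightarrow> b \<in> Basis \<Longrightarrow> dd b (\<lambda>x. f x + g x) = (\<lambda>x. dd b f x + dd b g x)"
  by (intro ext ddI has_vector_derivative_add sbd_derivative)

lemma dd_linear: "bounded_linear h \<Longrightarrow> sbd \<omega> f \<Longrightarrow> b \<in> Basis \<Longrightarrow> dd b (\<lambda>x. h (f x)) = (\<lambda>x. h (dd b f x))"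
  by (intro ext ddI bounded_linear.has_vector_derivative[of h] sbd_derivative)

section \<open>Fourier transforms: derivatives and decay\<close>

lemma cis_neg_derivative:
  fixes y b \<eta> :: "'e::euclidean_space"
  shows "((\<lambda>t. cis (- ((y + t *\<^sub>R b) \<bullet> \<eta>))) has_vector_derivative (- \<i> * of_real (b \<bullet> \<eta>)) * cis (- (y \<bullet> \<eta>))) (at 0)"
proof -
  have "((\<lambda>t. - ((y + t *\<^sub>R b) \<bullet> \<eta>)) has_real_derivative - (b \<bullet> \<eta>)) (at 0)"
    by (auto simp: inner_add_left intro!: derivative_eq_intros)
  then have "((\<lambda>t. - ((y + t *\<^sub>R b) \<bullet> \<eta>)) has_derivative (\<lambda>h. h *\<^sub>R (- (b \<bullet> \<eta>)))) (at 0)"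
    unfolding has_field_derivative_def by (rule has_derivative_eq_rhs) (simp add: fun_eq_iff)
  from has_derivative_cis[OF this] show ?thesis
    by (simp add: has_vector_derivative_def scaleR_conv_of_real algebra_simps)
qed

lemma fourier_bound:
  fixes h :: "real^'n::finite \<Rightarrow> 'x::complex_banach"
  assumes "continuous_on UNIV h" "\<And>x. norm (h x) \<le> g x" "g integrable_on UNIV"
  shows "(\<lambda>y. cis (- (y \<bullet> \<eta>)) *\<^sub>C h y) integrable_on UNIV"
    "norm (fourier h \<eta>) \<le> integral UNIV g"
proof -
  have c: "continuous_on UNIV (\<lambda>y. cis (- (y \<bullet> \<eta>)) *\<^sub>C h y)"
    by (intro continuous_intros assms)
  show "(\<lambda>y. cis (- (y \<bullet> \<eta>)) *\<^sub>C h y) integrable_on UNIV"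
    by (rule integrable_dominated[OF c _ assms(3)]) (simp add: norm_scaleC assms(2))
  show "norm (fourier h \<eta>) \<le> integral UNIV g"
    unfolding fourier_def by (rule norm_integral_le[OF c _ assms(3)]) (simp add: norm_scaleC assms(2))
qed

lemma integrable_cmult_wt: "(\<lambda>x. C * wt x) integrable_on UNIV"
  by (intro integrable_on_mult_right integrable_wt)

lemma fourier_integrable:
  fixes h :: "real^'n::finite \<Rightarrow> 'x::complex_banach"
  assumes "sbd wt h"
  shows "(\<lambda>y. cis (- (y \<bullet> \<eta>)) *\<^sub>C h y) integrable_on UNIV"
proof -
  obtain C where "\<And>x. norm (h x) \<le> C * wt x" using sbd_boundE[OF assms] by metis
  then show ?thesis by (rule fourier_bound(1)[OF sbd_continuous[OF assms] _ integrable_cmult_wt])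
qed

lemma fourier_add:
  fixes f g :: "real^'n::finite \<Rightarrow> 'x::complex_banach"
  assumes "sbd wt f" "sbd wt g"
  shows "fourier (\<lambda>x. f x + g x) \<eta> = fourier f \<eta> + fourier g \<eta>"
  unfolding fourier_def scaleC.add_right
  by (intro integral_add fourier_integrable assms)

lemma fourier_linear:
  fixes f :: "real^'n::finite \<Rightarrow> 'x::complex_banach"
  assumes "sbd wt f" "bounded_linear h" "\<And>c x. h (c *\<^sub>C x) = c *\<^sub>C h x"
  shows "fourier (\<lambda>x. h (f x)) \<eta> = h (fourier f \<eta>)"
  unfolding fourier_def
  using integral_linear[OF fourier_integrable[OF assms(1)] assms(2)] by (simp add: o_def assms(3))

lemma fourier_scaleC:
  fixes f :: "real^'n::finite \<Rightarrow> 'x::complex_banach"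
  assumes "sbd wt f"
  shows "fourier (\<lambda>x. c *\<^sub>C f x) \<eta> = c *\<^sub>C fourier f \<eta>"
  by (rule fourier_linear[OF assms scaleC.bounded_linear_right]) (simp add: scaleC_scaleC mult.commute)

text \<open>The derivative of \<open>exp (- i y \<cdot> \<eta>) h(y)\<close> in \<open>y\<close> has
  integral zero.\<close>

lemma fourier_dd:
  fixes h :: "real^'n::finite \<Rightarrow> 'x::complex_banach"
  assumes h: "sbd wt h" and b: "b \<in> Basis"
  shows "fourier (dd b h) \<eta> = (\<i> * of_real (b \<bullet> \<eta>)) *\<^sub>C fourier h \<eta>"
proof -
  define F' where "F' y = cis (- (y \<bullet> \<eta>)) *\<^sub>C dd b h y + (- (\<i> * of_real (b \<bullet> \<eta>))) *\<^sub>C cis (- (y \<bullet> \<eta>)) *\<^sub>C h y" for y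
  obtain C where C: "\<And>x. norm (h x) \<le> C * wt x" "C \<ge> 0" using sbd_boundE[OF h] by metis
  obtain C' where C': "\<And>x. norm (dd b h x) \<le> C' * wt x" "C' \<ge> 0" using sbd_boundE[OF sbd_dd[OF h b]] by metis
  define D where "D = C + C' + \<bar>b \<bullet> \<eta>\<bar> * C"
  have "integral UNIV F' = 0"
  proof (rule integral_partial_derivative_zero[OF b, where F="\<lambda>y. cis (- (y \<bullet> \<eta>)) *\<^sub>C h y" and C=D])
    show "((\<lambda>t. cis (- ((x + t *\<^sub>R b) \<bullet> \<eta>)) *\<^sub>C h (x + t *\<^sub>R b)) has_vector_derivative F' x) (at 0)" for x
      using scaleC.has_vector_derivative[OF cis_neg_derivative sbd_derivative[OF h b, of x], of x b \<eta>]
      by (simp add: F'_def scaleC_scaleC)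
    show "continuous_on UNIV (\<lambda>y. cis (- (y \<bullet> \<eta>)) *\<^sub>C h y)" "continuous_on UNIV F'"
      unfolding F'_def by (intro continuous_intros sbd_continuous[OF h] sbd_continuous[OF sbd_dd[OF h b]])+
    show "norm (cis (- (x \<bullet> \<eta>)) *\<^sub>C h x) \<le> D * wt x" for x
    proof -
      have "C \<le> D" using C(2) C'(2) by (simp add: D_def)
      from order_trans[OF C(1) mult_right_mono[OF this wt_nonneg]] show ?thesis by (simp add: norm_scaleC)
    qed
    show "norm (F' x) \<le> D * wt x" for x
    proof -
      have "norm (F' x) \<le> norm (dd b h x) + \<bar>b \<bullet> \<eta>\<bar> * norm (h x)"
        unfolding F'_def by (rule order_trans[OF norm_triangle_ineq]) (simp add: norm_scaleC norm_mult)
      also have "\<dots> \<le> C' * wt x + \<bar>b \<bullet> \<eta>\<bar> * (C * wt x)"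
        by (intro add_mono mult_left_mono C C') auto
      also have "\<dots> \<le> D * wt x" using C(2) by (simp add: D_def algebra_simps)
      finally show ?thesis .
    qed
  qed
  moreover have "integral UNIV F' = fourier (dd b h) \<eta> + (- (\<i> * of_real (b \<bullet> \<eta>))) *\<^sub>C fourier h \<eta>"
  proof -
    have "(\<lambda>y. (- (\<i> * of_real (b \<bullet> \<eta>))) *\<^sub>C cis (- (y \<bullet> \<eta>)) *\<^sub>C h y) integrable_on UNIV"
      "integral UNIV (\<lambda>y. (- (\<i> * of_real (b \<bullet> \<eta>))) *\<^sub>C cis (- (y \<bullet> \<eta>)) *\<^sub>C h y) = (- (\<i> * of_real (b \<bullet> \<eta>))) *\<^sub>C fourier h \<eta>"
      using integrable_linear[OF fourier_integrable[OF h, of \<eta>] scaleC.bounded_linear_right]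
        integral_linear[OF fourier_integrable[OF h, of \<eta>] scaleC.bounded_linear_right]
      by (simp_all only: o_def fourier_def)
    then show ?thesis
      unfolding F'_def fourier_def[of "dd b h"]
      by (simp add: integral_add[OF fourier_integrable[OF sbd_dd[OF h b]]] del: scaleC.minus_left)
  qed
  ultimately show ?thesis by (simp add: scaleC.minus_left)
qed

lemma fourier_continuous:
  fixes h :: "real^'n::finite \<Rightarrow> 'x::complex_banach"
  assumes h: "sbd wt h"
  shows "continuous_on S (fourier h)"
proof -
  obtain C where C: "\<And>x. norm (h x) \<le> C * wt x" using sbd_boundE[OF h] by metis
  have "continuous_on UNIV (\<lambda>\<eta>. integral UNIV (\<lambda>y. cis (- (y \<bullet> \<eta>)) *\<^sub>C h y))"
    by (rule continuous_on_integral_param[OF _ _ _ integrable_cmult_wt])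
      (auto intro!: continuous_intros sbd_continuous[OF h] C simp: norm_scaleC)
  then show ?thesis
    using continuous_on_subset by (fastforce simp: fourier_def[abs_def])
qed

lemma fourier_derivative:
  fixes h :: "real^'n::finite \<Rightarrow> 'x::complex_banach"
  assumes h: "sbd wt h" and wh: "sbd wt (\<lambda>w. (w \<bullet> b) *\<^sub>R h w)"
  shows "((\<lambda>t. fourier h (\<eta> + t *\<^sub>R b)) has_vector_derivative - fourier (\<lambda>w. \<i> *\<^sub>C (w \<bullet> b) *\<^sub>R h w) \<eta>) (at 0)"
proof -
  obtain C where C: "\<And>x. norm (h x) \<le> C * wt x" using sbd_boundE[OF h] by metis
  obtain C' where C': "\<And>x. norm ((x \<bullet> b) *\<^sub>R h x) \<le> C' * wt x" using sbd_boundE[OF wh] by metis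
  define F' where "F' t y = - (cis (- (y \<bullet> (\<eta> + t *\<^sub>R b))) *\<^sub>C \<i> *\<^sub>C (y \<bullet> b) *\<^sub>R h y)" for t y
  have "((\<lambda>t. fourier h (\<eta> + t *\<^sub>R b)) has_vector_derivative integral UNIV (F' 0)) (at 0)"
    unfolding fourier_def
  proof (rule integral_vector_derivative[where e=1, OF _ _ _ _ _ _ integrable_cmult_wt])
    show "((\<lambda>t. cis (- (x \<bullet> (\<eta> + t *\<^sub>R b))) *\<^sub>C h x) has_vector_derivative F' s x) (at s)" for s x
    proof -
      have 0: "((\<lambda>t. cis (- (x \<bullet> (\<zeta> + t *\<^sub>R b)))) has_vector_derivative (- \<i> * of_real (x \<bullet> b)) * cis (- (x \<bullet> \<zeta>))) (at 0)" for \<zeta>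
        using cis_neg_derivative[of \<zeta> b x] by (simp add: inner_commute)
      from bounded_linear.has_vector_derivative[OF scaleC.bounded_linear_left has_vector_derivative_line_zero[OF 0]]
      show ?thesis
        by (rule has_vector_derivative_eq_rhs) 
          (simp add: F'_def scaleC_of_real[symmetric] scaleC_scaleC scaleC.minus_left[symmetric] mult_ac)
    qed
    show "continuous_on UNIV (\<lambda>y. cis (- (y \<bullet> (\<eta> + s *\<^sub>R b))) *\<^sub>C h y)" for s
      by (intro continuous_intros sbd_continuous[OF h])
    show "continuous_on UNIV (F' 0)"
      unfolding F'_def by (intro continuous_intros sbd_continuous[OF h])
    show "(\<lambda>y. cis (- (y \<bullet> (\<eta> + s *\<^sub>R b))) *\<^sub>C h y) integrable_on UNIV" for s
      by (rule fourier_integrable[OF h])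
    show "norm (F' s x) \<le> C' * wt x" for s x
      using C'[of x] by (simp add: F'_def norm_scaleC)
  qed simp
  moreover have "integral UNIV (F' 0) = - fourier (\<lambda>w. \<i> *\<^sub>C (w \<bullet> b) *\<^sub>R h w) \<eta>"
    unfolding F'_def fourier_def by simp
  ultimately show ?thesis by simp
qed

text \<open>If every derivative costs a factor \<open>r p\<close>, then \<open>N\<close> of them
  show that \<open>|\<eta>_b|^N\<close> times the transform is at most a multiple of
  \<open>r p ^ N\<close> times the integral of the envelope. The powers of \<open>r p\<close>
  matter: with an envelope concentrated at scale \<open>1 / r\<close> this is decay at frequency
  scale \<open>r\<close>, with a constant that does not depend on \<open>p\<close>.\<close>

lemma fourier_decay_family:
  fixes h :: "'p \<Rightarrow> real^'n::finite \<Rightarrow> 'x::complex_banach"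
  assumes h: "\<And>k. bdiff k P (\<lambda>j p w. r p ^ j * g p w) h"
    and g: "\<And>p. p \<in> P \<Longrightarrow> g p integrable_on UNIV" and gw: "\<And>p w. p \<in> P \<Longrightarrow> g p w \<le> D p * wt w"
    and g0: "\<And>p w. p \<in> P \<Longrightarrow> 0 \<le> g p w"
    and D: "\<And>p. p \<in> P \<Longrightarrow> D p \<ge> 0" and r: "\<And>p. p \<in> P \<Longrightarrow> r p > 0"
  shows "\<exists>C\<ge>0. \<forall>p\<in>P. \<forall>\<eta>. (r p + norm \<eta>) ^ N * norm (fourier (h p) \<eta>) \<le> C * r p ^ N * integral UNIV (g p)"
proof -
  have dn: "bdiff k P (\<lambda>j p w. r p ^ (j + N) * g p w) (\<lambda>p. (dd b ^^ N) (h p))" if "b \<in> Basis" for b k N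
  proof (induction N arbitrary: k)
    case 0
    then show ?case using h by simp
  next
    case (Suc N)
    show ?case using bdiff_dd[OF Suc[of "Suc k"] that] by simp
  qed
  have sb: "sbd wt ((dd b ^^ N) (h p))" if b: "b \<in> Basis" and p: "p \<in> P" for b p N
  proof (rule sbd_of_bdiff[OF dn[OF b] p])
    fix j
    show "\<exists>Da\<ge>0. \<forall>x. r p ^ (j + N) * g p x \<le> Da * wt x"
      using mult_left_mono[OF gw[OF p], of "r p ^ (j + N)"] r[OF p] D[OF p]
      by (intro exI[of _ "r p ^ (j + N) * D p"]) (simp add: mult.assoc)
  qed
  have pw: "\<bar>b \<bullet> \<eta>\<bar> ^ N * norm (fourier (h p) \<eta>) = norm (fourier ((dd b ^^ N) (h p)) \<eta>)" if b: "b \<in> Basis" and p: "p \<in> P" for b p \<eta> N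
  proof (induction N)
    case (Suc N)
    then show ?case
      using fourier_dd[OF sb[OF b p, of N] b, of \<eta>] by (simp add: norm_scaleC norm_mult)
  qed simp
  have I0: "0 \<le> integral UNIV (g p)" if "p \<in> P" for p
    using integral_nonneg[OF g[OF that]] g0[OF that] by simp
  have "\<exists>C\<ge>0. \<forall>p\<in>P. \<forall>\<eta>. \<bar>b \<bullet> \<eta>\<bar> ^ N * norm (fourier (h p) \<eta>) \<le> C * r p ^ N * integral UNIV (g p)" if b: "b \<in> Basis" for b N
  proof -
    obtain C where C: "C \<ge> 0" "\<And>p x. p \<in> P \<Longrightarrow> norm ((dd b ^^ N) (h p) x) \<le> C * (r p ^ (0 + N) * g p x)"
      by (rule bdiff_boundE[OF dn[OF b, of 0 N]]) blast
    have "norm (fourier ((dd b ^^ N) (h p)) \<eta>) \<le> C * r p ^ N * integral UNIV (g p)" if p: "p \<in> P" for p \<eta>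
      using fourier_bound(2)[OF sbd_continuous[OF sb[OF b p]] C(2)[OF p], of \<eta>]
        integrable_on_mult_right[OF integrable_on_mult_right[OF g[OF p], of "r p ^ N"], of C]
      by (simp add: mult.assoc)
    then show ?thesis using C(1) pw[OF b] by (intro exI[of _ C]) auto
  qed
  then have "\<forall>b\<in>Basis. \<exists>C\<ge>0. \<forall>p\<in>P. \<forall>\<eta>. \<bar>b \<bullet> \<eta>\<bar> ^ N * norm (fourier (h p) \<eta>) \<le> C * r p ^ N * integral UNIV (g p)"
    by blast
  then obtain C where C: "\<And>b. b \<in> Basis \<Longrightarrow> C b \<ge> 0" "\<And>b p \<eta>. b \<in> Basis \<Longrightarrow> p \<in> P \<Longrightarrow>
      \<bar>b \<bullet> \<eta>\<bar> ^ N * norm (fourier (h p) \<eta>) \<le> C b * r p ^ N * integral UNIV (g p)"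
    by (metis (no_types, lifting))
  obtain C0 where C0: "C0 \<ge> 0" "\<And>p x. p \<in> P \<Longrightarrow> norm (h p x) \<le> C0 * (r p ^ 0 * g p x)"
    by (rule bdiff_boundE[OF h[of 0]]) blast
  have F0: "norm (fourier (h p) \<eta>) \<le> C0 * integral UNIV (g p)" if p: "p \<in> P" for p \<eta>
    using fourier_bound(2)[OF bdiff_continuous[OF h p] C0(2)[OF p], of \<eta>] integrable_on_mult_right[OF g[OF p], of C0] by simp
  define K where "K = real DIM(real^'n) + 1"
  define C1 where "C1 = K ^ N * (C0 + (\<Sum>b\<in>(Basis :: (real^'n) set). C b))"
  have "(r p + norm \<eta>) ^ N * norm (fourier (h p) \<eta>) \<le> C1 * r p ^ N * integral UNIV (g p)" if p: "p \<in> P" for p \<eta>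
  proof -
    \<comment> \<open>\<open>r p + norm \<eta>\<close> is at most \<open>K\<close> times the largest
      element of \<open>S\<close>, so it suffices to bound the transform times the
      \<open>N\<close>-th power of that single element.\<close>
    define S where "S = insert (r p) ((\<lambda>b. \<bar>b \<bullet> \<eta>\<bar>) ` Basis)"
    have S: "finite S" "S \<noteq> {}" by (auto simp: S_def)
    define M where "M = Max S"
    have rM: "r p \<le> M" and bM: "\<And>b. b \<in> Basis \<Longrightarrow> \<bar>b \<bullet> \<eta>\<bar> \<le> M"
      unfolding M_def by (rule Max_ge[OF S(1)], simp add: S_def)+
    have "norm \<eta> \<le> (\<Sum>b\<in>(Basis :: (real^'n) set). \<bar>\<eta> \<bullet> b\<bar>)" by (rule norm_le_l1)
    also have "\<dots> \<le> real DIM(real^'n) * M"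
      using bM by (intro sum_bounded_above) (simp add: inner_commute)
    finally have "r p + norm \<eta> \<le> K * M" using rM by (simp add: K_def algebra_simps)
    then have "(r p + norm \<eta>) ^ N \<le> K ^ N * M ^ N"
      using r[OF p] by (simp add: power_mult_distrib[symmetric] power_mono)
    then have "(r p + norm \<eta>) ^ N * norm (fourier (h p) \<eta>) \<le> K ^ N * (M ^ N * norm (fourier (h p) \<eta>))"
      by (simp add: mult.assoc[symmetric] mult_right_mono)
    also have "M ^ N * norm (fourier (h p) \<eta>) \<le> (C0 + (\<Sum>b\<in>(Basis :: (real^'n) set). C b)) * r p ^ N * integral UNIV (g p)"
    proof -
      have pos: "0 \<le> r p ^ N * integral UNIV (g p)" using r[OF p] I0[OF p] by simp
      have "M \<in> S" unfolding M_def by (rule Max_in[OF S])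
      then consider "M = r p" | b where "b \<in> Basis" "M = \<bar>b \<bullet> \<eta>\<bar>" by (auto simp: S_def)
      then show ?thesis
      proof cases
        case 1
        have "M ^ N * norm (fourier (h p) \<eta>) \<le> C0 * (r p ^ N * integral UNIV (g p))"
          unfolding 1 using mult_left_mono[OF F0[OF p, of \<eta>], of "r p ^ N"] r[OF p] by (simp add: mult_ac)
        also have "\<dots> \<le> (C0 + (\<Sum>b\<in>(Basis :: (real^'n) set). C b)) * (r p ^ N * integral UNIV (g p))"
          using C(1) by (intro mult_right_mono pos) (simp add: sum_nonneg)
        finally show ?thesis by (simp add: mult.assoc)
      next
        case 2
        have "M ^ N * norm (fourier (h p) \<eta>) \<le> C b * (r p ^ N * integral UNIV (g p))"
          unfolding 2(2) using C(2)[OF 2(1) p] by (simp add: mult.assoc)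
        also have "\<dots> \<le> (C0 + (\<Sum>b\<in>(Basis :: (real^'n) set). C b)) * (r p ^ N * integral UNIV (g p))"
          using C(1) C0(1) member_le_sum[of b Basis C] 2(1) by (intro mult_right_mono pos) (simp add: add_increasing)
        finally show ?thesis by (simp add: mult.assoc)
      qed
    qed
    finally show ?thesis using K_def by (simp add: C1_def mult.assoc mult_left_mono)
  qed
  moreover have "C1 \<ge> 0" using C(1) C0(1) by (auto simp: C1_def K_def intro!: mult_nonneg_nonneg add_nonneg_nonneg sum_nonneg)
  ultimately show ?thesis by blast
qed

text \<open>Exchange rate between polynomial decay and the integrable weight:
  \<open>2 * DIM('e)\<close> surplus powers of \<open>1 + norm \<eta>\<close> pay for one factor
  \<open>wt \<eta>\<close>.\<close>

lemma wt_ge: "1 \<le> wt \<eta> * (1 + norm \<eta>) ^ (2 * DIM('e))" for \<eta> :: "'e::euclidean_space"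
proof -
  have "(\<Prod>b\<in>(Basis::'e set). 1) \<le> (\<Prod>b\<in>Basis. inverse (1 + (\<eta> \<bullet> b)\<^sup>2) * (1 + norm \<eta>)\<^sup>2)"
  proof (rule prod_mono, intro conjI)
    fix b :: 'e assume b: "b \<in> Basis"
    have "(\<eta> \<bullet> b)\<^sup>2 \<le> (norm \<eta>)\<^sup>2" using Basis_le_norm[OF b, of \<eta>] by (simp add: abs_le_square_iff[symmetric])
    then have "1 + (\<eta> \<bullet> b)\<^sup>2 \<le> (1 + norm \<eta>)\<^sup>2" using norm_ge_zero[of \<eta>] by (simp add: power2_sum add_increasing2)
    then show "1 \<le> inverse (1 + (\<eta> \<bullet> b)\<^sup>2) * (1 + norm \<eta>)\<^sup>2" by (simp add: field_simps)
  qed simp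
  then show ?thesis by (simp add: prod.distrib wt_def power_mult)
qed

lemma fourier_decay:
  fixes h :: "real^'n::finite \<Rightarrow> 'x::complex_banach"
  assumes h: "sbd wt h"
  obtains C where "C \<ge> 0" "\<And>\<eta>. (1 + norm \<eta>) ^ N * norm (fourier h \<eta>) \<le> C * wt \<eta>"
proof -
  let ?N = "N + 2 * DIM(real^'n)"
  have "\<exists>C\<ge>0. \<forall>p\<in>(UNIV::unit set). \<forall>\<eta>. (1 + norm \<eta>) ^ ?N * norm (fourier h \<eta>) \<le> C * 1 ^ ?N * integral UNIV (wt :: real^'n \<Rightarrow> real)"
    by (rule fourier_decay_family[where D="\<lambda>_. 1"]) (use h in \<open>simp_all add: sbd_def integrable_wt\<close>)
  then obtain C where C: "C \<ge> 0" "\<And>\<eta>. (1 + norm \<eta>) ^ ?N * norm (fourier h \<eta>) \<le> C * integral UNIV (wt :: real^'n \<Rightarrow> real)"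
    by auto
  define D where "D = C * integral UNIV (wt :: real^'n \<Rightarrow> real)"
  have "(1 + norm \<eta>) ^ N * norm (fourier h \<eta>) \<le> D * wt \<eta>" for \<eta>
  proof -
    have "(1 + norm \<eta>) ^ N * norm (fourier h \<eta>) \<le> (1 + norm \<eta>) ^ N * norm (fourier h \<eta>) * (wt \<eta> * (1 + norm \<eta>) ^ (2 * DIM(real^'n)))"
      using mult_left_mono[OF wt_ge[of \<eta>], of "(1 + norm \<eta>) ^ N * norm (fourier h \<eta>)"] by simp
    also have "\<dots> = (1 + norm \<eta>) ^ ?N * norm (fourier h \<eta>) * wt \<eta>" by (simp add: power_add mult_ac)
    also have "\<dots> \<le> D * wt \<eta>" unfolding D_def by (intro mult_right_mono C) simp
    finally show ?thesis .
  qed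
  moreover have "D \<ge> 0" unfolding D_def using C(1) by (intro mult_nonneg_nonneg integral_nonneg integrable_wt) auto
  ultimately show ?thesis using that by blast
qed

section \<open>Symbols of polynomial growth and the regularising operators and factors\<close>

definition spoly :: "('e::euclidean_space \<Rightarrow> 'x::real_normed_vector) \<Rightarrow> bool"
  where "spoly a \<longleftrightarrow> (\<exists>M. sbd (\<lambda>\<eta>. (1 + norm \<eta>) ^ M) a)"

lemma spoly_add: assumes "spoly a" "spoly a'" shows "spoly (\<lambda>\<eta>. a \<eta> + a' \<eta>)"
proof -
  obtain M M' where M: "sbd (\<lambda>\<eta>. (1 + norm \<eta>) ^ M) a" "sbd (\<lambda>\<eta>. (1 + norm \<eta>) ^ M') a'"
    using assms by (auto simp: spoly_def)
  have "sbd (\<lambda>\<eta>. (1 + norm \<eta>) ^ max M M') a" "sbd (\<lambda>\<eta>. (1 + norm \<eta>) ^ max M M') a'"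
    by (auto intro!: sbd_weaken[OF M(1), of 1] sbd_weaken[OF M(2), of 1] power_increasing)
  from sbd_add[OF this] show ?thesis unfolding spoly_def by blast
qed

lemma spoly_linear: "bounded_linear h \<Longrightarrow> spoly a \<Longrightarrow> spoly (\<lambda>\<eta>. h (a \<eta>))"
  unfolding spoly_def using sbd_linear by blast

lemma spoly_scaleR: "spoly a \<Longrightarrow> spoly (\<lambda>\<eta>. r *\<^sub>R a \<eta>)"
  by (rule spoly_linear[OF bounded_linear_scaleR_right])

lemma spoly_dd: "spoly a \<Longrightarrow> b \<in> Basis \<Longrightarrow> spoly (dd b a)"
  unfolding spoly_def using sbd_dd by blast

lemma spoly_coord:
  assumes "spoly a" "b \<in> Basis" shows "spoly (\<lambda>\<eta>. (\<eta> \<bullet> b) *\<^sub>R a \<eta>)"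
proof -
  obtain M where M: "sbd (\<lambda>\<eta>. (1 + norm \<eta>) ^ M) a" using assms by (auto simp: spoly_def)
  have "sbd (\<lambda>\<eta>. (1 + norm \<eta>) ^ Suc M) (\<lambda>\<eta>. (\<eta> \<bullet> b) *\<^sub>R a \<eta>)"
    using Basis_le_norm[OF assms(2)]
    by (intro sbd_bilinear[OF bounded_bilinear_scaleR sbd_coord M, of 1]) (simp_all add: mult_right_mono)
  then show ?thesis unfolding spoly_def by blast
qed

lemma spoly_dd_add: "spoly a \<Longrightarrow> spoly a' \<Longrightarrow> b \<in> Basis \<Longrightarrow> dd b (\<lambda>x. a x + a' x) = (\<lambda>x. dd b a x + dd b a' x)"
  unfolding spoly_def using dd_add by blast

lemma spoly_dd_linear: "bounded_linear h \<Longrightarrow> spoly a \<Longrightarrow> b \<in> Basis \<Longrightarrow> dd b (\<lambda>x. h (a x)) = (\<lambda>x. h (dd b a x))"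
  unfolding spoly_def using dd_linear by blast

lemma spoly_dd_commute: "spoly a \<Longrightarrow> b \<in> Basis \<Longrightarrow> c \<in> Basis \<Longrightarrow> dd c (dd b a) = dd b (dd c a)"
  unfolding spoly_def using sbd_dd_commute by blast

lemma spoly_dd_coord:
  assumes "spoly a" "b \<in> Basis" "c \<in> Basis"
  shows "dd c (\<lambda>\<eta>. (\<eta> \<bullet> b) *\<^sub>R a \<eta>) = (\<lambda>\<eta>. (\<eta> \<bullet> b) *\<^sub>R dd c a \<eta> + (if c = b then a \<eta> else 0))"
proof
  fix \<eta>
  have 1: "((\<lambda>t. (\<eta> + t *\<^sub>R c) \<bullet> b) has_vector_derivative c \<bullet> b) (at 0)"
    by (auto simp: inner_add_left intro!: derivative_eq_intros)
  obtain M where M: "sbd (\<lambda>\<eta>. (1 + norm \<eta>) ^ M) a" using assms by (auto simp: spoly_def)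
  from bounded_bilinear.has_vector_derivative[OF bounded_bilinear_scaleR 1 sbd_derivative[OF M assms(3), of \<eta>]]
  show "dd c (\<lambda>\<eta>. (\<eta> \<bullet> b) *\<^sub>R a \<eta>) \<eta> = (\<eta> \<bullet> b) *\<^sub>R dd c a \<eta> + (if c = b then a \<eta> else 0)"
    using assms by (intro ddI) (simp add: inner_Basis split: if_splits)
qed

text \<open>For a list \<open>L\<close> of pairs \<open>(b, R)\<close>, the operator \<open>Eop L\<close> is the product of the operators \<open>1 + R \<partial>\<^sub>b\<close>, and
  \<open>Wt L\<close> the product of the functions \<open>1 / (1 + i R w\<^sub>b)\<close> that compensate for them after an integration by parts
  in \<open>\<integral>\<integral> exp (- i w \<cdot> \<eta>) a(\<eta>) h(w) dw d\<eta>\<close>.\<close>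

primrec Eop :: "('e::euclidean_space \<times> real) list \<Rightarrow> ('e \<Rightarrow> 'x::real_normed_vector) \<Rightarrow> 'e \<Rightarrow> 'x" where
  "Eop [] a = a"
| "Eop (x # L) a = (\<lambda>\<eta>. Eop L a \<eta> + snd x *\<^sub>R dd (fst x) (Eop L a) \<eta>)"

primrec Wt :: "('e::euclidean_space \<times> real) list \<Rightarrow> 'e \<Rightarrow> complex" where
  "Wt [] w = 1"
| "Wt (x # L) w = inverse (Complex 1 (snd x * (w \<bullet> fst x))) * Wt L w"

abbreviation bas :: "('e::euclidean_space \<times> real) list \<Rightarrow> bool"
  where "bas L \<equiv> fst ` set L \<subseteq> Basis"

lemma spoly_Eop: "spoly a \<Longrightarrow> bas L \<Longrightarrow> spoly (Eop L a)"
  by (induction L) (auto intro!: spoly_add spoly_scaleR spoly_dd)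

lemma Eop_add: "spoly a \<Longrightarrow> spoly a' \<Longrightarrow> bas L \<Longrightarrow> Eop L (\<lambda>x. a x + a' x) = (\<lambda>x. Eop L a x + Eop L a' x)"
  by (induction L) (simp_all add: spoly_dd_add spoly_Eop scaleR_add_right algebra_simps)

lemma Eop_linear: "bounded_linear h \<Longrightarrow> spoly a \<Longrightarrow> bas L \<Longrightarrow> Eop L (\<lambda>x. h (a x)) = (\<lambda>x. h (Eop L a x))"
  by (induction L) (simp_all add: spoly_dd_linear spoly_Eop linear_add linear_cmul bounded_linear.linear)

lemma Eop_dd: "spoly a \<Longrightarrow> bas L \<Longrightarrow> b \<in> Basis \<Longrightarrow> Eop L (dd b a) = dd b (Eop L a)"
proof (induction L)
  case (Cons x L)
  then have "dd b (\<lambda>\<eta>. Eop L a \<eta> + snd x *\<^sub>R dd (fst x) (Eop L a) \<eta>) =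
     (\<lambda>\<eta>. dd b (Eop L a) \<eta> + snd x *\<^sub>R dd b (dd (fst x) (Eop L a)) \<eta>)"
    by (simp add: spoly_dd_add spoly_Eop spoly_scaleR spoly_dd spoly_dd_linear[OF bounded_linear_scaleR_right])
  with Cons show ?case by (simp add: spoly_Eop spoly_dd_commute[of "Eop L a" b "fst x"])
qed simp

text \<open>The operator at the head of the list is outermost by definition; since derivatives
  commute, it may also act first. Inductions over the list that vary the symbol need this
  form.\<close>

lemma Eop_step: "spoly a \<Longrightarrow> bas (x # L) \<Longrightarrow> Eop (x # L) a = Eop L (\<lambda>\<eta>. a \<eta> + snd x *\<^sub>R dd (fst x) a \<eta>)"
  by (simp add: Eop_add Eop_linear[OF bounded_linear_scaleR_right] Eop_dd spoly_scaleR spoly_dd)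

lemma Eop_append: "Eop (L @ L') a = Eop L (Eop L' a)"
  by (induction L) simp_all

lemma Eop_append_commute: "spoly a \<Longrightarrow> bas L \<Longrightarrow> bas L' \<Longrightarrow> Eop (L @ L') a = Eop (L' @ L) a"
proof (induction L)
  case (Cons x L)
  then have "Eop ((x # L) @ L') a = (\<lambda>\<eta>. Eop L' (Eop L a) \<eta> + snd x *\<^sub>R dd (fst x) (Eop L' (Eop L a)) \<eta>)"
    by (simp add: Eop_append)
  also have "\<dots> = Eop (x # L') (Eop L a)" by simp
  also have "\<dots> = Eop L' (Eop (x # L) a)"
    using Cons.prems Eop_step[of "Eop L a" x L'] by (simp add: spoly_Eop)
  finally show ?case by (simp add: Eop_append)
qed simp

lemma Wt_append: "Wt (L @ L') w = Wt L w * Wt L' w"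
  by (induction L) simp_all

lemma Complex_1_nonzero [simp]: "Complex 1 t \<noteq> 0"
  by (simp add: complex_eq_iff)

lemma norm_inverse_Complex: "cmod (inverse (Complex 1 t)) = inverse (sqrt (1 + t\<^sup>2))"
  by (simp add: norm_inverse complex_norm)

lemma inverse_Complex_derivative:
  fixes w b c :: "'e::euclidean_space"
  assumes "b \<in> Basis" "c \<in> Basis"
  shows "((\<lambda>t. inverse (Complex 1 (R * ((w + t *\<^sub>R c) \<bullet> b)))) has_vector_derivative
     (if c = b then - (\<i> * of_real R * (inverse (Complex 1 (R * (w \<bullet> b))) * inverse (Complex 1 (R * (w \<bullet> b))))) else 0)) (at 0)"
proof -
  have eq: "Complex 1 s = 1 + \<i> * of_real s" for s by (simp add: complex_eq_iff)
  have nz: "1 + \<i> * of_real s \<noteq> 0" for s using Complex_1_nonzero[of s] unfolding eq .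
  have "((\<lambda>t. inverse (1 + \<i> * of_real (R * ((w + t *\<^sub>R c) \<bullet> b)))) has_vector_derivative
     - (inverse (1 + \<i> * of_real (R * (w \<bullet> b))) * (\<i> * of_real (R * (c \<bullet> b))) * inverse (1 + \<i> * of_real (R * (w \<bullet> b))))) (at 0)"
  proof -
    have "((\<lambda>t. 1 + \<i> * of_real (R * ((w + t *\<^sub>R c) \<bullet> b))) has_vector_derivative \<i> * of_real (R * (c \<bullet> b))) (at 0)"
    proof -
      have "((\<lambda>t. R * ((w + t *\<^sub>R c) \<bullet> b)) has_real_derivative R * (c \<bullet> b)) (at 0)"
        by (auto simp: inner_add_left intro!: derivative_eq_intros)
      from has_vector_derivative_add[OF has_vector_derivative_const has_vector_derivative_mult_right[OF has_vector_derivative_of_real[OF this]]]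
      show ?thesis by (rule has_vector_derivative_eq_rhs) simp
    qed
    from Deriv.has_derivative_inverse[OF nz this[unfolded has_vector_derivative_def]]
    show ?thesis unfolding has_vector_derivative_def
      by (rule has_derivative_eq_rhs) (simp_all add: fun_eq_iff scaleR_conv_of_real)
  qed
  then show ?thesis unfolding eq
    by (rule has_vector_derivative_eq_rhs) (use assms in \<open>auto simp: inner_Basis mult_ac\<close>)
qed

text \<open>The derivative is \<open>- i R\<close> times the square of the function, and the square
  obeys the same bound because the function has modulus at most \<open>1\<close>. Hence each
  derivative costs exactly one \<open>R\<close>, uniformly in \<open>R\<close>.\<close>

lemma bdiff_inverse_Complex:
  fixes b :: "'e::euclidean_space"
  assumes b: "b \<in> Basis"
  shows "bdiff k {R. R > 0} (\<lambda>j R w. R ^ j * inverse (sqrt (1 + (R * (w \<bullet> b))\<^sup>2)))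
    (\<lambda>R w. inverse (Complex 1 (R * (w \<bullet> b))))"
proof (induction k)
  have bd: "\<exists>C\<ge>0. \<forall>R\<in>{R. R > 0}. \<forall>w. cmod (inverse (Complex 1 (R * (w \<bullet> b)))) \<le> C * (R ^ 0 * inverse (sqrt (1 + (R * (w \<bullet> b))\<^sup>2)))"
    by (intro exI[of _ 1]) (simp add: norm_inverse_Complex del: norm_inverse)
  {
    case 0
    have "continuous_on UNIV (\<lambda>w. inverse (Complex 1 (R * (w \<bullet> b))))" for R
      by (intro continuous_on_inverse) (auto simp: Complex_eq Complex_1_nonzero[unfolded Complex_eq of_real_1] simp del: of_real_mult intro!: continuous_intros)
    then show ?case using bd by simp
  next
    case (Suc k)
    show ?case
    proof (rule bdiff_SucI)
      show "\<exists>C\<ge>0. \<forall>R\<in>{R. R > 0}. \<forall>w. cmod (inverse (Complex 1 (R * (w \<bullet> b)))) \<le> C * (R ^ 0 * inverse (sqrt (1 + (R * (w \<bullet> b))\<^sup>2)))"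
        by (rule bd)
      fix c :: 'e assume "c \<in> Basis"
      show "((\<lambda>t. inverse (Complex 1 (R * ((w + t *\<^sub>R c) \<bullet> b)))) has_vector_derivative
          (if c = b then - (\<i> * of_real R * (inverse (Complex 1 (R * (w \<bullet> b))) * inverse (Complex 1 (R * (w \<bullet> b))))) else 0)) (at 0)" for R w
        by (rule inverse_Complex_derivative[OF b \<open>c \<in> Basis\<close>])
      have "bdiff k {R. R > 0} (\<lambda>j R w. R ^ Suc j * inverse (sqrt (1 + (R * (w \<bullet> b))\<^sup>2)))
        (\<lambda>R w. - (\<i> * of_real R * (inverse (Complex 1 (R * (w \<bullet> b))) * inverse (Complex 1 (R * (w \<bullet> b))))))"
      proof (rule bdiff_linear[OF bounded_linear_minus[OF bounded_linear_ident]],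
          rule bdiff_bilinear[OF bounded_bilinear_mult])
        \<comment> \<open>\<open>i R\<close> is constant in \<open>w\<close>: the factor
          \<open>0 ^ j\<close> is \<open>1\<close> for \<open>j = 0\<close> and kills the bound for
          every genuine derivative.\<close>
        show "bdiff k {R. R > 0} (\<lambda>j R w. R * 0 ^ j) (\<lambda>R w::'e. \<i> * of_real R)"
          by (rule bdiff_const[of 1]) (auto simp: norm_mult)
        show "bdiff k {R. R > 0} (\<lambda>j R w. R ^ j * inverse (sqrt (1 + (R * (w \<bullet> b))\<^sup>2)))
            (\<lambda>R w. inverse (Complex 1 (R * (w \<bullet> b))) * inverse (Complex 1 (R * (w \<bullet> b))))"
        proof (rule bdiff_bilinear[OF bounded_bilinear_mult Suc.IH Suc.IH])
          fix i j R and w :: 'e assume "R \<in> {R::real. R > 0}"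
          define v where "v = inverse (sqrt (1 + (R * (w \<bullet> b))\<^sup>2))"
          have v: "v \<ge> 0" "v \<le> 1" by (simp_all add: v_def inverse_le_1_iff)
          then have "v * v \<le> v" by (simp add: mult_left_le)
          then show "R ^ i * inverse (sqrt (1 + (R * (w \<bullet> b))\<^sup>2)) * (R ^ j * inverse (sqrt (1 + (R * (w \<bullet> b))\<^sup>2)))
              \<le> R ^ (i + j) * inverse (sqrt (1 + (R * (w \<bullet> b))\<^sup>2))"
            using \<open>R \<in> _\<close> mult_right_mono[OF \<open>v * v \<le> v\<close>, of "R ^ i * R ^ j"]
            unfolding v_def[symmetric] by (simp add: power_add mult_ac)
        qed
        fix i j R and w :: 'e assume "R \<in> {R::real. R > 0}"
        then show "R * 0 ^ i * (R ^ j * inverse (sqrt (1 + (R * (w \<bullet> b))\<^sup>2))) \<le> R ^ Suc (i + j) * inverse (sqrt (1 + (R * (w \<bullet> b))\<^sup>2))"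
          by (cases i) auto
      qed
      then show "bdiff k {R. R > 0} (\<lambda>j R w. R ^ Suc j * inverse (sqrt (1 + (R * (w \<bullet> b))\<^sup>2)))
        (\<lambda>R w. if c = b then - (\<i> * of_real R * (inverse (Complex 1 (R * (w \<bullet> b))) * inverse (Complex 1 (R * (w \<bullet> b))))) else 0)"
        by (cases "c = b") (simp_all add: bdiff_zero)
    qed
  }
qed

lemma sqrt_inverse_le_1: "inverse (sqrt (1 + (t::real)\<^sup>2)) \<le> 1"
  by (simp add: inverse_le_1_iff)

lemma sbd_inverse_Complex:
  fixes b :: "'e::euclidean_space"
  assumes b: "b \<in> Basis"
  shows "sbd (\<lambda>_. 1) (\<lambda>w. inverse (Complex 1 (R * (w \<bullet> b))))"
proof -
  have pos: "sbd (\<lambda>_. 1) (\<lambda>w. inverse (Complex 1 (R * (w \<bullet> b))))" if "R > 0" "b \<in> Basis" for R and b :: 'e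
  proof (rule sbd_of_bdiff[OF bdiff_inverse_Complex[OF that(2)]])
    fix j
    show "\<exists>D\<ge>0. \<forall>x. R ^ j * inverse (sqrt (1 + (R * (x \<bullet> b))\<^sup>2)) \<le> D * 1"
      using mult_left_mono[OF sqrt_inverse_le_1, of "R ^ j"] \<open>R > 0\<close> by (intro exI[of _ "R ^ j"]) auto
  qed (use that in simp)
  consider "R > 0" | "R = 0" | "- R > 0" by linarith
  then show ?thesis
  proof cases
    case 1
    then show ?thesis using pos b by blast
  next
    case 2
    then show ?thesis by (simp add: sbd_const[of "cmod (inverse (Complex 1 0))"])
  next
    case 3
    have "inverse (Complex 1 (R * (w \<bullet> b))) = cnj (inverse (Complex 1 (- R * (w \<bullet> b))))" for w
      by (simp add: complex_cnj_inverse complex_cnj)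
    then show ?thesis using sbd_linear[OF bounded_linear_cnj pos[OF 3 b]] by simp
  qed
qed

lemma sbd_Wt_mult:
  fixes h :: "'e::euclidean_space \<Rightarrow> 'x::complex_banach"
  assumes "bas L" "sbd \<omega> h" "\<And>x. \<omega> x \<ge> 0"
  shows "sbd \<omega> (\<lambda>w. Wt L w *\<^sub>C h w)"
  using assms(1)
proof (induction L)
  case (Cons x L)
  have "sbd \<omega> (\<lambda>w. inverse (Complex 1 (snd x * (w \<bullet> fst x))) *\<^sub>C (Wt L w *\<^sub>C h w))"
    using Cons assms(3) by (intro sbd_bilinear[OF bounded_bilinear_scaleC sbd_inverse_Complex, of _ \<omega> _ 1]) auto
  then show ?case by (simp only: Wt.simps scaleC_scaleC)
qed (simp add: assms)

lemma sbd_wt_sq: "sbd (\<lambda>w. (wt w)\<^sup>2) h \<Longrightarrow> sbd wt h"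
  by (rule sbd_weaken[of _ _ 1]) (auto simp: power2_eq_square mult_left_le)

text \<open>The reason for requiring the squared weight of amplitudes: one factor \<open>wt\<close>
  is kept for integrability, the other absorbs a coordinate of \<open>w\<close>, since
  \<open>(1 + |t|) / (1 + t^2) \<le> 2\<close>.\<close>

lemma coord_wt_le:
  fixes w :: "'e::euclidean_space"
  assumes b: "b \<in> Basis"
  shows "(1 + \<bar>w \<bullet> b\<bar>) * (wt w)\<^sup>2 \<le> 2 * wt w"
proof -
  have "wt w \<le> inverse (1 + (w \<bullet> b)\<^sup>2)"
  proof -
    have "wt w = inverse (1 + (w \<bullet> b)\<^sup>2) * (\<Prod>c\<in>Basis - {b}. inverse (1 + (w \<bullet> c)\<^sup>2))"
      unfolding wt_def using b by (simp add: prod.remove)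
    moreover have "(\<Prod>c\<in>Basis - {b}. inverse (1 + (w \<bullet> c)\<^sup>2)) \<le> 1"
      by (rule prod_le_1) (auto intro: inverse_le_1_iff[THEN iffD2] simp: less_imp_le)
    ultimately show ?thesis by (simp add: mult_left_le)
  qed
  then have "(1 + \<bar>w \<bullet> b\<bar>) * wt w \<le> (1 + \<bar>w \<bullet> b\<bar>) * inverse (1 + (w \<bullet> b)\<^sup>2)"
    by (intro mult_left_mono) auto
  also have "\<dots> \<le> 2"
  proof -
    have "\<bar>w \<bullet> b\<bar> \<le> 1 + (w \<bullet> b)\<^sup>2"
      using zero_le_power2[of "\<bar>w \<bullet> b\<bar> - 1"] zero_le_power2[of "w \<bullet> b"] by (simp add: power2_diff)
    moreover have "0 \<le> (w \<bullet> b)\<^sup>2" by simp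
    ultimately have "1 + \<bar>w \<bullet> b\<bar> \<le> 2 * (1 + (w \<bullet> b)\<^sup>2)" unfolding distrib_left by linarith
    then show ?thesis by (simp add: divide_inverse[symmetric] pos_divide_le_eq)
  qed
  finally show ?thesis
    unfolding power2_eq_square mult.assoc[symmetric] by (intro mult_right_mono) auto
qed

lemma sbd_coord_mult:
  fixes h :: "'e::euclidean_space \<Rightarrow> 'x::complex_banach"
  assumes b: "b \<in> Basis" and h: "sbd (\<lambda>w. (wt w)\<^sup>2) h"
  shows "sbd wt (\<lambda>w. (w \<bullet> b) *\<^sub>R h w)"
  by (rule sbd_bilinear[OF bounded_bilinear_scaleR sbd_coord h, of 2]) (simp_all add: coord_wt_le[OF b])

text \<open>Three pairings occur: \<open>opC\<close> pairs an operator-valued symbol with a complex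
  amplitude, \<open>blinfun_apply\<close> lets it act on a vector-valued function, and
  \<open>scaleR\<close> with the constant symbol serves for Fourier inversion.\<close>

locale fpairing =
  fixes pr :: "'x::banach \<Rightarrow> 'y::complex_banach \<Rightarrow> 'z::banach"
  assumes pr: "bounded_bilinear pr"
begin

sublocale bounded_bilinear pr by (rule pr)

text \<open>The oscillatory integral \<open>\<integral>\<integral> exp (- i w \<cdot> \<eta>) a(\<eta>) h(w) dw d\<eta>\<close>, regularised by \<open>L\<close>. Its value is the same for all
  \<open>L\<close> for which \<open>Wt L\<close> makes \<open>h\<close> decay.\<close>

definition pair :: "((real^'n::finite) \<times> real) list \<Rightarrow> (real^'n \<Rightarrow> 'x) \<Rightarrow> (real^'n \<Rightarrow> 'y) \<Rightarrow> 'z"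
  where "pair L a h = integral UNIV (\<lambda>\<eta>. pr (Eop L a \<eta>) (fourier (\<lambda>w. Wt L w *\<^sub>C h w) \<eta>))"

lemma pr_fourier_bound:
  fixes h :: "real^'n::finite \<Rightarrow> 'y"
  assumes a: "spoly a" and h: "sbd wt h"
  obtains C where "\<And>\<eta>. norm (pr (a \<eta>) (fourier h \<eta>)) \<le> C * wt \<eta>"
proof -
  obtain M where M: "sbd (\<lambda>\<eta>. (1 + norm \<eta>) ^ M) a" using a by (auto simp: spoly_def)
  obtain C where C: "C \<ge> 0" "\<And>\<eta>. norm (a \<eta>) \<le> C * (1 + norm \<eta>) ^ M" using sbd_boundE[OF M] by metis
  obtain D where D: "D \<ge> 0" "\<And>\<eta>. (1 + norm \<eta>) ^ M * norm (fourier h \<eta>) \<le> D * wt \<eta>" using fourier_decay[OF h] by metis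
  obtain K where K: "K \<ge> 0" "\<And>x y. norm (pr x y) \<le> norm x * norm y * K" using nonneg_bounded by blast
  have "norm (pr (a \<eta>) (fourier h \<eta>)) \<le> (C * D * K) * wt \<eta>" for \<eta>
  proof -
    have "norm (a \<eta>) * norm (fourier h \<eta>) \<le> C * ((1 + norm \<eta>) ^ M * norm (fourier h \<eta>))"
      using mult_right_mono[OF C(2)[of \<eta>], of "norm (fourier h \<eta>)"] by (simp add: mult.assoc)
    also have "\<dots> \<le> C * (D * wt \<eta>)" by (intro mult_left_mono D C)
    finally have "norm (a \<eta>) * norm (fourier h \<eta>) \<le> C * (D * wt \<eta>)" .
    from order_trans[OF K(2) mult_right_mono[OF this K(1)]] show ?thesis by (simp add: mult_ac)
  qed
  then show ?thesis by (rule that)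
qed

lemma spoly_continuous: "spoly a \<Longrightarrow> continuous_on S a"
  unfolding spoly_def using sbd_continuous by blast

lemma pr_fourier_integrable:
  fixes h :: "real^'n::finite \<Rightarrow> 'y"
  assumes a: "spoly a" and h: "sbd wt h"
  shows "(\<lambda>\<eta>. pr (a \<eta>) (fourier h \<eta>)) integrable_on UNIV"
proof -
  obtain C where C: "\<And>\<eta>. norm (pr (a \<eta>) (fourier h \<eta>)) \<le> C * wt \<eta>" using pr_fourier_bound[OF assms] by metis
  show ?thesis
    by (rule integrable_dominated[OF _ C integrable_cmult_wt])
      (intro continuous_on spoly_continuous[OF a] fourier_continuous[OF h])
qed

lemma integral_pr_add_right:
  fixes f :: "real^'n::finite \<Rightarrow> 'y"
  assumes a: "spoly a" and h: "sbd wt f" "sbd wt g"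
  shows "integral UNIV (\<lambda>\<eta>. pr (a \<eta>) (fourier (\<lambda>w. f w + g w) \<eta>)) =
    integral UNIV (\<lambda>\<eta>. pr (a \<eta>) (fourier f \<eta>)) + integral UNIV (\<lambda>\<eta>. pr (a \<eta>) (fourier g \<eta>))"
  unfolding fourier_add[OF h] add_right by (intro integral_add pr_fourier_integrable assms)

lemma integral_pr_add_left:
  fixes f :: "real^'n::finite \<Rightarrow> 'y"
  assumes a: "spoly a" "spoly a'" and h: "sbd wt f"
  shows "integral UNIV (\<lambda>\<eta>. pr (a \<eta> + a' \<eta>) (fourier f \<eta>)) =
    integral UNIV (\<lambda>\<eta>. pr (a \<eta>) (fourier f \<eta>)) + integral UNIV (\<lambda>\<eta>. pr (a' \<eta>) (fourier f \<eta>))"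
  unfolding add_left by (intro integral_add pr_fourier_integrable assms)

text \<open>The product rule in \<eta>: the transform of \<open>h\<close> has derivative minus the
  transform of \<open>i w_b h\<close>. This trades a coordinate of \<open>w\<close> in the amplitude
  for a derivative of the symbol.\<close>

lemma fourier_by_parts:
  fixes h :: "real^'n::finite \<Rightarrow> 'y"
  assumes a: "spoly a" and h: "sbd wt h" "sbd wt (\<lambda>w. (w \<bullet> b) *\<^sub>R h w)" and b: "b \<in> Basis"
  shows "integral UNIV (\<lambda>\<eta>. pr (dd b a \<eta>) (fourier h \<eta>)) =
    integral UNIV (\<lambda>\<eta>. pr (a \<eta>) (fourier (\<lambda>w. \<i> *\<^sub>C (w \<bullet> b) *\<^sub>R h w) \<eta>))" (is "?l = ?r")
proof -
  let ?h' = "\<lambda>w. \<i> *\<^sub>C (w \<bullet> b) *\<^sub>R h w"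
  have h': "sbd wt ?h'" by (rule sbd_linear[OF scaleC.bounded_linear_right h(2)])
  define F' where "F' \<eta> = pr (dd b a \<eta>) (fourier h \<eta>) - pr (a \<eta>) (fourier ?h' \<eta>)" for \<eta>
  obtain C1 where C1: "\<And>\<eta>. norm (pr (a \<eta>) (fourier h \<eta>)) \<le> C1 * wt \<eta>" using pr_fourier_bound[OF a h(1)] by metis
  obtain C2 where C2: "\<And>\<eta>. norm (pr (dd b a \<eta>) (fourier h \<eta>)) \<le> C2 * wt \<eta>" using pr_fourier_bound[OF spoly_dd[OF a b] h(1)] by metis
  obtain C3 where C3: "\<And>\<eta>. norm (pr (a \<eta>) (fourier ?h' \<eta>)) \<le> C3 * wt \<eta>" using pr_fourier_bound[OF a h'] by metis
  obtain M where M: "sbd (\<lambda>\<eta>. (1 + norm \<eta>) ^ M) a" using a by (auto simp: spoly_def)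
  have "integral UNIV F' = 0"
  proof (rule integral_partial_derivative_zero[OF b, where F="\<lambda>\<eta>. pr (a \<eta>) (fourier h \<eta>)" and C="max C1 (C2 + C3)"])
    show "((\<lambda>t. pr (a (x + t *\<^sub>R b)) (fourier h (x + t *\<^sub>R b))) has_vector_derivative F' x) (at 0)" for x
      using has_vector_derivative[OF sbd_derivative[OF M b, of x] fourier_derivative[OF h, of x]]
      by (simp add: F'_def minus_right)
    show "continuous_on UNIV (\<lambda>\<eta>. pr (a \<eta>) (fourier h \<eta>))" "continuous_on UNIV F'"
      unfolding F'_def
      by (intro continuous_on_diff continuous_on spoly_continuous[OF a] fourier_continuous[OF h(1)] fourier_continuous[OF h']
          spoly_continuous[OF spoly_dd[OF a b]])+
    show "norm (pr (a x) (fourier h x)) \<le> max C1 (C2 + C3) * wt x" for x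
      using order_trans[OF C1 mult_right_mono[OF max.cobounded1 wt_nonneg]] .
    show "norm (F' x) \<le> max C1 (C2 + C3) * wt x" for x
    proof -
      have "norm (F' x) \<le> C2 * wt x + C3 * wt x"
        unfolding F'_def by (rule order_trans[OF norm_triangle_ineq4 add_mono[OF C2 C3]])
      also have "\<dots> \<le> max C1 (C2 + C3) * wt x"
        unfolding distrib_right[symmetric] by (rule mult_right_mono) auto
      finally show ?thesis .
    qed
  qed
  then show ?thesis
    unfolding F'_def by (simp add: integral_diff pr_fourier_integrable a h h' spoly_dd b)
qed

text \<open>With \<open>h' = h / (1 + i R w_b)\<close> one has \<open>h = h' + i R w_b h'\<close>,
  and the coordinate in the second summand turns into a derivative of \<open>a\<close>.\<close>

lemma integral_step:
  fixes h :: "real^'n::finite \<Rightarrow> 'y"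
  assumes a: "spoly a" and h: "sbd (\<lambda>w. (wt w)\<^sup>2) h" and b: "b \<in> Basis"
  shows "integral UNIV (\<lambda>\<eta>. pr (a \<eta> + R *\<^sub>R dd b a \<eta>) (fourier (\<lambda>w. inverse (Complex 1 (R * (w \<bullet> b))) *\<^sub>C h w) \<eta>)) =
    integral UNIV (\<lambda>\<eta>. pr (a \<eta>) (fourier h \<eta>))"
proof -
  define h' where "h' w = inverse (Complex 1 (R * (w \<bullet> b))) *\<^sub>C h w" for w
  have h': "sbd (\<lambda>w. (wt w)\<^sup>2) h'"
    unfolding h'_def by (rule sbd_bilinear[OF bounded_bilinear_scaleC sbd_inverse_Complex[OF b] h, of 1]) simp_all
  have wh': "sbd wt (\<lambda>w. (w \<bullet> b) *\<^sub>R h' w)" by (rule sbd_coord_mult[OF b h'])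
  note h1 = sbd_wt_sq[OF h']
  have iwh': "sbd wt (\<lambda>w. R *\<^sub>R \<i> *\<^sub>C (w \<bullet> b) *\<^sub>R h' w)"
    by (intro sbd_linear[OF bounded_linear_scaleR_right] sbd_linear[OF scaleC.bounded_linear_right] wh')
  have eq: "h w = h' w + R *\<^sub>R \<i> *\<^sub>C (w \<bullet> b) *\<^sub>R h' w" for w
  proof -
    have "h' w + R *\<^sub>R \<i> *\<^sub>C (w \<bullet> b) *\<^sub>R h' w = Complex 1 (R * (w \<bullet> b)) *\<^sub>C h' w"
      by (simp add: Complex_eq scaleC_add_left scaleC_of_real[symmetric] scaleC_scaleC mult_ac)
    also have "\<dots> = h w" by (simp add: h'_def scaleC_scaleC)
    finally show ?thesis by simp
  qed
  have "integral UNIV (\<lambda>\<eta>. pr (a \<eta> + R *\<^sub>R dd b a \<eta>) (fourier h' \<eta>)) =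
    integral UNIV (\<lambda>\<eta>. pr (a \<eta>) (fourier h' \<eta>)) + integral UNIV (\<lambda>\<eta>. pr (R *\<^sub>R dd b a \<eta>) (fourier h' \<eta>))"
    by (rule integral_pr_add_left[OF a spoly_scaleR[OF spoly_dd[OF a b]] h1])
  also have "integral UNIV (\<lambda>\<eta>. pr (R *\<^sub>R dd b a \<eta>) (fourier h' \<eta>)) = R *\<^sub>R integral UNIV (\<lambda>\<eta>. pr (dd b a \<eta>) (fourier h' \<eta>))"
    by (simp add: scaleR_left)
  also have "\<dots> = R *\<^sub>R integral UNIV (\<lambda>\<eta>. pr (a \<eta>) (fourier (\<lambda>w. \<i> *\<^sub>C (w \<bullet> b) *\<^sub>R h' w) \<eta>))"
    by (simp add: fourier_by_parts[OF a h1 wh' b])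
  also have "\<dots> = integral UNIV (\<lambda>\<eta>. pr (a \<eta>) (fourier (\<lambda>w. R *\<^sub>R \<i> *\<^sub>C (w \<bullet> b) *\<^sub>R h' w) \<eta>))"
    by (subst fourier_linear[OF sbd_linear[OF scaleC.bounded_linear_right wh'] bounded_linear_scaleR_right])
      (simp_all only: scaleR_right scaleC_scaleR[symmetric] integral_cmul)
  also have "integral UNIV (\<lambda>\<eta>. pr (a \<eta>) (fourier h' \<eta>)) + \<dots> = integral UNIV (\<lambda>\<eta>. pr (a \<eta>) (fourier h \<eta>))"
    unfolding integral_pr_add_right[OF a h1 iwh', symmetric] eq[symmetric] ..
  finally show ?thesis unfolding h'_def .
qed

lemma pair_Cons:
  fixes h :: "real^'n::finite \<Rightarrow> 'y"
  assumes a: "spoly a" and h: "sbd (\<lambda>w. (wt w)\<^sup>2) (\<lambda>w. Wt L w *\<^sub>C h w)" and L: "bas (x # L)"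
  shows "pair (x # L) a h = pair L a h"
  using integral_step[OF spoly_Eop[OF a] h, where b="fst x" and R="snd x"] L
  by (simp add: pair_def scaleC_scaleC)

lemma pair_append:
  fixes h :: "real^'n::finite \<Rightarrow> 'y"
  assumes a: "spoly a" and h: "sbd (\<lambda>w. (wt w)\<^sup>2) (\<lambda>w. Wt L w *\<^sub>C h w)" and L: "bas L" and L': "bas L'"
  shows "pair (L' @ L) a h = pair L a h"
  using L'
proof (induction L')
  case (Cons x L')
  have "sbd (\<lambda>w. (wt w)\<^sup>2) (\<lambda>w. Wt L' w *\<^sub>C (Wt L w *\<^sub>C h w))"
    by (rule sbd_Wt_mult[OF _ h]) (use Cons.prems in auto)
  then have "pair (x # (L' @ L)) a h = pair (L' @ L) a h"
    using Cons.prems L by (intro pair_Cons[OF a]) (auto simp: Wt_append scaleC_scaleC)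
  with Cons show ?case by simp
qed simp

text \<open>Both values agree with the one for the concatenated list, whose order does not matter
  because the operators commute and the factors are numbers.\<close>

lemma pair_independent:
  fixes h :: "real^'n::finite \<Rightarrow> 'y"
  assumes a: "spoly a" and L: "bas L" "sbd (\<lambda>w. (wt w)\<^sup>2) (\<lambda>w. Wt L w *\<^sub>C h w)"
    and L': "bas L'" "sbd (\<lambda>w. (wt w)\<^sup>2) (\<lambda>w. Wt L' w *\<^sub>C h w)"
  shows "pair L a h = pair L' a h"
proof -
  have "pair L a h = pair (L' @ L) a h" by (rule pair_append[OF a L(2,1) L'(1), symmetric])
  also have "\<dots> = pair (L @ L') a h"
    unfolding pair_def using a L L' Eop_append_commute[of a L L'] by (simp add: Wt_append mult.commute)
  also have "\<dots> = pair L' a h" by (rule pair_append[OF a L'(2,1) L(1)])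
  finally show ?thesis .
qed

lemma pair_dd_left:
  fixes h :: "real^'n::finite \<Rightarrow> 'y"
  assumes a: "spoly a" and L: "bas L" "sbd (\<lambda>w. (wt w)\<^sup>2) (\<lambda>w. Wt L w *\<^sub>C h w)" and b: "b \<in> Basis"
  shows "pair L (dd b a) h = pair L a (\<lambda>w. \<i> *\<^sub>C (w \<bullet> b) *\<^sub>R h w)"
  using fourier_by_parts[OF spoly_Eop[OF a L(1)] sbd_wt_sq[OF L(2)] sbd_coord_mult[OF b L(2)] b]
  by (simp add: pair_def Eop_dd[OF a L(1) b] scaleC_scaleC scaleC_scaleR mult.commute)

text \<open>The conjugate of \<open>\<partial>\<^sub>b\<close> by the multiplication with \<open>Wt L\<close>.\<close>

primrec Zop :: "real^'n::finite \<Rightarrow> ((real^'n) \<times> real) list \<Rightarrow> (real^'n \<Rightarrow> 'y) \<Rightarrow> real^'n \<Rightarrow> 'y" where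
  "Zop b [] h = dd b h"
| "Zop b (x # L) h = (\<lambda>w. Zop b L h w + (if fst x = b then inverse (Complex 1 (snd x * (w \<bullet> fst x))) *\<^sub>C (\<i> * of_real (snd x)) *\<^sub>C h w else 0))"

lemma sbd_Zop:
  assumes "bas L" "b \<in> Basis" "sbd \<omega> h" "\<And>x. \<omega> x \<ge> 0"
  shows "sbd \<omega> (Zop b L h)"
  using assms(1)
proof (induction L)
  case Nil
  then show ?case by (simp add: sbd_dd assms)
next
  case (Cons x L)
  have "sbd \<omega> (\<lambda>w. inverse (Complex 1 (snd x * (w \<bullet> fst x))) *\<^sub>C (\<i> * of_real (snd x)) *\<^sub>C h w)"
    using Cons.prems assms(4)
    by (intro sbd_bilinear[OF bounded_bilinear_scaleC sbd_inverse_Complex, of _ \<omega> _ 1] sbd_linear[OF scaleC.bounded_linear_right] assms(3)) auto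
  then show ?case
    using Cons by (cases "fst x = b") (auto intro: sbd_add)
qed

text \<open>The derivative of \<open>1 / (1 + i R w_b)\<close> is \<open>- i R\<close> times its
  square, and the additional summands of \<open>Zop\<close> cancel these terms one by one.\<close>

lemma Zop_Wt:
  assumes "bas L" "b \<in> Basis" "sbd \<omega> h" "\<And>x. \<omega> x \<ge> 0"
  shows "Zop b L (\<lambda>w. Wt L w *\<^sub>C h w) w = Wt L w *\<^sub>C dd b h w"
  using assms(1,3)
proof (induction L arbitrary: h)
  case Nil
  then show ?case by simp
next
  case (Cons x L)
  define v where "v w = inverse (Complex 1 (snd x * (w \<bullet> fst x)))" for w
  have x: "fst x \<in> Basis" using Cons.prems by simp
  have vh: "sbd \<omega> (\<lambda>w. v w *\<^sub>C h w)"
    unfolding v_def using assms(4) x by (intro sbd_bilinear[OF bounded_bilinear_scaleC sbd_inverse_Complex Cons.prems(2), of _ 1]) auto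
  have dv: "dd b (\<lambda>w. v w *\<^sub>C h w) w = v w *\<^sub>C dd b h w + (if fst x = b then - (\<i> * of_real (snd x) * (v w * v w)) *\<^sub>C h w else 0)"
  proof (rule ddI)
    show "((\<lambda>t. v (w + t *\<^sub>R b) *\<^sub>C h (w + t *\<^sub>R b)) has_vector_derivative
        v w *\<^sub>C dd b h w + (if fst x = b then - (\<i> * of_real (snd x) * (v w * v w)) *\<^sub>C h w else 0)) (at 0)"
      using scaleC.has_vector_derivative[OF inverse_Complex_derivative[OF x assms(2), of "snd x" w] sbd_derivative[OF Cons.prems(2) assms(2), of w]]
      by (cases "fst x = b") (simp_all add: v_def scaleC.zero_left)
  qed
  have W: "Wt (x # L) w = v w * Wt L w" for w by (simp add: v_def)
  have "Zop b (x # L) (\<lambda>w. Wt (x # L) w *\<^sub>C h w) w =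
      Zop b L (\<lambda>w. Wt L w *\<^sub>C (v w *\<^sub>C h w)) w + (if fst x = b then v w *\<^sub>C (\<i> * of_real (snd x)) *\<^sub>C (v w * Wt L w) *\<^sub>C h w else 0)"
    unfolding W by (auto simp: v_def scaleC_scaleC mult.commute)
  also have "\<dots> = Wt L w *\<^sub>C dd b (\<lambda>w. v w *\<^sub>C h w) w + (if fst x = b then v w *\<^sub>C (\<i> * of_real (snd x)) *\<^sub>C (v w * Wt L w) *\<^sub>C h w else 0)"
    using Cons.IH[OF _ vh] Cons.prems by simp
  also have "\<dots> = Wt (x # L) w *\<^sub>C dd b h w"
    unfolding dv W by (simp add: scaleC_add_right scaleC_scaleC scaleC.minus_left scaleC.minus_right scaleC.zero_right mult_ac)
  finally show ?case .
qed

text \<open>For the empty list this is the rule for the transform of a derivative. Adding a factor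
  in the direction \<open>b\<close> itself produces the commutator of
  \<open>1 + R \<partial>_b\<close> with multiplication by \<open>\<eta>_b\<close>, which is
  \<open>R\<close>; it is matched by the additional summand of \<open>Zop\<close>, after
  \<open>integral_step\<close> removes its regularising factor.\<close>

lemma integral_Zop:
  fixes h :: "real^'n::finite \<Rightarrow> 'y"
  assumes "spoly a" and h: "sbd (\<lambda>w. (wt w)\<^sup>2) h" and L: "bas L" and b: "b \<in> Basis"
  shows "integral UNIV (\<lambda>\<eta>. pr (Eop L a \<eta>) (fourier (Zop b L h) \<eta>)) =
    integral UNIV (\<lambda>\<eta>. pr (Eop L (\<lambda>\<eta>. (\<eta> \<bullet> b) *\<^sub>R a \<eta>) \<eta>) (fourier (\<lambda>w. \<i> *\<^sub>C h w) \<eta>))"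
  using assms(1) L
proof (induction L arbitrary: a)
  case Nil
  have "pr (a \<eta>) (fourier (dd b h) \<eta>) = pr ((\<eta> \<bullet> b) *\<^sub>R a \<eta>) (fourier (\<lambda>w. \<i> *\<^sub>C h w) \<eta>)" for \<eta>
  proof -
    have "fourier (dd b h) \<eta> = (\<eta> \<bullet> b) *\<^sub>R (\<i> *\<^sub>C fourier h \<eta>)"
      unfolding fourier_dd[OF sbd_wt_sq[OF h] b] scaleC_of_real[symmetric] scaleC_scaleC by (simp add: mult.commute inner_commute)
    then show ?thesis by (simp add: fourier_scaleC[OF sbd_wt_sq[OF h]] scaleR_left scaleR_right)
  qed
  then show ?case by simp
next
  case (Cons x L)
  obtain c R where x: "x = (c, R)" by (cases x)
  have c: "c \<in> Basis" and L: "bas L" using Cons.prems x by auto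
  define a' where "a' \<eta> = a \<eta> + R *\<^sub>R dd c a \<eta>" for \<eta>
  have a': "spoly a'" unfolding a'_def by (intro spoly_add spoly_scaleR spoly_dd Cons.prems c)
  have Ea: "Eop (x # L) a = Eop L a'" using Eop_step[OF Cons.prems] by (simp add: x a'_def[abs_def])
  define g where "g w = inverse (Complex 1 (R * (w \<bullet> c))) *\<^sub>C (\<i> * of_real R) *\<^sub>C h w" for w
  have iRh: "sbd (\<lambda>w. (wt w)\<^sup>2) (\<lambda>w. (\<i> * of_real R) *\<^sub>C h w)" by (rule sbd_linear[OF scaleC.bounded_linear_right h])
  have g: "sbd (\<lambda>w. (wt w)\<^sup>2) g" unfolding g_def
    by (rule sbd_bilinear[OF bounded_bilinear_scaleC sbd_inverse_Complex[OF c] iRh, of 1]) simp_all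
  have Z: "sbd wt (Zop b L h)" by (rule sbd_wt_sq[OF sbd_Zop[OF L b h]]) simp
  have ih: "sbd wt (\<lambda>w. \<i> *\<^sub>C h w)" by (rule sbd_wt_sq[OF sbd_linear[OF scaleC.bounded_linear_right h]])
  have yb: "spoly (\<lambda>\<eta>. (\<eta> \<bullet> b) *\<^sub>R a \<eta>)" "spoly (\<lambda>\<eta>. (\<eta> \<bullet> b) *\<^sub>R a' \<eta>)" by (intro spoly_coord Cons.prems a' b)+
  have IH: "integral UNIV (\<lambda>\<eta>. pr (Eop (x # L) a \<eta>) (fourier (Zop b L h) \<eta>)) =
    integral UNIV (\<lambda>\<eta>. pr (Eop L (\<lambda>\<eta>. (\<eta> \<bullet> b) *\<^sub>R a' \<eta>) \<eta>) (fourier (\<lambda>w. \<i> *\<^sub>C h w) \<eta>))"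
    unfolding Ea by (rule Cons.IH[OF a' L])
  show ?case
  proof (cases "c = b")
    case False
    have "Eop (x # L) (\<lambda>\<eta>. (\<eta> \<bullet> b) *\<^sub>R a \<eta>) = Eop L (\<lambda>\<eta>. (\<eta> \<bullet> b) *\<^sub>R a' \<eta>)"
      using Eop_step[OF yb(1) Cons.prems(2)] spoly_dd_coord[OF Cons.prems(1) b c] False
      by (simp add: x a'_def scaleR_add_right mult.commute)
    then show ?thesis using IH False by (simp add: x)
  next
    case True
    have "Eop (x # L) (\<lambda>\<eta>. (\<eta> \<bullet> b) *\<^sub>R a \<eta>) = Eop L (\<lambda>\<eta>. (\<eta> \<bullet> b) *\<^sub>R a' \<eta> + R *\<^sub>R a \<eta>)"
      using Eop_step[OF yb(1) Cons.prems(2)] spoly_dd_coord[OF Cons.prems(1) b c] True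
      by (simp add: x a'_def scaleR_add_right mult.commute add.assoc)
    also have "\<dots> = (\<lambda>\<eta>. Eop L (\<lambda>\<eta>. (\<eta> \<bullet> b) *\<^sub>R a' \<eta>) \<eta> + R *\<^sub>R Eop L a \<eta>)"
      by (simp add: Eop_add[OF yb(2) spoly_scaleR[OF Cons.prems(1)] L] Eop_linear[OF bounded_linear_scaleR_right Cons.prems(1) L])
    finally have E: "Eop (x # L) (\<lambda>\<eta>. (\<eta> \<bullet> b) *\<^sub>R a \<eta>) = (\<lambda>\<eta>. Eop L (\<lambda>\<eta>. (\<eta> \<bullet> b) *\<^sub>R a' \<eta>) \<eta> + R *\<^sub>R Eop L a \<eta>)" .
    have "integral UNIV (\<lambda>\<eta>. pr (Eop (x # L) a \<eta>) (fourier g \<eta>)) = integral UNIV (\<lambda>\<eta>. pr (Eop L a \<eta>) (fourier (\<lambda>w. (\<i> * of_real R) *\<^sub>C h w) \<eta>))"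
      using integral_step[OF spoly_Eop[OF Cons.prems(1) L] iRh c, of R] by (simp add: x g_def[abs_def])
    also have "\<dots> = integral UNIV (\<lambda>\<eta>. pr (R *\<^sub>R Eop L a \<eta>) (fourier (\<lambda>w. \<i> *\<^sub>C h w) \<eta>))"
    proof -
      have "fourier (\<lambda>w. (\<i> * of_real R) *\<^sub>C h w) \<eta> = R *\<^sub>R fourier (\<lambda>w. \<i> *\<^sub>C h w) \<eta>" for \<eta>
        unfolding fourier_scaleC[OF sbd_wt_sq[OF h]] scaleC_of_real[symmetric] scaleC_scaleC by (simp add: mult.commute)
      then show ?thesis by (simp add: scaleR_left scaleR_right)
    qed
    finally have G: "integral UNIV (\<lambda>\<eta>. pr (Eop (x # L) a \<eta>) (fourier g \<eta>)) = integral UNIV (\<lambda>\<eta>. pr (R *\<^sub>R Eop L a \<eta>) (fourier (\<lambda>w. \<i> *\<^sub>C h w) \<eta>))" .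
    have "Zop b (x # L) h = (\<lambda>w. Zop b L h w + g w)" by (simp add: x True g_def)
    then show ?thesis
      unfolding E
      by (simp only: integral_pr_add_right[OF spoly_Eop[OF Cons.prems] Z sbd_wt_sq[OF g]] IH G
          integral_pr_add_left[OF spoly_Eop[OF yb(2) L] spoly_scaleR[OF spoly_Eop[OF Cons.prems(1) L]] ih])
  qed
qed

text \<open>\<open>h\<close> is merely bounded and decays only after multiplication by
  \<open>Wt L\<close>, so its derivative must first be carried past \<open>Wt L\<close> before the
  Fourier transform can convert it into a factor \<open>\<eta>_b\<close>.\<close>

lemma pair_dd_right:
  fixes h :: "real^'n::finite \<Rightarrow> 'y"
  assumes a: "spoly a" and h: "sbd (\<lambda>_. 1) h" and L: "bas L" "sbd (\<lambda>w. (wt w)\<^sup>2) (\<lambda>w. Wt L w *\<^sub>C h w)" and b: "b \<in> Basis"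
  shows "pair L a (dd b h) = pair L (\<lambda>\<eta>. (\<eta> \<bullet> b) *\<^sub>R a \<eta>) (\<lambda>w. \<i> *\<^sub>C h w)"
proof -
  have "(\<lambda>w. Wt L w *\<^sub>C dd b h w) = Zop b L (\<lambda>w. Wt L w *\<^sub>C h w)"
    using Zop_Wt[OF L(1) b h] by (intro ext) simp
  moreover have "(\<lambda>w. Wt L w *\<^sub>C \<i> *\<^sub>C h w) = (\<lambda>w. \<i> *\<^sub>C Wt L w *\<^sub>C h w)"
    by (simp add: scaleC_scaleC mult.commute)
  ultimately show ?thesis
    unfolding pair_def using integral_Zop[OF a L(2) L(1) b] by simp
qed

end

context fpairing begin

lemma pair_add_right:
  fixes f :: "real^'n::finite \<Rightarrow> 'y"
  assumes "spoly a" "bas L" "sbd wt (\<lambda>w. Wt L w *\<^sub>C f w)" "sbd wt (\<lambda>w. Wt L w *\<^sub>C g w)"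
  shows "pair L a (\<lambda>w. f w + g w) = pair L a f + pair L a g"
  unfolding pair_def scaleC_add_right
  by (rule integral_pr_add_right[OF spoly_Eop assms(3,4)]) (use assms in auto)

lemma pair_zero_right: "pair L a (\<lambda>w. 0) = 0"
  by (simp add: pair_def scaleC.zero_right fourier_def zero_right)

lemma pair_sum_right:
  fixes f :: "'i \<Rightarrow> real^'n::finite \<Rightarrow> 'y"
  assumes "spoly a" "bas L" "\<And>i. i \<in> I \<Longrightarrow> sbd wt (\<lambda>w. Wt L w *\<^sub>C f i w)"
  shows "pair L a (\<lambda>w. \<Sum>i\<in>I. f i w) = (\<Sum>i\<in>I. pair L a (f i))"
  using assms(3)
proof (induction I rule: infinite_finite_induct)
  case (insert i I)
  have "sbd wt (\<lambda>w. Wt L w *\<^sub>C (\<Sum>i\<in>I. f i w))"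
    unfolding scaleC.sum_right using insert.prems by (intro sbd_sum) auto
  with insert show ?case by (simp add: pair_add_right[OF assms(1,2)])
qed (simp_all add: pair_zero_right)

lemma pair_scaleR_right:
  fixes f :: "real^'n::finite \<Rightarrow> 'y"
  assumes "sbd wt (\<lambda>w. Wt L w *\<^sub>C f w)"
  shows "pair L a (\<lambda>w. r *\<^sub>R f w) = r *\<^sub>R pair L a f"
  unfolding pair_def scaleC_scaleR
  by (simp add: fourier_linear[OF assms bounded_linear_scaleR_right] scaleC_scaleR scaleR_right)

lemma pair_add_left:
  fixes f :: "real^'n::finite \<Rightarrow> 'y"
  assumes "spoly a" "spoly a'" "bas L" "sbd wt (\<lambda>w. Wt L w *\<^sub>C f w)"
  shows "pair L (\<lambda>\<eta>. a \<eta> + a' \<eta>) f = pair L a f + pair L a' f"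
  unfolding pair_def Eop_add[OF assms(1-3)]
  by (rule integral_pr_add_left[OF spoly_Eop spoly_Eop assms(4)]) (use assms in auto)

lemma pair_scaleR_left:
  fixes f :: "real^'n::finite \<Rightarrow> 'y"
  assumes "spoly a" "bas L"
  shows "pair L (\<lambda>\<eta>. r *\<^sub>R a \<eta>) f = r *\<^sub>R pair L a f"
  unfolding pair_def by (simp add: Eop_linear[OF bounded_linear_scaleR_right assms] scaleR_left)

text \<open>Two differentiations under the integral sign: first in the Fourier integral over
  \<open>w\<close>, then in the integral over \<eta>. The second one needs decay of the transforms
  that is uniform in \<open>s\<close>, hence the hypotheses on families in \<open>s\<close>.\<close>

lemma pair_has_vector_derivative:
  fixes h :: "real \<Rightarrow> real^'n::finite \<Rightarrow> 'y"
  assumes a: "\<And>s. \<bar>s\<bar> < 1 \<Longrightarrow> spoly (a s)" "\<And>s. \<bar>s\<bar> < 1 \<Longrightarrow> spoly (a' s)" and L: "bas L"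
    and da: "\<And>s \<eta>. \<bar>s\<bar> < 1 \<Longrightarrow> ((\<lambda>s. Eop L (a s) \<eta>) has_vector_derivative Eop L (a' s) \<eta>) (at s)"
    and ba: "\<And>s \<eta>. \<bar>s\<bar> < 1 \<Longrightarrow> norm (Eop L (a s) \<eta>) \<le> A * (1 + norm \<eta>) ^ M"
      "\<And>s \<eta>. \<bar>s\<bar> < 1 \<Longrightarrow> norm (Eop L (a' s) \<eta>) \<le> A * (1 + norm \<eta>) ^ M"
    and dh: "\<And>s w. \<bar>s\<bar> < 1 \<Longrightarrow> ((\<lambda>s. h s w) has_vector_derivative h' s w) (at s)"
    and bh: "\<And>k. bdiff k {s. \<bar>s\<bar> < 1} (\<lambda>_ _ w. wt w) (\<lambda>s w. Wt L w *\<^sub>C h s w)"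
      "\<And>k. bdiff k {s. \<bar>s\<bar> < 1} (\<lambda>_ _ w. wt w) (\<lambda>s w. Wt L w *\<^sub>C h' s w)"
  shows "((\<lambda>s. pair L (a s) (h s)) has_vector_derivative pair L (a' 0) (h 0) + pair L (a 0) (h' 0)) (at 0)"
proof -
  have sh: "sbd wt (\<lambda>w. Wt L w *\<^sub>C h s w)" "sbd wt (\<lambda>w. Wt L w *\<^sub>C h' s w)" if "\<bar>s\<bar> < 1" for s
    using that by (auto intro!: sbd_of_bdiff[OF bh(1)] sbd_of_bdiff[OF bh(2)] exI[of _ 1])
  have A: "A \<ge> 0"
    by (rule nonneg_of_mult[OF order_trans[OF norm_ge_zero ba(1)[of 0 0]]]) auto
  obtain B where B: "B \<ge> 0" "\<And>s w. \<bar>s\<bar> < 1 \<Longrightarrow> norm (Wt L w *\<^sub>C h' s w) \<le> B * wt w"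
    using bdiff_bound[OF bh(2)[of 0]] by auto
  define FT where "FT s = fourier (\<lambda>w. Wt L w *\<^sub>C h s w)" for s
  define FT' where "FT' s = fourier (\<lambda>w. Wt L w *\<^sub>C h' s w)" for s
  have dFT: "((\<lambda>s. FT s \<eta>) has_vector_derivative FT' s \<eta>) (at s)" if s: "\<bar>s\<bar> < 1" for s \<eta>
  proof -
    \<comment> \<open>The room left around \<open>s\<close>: for \<open>\<bar>t\<bar> < e\<close>
      the parameter \<open>s + t\<close> stays in the interval on which the hypotheses hold.\<close>
    define e where "e = 1 - \<bar>s\<bar>"
    have "((\<lambda>t. FT (s + t *\<^sub>R 1) \<eta>) has_vector_derivative integral UNIV (\<lambda>w. cis (- (w \<bullet> \<eta>)) *\<^sub>C Wt L w *\<^sub>C h' (s + 0) w)) (at 0)"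
      unfolding FT_def fourier_def
    proof (rule integral_vector_derivative[where e=e and F'="\<lambda>t w. cis (- (w \<bullet> \<eta>)) *\<^sub>C Wt L w *\<^sub>C h' (s + t) w", OF _ _ _ _ _ _ integrable_cmult_wt])
      show "e > 0" using s by (simp add: e_def)
      fix t assume "\<bar>t\<bar> < e"
      then have st: "\<bar>s + t\<bar> < 1" unfolding e_def by linarith
      have "((\<lambda>t. h (s + t *\<^sub>R 1) w) has_vector_derivative h' (s + t) w) (at t)" for w
      proof -
        have "((\<lambda>t. s + t) has_vector_derivative 1) (at t)" by (auto intro!: derivative_eq_intros)
        from vector_diff_chain_at[OF this dh[OF st, of w]] show ?thesis by (simp add: o_def)
      qed
      then show "((\<lambda>t. cis (- (w \<bullet> \<eta>)) *\<^sub>C Wt L w *\<^sub>C h (s + t *\<^sub>R 1) w) has_vector_derivative cis (- (w \<bullet> \<eta>)) *\<^sub>C Wt L w *\<^sub>C h' (s + t) w) (at t)" for w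
        by (intro bounded_linear.has_vector_derivative[OF scaleC.bounded_linear_right])
      show "continuous_on UNIV (\<lambda>w. cis (- (w \<bullet> \<eta>)) *\<^sub>C Wt L w *\<^sub>C h (s + t *\<^sub>R 1) w)"
        by (rule continuous_on_scaleC[OF _ sbd_continuous[OF sh(1)]]) (use st in \<open>auto intro!: continuous_intros\<close>)
      show "(\<lambda>w. cis (- (w \<bullet> \<eta>)) *\<^sub>C Wt L w *\<^sub>C h (s + t *\<^sub>R 1) w) integrable_on UNIV"
        using fourier_integrable[OF sh(1)[OF st]] by simp
      show "norm (cis (- (w \<bullet> \<eta>)) *\<^sub>C Wt L w *\<^sub>C h' (s + t) w) \<le> B * wt w" for w
        using B(2)[OF st] by (simp add: norm_scaleC)
    next
      show "continuous_on UNIV (\<lambda>w. cis (- (w \<bullet> \<eta>)) *\<^sub>C Wt L w *\<^sub>C h' (s + 0) w)"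
        by (rule continuous_on_scaleC[OF _ sbd_continuous[OF sh(2)]]) (use s in \<open>auto intro!: continuous_intros\<close>)
    qed
    then have "((\<lambda>t. FT (0 + (s *\<^sub>R 1) + t *\<^sub>R 1) \<eta>) has_vector_derivative FT' s \<eta>) (at 0)"
      unfolding FT'_def fourier_def by simp
    from has_vector_derivative_line[OF this] show ?thesis by simp
  qed
  \<comment> \<open>\<open>M\<close> powers offset the growth of the symbols, the others produce the
    integrable weight by \<open>wt_ge\<close>.\<close>
  let ?N = "M + 2 * DIM(real^'n)"
  let ?W = "integral UNIV (wt :: real^'n \<Rightarrow> real)"
  have dec: "\<exists>C\<ge>0. \<forall>s\<in>{s. \<bar>s\<bar> < 1}. \<forall>\<eta>. (1 + norm \<eta>) ^ ?N * norm (fourier (\<lambda>w. Wt L w *\<^sub>C g s w) \<eta>) \<le> C * 1 ^ ?N * ?W"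
    if "\<And>k. bdiff k {s. \<bar>s\<bar> < 1} (\<lambda>_ _ w. wt w) (\<lambda>s w. Wt L w *\<^sub>C g s w)" for g
    by (rule fourier_decay_family[where D="\<lambda>_. 1"]) (use that in \<open>simp_all add: integrable_wt\<close>)
  obtain C1 where C1: "C1 \<ge> 0" "\<And>s \<eta>. \<bar>s\<bar> < 1 \<Longrightarrow> (1 + norm \<eta>) ^ ?N * norm (FT s \<eta>) \<le> C1 * ?W"
    using dec[OF bh(1)] unfolding FT_def by auto
  obtain C2 where C2: "C2 \<ge> 0" "\<And>s \<eta>. \<bar>s\<bar> < 1 \<Longrightarrow> (1 + norm \<eta>) ^ ?N * norm (FT' s \<eta>) \<le> C2 * ?W"
    using dec[OF bh(2)] unfolding FT'_def by auto
  obtain K where K: "K \<ge> 0" "\<And>x y. norm (pr x y) \<le> norm x * norm y * K" using nonneg_bounded by blast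
  have prb: "norm (pr x y) \<le> (K * A * C * ?W) * wt \<eta>"
    if "norm x \<le> A * (1 + norm \<eta>) ^ M" "(1 + norm \<eta>) ^ ?N * norm y \<le> C * ?W" for x y C and \<eta> :: "real^'n"
  proof -
    have "norm x * norm y \<le> (A * (1 + norm \<eta>) ^ M * norm y) * 1"
      using mult_right_mono[OF that(1), of "norm y"] by simp
    also have "\<dots> \<le> (A * (1 + norm \<eta>) ^ M * norm y) * (wt \<eta> * (1 + norm \<eta>) ^ (2 * DIM(real^'n)))"
      using A wt_ge[of \<eta>] by (intro mult_left_mono) auto
    also have "\<dots> = A * wt \<eta> * ((1 + norm \<eta>) ^ ?N * norm y)" by (simp add: power_add mult_ac)
    also have "\<dots> \<le> A * wt \<eta> * (C * ?W)" using A by (intro mult_left_mono that) auto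
    finally have "norm x * norm y \<le> A * wt \<eta> * (C * ?W)" .
    from order_trans[OF K(2) mult_right_mono[OF this K(1)]] show ?thesis by (simp add: mult_ac)
  qed
  have "((\<lambda>s. integral UNIV (\<lambda>\<eta>. pr (Eop L (a s) \<eta>) (FT s \<eta>))) has_vector_derivative
      integral UNIV (\<lambda>\<eta>. pr (Eop L (a 0) \<eta>) (FT' 0 \<eta>) + pr (Eop L (a' 0) \<eta>) (FT 0 \<eta>))) (at 0)"
  proof (rule integral_vector_derivative[where e=1 and F'="\<lambda>s \<eta>. pr (Eop L (a s) \<eta>) (FT' s \<eta>) + pr (Eop L (a' s) \<eta>) (FT s \<eta>)", OF _ _ _ _ _ _ integrable_cmult_wt])
    fix s :: real assume s: "\<bar>s\<bar> < 1"
    show "((\<lambda>s. pr (Eop L (a s) \<eta>) (FT s \<eta>)) has_vector_derivative pr (Eop L (a s) \<eta>) (FT' s \<eta>) + pr (Eop L (a' s) \<eta>) (FT s \<eta>)) (at s)" for \<eta>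
      by (rule has_vector_derivative[OF da[OF s] dFT[OF s]])
    show "continuous_on UNIV (\<lambda>\<eta>. pr (Eop L (a s) \<eta>) (FT s \<eta>))"
      unfolding FT_def by (intro continuous_on spoly_continuous[OF spoly_Eop[OF a(1)[OF s] L]] fourier_continuous sh s)
    show "(\<lambda>\<eta>. pr (Eop L (a s) \<eta>) (FT s \<eta>)) integrable_on UNIV"
      unfolding FT_def by (intro pr_fourier_integrable spoly_Eop a sh s L)
    show "norm (pr (Eop L (a s) \<eta>) (FT' s \<eta>) + pr (Eop L (a' s) \<eta>) (FT s \<eta>)) \<le> (K * A * C2 * ?W + K * A * C1 * ?W) * wt \<eta>" for \<eta>
      unfolding distrib_right by (intro norm_triangle_mono prb ba C1 C2 s)
  next
    show "continuous_on UNIV (\<lambda>\<eta>. pr (Eop L (a 0) \<eta>) (FT' 0 \<eta>) + pr (Eop L (a' 0) \<eta>) (FT 0 \<eta>))"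
      unfolding FT_def FT'_def
      by (intro continuous_on_add continuous_on spoly_continuous[OF spoly_Eop[OF a(1) L]] spoly_continuous[OF spoly_Eop[OF a(2) L]] fourier_continuous sh) auto
  qed simp
  moreover have "integral UNIV (\<lambda>\<eta>. pr (Eop L (a 0) \<eta>) (FT' 0 \<eta>) + pr (Eop L (a' 0) \<eta>) (FT 0 \<eta>)) = pair L (a' 0) (h 0) + pair L (a 0) (h' 0)"
    unfolding pair_def FT_def FT'_def
    by (subst integral_add) (auto intro!: pr_fourier_integrable spoly_Eop a sh L simp: add.commute)
  ultimately show ?thesis unfolding pair_def FT_def by simp
qed

end

section \<open>Symbols\<close>

lemma one_le_jb [simp]: "1 \<le> japanese_bracket \<xi>" and jb_pos [simp]: "0 < japanese_bracket \<xi>"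
  and jb_nonneg [simp]: "0 \<le> japanese_bracket \<xi>"
  and norm_le_jb: "norm \<xi> \<le> japanese_bracket \<xi>"
  and jb_le: "japanese_bracket \<xi> \<le> 1 + norm \<xi>"
  unfolding japanese_bracket_def
  by (auto simp: add_pos_nonneg real_le_rsqrt intro!: real_le_lsqrt simp: power2_sum)

lemma jb_nonzero [simp]: "japanese_bracket \<xi> \<noteq> 0"
  using jb_pos[of \<xi>] by linarith

lemma continuous_on_jb [continuous_intros]: "continuous_on S japanese_bracket"
  unfolding japanese_bracket_def[abs_def] by (intro continuous_intros)

section \<open>The standard regularisation and families of symbols\<close>

definition basis_list :: "(real^'n::finite) list"
  where "basis_list = (SOME bs. set bs = Basis \<and> distinct bs)"

lemma set_basis_list: "set (basis_list :: (real^'n::finite) list) = Basis" and distinct_basis_list: "distinct (basis_list :: (real^'n::finite) list)"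
proof -
  have "\<exists>bs::(real^'n) list. set bs = Basis \<and> distinct bs"
    by (rule finite_distinct_list) simp
  from someI_ex[OF this] show "set (basis_list :: (real^'n) list) = Basis" "distinct (basis_list :: (real^'n) list)"
    unfolding basis_list_def by auto
qed

text \<open>Four factors \<open>1 / (1 + i R w_b)\<close> have modulus
  \<open>1 / (1 + (R w_b)^2)^2\<close>, so that four per direction give the square of
  \<open>wt (R *\<^sub>R w)\<close>: exactly the decay required of regularised amplitudes.\<close>

definition bs4 :: "(real^'n::finite) list"
  where "bs4 = concat (map (\<lambda>b. [b, b, b, b]) basis_list)"

definition L4 :: "real \<Rightarrow> ((real^'n::finite) \<times> real) list"
  where "L4 R = map (\<lambda>b. (b, R)) bs4"

lemma set_bs4: "set (bs4 :: (real^'n::finite) list) = Basis"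
  by (auto simp: bs4_def set_basis_list)

lemma bas_L4: "bas (L4 R)"
  by (auto simp: L4_def set_bs4)

lemma bdiff_Wt_L4:
  "bdiff k {R. R > 0} (\<lambda>j R w. R ^ j * (wt (R *\<^sub>R w))\<^sup>2) (\<lambda>R w::real^'n::finite. Wt (L4 R) w)"
proof -
  define u where "u R b w = inverse (1 + (R * (w \<bullet> b))\<^sup>2)" for R and b w :: "real^'n"
  define v where "v R b w = inverse (Complex 1 (R * (w \<bullet> b)))" for R and b w :: "real^'n"
  have v2: "bdiff k {R. R > 0} (\<lambda>j R w. R ^ j * u R b w) (\<lambda>R w. v R b w * v R b w)" if b: "b \<in> Basis" for b k
    unfolding v_def
  proof (rule bdiff_bilinear[OF bounded_bilinear_mult bdiff_inverse_Complex[OF b] bdiff_inverse_Complex[OF b]])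
    fix i j R and w :: "real^'n" assume "R \<in> {R::real. R > 0}"
    have "inverse (sqrt (1 + (R * (w \<bullet> b))\<^sup>2)) * inverse (sqrt (1 + (R * (w \<bullet> b))\<^sup>2)) = u R b w"
      unfolding u_def inverse_mult_distrib[symmetric] by simp
    then show "R ^ i * inverse (sqrt (1 + (R * (w \<bullet> b))\<^sup>2)) * (R ^ j * inverse (sqrt (1 + (R * (w \<bullet> b))\<^sup>2))) \<le> R ^ (i + j) * u R b w"
      by (simp add: power_add mult_ac)
  qed
  have v4: "bdiff k {R. R > 0} (\<lambda>j R w. R ^ j * (u R b w)\<^sup>2) (\<lambda>R w. (v R b w * v R b w) * (v R b w * v R b w))" if b: "b \<in> Basis" for b k
    by (rule bdiff_bilinear[OF bounded_bilinear_mult v2[OF b] v2[OF b]]) (simp add: power_add power2_eq_square mult_ac)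
  have "bdiff k {R. R > 0} (\<lambda>j R w. R ^ j * (\<Prod>b\<leftarrow>bs. u R b w)\<^sup>2) (\<lambda>R w. Wt (map (\<lambda>b. (b, R)) (concat (map (\<lambda>b. [b, b, b, b]) bs))) w)"
    if "set bs \<subseteq> Basis" for bs k
    using that
  proof (induction bs)
    case Nil
    show ?case by (auto intro!: bdiff_cong_imp[OF bdiff_const[of 1 "{R::real. R > 0}" "\<lambda>_. 1::complex" "\<lambda>j R w. R ^ j * 1"]])
  next
    case (Cons b bs)
    have "bdiff k {R. R > 0} (\<lambda>j R w. R ^ j * (\<Prod>b\<leftarrow>b # bs. u R b w)\<^sup>2)
      (\<lambda>R w. (v R b w * v R b w) * (v R b w * v R b w) * Wt (map (\<lambda>b. (b, R)) (concat (map (\<lambda>b. [b, b, b, b]) bs))) w)"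
      using Cons by (intro bdiff_bilinear[OF bounded_bilinear_mult v4 Cons.IH]) (auto simp: power_add power_mult_distrib mult_ac)
    then show ?case by (simp add: v_def mult.assoc)
  qed
  from this[of basis_list]
  have "bdiff k {R. R > 0} (\<lambda>j R w. R ^ j * (\<Prod>b\<leftarrow>basis_list. u R b w)\<^sup>2) (\<lambda>R w. Wt (L4 R) w)"
    by (simp add: set_basis_list L4_def bs4_def)
  moreover have "(\<Prod>b\<leftarrow>basis_list. u R b w) = wt (R *\<^sub>R w)" for R w
    by (simp add: prod.distinct_set_conv_list[OF distinct_basis_list, symmetric] set_basis_list wt_def u_def)
  ultimately show ?thesis by simp
qed

lemma wt_scaled_le: "R \<ge> 1 \<Longrightarrow> wt (R *\<^sub>R w) \<le> wt w"
  unfolding wt_def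
proof (intro prod_mono conjI)
  fix b :: 'a assume "R \<ge> 1"
  then have "\<bar>w \<bullet> b\<bar> \<le> \<bar>R *\<^sub>R w \<bullet> b\<bar>" by (simp add: abs_mult mult_le_cancel_right1)
  then have "(w \<bullet> b)\<^sup>2 \<le> (R *\<^sub>R w \<bullet> b)\<^sup>2" by (simp only: abs_le_square_iff)
  then show "inverse (1 + (R *\<^sub>R w \<bullet> b)\<^sup>2) \<le> inverse (1 + (w \<bullet> b)\<^sup>2)"
    by (intro le_imp_inverse_le) auto
qed (simp add: less_imp_le)

text \<open>Symbol estimates in one variable, where each derivative gains one order. The factor
  \<open>c p\<close> carries the size of the member \<open>p\<close>; it will be \<open>1\<close>
  for a bounded family and a power of \<open>|y - y'|\<close> for differences of symbols at two
  points.\<close>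

definition symb :: "'p set \<Rightarrow> ('p \<Rightarrow> real) \<Rightarrow> real \<Rightarrow> ('p \<Rightarrow> real^'n::finite \<Rightarrow> 'x::real_normed_vector) \<Rightarrow> bool"
  where "symb P c m a \<longleftrightarrow> (\<forall>p\<in>P. 0 \<le> c p) \<and>
    (\<forall>k. bdiff k P (\<lambda>j p \<eta>. c p * japanese_bracket \<eta> powr (m - real j)) a)"

lemma symbI:
  "(\<And>p. p \<in> P \<Longrightarrow> 0 \<le> c p) \<Longrightarrow> (\<And>k. bdiff k P (\<lambda>j p \<eta>. c p * japanese_bracket \<eta> powr (m - real j)) a) \<Longrightarrow> symb P c m a"
  unfolding symb_def by blast

lemma symb_nonneg: "symb P c m a \<Longrightarrow> p \<in> P \<Longrightarrow> 0 \<le> c p"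
  unfolding symb_def by blast

lemma symb_bdiff: "symb P c m a \<Longrightarrow> bdiff k P (\<lambda>j p \<eta>. c p * japanese_bracket \<eta> powr (m - real j)) a"
  unfolding symb_def by blast

lemma symb_boundE:
  assumes "symb P c m a"
  obtains C where "C \<ge> 0" "\<And>p \<eta>. p \<in> P \<Longrightarrow> norm (a p \<eta>) \<le> C * (c p * japanese_bracket \<eta> powr m)"
  using bdiff_bound[OF symb_bdiff[OF assms, of 0]] by auto

lemma symb_dd: "symb P c m a \<Longrightarrow> b \<in> Basis \<Longrightarrow> symb P c (m - 1) (\<lambda>p. dd b (a p))"
proof (rule symbI)
  fix k assume a: "symb P c m a" and b: "b \<in> Basis"
  from bdiff_dd[OF symb_bdiff[OF a, of "Suc k"] b]
  show "bdiff k P (\<lambda>j p \<eta>. c p * japanese_bracket \<eta> powr (m - 1 - real j)) (\<lambda>p. dd b (a p))"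
    by (simp add: algebra_simps)
qed (rule symb_nonneg)

lemma symb_reparam: "symb P c m a \<Longrightarrow> (\<And>q. q \<in> Q \<Longrightarrow> \<phi> q \<in> P) \<Longrightarrow> symb Q (\<lambda>q. c (\<phi> q)) m (\<lambda>q. a (\<phi> q))"
  unfolding symb_def using bdiff_reparam[of _ P _ a Q \<phi>] by blast

lemma symb_add: "symb P c m a \<Longrightarrow> symb P c m a' \<Longrightarrow> symb P c m (\<lambda>p \<eta>. a p \<eta> + a' p \<eta>)"
  unfolding symb_def by (auto intro: bdiff_add)

lemma symb_zero: "(\<And>p. p \<in> P \<Longrightarrow> 0 \<le> c p) \<Longrightarrow> symb P c m (\<lambda>p \<eta>. 0)"
  by (rule symbI[OF _ bdiff_zero])

lemma symb_linear: "bounded_linear h \<Longrightarrow> symb P c m a \<Longrightarrow> symb P c m (\<lambda>p \<eta>. h (a p \<eta>))"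
  unfolding symb_def by (auto intro: bdiff_linear)

lemma symb_weaken:
  fixes a :: "'p \<Rightarrow> real^'n::finite \<Rightarrow> 'x::real_normed_vector"
  assumes a: "symb P c m a" and m: "m \<le> m'" and D: "D \<ge> 0" "\<And>p. p \<in> P \<Longrightarrow> c p \<le> D * c' p" "\<And>p. p \<in> P \<Longrightarrow> 0 \<le> c' p"
  shows "symb P c' m' a"
proof (rule symbI[OF D(3)])
  fix k
  show "bdiff k P (\<lambda>j p \<eta>. c' p * japanese_bracket \<eta> powr (m' - real j)) a"
  proof (rule bdiff_weaken[OF symb_bdiff[OF a]], intro exI[of _ D] conjI ballI allI D(1))
    fix j p and x :: "real^'n" assume "p \<in> P"
    then have "c p * japanese_bracket x powr (m - real j) \<le> (D * c' p) * japanese_bracket x powr (m' - real j)"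
      using m by (intro mult_mono D powr_mono mult_nonneg_nonneg) auto
    then show "c p * japanese_bracket x powr (m - real j) \<le> D * (c' p * japanese_bracket x powr (m' - real j))"
      by (simp add: mult.assoc)
  qed
qed

lemma jb_powr_le: "japanese_bracket \<eta> powr s \<le> (1 + norm \<eta>) ^ nat \<lceil>s\<rceil>"
proof -
  have "japanese_bracket \<eta> powr s \<le> japanese_bracket \<eta> powr real (nat \<lceil>s\<rceil>)"
    by (intro powr_mono) (auto simp: of_nat_ceiling)
  also have "\<dots> = japanese_bracket \<eta> ^ nat \<lceil>s\<rceil>" by (rule powr_realpow) simp
  also have "\<dots> \<le> (1 + norm \<eta>) ^ nat \<lceil>s\<rceil>" by (rule power_mono) (auto simp: jb_le)
  finally show ?thesis .
qed

lemma symb_spoly: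
  fixes a :: "'p \<Rightarrow> real^'n::finite \<Rightarrow> 'x::real_normed_vector"
  assumes "symb P c m a" "p \<in> P"
  shows "spoly (a p)"
proof -
  have "sbd (\<lambda>\<eta>. (1 + norm \<eta>) ^ nat \<lceil>m\<rceil>) (a p)"
  proof (rule sbd_of_bdiff[OF symb_bdiff[OF assms(1)] assms(2)], intro exI[of _ "c p"] conjI allI)
    fix j and x :: "real^'n"
    have "japanese_bracket x powr (m - real j) \<le> japanese_bracket x powr m" by (intro powr_mono) auto
    also have "\<dots> \<le> (1 + norm x) ^ nat \<lceil>m\<rceil>" by (rule jb_powr_le)
    finally show "c p * japanese_bracket x powr (m - real j) \<le> c p * (1 + norm x) ^ nat \<lceil>m\<rceil>"
      by (intro mult_left_mono symb_nonneg[OF assms])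
  qed (rule symb_nonneg[OF assms])
  then show ?thesis unfolding spoly_def by blast
qed

lemma symb_coord:
  fixes a :: "'p \<Rightarrow> real^'n::finite \<Rightarrow> 'x::real_normed_vector"
  assumes a: "symb P c m a" and b: "b \<in> Basis"
  shows "symb P c (m + 1) (\<lambda>p \<eta>. (\<eta> \<bullet> b) *\<^sub>R a p \<eta>)"
proof (rule symbI[OF symb_nonneg[OF a]])
  fix k
  show "bdiff k P (\<lambda>j p \<eta>. c p * japanese_bracket \<eta> powr (m + 1 - real j)) (\<lambda>p \<eta>. (\<eta> \<bullet> b) *\<^sub>R a p \<eta>)"
  proof (rule bdiff_bilinear[OF bounded_bilinear_scaleR _ symb_bdiff[OF a]])
    show "bdiff k P (\<lambda>j p \<eta>. japanese_bracket \<eta> powr (1 - real j)) (\<lambda>p \<eta>. \<eta> \<bullet> b)"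
    proof (cases k)
      have bd: "\<exists>C\<ge>0. \<forall>p\<in>P. \<forall>x. norm (x \<bullet> b) \<le> C * japanese_bracket x powr (1 - real 0)"
        using order_trans[OF Basis_le_norm[OF b] norm_le_jb] by (intro exI[of _ 1]) simp
      {
        case 0
        then show ?thesis using bd by (auto intro!: continuous_intros)
      next
        case (Suc i)
        show ?thesis unfolding Suc
        proof (rule bdiff_SucI[where f'="\<lambda>d p \<eta>. d \<bullet> b"])
          show "\<exists>C\<ge>0. \<forall>p\<in>P. \<forall>x. norm (x \<bullet> b) \<le> C * japanese_bracket x powr (1 - real 0)" by (rule bd)
          show "((\<lambda>t. (x + t *\<^sub>R d) \<bullet> b) has_vector_derivative d \<bullet> b) (at 0)" for x d
            by (auto simp: inner_add_left intro!: derivative_eq_intros)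
          show "bdiff i P (\<lambda>j p x. japanese_bracket x powr (1 - real (Suc j))) (\<lambda>p x. d \<bullet> b)" for d
            by (rule bdiff_const[of "\<bar>d \<bullet> b\<bar>"]) auto
        qed
      }
    qed
    fix i j p and x :: "real^'n" assume "p \<in> P"
    show "japanese_bracket x powr (1 - real i) * (c p * japanese_bracket x powr (m - real j)) \<le> c p * japanese_bracket x powr (m + 1 - real (i + j))"
      by (simp add: powr_add[symmetric] algebra_simps)
  qed
qed

lemma bs4_subset: "set (bs4 :: (real^'n::finite) list) \<subseteq> Basis"
  by (simp add: set_bs4)

text \<open>An operator \<open>1 + R \<partial>_b\<close> preserves the bound because
  \<open>R (R + |\<eta>|)^(m-1) \<le> (R + |\<eta>|)^m\<close>. Each operator lowers the order by
  one in the induction; the assumption on the length keeps it nonnegative at the end, where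
  \<open>\<langle>\<eta>\<rangle> \<le> R + |\<eta>|\<close> has to be raised to that power.\<close>

lemma Eop_symb_bound:
  fixes a :: "'p \<Rightarrow> real^'n::finite \<Rightarrow> 'x::real_normed_vector"
  shows "set bs \<subseteq> Basis \<Longrightarrow> symb P c m a \<Longrightarrow> real (length bs) \<le> m \<Longrightarrow>
    \<exists>C\<ge>0. \<forall>p\<in>P. \<forall>R\<ge>1. \<forall>\<eta>. norm (Eop (map (\<lambda>b. (b, R)) bs) (a p) \<eta>) \<le> C * c p * (R + norm \<eta>) powr m"
proof (induction bs arbitrary: a m)
  case Nil
  obtain C where C: "C \<ge> 0" "\<And>p \<eta>. p \<in> P \<Longrightarrow> norm (a p \<eta>) \<le> C * (c p * japanese_bracket \<eta> powr m)"
    using symb_boundE[OF Nil(2)] by metis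
  have "norm (a p \<eta>) \<le> C * c p * (R + norm \<eta>) powr m" if "p \<in> P" "R \<ge> 1" for p R \<eta>
  proof -
    have "japanese_bracket \<eta> powr m \<le> (R + norm \<eta>) powr m"
      using Nil(3) jb_le[of \<eta>] that by (intro powr_mono2) auto
    then have "C * (c p * japanese_bracket \<eta> powr m) \<le> C * (c p * (R + norm \<eta>) powr m)"
      using C(1) symb_nonneg[OF Nil(2) that(1)] by (intro mult_left_mono) auto
    then show ?thesis using C(2)[OF that(1), of \<eta>] by (simp add: mult.assoc)
  qed
  then show ?case using C(1) by auto
next
  case (Cons b bs)
  have b: "b \<in> Basis" and bs: "set bs \<subseteq> Basis" using Cons.prems by auto
  obtain C1 where C1: "C1 \<ge> 0" "\<And>p R \<eta>. p \<in> P \<Longrightarrow> R \<ge> 1 \<Longrightarrow>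
      norm (Eop (map (\<lambda>b. (b, R)) bs) (a p) \<eta>) \<le> C1 * c p * (R + norm \<eta>) powr m"
    using Cons.IH[OF bs Cons.prems(2)] Cons.prems(3) by auto
  obtain C2 where C2: "C2 \<ge> 0" "\<And>p R \<eta>. p \<in> P \<Longrightarrow> R \<ge> 1 \<Longrightarrow>
      norm (Eop (map (\<lambda>b. (b, R)) bs) (dd b (a p)) \<eta>) \<le> C2 * c p * (R + norm \<eta>) powr (m - 1)"
    using Cons.IH[OF bs symb_dd[OF Cons.prems(2) b]] Cons.prems(3) by auto
  have "norm (Eop (map (\<lambda>b. (b, R)) (b # bs)) (a p) \<eta>) \<le> (C1 + C2) * c p * (R + norm \<eta>) powr m"
    if p: "p \<in> P" and R: "R \<ge> 1" for p R \<eta>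
  proof -
    let ?L = "map (\<lambda>b. (b, R)) bs"
    have sp: "spoly (a p)" by (rule symb_spoly[OF Cons.prems(2) p])
    have L: "bas ?L" using bs by auto
    have "Eop (map (\<lambda>b. (b, R)) (b # bs)) (a p) \<eta> = Eop ?L (a p) \<eta> + R *\<^sub>R Eop ?L (dd b (a p)) \<eta>"
      using Eop_dd[OF sp L b] by simp
    also have "norm \<dots> \<le> C1 * c p * (R + norm \<eta>) powr m + R * (C2 * c p * (R + norm \<eta>) powr (m - 1))"
      using mult_left_mono[OF C2(2)[OF p R, of \<eta>], of R] R by (intro norm_triangle_mono C1 p R) simp
    also have "R * (C2 * c p * (R + norm \<eta>) powr (m - 1)) \<le> C2 * c p * (R + norm \<eta>) powr m"
    proof -
      have "R * (R + norm \<eta>) powr (m - 1) \<le> (R + norm \<eta>) * (R + norm \<eta>) powr (m - 1)"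
        by (intro mult_right_mono) auto
      also have "\<dots> = (R + norm \<eta>) powr m"
        using R norm_ge_zero[of \<eta>] powr_add[of "R + norm \<eta>" 1 "m - 1"] by simp
      finally have "(C2 * c p) * (R * (R + norm \<eta>) powr (m - 1)) \<le> (C2 * c p) * (R + norm \<eta>) powr m"
        using C2(1) symb_nonneg[OF Cons.prems(2) p] by (intro mult_left_mono) auto
      then show ?thesis by (simp add: mult_ac)
    qed
    finally show ?thesis by (simp add: distrib_right)
  qed
  then show ?case using C1(1) C2(1) by (intro exI[of _ "C1 + C2"]) auto
qed

section \<open>Diffeomorphisms and phase functions\<close>

lemma sbd_compose:
  fixes f :: "'f::euclidean_space \<Rightarrow> 'x::real_normed_vector" and g :: "'e::euclidean_space \<Rightarrow> 'f"
  assumes f: "sbd \<omega> f" and g: "partials g (\<lambda>b. dd b g)" "\<And>b. b \<in> Basis \<Longrightarrow> sbd (\<lambda>_. 1) (dd b g)"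
    and w: "\<And>x. \<omega> (g x) \<le> D * \<Omega> x" "D \<ge> 0"
  shows "sbd \<Omega> (\<lambda>x. f (g x))"
proof (rule sbd_weaken[of "\<lambda>x. \<omega> (g x)"])
  show "sbd (\<lambda>x. \<omega> (g x)) (\<lambda>x. f (g x))"
    unfolding sbd_def
    by (rule allI, rule bdiff_compose[where g="\<lambda>_. g" and f="\<lambda>_. f" and \<omega>="\<lambda>_. \<omega>"])
      (use f g in \<open>auto simp: sbd_def\<close>)
qed (use w in auto)

lemma partials_affine:
  fixes g :: "'e::euclidean_space \<Rightarrow> 'f::real_normed_vector"
  assumes "bounded_linear l" "\<And>x. g x = c + l x"
  shows "partials g (\<lambda>b. dd b g)" "dd b g = (\<lambda>_. l b)"
proof -
  interpret bounded_linear l by fact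
  have g: "g = (\<lambda>x. c + l x)" using assms(2) by auto
  have "((\<lambda>t. g (x + t *\<^sub>R b)) has_vector_derivative l b) (at 0)" for x b
    unfolding g by (auto simp: add scaleR intro!: derivative_eq_intros)
  then have *: "dd b g = (\<lambda>_. l b)" for b by (intro ext ddI)
  show "dd b g = (\<lambda>_. l b)" by (rule *)
  have l: "l v = (\<Sum>b\<in>Basis. (v \<bullet> b) *\<^sub>R l b)" for v
    by (subst euclidean_representation[of v, symmetric]) (simp only: sum scaleR)
  show "partials g (\<lambda>b. dd b g)"
    unfolding partials_def * l[symmetric] unfolding g
    by (auto intro!: derivative_eq_intros has_derivative)
qed

lemma sbd_1_const: "sbd (\<lambda>_. 1) (\<lambda>_. c)"
  by (rule sbd_const[of "norm c"]) auto

lemma sbd_compose_affine: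
  fixes f :: "'f::euclidean_space \<Rightarrow> 'x::real_normed_vector" and l :: "'e::euclidean_space \<Rightarrow> 'f"
  assumes "sbd (\<lambda>_. 1) f" "bounded_linear l"
  shows "sbd (\<lambda>_. 1) (\<lambda>x. f (c + l x))"
  by (rule sbd_compose[OF assms(1) partials_affine(1)[OF assms(2) refl], where D=1])
    (auto simp: partials_affine(2)[OF assms(2) refl] sbd_1_const)

lemma sbd_mult:
  fixes f g :: "'e::euclidean_space \<Rightarrow> 'x::real_normed_algebra"
  shows "sbd (\<lambda>_. 1) f \<Longrightarrow> sbd (\<lambda>_. 1) g \<Longrightarrow> sbd (\<lambda>_. 1) (\<lambda>x. f x * g x)"
  by (rule sbd_bilinear[OF bounded_bilinear_mult, where D=1]) auto

text \<open>Freezing the first variable keeps the constants: bounds on the joint derivatives are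
  uniform in it.\<close>

lemma bdiff_slice:
  fixes f :: "'p::euclidean_space \<times> 'e::euclidean_space \<Rightarrow> 'x::real_normed_vector"
  assumes "sbd (\<lambda>_. 1) f"
  shows "bdiff k UNIV (\<lambda>_ _ _. 1) (\<lambda>y w. f (y, w))"
proof (rule bdiff_compose[where f="\<lambda>_. f" and g="\<lambda>y w. (y, w)" and \<omega>="\<lambda>_ _. 1" and \<Omega>="\<lambda>_ _. 1"])
  have l: "bounded_linear (\<lambda>w::'e. (0::'p, w))" by (intro bounded_linear_intros)
  have e: "\<And>w::'e. (y, w) = (y, 0) + (0::'p, w)" for y :: 'p by simp
  show "partials (Pair y :: 'e \<Rightarrow> 'p \<times> 'e) (\<lambda>b. dd b (Pair y))" for y
    by (rule partials_affine(1)[where g="Pair y", OF l e])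
  show "bdiff k UNIV (\<lambda>_ _ _. 1) (\<lambda>y::'p. dd b (Pair y))" if "b \<in> Basis" for b :: 'e
    unfolding partials_affine(2)[where g="Pair _", OF l e] by (rule bdiff_const[of "norm b"]) (auto simp: norm_Pair)
  show "bdiff k UNIV (\<lambda>_ _ _. 1) (\<lambda>_::'p. f)"
    using bdiff_reparam[OF assms[unfolded sbd_def, rule_format], where Q=UNIV and \<phi>="\<lambda>_. ()"] by simp
qed simp

lemma sbd_sum_arg:
  fixes f :: "'e::euclidean_space \<Rightarrow> 'x::real_normed_vector"
  assumes "sbd (\<lambda>_. 1) f"
  shows "sbd (\<lambda>_. 1) (\<lambda>z::'e \<times> 'e. f (fst z + snd z))"
proof -
  have "bounded_linear (\<lambda>z::'e \<times> 'e. fst z + snd z)" by (intro bounded_linear_intros)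
  from sbd_compose_affine[OF assms this, of 0] show ?thesis by (simp only: add_0)
qed

lemma Basis_prodI: "b \<in> Basis \<Longrightarrow> (b, 0) \<in> Basis" "b \<in> Basis \<Longrightarrow> (0, b) \<in> Basis"
  by (auto simp: Basis_prod_def)

text \<open>The case \<open>s = 0\<close> gives the coefficients in Hadamard's lemma; each derivative with respect to the
  direction of the segment produces a factor \<open>t\<close>, hence the powers.\<close>

definition segint :: "nat \<Rightarrow> ('e::euclidean_space \<Rightarrow> 'x::banach) \<Rightarrow> 'e \<times> 'e \<Rightarrow> 'x"
  where "segint s f z = integral {0..1} (\<lambda>t. (t ^ s) *\<^sub>R f (fst z + t *\<^sub>R snd z))"

lemma segint_continuous:
  fixes f :: "'e::euclidean_space \<Rightarrow> 'x::banach"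
  assumes "continuous_on UNIV f"
  shows "continuous_on S (segint s f)"
proof -
  have "continuous_on (UNIV \<times> cbox 0 1) (\<lambda>(z, t::real). (t ^ s) *\<^sub>R f (fst z + t *\<^sub>R snd z))"
    unfolding case_prod_unfold by (intro continuous_intros continuous_on_compose2[OF assms]) auto
  from integral_continuous_on_param[OF this] show ?thesis
    unfolding segint_def[abs_def] by (auto intro: continuous_on_subset)
qed

lemma segint_bound:
  fixes f :: "'e::euclidean_space \<Rightarrow> 'x::banach"
  assumes "continuous_on UNIV f" "\<And>x. norm (f x) \<le> C"
  shows "norm (segint s f z) \<le> C"
proof -
  have C: "C \<ge> 0" by (rule order_trans[OF norm_ge_zero assms(2)])
  have "norm (integral (cbox 0 1) (\<lambda>t. (t ^ s) *\<^sub>R f (fst z + t *\<^sub>R snd z))) \<le> C * measure lborel (cbox 0 (1::real))"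
  proof (rule integrable_bound)
    show "norm (t ^ s *\<^sub>R f (fst z + t *\<^sub>R snd z)) \<le> C" if "t \<in> cbox 0 1" for t :: real
      using mult_mono[of "t ^ s" 1 "norm (f (fst z + t *\<^sub>R snd z))" C] that assms(2) C
      by (simp add: power_le_one)
    show "(\<lambda>t. t ^ s *\<^sub>R f (fst z + t *\<^sub>R snd z)) integrable_on cbox 0 1"
      by (intro integrable_continuous continuous_intros continuous_on_compose2[OF assms(1)]) auto
  qed (use C in auto)
  then show ?thesis by (simp add: segint_def)
qed

lemma segint_derivative:
  fixes f :: "'e::euclidean_space \<Rightarrow> 'x::banach"
  assumes f: "sbd (\<lambda>_. 1) f" and b: "b \<in> Basis"
  shows "((\<lambda>r. segint s f (z + r *\<^sub>R (b, 0))) has_vector_derivative segint s (dd b f) z) (at 0)"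
    and "((\<lambda>r. segint s f (z + r *\<^sub>R (0, b))) has_vector_derivative segint (Suc s) (dd b f) z) (at 0)"
proof -
  note df = has_vector_derivative_line_zero[OF sbd_derivative[OF f b]]
  note cf = sbd_continuous[OF f, of UNIV] and cdf = sbd_continuous[OF sbd_dd[OF f b], of UNIV]
  have "((\<lambda>r. integral (cbox 0 1) (\<lambda>t. (t ^ s) *\<^sub>R f (fst z + t *\<^sub>R snd z + r *\<^sub>R b))) has_vector_derivative
      integral (cbox 0 1) (\<lambda>t. (t ^ s) *\<^sub>R dd b f (fst z + t *\<^sub>R snd z + 0 *\<^sub>R b))) (at 0 within UNIV)"
  proof (rule leibniz_rule_vector_derivative)
    show "((\<lambda>r. (t ^ s) *\<^sub>R f (fst z + t *\<^sub>R snd z + r *\<^sub>R b)) has_vector_derivative (t ^ s) *\<^sub>R dd b f (fst z + t *\<^sub>R snd z + r *\<^sub>R b)) (at r within UNIV)" for r t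
      by (intro bounded_linear.has_vector_derivative[OF bounded_linear_scaleR_right] df)
    show "(\<lambda>t. t ^ s *\<^sub>R f (fst z + t *\<^sub>R snd z + r *\<^sub>R b)) integrable_on cbox 0 1" for r
      by (intro integrable_continuous continuous_intros continuous_on_compose2[OF cf]) auto
    show "continuous_on (UNIV \<times> cbox 0 1) (\<lambda>(r, t). t ^ s *\<^sub>R dd b f (fst z + t *\<^sub>R snd z + r *\<^sub>R b))"
      unfolding case_prod_unfold by (intro continuous_intros continuous_on_compose2[OF cdf]) auto
  qed auto
  then show "((\<lambda>r. segint s f (z + r *\<^sub>R (b, 0))) has_vector_derivative segint s (dd b f) z) (at 0)"
    by (simp add: segint_def algebra_simps)
  have "((\<lambda>r. integral (cbox 0 1) (\<lambda>t. (t ^ s) *\<^sub>R f (fst z + t *\<^sub>R snd z + (t * r) *\<^sub>R b))) has_vector_derivative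
      integral (cbox 0 1) (\<lambda>t. (t ^ s) *\<^sub>R t *\<^sub>R dd b f (fst z + t *\<^sub>R snd z + (t * 0) *\<^sub>R b))) (at 0 within UNIV)"
  proof (rule leibniz_rule_vector_derivative)
    show "((\<lambda>r. (t ^ s) *\<^sub>R f (fst z + t *\<^sub>R snd z + (t * r) *\<^sub>R b)) has_vector_derivative (t ^ s) *\<^sub>R t *\<^sub>R dd b f (fst z + t *\<^sub>R snd z + (t * r) *\<^sub>R b)) (at r within UNIV)" for r t
    proof -
      have "((\<lambda>r. t * r) has_vector_derivative t) (at r)" by (auto intro!: derivative_eq_intros)
      from vector_diff_chain_at[OF this df[of "fst z + t *\<^sub>R snd z" "t * r"]]
      show ?thesis by (intro bounded_linear.has_vector_derivative[OF bounded_linear_scaleR_right]) (simp add: o_def)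
    qed
    show "(\<lambda>t. t ^ s *\<^sub>R f (fst z + t *\<^sub>R snd z + (t * r) *\<^sub>R b)) integrable_on cbox 0 1" for r
      by (intro integrable_continuous continuous_intros continuous_on_compose2[OF cf]) auto
    show "continuous_on (UNIV \<times> cbox 0 1) (\<lambda>(r, t). t ^ s *\<^sub>R t *\<^sub>R dd b f (fst z + t *\<^sub>R snd z + (t * r) *\<^sub>R b))"
      unfolding case_prod_unfold by (intro continuous_intros continuous_on_compose2[OF cdf]) auto
  qed auto
  then show "((\<lambda>r. segint s f (z + r *\<^sub>R (0, b))) has_vector_derivative segint (Suc s) (dd b f) z) (at 0)"
    by (simp add: segint_def algebra_simps)
qed

lemma sbd_segint:
  fixes f :: "'e::euclidean_space \<Rightarrow> 'x::banach"
  assumes "sbd (\<lambda>_. 1) f"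
  shows "sbd (\<lambda>_. 1) (segint s f)"
  unfolding sbd_def
proof
  have bd: "\<exists>C\<ge>0. \<forall>p\<in>(UNIV::unit set). \<forall>z. norm (segint s f z) \<le> C * 1" if f: "sbd (\<lambda>_. 1) f" for s and f :: "'e \<Rightarrow> 'x"
  proof -
    obtain C where "C \<ge> 0" "\<And>x. norm (f x) \<le> C * 1" using sbd_boundE[OF f] by metis
    then show ?thesis using segint_bound[OF sbd_continuous[OF f], of C s] by auto
  qed
  fix k show "bdiff k (UNIV::unit set) (\<lambda>_ _ _. 1) (\<lambda>_. segint s f)"
    using assms
  proof (induction k arbitrary: s f)
    case 0
    then show ?case using bd[OF 0, of s] segint_continuous[OF sbd_continuous[OF 0]] by simp
  next
    case (Suc k)
    show ?case
    proof (rule bdiff_SucI[where f' = "\<lambda>b _. if snd b = 0 then segint s (dd (fst b) f) else segint (Suc s) (dd (snd b) f)"])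
      show "\<exists>C\<ge>0. \<forall>p\<in>(UNIV::unit set). \<forall>z. norm (segint s f z) \<le> C * 1" by (rule bd[OF Suc.prems])
      fix b :: "'e \<times> 'e" assume "b \<in> Basis"
      then consider c where "c \<in> Basis" "b = (c, 0)" | c where "c \<in> Basis" "b = (0, c)"
        by (auto simp: Basis_prod_def)
      note cs = this
      show "((\<lambda>t. segint s f (z + t *\<^sub>R b)) has_vector_derivative (if snd b = 0 then segint s (dd (fst b) f) else segint (Suc s) (dd (snd b) f)) z) (at 0)" for z
        by (cases rule: cs) (use segint_derivative[OF Suc.prems] in \<open>auto simp: nonzero_Basis\<close>)
      show "bdiff k (UNIV::unit set) (\<lambda>_ _ _. 1) (\<lambda>_. if snd b = 0 then segint s (dd (fst b) f) else segint (Suc s) (dd (snd b) f))"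
        by (cases rule: cs) (use Suc.IH[OF sbd_dd[OF Suc.prems]] in \<open>auto simp: nonzero_Basis\<close>)
    qed
  qed
qed

text \<open>Integrate the derivative of \<open>f\<close> along the segment from \<open>y\<close> to
  \<open>y + w\<close>.\<close>

lemma hadamard:
  fixes f :: "'e::euclidean_space \<Rightarrow> 'x::banach"
  assumes p: "partials f (\<lambda>b. dd b f)" and c: "\<And>b. b \<in> Basis \<Longrightarrow> continuous_on UNIV (dd b f)"
  shows "f (y + w) - f y = (\<Sum>b\<in>Basis. (w \<bullet> b) *\<^sub>R segint 0 (dd b f) (y, w))"
proof -
  have "((\<lambda>t. \<Sum>b\<in>Basis. (w \<bullet> b) *\<^sub>R dd b f (y + t *\<^sub>R w)) has_integral f (y + 1 *\<^sub>R w) - f (y + 0 *\<^sub>R w)) {0..1}"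
    by (rule fundamental_theorem_of_calculus)
      (auto intro: has_vector_derivative_at_within[OF partials_direction[OF p]])
  moreover have "((\<lambda>t. \<Sum>b\<in>Basis. (w \<bullet> b) *\<^sub>R dd b f (y + t *\<^sub>R w)) has_integral (\<Sum>b\<in>Basis. (w \<bullet> b) *\<^sub>R segint 0 (dd b f) (y, w))) {0..1}"
  proof (intro has_integral_sum has_integral_cmul)
    fix b :: 'e assume b: "b \<in> Basis"
    have "continuous_on {0..1} (\<lambda>t. dd b f (y + t *\<^sub>R w))"
      by (intro continuous_on_compose2[OF c[OF b]] continuous_intros) auto
    from integrable_integral[OF integrable_continuous_interval[OF this]]
    show "((\<lambda>t. dd b f (y + t *\<^sub>R w)) has_integral segint 0 (dd b f) (y, w)) {0..1}"
      by (simp add: segint_def)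
  qed simp
  ultimately show ?thesis by (auto dest: has_integral_unique)
qed

text \<open>The bounds concern derivatives of order at least one, so \<open>sbd\<close> is imposed
  on the \<open>dd b \<kappa>\<close> and not on \<kappa>, which grows linearly.\<close>

locale diffeo =
  fixes \<kappa> \<kappa>' :: "real^'n::finite \<Rightarrow> real^'n"
  assumes inv1: "\<kappa>' (\<kappa> x) = x" and inv2: "\<kappa> (\<kappa>' x) = x"
    and partials_k: "partials \<kappa> (\<lambda>b. dd b \<kappa>)" and sbd_k: "b \<in> Basis \<Longrightarrow> sbd (\<lambda>_. 1) (dd b \<kappa>)"
    and partials_k': "partials \<kappa>' (\<lambda>b. dd b \<kappa>')" and sbd_k': "b \<in> Basis \<Longrightarrow> sbd (\<lambda>_. 1) (dd b \<kappa>')"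
begin

text \<open>With \<open>\<kappa> y\<close> subtracted the phase vanishes at \<open>w = 0\<close>,
  and its derivatives in \<xi> and in \<open>y\<close> acquire factors \<open>w_c\<close>. The
  factor split off is the exponential of the pseudodifferential operator at the point
  \<open>x = \<kappa> y\<close>.\<close>

definition phase :: "real^'n \<Rightarrow> real^'n \<Rightarrow> real^'n \<Rightarrow> real"
  where "phase y \<xi> w = (\<kappa> (y + w) - \<kappa> y) \<bullet> \<xi>"

abbreviation amp :: "((real^'n) \<times> (real^'n) \<Rightarrow> complex) \<Rightarrow> bool"
  where "amp \<rho> \<equiv> sbd (\<lambda>_. 1) \<rho>"

definition osc :: "((real^'n) \<times> (real^'n) \<Rightarrow> complex) \<Rightarrow> real^'n \<Rightarrow> real^'n \<Rightarrow> real^'n \<Rightarrow> complex"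
  where "osc \<rho> y \<xi> w = \<rho> (y, w) * cis (phase y \<xi> w)"

lemma k_derivative: "b \<in> Basis \<Longrightarrow> ((\<lambda>t. \<kappa> (y + t *\<^sub>R b)) has_vector_derivative dd b \<kappa> (y + s *\<^sub>R b)) (at s)"
  by (rule partials_Basis[OF partials_k])

lemma has_vector_derivative_cis:
  assumes "(f has_vector_derivative D) (at s)"
  shows "((\<lambda>t. cis (f t)) has_vector_derivative (\<i> * of_real D) * cis (f s)) (at s)"
proof -
  have "(f has_derivative (\<lambda>h. h *\<^sub>R D)) (at s)" using assms by (simp add: has_vector_derivative_def)
  from has_derivative_cis[OF this] show ?thesis
    by (simp add: has_vector_derivative_def scaleR_conv_of_real algebra_simps)
qed

lemma cis_phase_derivative:
  assumes "b \<in> Basis"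
  shows "((\<lambda>t. cis (phase y \<xi> (w + t *\<^sub>R b))) has_vector_derivative (\<i> * of_real (dd b \<kappa> (y + w) \<bullet> \<xi>)) * cis (phase y \<xi> w)) (at 0)"
proof -
  have "((\<lambda>t. phase y \<xi> (w + t *\<^sub>R b)) has_vector_derivative (dd b \<kappa> (y + w) - 0) \<bullet> \<xi>) (at 0)"
    unfolding phase_def
    by (intro bounded_linear.has_vector_derivative[OF bounded_linear_inner_left] has_vector_derivative_diff has_vector_derivative_const)
      (use k_derivative[OF assms, of "y + w" 0] in \<open>simp add: add.assoc\<close>)
  from has_vector_derivative_cis[OF this] show ?thesis by simp
qed

text \<open>A \<open>w\<close>-derivative brings down
  \<open>dd b \<kappa> (y + w) \<bullet> \<xi>\<close>, which with all its derivatives is at most a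
  multiple of the bracket of \<xi>.\<close>

lemma bdiff_cis_phase:
  "bdiff k UNIV (\<lambda>j (y, \<xi>) w. japanese_bracket \<xi> ^ j) (\<lambda>(y, \<xi>) w. cis (phase y \<xi> w))"
proof (induction k)
  have bd: "\<exists>C\<ge>0. \<forall>p\<in>UNIV. \<forall>w. norm ((case p of (y, \<xi>) \<Rightarrow> \<lambda>w. cis (phase y \<xi> w)) w) \<le> C * (case p of (y, \<xi>) \<Rightarrow> \<lambda>w. japanese_bracket \<xi> ^ 0) w"
    by (intro exI[of _ 1]) (auto simp: case_prod_unfold)
  have ck: "continuous_on UNIV \<kappa>" by (rule partials_continuous[OF partials_k])
  {
    case 0
    have "continuous_on UNIV (\<lambda>w. cis (phase y \<xi> w))" for y \<xi>
      unfolding phase_def by (intro continuous_intros continuous_on_compose2[OF ck]) auto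
    then show ?case using bd by auto
  next
    case (Suc k)
    show ?case
    proof (rule bdiff_SucI[where f' = "\<lambda>b (y, \<xi>) w. (\<i> * of_real (dd b \<kappa> (y + w) \<bullet> \<xi>)) * cis (phase y \<xi> w)"])
      show "\<exists>C\<ge>0. \<forall>p\<in>UNIV. \<forall>w. norm ((case p of (y, \<xi>) \<Rightarrow> \<lambda>w. cis (phase y \<xi> w)) w) \<le> C * (case p of (y, \<xi>) \<Rightarrow> \<lambda>w. japanese_bracket \<xi> ^ 0) w"
        by (rule bd)
      fix b :: "real^'n" assume b: "b \<in> Basis"
      show "((\<lambda>t. (case p of (y, \<xi>) \<Rightarrow> \<lambda>w. cis (phase y \<xi> w)) (x + t *\<^sub>R b)) has_vector_derivative
         (case p of (y, \<xi>) \<Rightarrow> \<lambda>w. (\<i> * of_real (dd b \<kappa> (y + w) \<bullet> \<xi>)) * cis (phase y \<xi> w)) x) (at 0)" for p x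
        using cis_phase_derivative[OF b] by (simp add: case_prod_unfold)
      have 1: "bdiff k UNIV (\<lambda>_ _ _. 1) (\<lambda>p w. dd b \<kappa> (fst p + w))" for k and p :: "(real^'n) \<times> (real^'n)"
        using bdiff_reparam[OF bdiff_slice[OF sbd_sum_arg[OF sbd_k[OF b]]], where Q=UNIV and \<phi>=fst] by simp
      have 2: "bdiff k UNIV (\<lambda>j p w. japanese_bracket (snd p) * 0 ^ j) (\<lambda>(p::(real^'n) \<times> (real^'n)) (w::real^'n). snd p)" for k
        by (rule bdiff_const[of 1]) (auto simp: norm_le_jb)
      have 3: "bdiff k UNIV (\<lambda>j p w. japanese_bracket (snd p) ^ Suc j) (\<lambda>(p::(real^'n) \<times> (real^'n)) w. dd b \<kappa> (fst p + w) \<bullet> snd p)"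
      proof (rule bdiff_bilinear[OF bounded_bilinear_inner 1 2])
        fix i j and p :: "(real^'n) \<times> (real^'n)" and w :: "real^'n"
        show "1 * (japanese_bracket (snd p) * 0 ^ j) \<le> japanese_bracket (snd p) ^ Suc (i + j)"
          using mult_left_mono[OF one_le_power[OF one_le_jb[of "snd p"], of "i + j"], of "japanese_bracket (snd p)"]
          by (cases j) auto
      qed
      have 4: "bounded_linear (\<lambda>r::real. \<i> * of_real r)"
        by (intro bounded_linear_const_mult bounded_linear_of_real)
      have "bdiff k UNIV (\<lambda>j p w. japanese_bracket (snd p) ^ Suc j)
        (\<lambda>(p::(real^'n) \<times> (real^'n)) w. (\<i> * of_real (dd b \<kappa> (fst p + w) \<bullet> snd p)) * (case p of (y, \<xi>) \<Rightarrow> \<lambda>w. cis (phase y \<xi> w)) w)"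
        by (rule bdiff_bilinear[OF bounded_bilinear_mult bdiff_linear[OF 4 3] Suc.IH]) (auto simp: power_add mult_ac)
      then show "bdiff k UNIV (\<lambda>j. (\<lambda>j (y, \<xi>) w. japanese_bracket \<xi> ^ j) (Suc j)) (\<lambda>(y, \<xi>) w. (\<i> * of_real (dd b \<kappa> (y + w) \<bullet> \<xi>)) * cis (phase y \<xi> w))"
        by (simp add: case_prod_unfold)
    qed
  }
qed

lemma bdiff_osc:
  assumes "amp \<rho>"
  shows "bdiff k UNIV (\<lambda>j (y, \<xi>) w. japanese_bracket \<xi> ^ j) (\<lambda>(y, \<xi>) w. osc \<rho> y \<xi> w)"
proof -
  have 1: "bdiff k UNIV (\<lambda>_ _ _. 1) (\<lambda>p w. \<rho> (fst p, w))" for p :: "(real^'n) \<times> (real^'n)"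
    using bdiff_reparam[OF bdiff_slice[OF assms], where Q=UNIV and \<phi>=fst] by simp
  have "bdiff k UNIV (\<lambda>j (y, \<xi>) w. japanese_bracket \<xi> ^ j) (\<lambda>(p::(real^'n) \<times> (real^'n)) w. \<rho> (fst p, w) * (case p of (y, \<xi>) \<Rightarrow> \<lambda>w. cis (phase y \<xi> w)) w)"
    by (rule bdiff_bilinear[OF bounded_bilinear_mult 1 bdiff_cis_phase]) (auto intro: power_increasing)
  then show ?thesis by (simp add: osc_def case_prod_unfold)
qed

lemma sbd_osc: "amp \<rho> \<Longrightarrow> sbd (\<lambda>_. 1) (osc \<rho> y \<xi>)"
  using sbd_of_bdiff[OF bdiff_osc, of \<rho> "(y, \<xi>)" "\<lambda>_. 1"]
  by (force intro: exI[of _ "japanese_bracket \<xi> ^ _"])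

text \<open>The choice of \<open>R\<close> as the bracket of \<xi> balances the two sources of
  derivatives: both the regularising factors and the phase factor cost \<open>R\<close> each
  time.\<close>

lemma bdiff_Wt_osc:
  assumes "amp \<rho>"
  shows "bdiff k UNIV (\<lambda>j (y, \<xi>) w. japanese_bracket \<xi> ^ j * wt (japanese_bracket \<xi> *\<^sub>R w))
    (\<lambda>(y, \<xi>) w. Wt (L4 (japanese_bracket \<xi>)) w *\<^sub>C osc \<rho> y \<xi> w)"
proof -
  have 1: "bdiff k UNIV (\<lambda>j p w. japanese_bracket (snd p) ^ j * (wt (japanese_bracket (snd p) *\<^sub>R w))\<^sup>2) (\<lambda>(p::(real^'n) \<times> (real^'n)) w. Wt (L4 (japanese_bracket (snd p))) w)"
    using bdiff_reparam[OF bdiff_Wt_L4, of UNIV "\<lambda>p. japanese_bracket (snd p)"] by simp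
  have "bdiff k UNIV (\<lambda>j (y, \<xi>) w. japanese_bracket \<xi> ^ j * wt (japanese_bracket \<xi> *\<^sub>R w))
    (\<lambda>(p::(real^'n) \<times> (real^'n)) w. Wt (L4 (japanese_bracket (snd p))) w *\<^sub>C (case p of (y, \<xi>) \<Rightarrow> \<lambda>w. osc \<rho> y \<xi> w) w)"
  proof (rule bdiff_bilinear[OF bounded_bilinear_scaleC 1 bdiff_osc[OF assms]])
    fix i j and p :: "(real^'n) \<times> (real^'n)" and w :: "real^'n"
    have "(wt (japanese_bracket (snd p) *\<^sub>R w))\<^sup>2 \<le> wt (japanese_bracket (snd p) *\<^sub>R w)"
      by (simp add: power2_eq_square mult_left_le)
    from mult_left_mono[OF this, of "japanese_bracket (snd p) ^ i * japanese_bracket (snd p) ^ j"]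
    show "japanese_bracket (snd p) ^ i * (wt (japanese_bracket (snd p) *\<^sub>R w))\<^sup>2 * (case p of (y, \<xi>) \<Rightarrow> \<lambda>w. japanese_bracket \<xi> ^ j) w
      \<le> (case p of (y, \<xi>) \<Rightarrow> \<lambda>w. japanese_bracket \<xi> ^ (i + j) * wt (japanese_bracket \<xi> *\<^sub>R w)) w"
      by (simp add: case_prod_unfold power_add mult_ac)
  qed
  then show ?thesis by (simp add: case_prod_unfold)
qed

end

lemma sbd_Wt_L4:
  fixes h :: "real^'n::finite \<Rightarrow> 'x::complex_banach"
  assumes h: "sbd (\<lambda>_. 1) h" and R: "R \<ge> 1"
  shows "sbd (\<lambda>w. (wt w)\<^sup>2) (\<lambda>w. Wt (L4 R) w *\<^sub>C h w)"
proof (rule sbd_bilinear[OF bounded_bilinear_scaleC _ h, where D=1])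
  show "sbd (\<lambda>w. (wt w)\<^sup>2) (Wt (L4 R) :: real^'n \<Rightarrow> complex)"
  proof (rule sbd_of_bdiff[where f="\<lambda>R w. Wt (L4 R) w" and p=R, OF bdiff_Wt_L4])
    fix j
    have "R ^ j * (wt (R *\<^sub>R x))\<^sup>2 \<le> R ^ j * (wt x)\<^sup>2" for x :: "real^'n"
      using R wt_scaled_le[OF R, of x] by (intro mult_left_mono power_mono) auto
    then show "\<exists>D\<ge>0. \<forall>x::real^'n. R ^ j * (wt (R *\<^sub>R x))\<^sup>2 \<le> D * (wt x)\<^sup>2"
      using R by (intro exI[of _ "R ^ j"]) auto
  qed (use R in auto)
qed auto

section \<open>Oscillatory integrals with the phase of \<kappa>: the crude bound for large
  orders\<close>

locale symcalc = diffeo \<kappa> \<kappa>' + fpairing pr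
  for \<kappa> \<kappa>' :: "real^'n::finite \<Rightarrow> real^'n" and pr :: "'x::banach \<Rightarrow> complex \<Rightarrow> 'z::banach"
begin

text \<open>\<open>bval a \<rho> y \<xi>\<close> is the oscillatory integral
  \<open>\<integral>\<integral> exp (i (\<kappa>(y + w) - \<kappa>(y)) \<cdot> \<xi> - i w \<cdot> \<eta>) a(\<eta>) \<rho>(y, w) dw d\<eta>\<close>.\<close>

definition bval :: "(real^'n \<Rightarrow> 'x) \<Rightarrow> ((real^'n) \<times> (real^'n) \<Rightarrow> complex) \<Rightarrow> real^'n \<Rightarrow> real^'n \<Rightarrow> 'z"
  where "bval a \<rho> y \<xi> = pair (L4 1) a (osc \<rho> y \<xi>)"

lemma sbd_Wt_osc: "amp \<rho> \<Longrightarrow> sbd (\<lambda>w. (wt w)\<^sup>2) (\<lambda>w. Wt (L4 1) w *\<^sub>C osc \<rho> y \<xi> w)"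
  by (rule sbd_Wt_L4[OF sbd_osc]) auto

lemmas sbd_Wt_osc' = sbd_wt_sq[OF sbd_Wt_osc]

text \<open>The definition uses the scale \<open>1\<close>, which does not move when \<xi> is varied
  in a derivative; estimates use the bracket of \<xi> instead. Both give the same value by
  \<open>pair_independent\<close>.\<close>

lemma bval_L4:
  assumes "spoly a" "amp \<rho>" "R \<ge> 1"
  shows "bval a \<rho> y \<xi> = pair (L4 R) a (osc \<rho> y \<xi>)"
  unfolding bval_def
  by (rule pair_independent[OF assms(1) bas_L4 _ bas_L4]; rule sbd_Wt_L4[OF sbd_osc[OF assms(2)]]; use assms(3) in simp)

text \<open>Let \<open>R\<close> be the bracket of \<xi>. The symbol with its operators is at most
  \<open>(R + |\<eta>|)^m\<close>, the transform of the amplitude at most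
  \<open>R^-n (1 + |\<eta>| / R)^-N\<close> up to constants, and the integral over \<eta> of a
  function of \<open>\<eta> / R\<close> returns the factor \<open>R^n\<close>.\<close>

lemma bval_bound_high:
  assumes a: "symb P c m a" and \<rho>: "amp \<rho>" and m: "real (length (bs4 :: (real^'n) list)) \<le> m"
  shows "\<exists>C\<ge>0. \<forall>p\<in>P. \<forall>y \<xi>. norm (bval (a p) \<rho> y \<xi>) \<le> C * c p * japanese_bracket \<xi> powr m"
proof -
  define n where "n = DIM(real^'n)"
  \<comment> \<open>The first summand beats the growth of the symbol, the second leaves the weight
    \<open>wt (\<eta> / R)\<close> by \<open>wt_ge\<close>.\<close>
  define N where "N = nat \<lceil>m\<rceil> + 2 * n"
  define W where "W = integral UNIV (wt :: real^'n \<Rightarrow> real)"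
  have m0: "m \<ge> 0" using m by simp
  obtain C1 where C1: "C1 \<ge> 0" "\<And>p R \<eta>. p \<in> P \<Longrightarrow> R \<ge> 1 \<Longrightarrow> norm (Eop (L4 R) (a p) \<eta>) \<le> C1 * c p * (R + norm \<eta>) powr m"
    using Eop_symb_bound[OF bs4_subset a m] unfolding L4_def[symmetric] by auto
  define FT where "FT y \<xi> = fourier (\<lambda>w. Wt (L4 (japanese_bracket \<xi>)) w *\<^sub>C osc \<rho> y \<xi> w)" for y \<xi>
  have "\<exists>C\<ge>0. \<forall>p\<in>UNIV. \<forall>\<eta>. (japanese_bracket (snd p) + norm \<eta>) ^ N * norm (fourier (case p of (y, \<xi>) \<Rightarrow> \<lambda>w. Wt (L4 (japanese_bracket \<xi>)) w *\<^sub>C osc \<rho> y \<xi> w) \<eta>)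
     \<le> C * japanese_bracket (snd p) ^ N * integral UNIV (\<lambda>w::real^'n. wt (japanese_bracket (snd p) *\<^sub>R w))"
  proof (rule fourier_decay_family[where D="\<lambda>_. 1" and r="\<lambda>p. japanese_bracket (snd p)" and g="\<lambda>p w. wt (japanese_bracket (snd p) *\<^sub>R w)"])
    show "bdiff k UNIV (\<lambda>j p w. japanese_bracket (snd p) ^ j * wt (japanese_bracket (snd p) *\<^sub>R w)) (\<lambda>p w. (case p of (y, \<xi>) \<Rightarrow> \<lambda>w. Wt (L4 (japanese_bracket \<xi>)) w *\<^sub>C osc \<rho> y \<xi> w) w)" for k
      using bdiff_Wt_osc[OF \<rho>, of k] by (simp add: case_prod_unfold)
  qed (simp_all add: wt_scaled_le integrable_wt_scaled)
  then obtain C2 where C2: "C2 \<ge> 0" "\<And>y \<xi> \<eta>. (japanese_bracket \<xi> + norm \<eta>) ^ N * norm (FT y \<xi> \<eta>) \<le> C2 * japanese_bracket \<xi> ^ N * (W / japanese_bracket \<xi> ^ n)"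
    unfolding FT_def by (auto simp: integrable_wt_scaled W_def n_def)
  obtain K where K: "K \<ge> 0" "\<And>x y. norm (pr x y) \<le> norm x * norm y * K" using nonneg_bounded by blast
  have W0: "W \<ge> 0" unfolding W_def by (intro integral_nonneg integrable_wt) auto
  define C where "C = K * C1 * C2 * W * W"
  have "norm (bval (a p) \<rho> y \<xi>) \<le> C * c p * japanese_bracket \<xi> powr m" if p: "p \<in> P" for p y \<xi>
  proof -
    define R where "R = japanese_bracket \<xi>"
    have R: "R \<ge> 1" "R > 0" by (simp_all add: R_def)
    have cp: "c p \<ge> 0" by (rule symb_nonneg[OF a p])
    have sp: "spoly (a p)" by (rule symb_spoly[OF a p])
    have le: "norm (pr (Eop (L4 R) (a p) \<eta>) (FT y \<xi> \<eta>)) \<le> (K * C1 * C2 * W * c p * (R powr m / R ^ n)) * wt ((1 / R) *\<^sub>R \<eta>)" for \<eta>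
    proof -
      define T where "T = R + norm \<eta>"
      have T: "T \<ge> R" "T > 0" using R by (simp_all add: T_def add_pos_nonneg)
      have "(T / R) powr m \<le> (T / R) ^ nat \<lceil>m\<rceil>"
      proof -
        have "(T / R) powr m \<le> (T / R) powr real (nat \<lceil>m\<rceil>)"
          using T R by (intro powr_mono) (auto simp: of_nat_ceiling)
        also have "\<dots> = (T / R) ^ nat \<lceil>m\<rceil>" using T R by (intro powr_realpow) auto
        finally show ?thesis .
      qed
      also have "(T / R) ^ nat \<lceil>m\<rceil> = (T / R) ^ N * (R / T) ^ (2 * n)"
        using T R by (simp add: N_def power_add power_divide)
      also have "(R / T) ^ (2 * n) \<le> wt ((1 / R) *\<^sub>R \<eta>)"
      proof -
        have "1 + norm ((1 / R) *\<^sub>R \<eta>) = T / R" using R by (simp add: T_def add_divide_distrib)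
        then have "1 \<le> wt ((1 / R) *\<^sub>R \<eta>) * (T / R) ^ (2 * n)"
          using wt_ge[of "(1 / R) *\<^sub>R \<eta>"] by (simp add: n_def)
        then show ?thesis using T R by (simp add: power_divide field_simps)
      qed
      finally have 1: "(T / R) powr m \<le> (T / R) ^ N * wt ((1 / R) *\<^sub>R \<eta>)"
        using T R by (simp add: mult_left_mono)
      have "T powr m = R powr m * (T / R) powr m" using T R by (simp add: powr_divide)
      also have "\<dots> \<le> R powr m * ((T / R) ^ N * wt ((1 / R) *\<^sub>R \<eta>))" by (intro mult_left_mono 1) auto
      finally have 2: "T powr m * norm (FT y \<xi> \<eta>) \<le> R powr m * ((T / R) ^ N * wt ((1 / R) *\<^sub>R \<eta>)) * norm (FT y \<xi> \<eta>)"
        by (rule mult_right_mono) simp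
      also have "\<dots> = (R powr m / R ^ N) * wt ((1 / R) *\<^sub>R \<eta>) * (T ^ N * norm (FT y \<xi> \<eta>))"
        by (simp add: power_divide)
      also have "\<dots> \<le> (R powr m / R ^ N) * wt ((1 / R) *\<^sub>R \<eta>) * (C2 * R ^ N * (W / R ^ n))"
        unfolding T_def R_def by (intro mult_left_mono C2) auto
      also have "\<dots> = C2 * W * (R powr m / R ^ n) * wt ((1 / R) *\<^sub>R \<eta>)"
        using R by simp
      finally have 3: "T powr m * norm (FT y \<xi> \<eta>) \<le> C2 * W * (R powr m / R ^ n) * wt ((1 / R) *\<^sub>R \<eta>)" .
      have "norm (Eop (L4 R) (a p) \<eta>) * norm (FT y \<xi> \<eta>) \<le> C1 * c p * T powr m * norm (FT y \<xi> \<eta>)"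
        unfolding T_def by (intro mult_right_mono C1 p R) auto
      also have "\<dots> \<le> C1 * c p * (C2 * W * (R powr m / R ^ n) * wt ((1 / R) *\<^sub>R \<eta>))"
        unfolding mult.assoc[of "C1 * c p" "T powr m"] using 3 C1(1) cp by (intro mult_left_mono) auto
      finally have "norm (Eop (L4 R) (a p) \<eta>) * norm (FT y \<xi> \<eta>) \<le> C1 * c p * (C2 * W * (R powr m / R ^ n) * wt ((1 / R) *\<^sub>R \<eta>))" .
      from order_trans[OF K(2) mult_right_mono[OF this K(1)]] show ?thesis by (simp add: mult_ac)
    qed
    have sw: "sbd wt (\<lambda>w. Wt (L4 R) w *\<^sub>C osc \<rho> y \<xi> w)"
      by (rule sbd_wt_sq[OF sbd_Wt_L4[OF sbd_osc[OF \<rho>] R(1)]])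
    have cont: "continuous_on UNIV (\<lambda>\<eta>. pr (Eop (L4 R) (a p) \<eta>) (FT y \<xi> \<eta>))"
      using sw unfolding FT_def R_def by (intro continuous_on spoly_continuous spoly_Eop sp bas_L4 fourier_continuous)
    have iw: "(\<lambda>\<eta>::real^'n. wt ((1 / R) *\<^sub>R \<eta>)) integrable_on UNIV" "integral UNIV (\<lambda>\<eta>::real^'n. wt ((1 / R) *\<^sub>R \<eta>)) = W * R ^ n"
      using integrable_wt_scaled[of "1 / R", where 'e="real^'n"] R by (simp_all add: W_def n_def power_divide)
    have "norm (bval (a p) \<rho> y \<xi>) \<le> integral UNIV (\<lambda>\<eta>::real^'n. (K * C1 * C2 * W * c p * (R powr m / R ^ n)) * wt ((1 / R) *\<^sub>R \<eta>))"
      unfolding bval_L4[OF sp \<rho> R(1)] pair_def FT_def[symmetric, unfolded R_def[symmetric]]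
      using norm_integral_le[OF cont le integrable_on_mult_right[OF iw(1)]] by (simp add: FT_def R_def)
    also have "\<dots> = C * c p * R powr m" using R by (simp add: iw(2) C_def)
    finally show ?thesis by (simp add: R_def)
  qed
  moreover have "C \<ge> 0" unfolding C_def using K C1 C2 W0 by simp
  ultimately show ?thesis by blast
qed

end

section \<open>Descent to arbitrary orders; derivatives of oscillatory integrals\<close>

lemma Eop_zero: "bas L \<Longrightarrow> Eop L (\<lambda>\<eta>. 0) = (\<lambda>\<eta>. 0)"
proof -
  have "dd b (\<lambda>\<eta>::'a. 0::'b) = (\<lambda>\<eta>. 0)" for b by (intro ext ddI) simp
  then show ?thesis by (induction L) simp_all
qed

lemma bdiff_coord_mult:
  fixes h :: "'p \<Rightarrow> real^'n::finite \<Rightarrow> complex"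
  assumes b: "b \<in> Basis" and h: "bdiff k P (\<lambda>_ _ w. (wt w)\<^sup>2) h"
  shows "bdiff k P (\<lambda>_ _ w. wt w) (\<lambda>p w. (w \<bullet> b) *\<^sub>R h p w)"
proof -
  have 1: "bdiff k P (\<lambda>_ _ w. 1 + \<bar>w \<bullet> b\<bar>) (\<lambda>p w. w \<bullet> b)"
    using bdiff_reparam[OF sbd_coord[unfolded sbd_def, rule_format], where Q=P and \<phi>="\<lambda>_. ()"] by simp
  have "bdiff k P (\<lambda>_ _ w. 2 * wt w) (\<lambda>p w. (w \<bullet> b) *\<^sub>R h p w)"
    by (rule bdiff_bilinear[OF bounded_bilinear_scaleR 1 h]) (rule coord_wt_le[OF b])
  then show ?thesis by (rule bdiff_weaken) (auto intro: exI[of _ 2])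
qed

lemma bounded_family_add:
  fixes F G :: "'q \<Rightarrow> 'x::real_normed_vector"
  assumes "\<exists>C\<ge>0. \<forall>q\<in>Q. norm (F q) \<le> C * w q" "\<exists>C\<ge>0. \<forall>q\<in>Q. norm (G q) \<le> C * w q"
  shows "\<exists>C\<ge>0. \<forall>q\<in>Q. norm (F q + G q) \<le> C * w q"
proof -
  obtain C D where "C \<ge> 0" "\<forall>q\<in>Q. norm (F q) \<le> C * w q" "D \<ge> 0" "\<forall>q\<in>Q. norm (G q) \<le> D * w q"
    using assms by blast
  then show ?thesis
    by (intro exI[of _ "C + D"]) (simp add: distrib_right norm_triangle_mono)
qed

lemma bounded_family_sum:
  fixes F :: "'i \<Rightarrow> 'q \<Rightarrow> 'x::real_normed_vector"
  assumes "\<And>i. i \<in> I \<Longrightarrow> \<exists>C\<ge>0. \<forall>q\<in>Q. norm (F i q) \<le> C * w q"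
  shows "\<exists>C\<ge>0. \<forall>q\<in>Q. norm (\<Sum>i\<in>I. F i q) \<le> C * w q"
  using assms
proof (induction I rule: infinite_finite_induct)
  case (insert i I)
  have "\<exists>C\<ge>0. \<forall>q\<in>Q. norm (F i q + (\<Sum>i\<in>I. F i q)) \<le> C * w q"
    by (intro bounded_family_add insert) auto
  with insert show ?case by simp
qed (auto intro: exI[of _ 0])

context symcalc begin

lemma amp_mult: "amp \<rho> \<Longrightarrow> amp \<sigma> \<Longrightarrow> amp (\<lambda>z. \<rho> z * \<sigma> z)"
  by (rule sbd_mult)

lemma amp_scaleC: "amp \<rho> \<Longrightarrow> amp (\<lambda>z. c * \<rho> z)"
  by (rule sbd_linear[OF bounded_linear_mult_right])

lemma amp_inner: "sbd (\<lambda>_. 1) f \<Longrightarrow> amp (\<lambda>z. of_real (f z \<bullet> v))"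
  by (intro sbd_linear[OF bounded_linear_of_real] sbd_linear[OF bounded_linear_inner_left])

text \<open>An entry of the inverse Jacobian matrix of \<kappa> at \<open>y + w\<close>. It is
  expressed through the derivative of the inverse map, for which bounds on all derivatives are
  available.\<close>

definition kinv_coeff :: "real^'n \<Rightarrow> real^'n \<Rightarrow> (real^'n) \<times> (real^'n) \<Rightarrow> complex"
  where "kinv_coeff b c z = of_real (dd b \<kappa>' (\<kappa> (fst z + snd z)) \<bullet> c)"

lemma amp_kinv_coeff: "b \<in> Basis \<Longrightarrow> amp (kinv_coeff b c)"
  unfolding kinv_coeff_def[abs_def]
  by (intro amp_inner sbd_sum_arg sbd_compose[OF sbd_k' partials_k sbd_k, where D=1]) auto

text \<open>The chain rule for \<open>\<kappa> (\<kappa>' x) = x\<close>, in direction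
  \<open>b\<close>.\<close>

lemma kinv_coeff_sum:
  assumes "b \<in> Basis"
  shows "(\<Sum>c\<in>Basis. (dd b \<kappa>' (\<kappa> z) \<bullet> c) *\<^sub>R dd c \<kappa> z) = b"
proof -
  have 1: "(\<kappa> has_derivative (\<lambda>v. \<Sum>c\<in>Basis. (v \<bullet> c) *\<^sub>R dd c \<kappa> z)) (at (\<kappa>' (\<kappa> z + 0 *\<^sub>R b)))"
    using partials_k by (simp add: partials_def inv1)
  have 2: "((\<lambda>t. \<kappa>' (\<kappa> z + t *\<^sub>R b)) has_derivative (\<lambda>h. h *\<^sub>R dd b \<kappa>' (\<kappa> z))) (at 0)"
    using partials_Basis[OF partials_k' assms, of "\<kappa> z" 0] by (simp add: has_vector_derivative_def)
  from diff_chain_at[OF 2 1]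
  have "((\<lambda>t. \<kappa> z + t *\<^sub>R b) has_derivative (\<lambda>h. \<Sum>c\<in>Basis. ((h *\<^sub>R dd b \<kappa>' (\<kappa> z)) \<bullet> c) *\<^sub>R dd c \<kappa> z)) (at 0)"
    by (simp add: o_def inv2)
  moreover have "((\<lambda>t. \<kappa> z + t *\<^sub>R b) has_derivative (\<lambda>h. h *\<^sub>R b)) (at 0)"
    by (auto intro!: derivative_eq_intros)
  ultimately have "(\<lambda>h. \<Sum>c\<in>Basis. ((h *\<^sub>R dd b \<kappa>' (\<kappa> z)) \<bullet> c) *\<^sub>R dd c \<kappa> z) = (\<lambda>h. h *\<^sub>R b)"
    by (rule has_derivative_unique)
  from fun_cong[OF this, of 1] show ?thesis by simp
qed

lemma dd_osc:
  assumes \<sigma>: "amp \<sigma>" and c: "c \<in> Basis"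
  shows "dd c (osc \<sigma> y \<xi>) w = osc (dd (0, c) \<sigma>) y \<xi> w + \<i> * of_real (dd c \<kappa> (y + w) \<bullet> \<xi>) * osc \<sigma> y \<xi> w"
proof (rule ddI)
  have "((\<lambda>t. \<sigma> (y, w + t *\<^sub>R c)) has_vector_derivative dd (0, c) \<sigma> (y, w)) (at 0)"
    using sbd_derivative[OF \<sigma> Basis_prodI(2)[OF c], of "(y, w)"] by simp
  from has_vector_derivative_mult[OF this cis_phase_derivative[OF c]]
  show "((\<lambda>t. osc \<sigma> y \<xi> (w + t *\<^sub>R c)) has_vector_derivative
      osc (dd (0, c) \<sigma>) y \<xi> w + \<i> * of_real (dd c \<kappa> (y + w) \<bullet> \<xi>) * osc \<sigma> y \<xi> w) (at 0)"
    unfolding osc_def by (rule has_vector_derivative_eq_rhs) (simp add: algebra_simps)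
qed

text \<open>Integration by parts against the phase. It reduces the estimate for symbols of order \<open>m\<close> to the one for order
  \<open>m + 1\<close>; this descent starts from the crude bound for large orders.\<close>

lemma bval_mult_xi:
  assumes a: "spoly a" and \<rho>: "amp \<rho>" and b: "b \<in> Basis"
  shows "(\<xi> \<bullet> b) *\<^sub>R bval a \<rho> y \<xi> = (\<Sum>c\<in>Basis.
    bval (\<lambda>\<eta>. (\<eta> \<bullet> c) *\<^sub>R a \<eta>) (\<lambda>z. \<rho> z * kinv_coeff b c z) y \<xi> +
    bval a (\<lambda>z. \<i> * dd (0, c) (\<lambda>z. \<rho> z * kinv_coeff b c z) z) y \<xi>)"
proof -
  define \<sigma> where "\<sigma> c z = \<rho> z * kinv_coeff b c z" for c z
  have \<sigma>: "amp (\<sigma> c)" for c unfolding \<sigma>_def[abs_def] by (intro amp_mult \<rho> amp_kinv_coeff b)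
  have \<sigma>': "amp (\<lambda>z. (- \<i>) * \<sigma> c z)" for c by (intro amp_scaleC \<sigma>)
  have ds: "amp (\<lambda>z. \<i> * dd (0, c) (\<sigma> c) z)" if "c \<in> Basis" for c
    by (intro amp_scaleC sbd_dd[OF \<sigma>] Basis_prodI that)
  \<comment> \<open>The \<open>w\<close>-derivatives of the phase, weighted with the inverse
    Jacobian, add up to \<open>\<xi> \<bullet> b\<close>. The factor \<open>- \<i>\<close> undoes
    the one from the exponential, and the second summand removes the derivative that falls on the
    amplitude.\<close>
  have "(\<xi> \<bullet> b) *\<^sub>R osc \<rho> y \<xi> w = (\<Sum>c\<in>Basis. dd c (osc (\<lambda>z. (- \<i>) * \<sigma> c z) y \<xi>) w + osc (\<lambda>z. \<i> * dd (0, c) (\<sigma> c) z) y \<xi> w)" for w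
  proof -
    have d: "dd (0, c) (\<lambda>z. (- \<i>) * \<sigma> c z) = (\<lambda>z. (- \<i>) * dd (0, c) (\<sigma> c) z)" if "c \<in> Basis" for c
      by (rule dd_linear[OF bounded_linear_mult_right \<sigma> Basis_prodI(2)[OF that]])
    have "(\<Sum>c\<in>Basis. dd c (osc (\<lambda>z. (- \<i>) * \<sigma> c z) y \<xi>) w + osc (\<lambda>z. \<i> * dd (0, c) (\<sigma> c) z) y \<xi> w)
      = (\<Sum>c\<in>Basis. of_real ((dd b \<kappa>' (\<kappa> (y + w)) \<bullet> c) * (dd c \<kappa> (y + w) \<bullet> \<xi>)) * osc \<rho> y \<xi> w)"
    proof (rule sum.cong[OF refl])
      fix c :: "real^'n" assume c: "c \<in> Basis"
      show "dd c (osc (\<lambda>z. (- \<i>) * \<sigma> c z) y \<xi>) w + osc (\<lambda>z. \<i> * dd (0, c) (\<sigma> c) z) y \<xi> w =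
          of_real ((dd b \<kappa>' (\<kappa> (y + w)) \<bullet> c) * (dd c \<kappa> (y + w) \<bullet> \<xi>)) * osc \<rho> y \<xi> w"
        unfolding dd_osc[OF \<sigma>' c] d[OF c] by (simp add: osc_def \<sigma>_def kinv_coeff_def algebra_simps)
    qed
    also have "\<dots> = of_real ((\<Sum>c\<in>Basis. (dd b \<kappa>' (\<kappa> (y + w)) \<bullet> c) *\<^sub>R dd c \<kappa> (y + w)) \<bullet> \<xi>) * osc \<rho> y \<xi> w"
      by (simp add: inner_sum_left sum_distrib_right)
    also have "\<dots> = (\<xi> \<bullet> b) *\<^sub>R osc \<rho> y \<xi> w"
      unfolding kinv_coeff_sum[OF b] by (simp add: scaleR_conv_of_real inner_commute)
    finally show ?thesis by simp
  qed
  note eq = this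
  have s1: "sbd wt (\<lambda>w. Wt (L4 1) w *\<^sub>C dd c (osc \<rho>' y \<xi>) w)" if "amp \<rho>'" "c \<in> Basis" for \<rho>' c
    by (rule sbd_wt_sq[OF sbd_Wt_L4[OF sbd_dd[OF sbd_osc]]]) (use that in auto)
  have "(\<xi> \<bullet> b) *\<^sub>R bval a \<rho> y \<xi> = pair (L4 1) a (\<lambda>w. (\<xi> \<bullet> b) *\<^sub>R osc \<rho> y \<xi> w)"
    unfolding bval_def by (rule pair_scaleR_right[symmetric]) (rule sbd_Wt_osc'[OF \<rho>])
  also have "\<dots> = (\<Sum>c\<in>Basis. pair (L4 1) a (\<lambda>w. dd c (osc (\<lambda>z. (- \<i>) * \<sigma> c z) y \<xi>) w + osc (\<lambda>z. \<i> * dd (0, c) (\<sigma> c) z) y \<xi> w))"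
    unfolding eq
    by (rule pair_sum_right[OF a bas_L4])
      (unfold scaleC_add_right, intro sbd_add s1 \<sigma>' sbd_Wt_osc' ds)
  also have "\<dots> = (\<Sum>c\<in>Basis. bval (\<lambda>\<eta>. (\<eta> \<bullet> c) *\<^sub>R a \<eta>) (\<sigma> c) y \<xi> + bval a (\<lambda>z. \<i> * dd (0, c) (\<sigma> c) z) y \<xi>)"
  proof (rule sum.cong[OF refl])
    fix c :: "real^'n" assume c: "c \<in> Basis"
    have "pair (L4 1) a (dd c (osc (\<lambda>z. (- \<i>) * \<sigma> c z) y \<xi>)) = pair (L4 1) (\<lambda>\<eta>. (\<eta> \<bullet> c) *\<^sub>R a \<eta>) (\<lambda>w. \<i> *\<^sub>C osc (\<lambda>z. (- \<i>) * \<sigma> c z) y \<xi> w)"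
      by (rule pair_dd_right[OF a sbd_osc[OF \<sigma>'] bas_L4 sbd_Wt_osc[OF \<sigma>'] c])
    also have "(\<lambda>w. \<i> *\<^sub>C osc (\<lambda>z. (- \<i>) * \<sigma> c z) y \<xi> w) = osc (\<sigma> c) y \<xi>"
      by (simp add: osc_def scaleC_complex_def fun_eq_iff mult.assoc[symmetric])
    finally show "pair (L4 1) a (\<lambda>w. dd c (osc (\<lambda>z. (- \<i>) * \<sigma> c z) y \<xi>) w + osc (\<lambda>z. \<i> * dd (0, c) (\<sigma> c) z) y \<xi> w) =
       bval (\<lambda>\<eta>. (\<eta> \<bullet> c) *\<^sub>R a \<eta>) (\<sigma> c) y \<xi> + bval a (\<lambda>z. \<i> * dd (0, c) (\<sigma> c) z) y \<xi>"
      unfolding bval_def pair_add_right[OF a bas_L4 s1[OF \<sigma>' c] sbd_Wt_osc'[OF ds[OF c]]] by simp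
  qed
  finally show ?thesis unfolding \<sigma>_def[abs_def] .
qed

text \<open>The bracket of \<xi> is at most \<open>1 + \<Sum> |\<xi>_b|\<close>. Bounds of order
  \<open>m + 1\<close> for the integral and for its products with the coordinates of \<xi> therefore
  give order \<open>m\<close>; the former uses that a symbol of order \<open>m\<close> also has
  order \<open>m + 1\<close>. The number \<open>d\<close> counts the steps up to the range of the
  crude bound.\<close>

lemma bval_bound:
  assumes "symb P c m a" "amp \<rho>"
  shows "\<exists>C\<ge>0. \<forall>q\<in>P \<times> UNIV \<times> UNIV. norm (case q of (p, y, \<xi>) \<Rightarrow> bval (a p) \<rho> y \<xi>)
    \<le> C * (case q of (p, y, \<xi>) \<Rightarrow> c p * japanese_bracket \<xi> powr m)"
proof -
  let ?J = "real (length (bs4 :: (real^'n) list))"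
  let ?b = "\<lambda>a \<rho> q. case q of (p, y, \<xi>) \<Rightarrow> bval (a p) \<rho> y \<xi>"
  let ?w = "\<lambda>m q. case q of (p, y, \<xi>) \<Rightarrow> c p * japanese_bracket \<xi> powr m"
  have "?J \<le> m + real d \<Longrightarrow> symb P c m a \<Longrightarrow> amp \<rho> \<Longrightarrow>
    \<exists>C\<ge>0. \<forall>q\<in>P \<times> UNIV \<times> UNIV. norm (?b a \<rho> q) \<le> C * ?w m q" for d
  proof (induction d arbitrary: m a \<rho>)
    case 0
    then show ?case using bval_bound_high[of P c m a \<rho>] by (auto simp: mult.assoc)
  next
    case (Suc d)
    note a = Suc.prems(2) and \<rho> = Suc.prems(3)
    have m1: "?J \<le> (m + 1) + real d" using Suc.prems(1) by simp
    have a1: "symb P c (m + 1) a"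
      by (rule symb_weaken[OF a, of _ 1]) (auto intro: symb_nonneg[OF a])
    define \<sigma> where "\<sigma> b k z = \<rho> z * kinv_coeff b k z" for b k z
    have \<sigma>: "amp (\<sigma> b k)" if "b \<in> Basis" for b k unfolding \<sigma>_def[abs_def] by (intro amp_mult \<rho> amp_kinv_coeff that)
    have ds: "amp (\<lambda>z. \<i> * dd (0, k) (\<sigma> b k) z)" if "b \<in> Basis" "k \<in> Basis" for b k
      by (intro amp_scaleC sbd_dd[OF \<sigma>] Basis_prodI that)
    have xb: "\<exists>C\<ge>0. \<forall>q\<in>P \<times> UNIV \<times> UNIV. norm ((snd (snd q) \<bullet> b) *\<^sub>R ?b a \<rho> q) \<le> C * ?w (m + 1) q" if b: "b \<in> Basis" for b
    proof -
      have "\<exists>C\<ge>0. \<forall>q\<in>P \<times> UNIV \<times> UNIV. norm (\<Sum>k\<in>Basis. ?b (\<lambda>p \<eta>. (\<eta> \<bullet> k) *\<^sub>R a p \<eta>) (\<sigma> b k) q + ?b a (\<lambda>z. \<i> * dd (0, k) (\<sigma> b k) z) q) \<le> C * ?w (m + 1) q"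
        by (intro bounded_family_sum bounded_family_add Suc.IH m1 symb_coord a a1 \<sigma> ds b)
      then obtain C where C: "C \<ge> 0" "\<And>q. q \<in> P \<times> UNIV \<times> UNIV \<Longrightarrow> norm (\<Sum>k\<in>Basis. ?b (\<lambda>p \<eta>. (\<eta> \<bullet> k) *\<^sub>R a p \<eta>) (\<sigma> b k) q + ?b a (\<lambda>z. \<i> * dd (0, k) (\<sigma> b k) z) q) \<le> C * ?w (m + 1) q"
        by blast
      have "norm ((snd (snd q) \<bullet> b) *\<^sub>R ?b a \<rho> q) \<le> C * ?w (m + 1) q" if q: "q \<in> P \<times> UNIV \<times> UNIV" for q
      proof -
        obtain p y \<xi> where pq: "q = (p, y, \<xi>)" "p \<in> P" using q by auto
        show ?thesis using C(2)[OF q] unfolding pq(1) prod.case snd_conv bval_mult_xi[OF symb_spoly[OF a pq(2)] \<rho> b] \<sigma>_def[symmetric] .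
      qed
      then show ?thesis using C(1) by blast
    qed
    have "\<exists>C\<ge>0. \<forall>q\<in>P \<times> UNIV \<times> UNIV. norm (norm (?b a \<rho> q) + (\<Sum>b\<in>Basis. norm ((snd (snd q) \<bullet> b) *\<^sub>R ?b a \<rho> q))) \<le> C * ?w (m + 1) q"
      by (intro bounded_family_add bounded_family_sum) (simp_all only: real_norm_def abs_norm_cancel xb Suc.IH[OF m1 a1 \<rho>])
    then obtain C where C: "C \<ge> 0" "\<And>q. q \<in> P \<times> UNIV \<times> UNIV \<Longrightarrow>
        norm (norm (?b a \<rho> q) + (\<Sum>b\<in>Basis. norm ((snd (snd q) \<bullet> b) *\<^sub>R ?b a \<rho> q))) \<le> C * ?w (m + 1) q" by blast
    have "norm (?b a \<rho> q) \<le> C * ?w m q" if q: "q \<in> P \<times> UNIV \<times> UNIV" for q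
    proof -
      obtain p y \<xi> where pq: "q = (p, y, \<xi>)" using q by auto
      let ?J = "japanese_bracket \<xi>"
      have "?J \<le> 1 + (\<Sum>b\<in>(Basis::(real^'n) set). \<bar>\<xi> \<bullet> b\<bar>)"
        using jb_le[of \<xi>] norm_le_l1[of \<xi>] by simp
      then have "?J * norm (bval (a p) \<rho> y \<xi>) \<le> (1 + (\<Sum>b\<in>(Basis::(real^'n) set). \<bar>\<xi> \<bullet> b\<bar>)) * norm (bval (a p) \<rho> y \<xi>)"
        by (rule mult_right_mono) simp
      also have "\<dots> = norm (?b a \<rho> q) + (\<Sum>b\<in>(Basis::(real^'n) set). norm ((snd (snd q) \<bullet> b) *\<^sub>R ?b a \<rho> q))"
        by (simp add: distrib_right sum_distrib_right pq)
      also have "\<dots> \<le> C * ?w (m + 1) q"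
        using C(2)[OF q] by (simp only: real_norm_def abs_le_iff)
      also have "\<dots> = ?J * (C * (c p * ?J powr m))" by (simp add: powr_add pq)
      finally show ?thesis by (simp add: mult_le_cancel_left_pos pq)
    qed
    with C(1) show ?case by blast
  qed
  moreover have "?J \<le> m + real (nat \<lceil>?J - m\<rceil>)"
    using real_nat_ceiling_ge[of "?J - m"] by linarith
  ultimately show ?thesis using assms by blast
qed

text \<open>For \<open>\<bar>s\<bar> < 1\<close> the bracket stays below
  \<open>2 + norm \<xi>\<close>, so its powers may enter constants depending on \<xi>.
  Differentiability at a fixed point needs no uniformity in \<xi>.\<close>

lemma bdiff_osc_line:
  assumes \<rho>: "amp \<rho>" and v: "norm v2 \<le> 1"
  shows "bdiff k {s. \<bar>s\<bar> < 1} (\<lambda>_ _ _. 1) (\<lambda>s w. osc \<rho> (y + s *\<^sub>R v1) (\<xi> + s *\<^sub>R v2) w)"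
proof -
  have "bdiff k {s. \<bar>s\<bar> < 1} (\<lambda>j s w. japanese_bracket (\<xi> + s *\<^sub>R v2) ^ j) (\<lambda>s w. osc \<rho> (y + s *\<^sub>R v1) (\<xi> + s *\<^sub>R v2) w)"
    using bdiff_reparam[OF bdiff_osc[OF \<rho>], where Q="{s. \<bar>s\<bar> < 1}" and \<phi>="\<lambda>s. (y + s *\<^sub>R v1, \<xi> + s *\<^sub>R v2)"] by simp
  then show ?thesis
  proof (rule bdiff_weaken)
    fix j :: nat
    have "japanese_bracket (\<xi> + s *\<^sub>R v2) ^ j \<le> (2 + norm \<xi>) ^ j * 1" if "\<bar>s\<bar> < 1" for s
    proof -
      have "norm (s *\<^sub>R v2) \<le> 1" using that v mult_mono[of "\<bar>s\<bar>" 1 "norm v2" 1] by simp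
      then have "japanese_bracket (\<xi> + s *\<^sub>R v2) \<le> 2 + norm \<xi>"
        using jb_le[of "\<xi> + s *\<^sub>R v2"] norm_triangle_ineq[of \<xi> "s *\<^sub>R v2"] by simp
      then show ?thesis by (simp add: power_mono)
    qed
    then show "\<exists>D\<ge>0. \<forall>s\<in>{s. \<bar>s\<bar> < 1}. \<forall>x. japanese_bracket (\<xi> + s *\<^sub>R v2) ^ j \<le> D * 1"
      by (intro exI[of _ "(2 + norm \<xi>) ^ j"]) auto
  qed
qed

lemma bdiff_Wt1:
  assumes "bdiff k P (\<lambda>_ _ _. 1) (h :: 'p \<Rightarrow> real^'n \<Rightarrow> complex)"
  shows "bdiff k P (\<lambda>_ _ w. (wt w)\<^sup>2) (\<lambda>p w. Wt (L4 1) w *\<^sub>C h p w)"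
proof -
  have "bdiff k P (\<lambda>_ _ w. (wt w)\<^sup>2) (\<lambda>_ w::real^'n. Wt (L4 1) w)"
    using bdiff_reparam[OF bdiff_Wt_L4, where Q=P and \<phi>="\<lambda>_. 1"] by simp
  from bdiff_bilinear[OF bounded_bilinear_scaleC this assms] show ?thesis by simp
qed

lemma bdiff_wt_sq:
  "bdiff k P (\<lambda>_ _ w. (wt w)\<^sup>2) h \<Longrightarrow> bdiff k P (\<lambda>_ _ w. wt w) h"
  by (erule bdiff_weaken) (auto simp: power2_eq_square mult_left_le intro!: exI[of _ 1])

text \<open>Covers derivatives in \<open>y\<close> and in \<xi> at once: the point moves with
  velocity \<open>(v1, v2)\<close> while the symbol varies too. The derivative of the amplitude must
  split into a bounded part and terms \<open>i w_c\<close> times bounded amplitudes; each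
  \<open>i w_c\<close> becomes the derivative \<open>dd c\<close> of the symbol.\<close>

lemma bval_has_vector_derivative:
  assumes a: "\<And>s. \<bar>s\<bar> < 1 \<Longrightarrow> spoly (a s)" "\<And>s. \<bar>s\<bar> < 1 \<Longrightarrow> spoly (a' s)"
    and da: "\<And>s \<eta>. \<bar>s\<bar> < 1 \<Longrightarrow> ((\<lambda>s. Eop (L4 1) (a s) \<eta>) has_vector_derivative Eop (L4 1) (a' s) \<eta>) (at s)"
    and ba: "\<And>s \<eta>. \<bar>s\<bar> < 1 \<Longrightarrow> norm (Eop (L4 1) (a s) \<eta>) \<le> A * (1 + norm \<eta>) ^ M"
      "\<And>s \<eta>. \<bar>s\<bar> < 1 \<Longrightarrow> norm (Eop (L4 1) (a' s) \<eta>) \<le> A * (1 + norm \<eta>) ^ M"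
    and v: "norm v2 \<le> 1" and \<rho>: "amp \<rho>" "amp \<rho>1" "\<And>c. c \<in> Basis \<Longrightarrow> amp (\<rho>2 c)"
    and d: "\<And>s w. \<bar>s\<bar> < 1 \<Longrightarrow> ((\<lambda>s. osc \<rho> (y + s *\<^sub>R v1) (\<xi> + s *\<^sub>R v2) w) has_vector_derivative
      osc \<rho>1 (y + s *\<^sub>R v1) (\<xi> + s *\<^sub>R v2) w +
      (\<Sum>c\<in>Basis. \<i> * of_real (w \<bullet> c) * osc (\<rho>2 c) (y + s *\<^sub>R v1) (\<xi> + s *\<^sub>R v2) w)) (at s)"
  shows "((\<lambda>s. bval (a s) \<rho> (y + s *\<^sub>R v1) (\<xi> + s *\<^sub>R v2)) has_vector_derivative
    bval (a' 0) \<rho> y \<xi> + (bval (a 0) \<rho>1 y \<xi> + (\<Sum>c\<in>Basis. bval (dd c (a 0)) (\<rho>2 c) y \<xi>))) (at 0)"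
proof -
  define h' where "h' s w = osc \<rho>1 (y + s *\<^sub>R v1) (\<xi> + s *\<^sub>R v2) w +
      (\<Sum>c\<in>Basis. \<i> *\<^sub>C (w \<bullet> c) *\<^sub>R osc (\<rho>2 c) (y + s *\<^sub>R v1) (\<xi> + s *\<^sub>R v2) w)" for s w
  have eq: "\<i> *\<^sub>C (w \<bullet> c) *\<^sub>R z = \<i> * of_real (w \<bullet> c) * z" for w c :: "real^'n" and z
    by (simp add: scaleC_complex_def scaleR_conv_of_real)
  have cw: "bdiff k {s. \<bar>s\<bar> < 1} (\<lambda>_ _ w. wt w) (\<lambda>s w. \<i> *\<^sub>C (w \<bullet> c) *\<^sub>R (Wt (L4 1) w *\<^sub>C osc (\<rho>2 c) (y + s *\<^sub>R v1) (\<xi> + s *\<^sub>R v2) w))" if c: "c \<in> Basis" for k c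
    by (rule bdiff_linear[OF scaleC.bounded_linear_right bdiff_coord_mult[OF c bdiff_Wt1[OF bdiff_osc_line[OF \<rho>(3)[OF c] v]]]])
  have comm: "Wt (L4 1) w *\<^sub>C \<i> *\<^sub>C (w \<bullet> c) *\<^sub>R z = \<i> *\<^sub>C (w \<bullet> c) *\<^sub>R (Wt (L4 1) w *\<^sub>C z)" for w c :: "real^'n" and z :: complex
    by (simp add: scaleC_complex_def)
  have "((\<lambda>s. pair (L4 1) (a s) (osc \<rho> (y + s *\<^sub>R v1) (\<xi> + s *\<^sub>R v2))) has_vector_derivative
     pair (L4 1) (a' 0) (osc \<rho> (y + 0 *\<^sub>R v1) (\<xi> + 0 *\<^sub>R v2)) + pair (L4 1) (a 0) (h' 0)) (at 0)"
  proof (rule pair_has_vector_derivative[OF a bas_L4 da ba])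
    show "((\<lambda>s. osc \<rho> (y + s *\<^sub>R v1) (\<xi> + s *\<^sub>R v2) w) has_vector_derivative h' s w) (at s)" if "\<bar>s\<bar> < 1" for s w
      unfolding h'_def eq by (rule d[OF that])
    show "bdiff k {s. \<bar>s\<bar> < 1} (\<lambda>_ _ w. wt w) (\<lambda>s w. Wt (L4 1) w *\<^sub>C osc \<rho> (y + s *\<^sub>R v1) (\<xi> + s *\<^sub>R v2) w)" for k
      by (rule bdiff_wt_sq[OF bdiff_Wt1[OF bdiff_osc_line[OF \<rho>(1) v]]])
    show "bdiff k {s. \<bar>s\<bar> < 1} (\<lambda>_ _ w. wt w) (\<lambda>s w. Wt (L4 1) w *\<^sub>C h' s w)" for k
      unfolding h'_def scaleC_add_right scaleC.sum_right comm
      by (intro bdiff_add bdiff_sum cw bdiff_wt_sq[OF bdiff_Wt1[OF bdiff_osc_line[OF \<rho>(2) v]]])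
  qed
  moreover have "pair (L4 1) (a 0) (h' 0) = bval (a 0) \<rho>1 y \<xi> + (\<Sum>c\<in>Basis. bval (dd c (a 0)) (\<rho>2 c) y \<xi>)"
  proof -
    have a0: "spoly (a 0)" by (rule a) simp
    have s: "sbd wt (\<lambda>w. Wt (L4 1) w *\<^sub>C \<i> *\<^sub>C (w \<bullet> c) *\<^sub>R osc (\<rho>2 c) y \<xi> w)" if c: "c \<in> Basis" for c
      unfolding comm by (rule sbd_linear[OF scaleC.bounded_linear_right sbd_coord_mult[OF c sbd_Wt_osc[OF \<rho>(3)[OF c]]]])
    have "pair (L4 1) (a 0) (h' 0) = pair (L4 1) (a 0) (osc \<rho>1 y \<xi>) + pair (L4 1) (a 0) (\<lambda>w. \<Sum>c\<in>Basis. \<i> *\<^sub>C (w \<bullet> c) *\<^sub>R osc (\<rho>2 c) y \<xi> w)"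
      unfolding h'_def
      by (subst pair_add_right[OF a0 bas_L4]) (auto simp: scaleC.sum_right intro!: sbd_Wt_osc' \<rho> sbd_sum s)
    also have "pair (L4 1) (a 0) (\<lambda>w. \<Sum>c\<in>Basis. \<i> *\<^sub>C (w \<bullet> c) *\<^sub>R osc (\<rho>2 c) y \<xi> w) = (\<Sum>c\<in>Basis. pair (L4 1) (a 0) (\<lambda>w. \<i> *\<^sub>C (w \<bullet> c) *\<^sub>R osc (\<rho>2 c) y \<xi> w))"
      by (rule pair_sum_right[OF a0 bas_L4 s])
    also have "\<dots> = (\<Sum>c\<in>Basis. bval (dd c (a 0)) (\<rho>2 c) y \<xi>)"
      unfolding bval_def by (intro sum.cong refl pair_dd_left[symmetric] a0 bas_L4 sbd_Wt_osc \<rho>)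
    finally show ?thesis by (simp add: bval_def)
  qed
  ultimately show ?thesis by (simp add: bval_def)
qed

end

section \<open>Hoelder continuous symbols\<close>

lemma finite_uniform_bound:
  fixes N :: "'i \<Rightarrow> 'q \<Rightarrow> real"
  assumes "finite I" "\<And>i. i \<in> I \<Longrightarrow> \<exists>C\<ge>0. \<forall>q\<in>Q. N i q \<le> C * w q" "\<And>q. q \<in> Q \<Longrightarrow> 0 \<le> w q"
  shows "\<exists>C\<ge>0. \<forall>i\<in>I. \<forall>q\<in>Q. N i q \<le> C * w q"
  using assms(1,2)
proof (induction I rule: finite_induct)
  case (insert i I)
  then obtain C D where C: "C \<ge> 0" "\<forall>i\<in>I. \<forall>q\<in>Q. N i q \<le> C * w q" and D: "D \<ge> 0" "\<forall>q\<in>Q. N i q \<le> D * w q"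
    by (metis insertCI)
  have "N j q \<le> (C + D) * w q" if "j \<in> insert i I" "q \<in> Q" for j q
  proof -
    have "C * w q \<le> (C + D) * w q" "D * w q \<le> (C + D) * w q"
      using C(1) D(1) assms(3)[OF that(2)] by (auto intro: mult_right_mono)
    then show ?thesis using C(2) D(2) that by force
  qed
  then show ?case using C(1) D(1) by (intro exI[of _ "C + D"]) auto
qed (auto intro: exI[of _ 0])

lemma gradient_bound:
  fixes g :: "'e::euclidean_space \<Rightarrow> 'x::real_normed_vector"
  assumes "\<And>b. b \<in> Basis \<Longrightarrow> sbd (\<lambda>_. 1) (dd b g)"
  obtains C where "C \<ge> 0" "\<And>b x. b \<in> Basis \<Longrightarrow> norm (dd b g x) \<le> C"
proof -
  have "\<exists>C\<ge>0. \<forall>b\<in>Basis. \<forall>x\<in>UNIV. norm (dd b g x) \<le> C * 1"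
  proof (rule finite_uniform_bound[OF finite_Basis])
    fix b :: 'e assume "b \<in> Basis"
    from sbd_boundE[OF assms[OF this]] show "\<exists>C\<ge>0. \<forall>x\<in>UNIV. norm (dd b g x) \<le> C * 1" by metis
  qed simp
  then show ?thesis using that by auto
qed

lemma lipschitz_of_partials:
  fixes f :: "'e::euclidean_space \<Rightarrow> 'x::real_normed_vector"
  assumes p: "partials f f'" and b: "\<And>b x. b \<in> Basis \<Longrightarrow> norm (f' b x) \<le> C"
  shows "norm (f y - f x) \<le> real DIM('e) * C * norm (y - x)"
proof -
  have "norm (f (x + 1 *\<^sub>R (y - x)) - f (x + 0 *\<^sub>R (y - x))) \<le> (real DIM('e) * C * norm (y - x)) * \<bar>1 - 0\<bar>"
  proof (rule norm_diff_le_of_derivative[where g="\<lambda>t. f (x + t *\<^sub>R (y - x))"])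
    fix s
    show "((\<lambda>t. f (x + t *\<^sub>R (y - x))) has_vector_derivative (\<Sum>b\<in>Basis. ((y - x) \<bullet> b) *\<^sub>R f' b (x + s *\<^sub>R (y - x)))) (at s)"
      by (rule partials_direction[OF p])
    have "norm (\<Sum>b\<in>Basis. ((y - x) \<bullet> b) *\<^sub>R f' b (x + s *\<^sub>R (y - x))) \<le> real DIM('e) * (norm (y - x) * C)"
      by (rule sum_norm_bound) (auto intro!: mult_mono b Basis_le_norm)
    then show "norm (\<Sum>b\<in>Basis. ((y - x) \<bullet> b) *\<^sub>R f' b (x + s *\<^sub>R (y - x))) \<le> real DIM('e) * C * norm (y - x)"
      by (simp add: mult_ac)
  qed
  then show ?thesis by simp
qed

text \<open>For \<open>r \<le> 1\<close> the Lipschitz bound suffices since then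
  \<open>r \<le> r powr \<theta>\<close>; for \<open>r > 1\<close> the trivial bound
  \<open>2 * A\<close> does.\<close>

lemma holder_of_lipschitz:
  fixes u v :: "'x::real_normed_vector"
  assumes th: "0 < \<theta>" "\<theta> < 1" and l: "norm (u - v) \<le> A * r" "norm u \<le> A" "norm v \<le> A" and r: "0 \<le> r"
  shows "norm (u - v) \<le> 2 * A * r powr \<theta>"
proof -
  have A: "A \<ge> 0" by (rule order_trans[OF norm_ge_zero l(2)])
  show ?thesis
  proof (cases "r \<le> 1")
    case True
    have "r \<le> r powr \<theta>"
    proof (cases "r = 0")
      case False
      then show ?thesis using True r th powr_mono'[of \<theta> 1 r] by simp
    qed simp
    then have "A * r \<le> A * r powr \<theta>" using A by (rule mult_left_mono)
    moreover have "A * r powr \<theta> \<le> 2 * A * r powr \<theta>" using A by (intro mult_right_mono) auto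
    ultimately show ?thesis using l(1) by linarith
  next
    case False
    have "norm (u - v) \<le> 2 * A" using norm_triangle_ineq4[of u v] l by simp
    also have "\<dots> \<le> 2 * A * r powr \<theta>"
      using False th A ge_one_powr_ge_zero[of r \<theta>] by (simp add: mult_le_cancel_left1)
    finally show ?thesis .
  qed
qed

lemma symb_scale:
  fixes a :: "'p \<Rightarrow> real^'n::finite \<Rightarrow> 'x::real_normed_vector"
  assumes a: "symb P c m a" and g: "\<And>p. p \<in> P \<Longrightarrow> \<bar>g p\<bar> \<le> D * e p" "\<And>p. p \<in> P \<Longrightarrow> 0 \<le> e p" "D \<ge> 0"
  shows "symb P (\<lambda>p. e p * c p) m (\<lambda>p \<eta>. g p *\<^sub>R a p \<eta>)"
proof (rule symbI)
  fix k
  show "bdiff k P (\<lambda>j p \<eta>. e p * c p * japanese_bracket \<eta> powr (m - real j)) (\<lambda>p \<eta>. g p *\<^sub>R a p \<eta>)"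
  proof (rule bdiff_bilinear[OF bounded_bilinear_scaleR _ symb_bdiff[OF a]])
    show "bdiff k P (\<lambda>j p \<eta>. e p * 0 ^ j) (\<lambda>p (\<eta>::real^'n). g p)"
      by (rule bdiff_const[OF g(3)]) (use g in auto)
    fix i j p and x :: "real^'n" assume p: "p \<in> P"
    show "e p * 0 ^ i * (c p * japanese_bracket x powr (m - real j)) \<le> e p * c p * japanese_bracket x powr (m - real (i + j))"
      using g(2)[OF p] symb_nonneg[OF a p] by (cases i) auto
  qed
qed (use g symb_nonneg[OF a] in auto)

lemma symb_const_dd:
  fixes a :: "'p \<Rightarrow> real^'n::finite \<Rightarrow> 'x::real_normed_vector"
  assumes "symb P c m a" "p \<in> P" "b \<in> Basis"
  shows "((\<lambda>t. a p (\<eta> + t *\<^sub>R b)) has_vector_derivative dd b (a p) (\<eta> + s *\<^sub>R b)) (at s)"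
  by (rule partials_Basis[OF bdiff_partials[OF symb_bdiff[OF assms(1), of "Suc 0"] assms(2)] assms(3)])

text \<open>Since the derivatives of \<open>F a\<close> are sums of functions \<open>F a'\<close> with \<open>a'\<close> of lower order, bounds for the
  values of all \<open>F a\<close> are already symbol estimates.\<close>

lemma symb_of_values:
  fixes F :: "'a \<Rightarrow> 'q \<Rightarrow> real^'n::finite \<Rightarrow> 'x::real_normed_vector"
  assumes c: "\<And>q. q \<in> Q \<Longrightarrow> 0 \<le> c q"
    and V: "\<And>m a. A m a \<Longrightarrow> \<exists>C\<ge>0. \<forall>q\<in>Q. \<forall>\<xi>. norm (F a q \<xi>) \<le> C * (c q * japanese_bracket \<xi> powr m)"
    and d: "\<And>m a b q \<xi>. A m a \<Longrightarrow> b \<in> Basis \<Longrightarrow> q \<in> Q \<Longrightarrow>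
      ((\<lambda>t. F a q (\<xi> + t *\<^sub>R b)) has_vector_derivative (\<Sum>i\<in>I. F (\<Phi> i b a) q \<xi>)) (at 0)"
    and \<Phi>: "\<And>m a b i. A m a \<Longrightarrow> b \<in> Basis \<Longrightarrow> i \<in> I \<Longrightarrow> A (m - 1) (\<Phi> i b a)"
  shows "A m a \<Longrightarrow> symb Q c m (F a)"
proof (rule symbI[OF c])
  fix k
  assume "A m a"
  then show "bdiff k Q (\<lambda>j q \<xi>. c q * japanese_bracket \<xi> powr (m - real j)) (F a)"
  proof (induction k arbitrary: m a)
    case 0
    have "\<exists>C\<ge>0. \<forall>b\<in>Basis. \<forall>p\<in>Q \<times> UNIV. norm (\<Sum>i\<in>I. F (\<Phi> i b a) (fst p) (snd p)) \<le> C * (c (fst p) * japanese_bracket (snd p) powr (m - 1))"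
    proof (rule finite_uniform_bound[OF finite_Basis])
      fix b :: "real^'n" assume b: "b \<in> Basis"
      show "\<exists>C\<ge>0. \<forall>p\<in>Q \<times> UNIV. norm (\<Sum>i\<in>I. F (\<Phi> i b a) (fst p) (snd p)) \<le> C * (c (fst p) * japanese_bracket (snd p) powr (m - 1))"
        by (rule bounded_family_sum) (use V[OF \<Phi>[OF 0 b]] in auto)
    qed (auto intro!: mult_nonneg_nonneg c)
    then obtain C where C: "\<And>b q \<xi>. b \<in> Basis \<Longrightarrow> q \<in> Q \<Longrightarrow> norm (\<Sum>i\<in>I. F (\<Phi> i b a) q \<xi>) \<le> C * (c q * japanese_bracket \<xi> powr (m - 1))"
      by auto
    have "continuous_on UNIV (F a q)" if q: "q \<in> Q" for q
      by (rule continuous_of_bounded_partials[OF d[OF 0 _ q] C[OF _ q]])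
        (auto intro!: continuous_intros continuous_on_powr')
    then show ?case using V[OF 0] by auto
  next
    case (Suc k)
    show ?case
    proof (rule bdiff_SucI[where f'="\<lambda>b q \<xi>. \<Sum>i\<in>I. F (\<Phi> i b a) q \<xi>"])
      show "\<exists>C\<ge>0. \<forall>p\<in>Q. \<forall>x. norm (F a p x) \<le> C * (c p * japanese_bracket x powr (m - real 0))"
        using V[OF Suc.prems] by simp
      fix b :: "real^'n" assume b: "b \<in> Basis"
      show "((\<lambda>t. F a p (x + t *\<^sub>R b)) has_vector_derivative (\<Sum>i\<in>I. F (\<Phi> i b a) p x)) (at 0)" if "p \<in> Q" for p x
        by (rule d[OF Suc.prems b that])
      have "bdiff k Q (\<lambda>j q \<xi>. c q * japanese_bracket \<xi> powr (m - 1 - real j)) (\<lambda>q \<xi>. \<Sum>i\<in>I. F (\<Phi> i b a) q \<xi>)"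
        by (intro bdiff_sum Suc.IH \<Phi>[OF Suc.prems b])
      then show "bdiff k Q (\<lambda>j p x. c p * japanese_bracket x powr (m - real (Suc j))) (\<lambda>q \<xi>. \<Sum>i\<in>I. F (\<Phi> i b a) q \<xi>)"
        by (simp add: algebra_simps)
    qed
  qed
qed

section \<open>Symbols that depend on a point in a Hoelder continuous way\<close>

definition ddy :: "'e::real_normed_vector \<Rightarrow> ('e \<Rightarrow> 'f \<Rightarrow> 'x::real_normed_vector) \<Rightarrow> 'e \<Rightarrow> 'f \<Rightarrow> 'x"
  where "ddy b a y \<eta> = dd b (\<lambda>z. a z \<eta>) y"

text \<open>Symbols \<open>a y \<eta>\<close> of order \<open>m\<close> that are \<open>C\<^bsup>k + \<theta>\<^esup>\<close> in \<open>y\<close>; the seminorm is a symbol estimate for the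
  differences \<open>a y - a y'\<close>.\<close>

primrec HS :: "real \<Rightarrow> nat \<Rightarrow> real \<Rightarrow> (real^'n::finite \<Rightarrow> real^'n \<Rightarrow> 'x::real_normed_vector) \<Rightarrow> bool" where
  "HS \<theta> 0 m a \<longleftrightarrow> symb UNIV (\<lambda>_. 1) m a \<and>
    symb UNIV (\<lambda>q. norm (fst q - snd q) powr \<theta>) m (\<lambda>q \<eta>. a (fst q) \<eta> - a (snd q) \<eta>)"
| "HS \<theta> (Suc k) m a \<longleftrightarrow> symb UNIV (\<lambda>_. 1) m a \<and>
    (\<forall>b\<in>Basis. (\<forall>y \<eta>. ((\<lambda>t. a (y + t *\<^sub>R b) \<eta>) has_vector_derivative ddy b a y \<eta>) (at 0)) \<and> HS \<theta> k m (ddy b a))"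

lemma HS_symb: "HS \<theta> k m a \<Longrightarrow> symb UNIV (\<lambda>_. 1) m a"
  by (cases k) auto

lemma HS_SucI:
  assumes "symb UNIV (\<lambda>_. 1) m a"
    and "\<And>b y \<eta>. b \<in> Basis \<Longrightarrow> ((\<lambda>t. a (y + t *\<^sub>R b) \<eta>) has_vector_derivative a' b y \<eta>) (at 0)"
    and "\<And>b. b \<in> Basis \<Longrightarrow> HS \<theta> k m (a' b)"
  shows "HS \<theta> (Suc k) m a"
proof -
  have "ddy b a = a' b" if "b \<in> Basis" for b
    using assms(2)[OF that] unfolding ddy_def[abs_def] by (intro ext ddI)
  then show ?thesis using assms by simp
qed

lemma HS_derivative:
  "HS \<theta> (Suc k) m a \<Longrightarrow> b \<in> Basis \<Longrightarrow> ((\<lambda>t. a (y + t *\<^sub>R b) \<eta>) has_vector_derivative ddy b a y \<eta>) (at 0)"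
  by simp

lemma HS_ddy: "HS \<theta> (Suc k) m a \<Longrightarrow> b \<in> Basis \<Longrightarrow> HS \<theta> k m (ddy b a)"
  by simp

lemma ddy_eq:
  assumes "\<And>y \<eta>. ((\<lambda>t. a (y + t *\<^sub>R b) \<eta>) has_vector_derivative a' y \<eta>) (at 0)"
  shows "ddy b a = a'"
  using assms unfolding ddy_def[abs_def] by (intro ext ddI)

lemma HS_add: "HS \<theta> k m a \<Longrightarrow> HS \<theta> k m a' \<Longrightarrow> HS \<theta> k m (\<lambda>y \<eta>. a y \<eta> + a' y \<eta>)"
proof (induction k arbitrary: a a')
  case 0
  have "(\<lambda>q \<eta>. (a (fst q) \<eta> + a' (fst q) \<eta>) - (a (snd q) \<eta> + a' (snd q) \<eta>)) = (\<lambda>q \<eta>. (a (fst q) \<eta> - a (snd q) \<eta>) + (a' (fst q) \<eta> - a' (snd q) \<eta>))"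
    by (simp add: fun_eq_iff)
  with 0 show ?case by (auto intro!: symb_add)
next
  case (Suc k)
  show ?case
    by (rule HS_SucI[where a'="\<lambda>b y \<eta>. ddy b a y \<eta> + ddy b a' y \<eta>"])
      (use Suc in \<open>auto intro!: symb_add has_vector_derivative_add\<close>)
qed

lemma HS_linear:
  assumes h: "bounded_linear h"
  shows "HS \<theta> k m a \<Longrightarrow> HS \<theta> k m (\<lambda>y \<eta>. h (a y \<eta>))"
proof (induction k arbitrary: a)
  case 0
  then show ?case
    using symb_linear[OF h, of UNIV _ m "\<lambda>q \<eta>. a (fst q) \<eta> - a (snd q) \<eta>"]
    by (auto intro!: symb_linear[OF h] simp: linear_diff[OF bounded_linear.linear[OF h]])
next
  case (Suc k)
  show ?case
    by (rule HS_SucI[where a'="\<lambda>b y \<eta>. h (ddy b a y \<eta>)"])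
      (use Suc in \<open>auto intro!: symb_linear[OF h] bounded_linear.has_vector_derivative[OF h]\<close>)
qed

lemma HS_zero: "HS \<theta> k m (\<lambda>y \<eta>. 0)"
proof (induction k)
  case (Suc k)
  show ?case
    by (rule HS_SucI[where a'="\<lambda>b y \<eta>. 0"]) (use Suc in \<open>auto intro: symb_zero\<close>)
qed (auto intro: symb_zero)

lemma HS_sum: "(\<And>i. i \<in> I \<Longrightarrow> HS \<theta> k m (a i)) \<Longrightarrow> HS \<theta> k m (\<lambda>y \<eta>. \<Sum>i\<in>I. a i y \<eta>)"
  by (induction I rule: infinite_finite_induct) (auto intro: HS_add HS_zero)

lemma HS_coord:
  assumes b: "b \<in> Basis"
  shows "HS \<theta> k m a \<Longrightarrow> HS \<theta> k (m + 1) (\<lambda>y \<eta>. (\<eta> \<bullet> b) *\<^sub>R a y \<eta>)"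
proof (induction k arbitrary: a)
  case 0
  then show ?case
    using symb_coord[OF _ b, of UNIV _ m "\<lambda>q \<eta>. a (fst q) \<eta> - a (snd q) \<eta>"]
    by (auto intro!: symb_coord[OF _ b] simp: scaleR_diff_right)
next
  case (Suc k)
  show ?case
    by (rule HS_SucI[where a'="\<lambda>c y \<eta>. (\<eta> \<bullet> b) *\<^sub>R ddy c a y \<eta>"])
      (use Suc in \<open>auto intro!: symb_coord[OF _ b] bounded_linear.has_vector_derivative[OF bounded_linear_scaleR_right]\<close>)
qed

lemma HS_pair_bound:
  assumes "HS \<theta> 0 m a"
  obtains C where "C \<ge> 0" "\<And>y y' \<eta>. norm (a y \<eta> - a y' \<eta>) \<le> C * (norm (y - y') powr \<theta> * japanese_bracket \<eta> powr m)"
proof -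
  obtain C where C: "C \<ge> 0" "\<And>q \<eta>. q \<in> UNIV \<Longrightarrow> norm (a (fst q) \<eta> - a (snd q) \<eta>) \<le> C * (norm (fst q - snd q) powr \<theta> * japanese_bracket \<eta> powr m)"
    using symb_boundE[of UNIV _ m "\<lambda>q \<eta>. a (fst q) \<eta> - a (snd q) \<eta>"] assms by auto
  show ?thesis
  proof (rule that[OF C(1)])
    show "norm (a y \<eta> - a y' \<eta>) \<le> C * (norm (y - y') powr \<theta> * japanese_bracket \<eta> powr m)" for y y' \<eta>
      using C(2)[of "(y, y')" \<eta>] by simp
  qed
qed

context
  fixes \<theta> :: real
  assumes th: "0 < \<theta>" "\<theta> < 1"
begin

lemma HS_continuous_y:
  fixes a :: "real^'n::finite \<Rightarrow> real^'n \<Rightarrow> 'x::real_normed_vector"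
  shows "HS \<theta> k m a \<Longrightarrow> continuous_on UNIV (\<lambda>y. a y \<eta>)"
proof (cases k)
  case 0
  assume "HS \<theta> k m a"
  then obtain C where C: "C \<ge> 0" "\<And>y y' \<eta>. norm (a y \<eta> - a y' \<eta>) \<le> C * (norm (y - y') powr \<theta> * japanese_bracket \<eta> powr m)"
    using HS_pair_bound 0 by metis
  show ?thesis
    unfolding continuous_on_def
  proof
    fix y :: "real^'n"
    have "continuous_on UNIV (\<lambda>y'. C * (norm (y' - y) powr \<theta> * japanese_bracket \<eta> powr m))"
      using th by (auto intro!: continuous_intros continuous_on_powr')
    then have "((\<lambda>y'. C * (norm (y' - y) powr \<theta> * japanese_bracket \<eta> powr m)) \<longlongrightarrow> C * (norm (y - y) powr \<theta> * japanese_bracket \<eta> powr m)) (at y)"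
      unfolding continuous_on_def by blast
    then have "((\<lambda>y'. a y' \<eta> - a y \<eta>) \<longlongrightarrow> 0) (at y)"
      by (intro Lim_null_comparison[OF always_eventually, of "\<lambda>y'. a y' \<eta> - a y \<eta>"]) (use C(2) in auto)
    then show "((\<lambda>y. a y \<eta>) \<longlongrightarrow> a y \<eta>) (at y)" by (simp add: LIM_zero_iff)
  qed
next
  case (Suc j)
  assume a: "HS \<theta> k m a"
  have "\<exists>C\<ge>0. \<forall>b\<in>Basis. \<forall>p\<in>UNIV. norm (ddy b a (fst p) (snd p)) \<le> C * japanese_bracket (snd p) powr m"
  proof (rule finite_uniform_bound[OF finite_Basis])
    fix b :: "real^'n" assume "b \<in> Basis"
    then have "symb UNIV (\<lambda>_. 1) m (ddy b a)" using a Suc by (auto intro: HS_symb)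
    from symb_boundE[OF this] show "\<exists>C\<ge>0. \<forall>p\<in>UNIV. norm (ddy b a (fst p) (snd p)) \<le> C * japanese_bracket (snd p) powr m"
      by (metis UNIV_I mult_1)
  qed simp
  then obtain C where C: "\<And>b y \<eta>. b \<in> Basis \<Longrightarrow> norm (ddy b a y \<eta>) \<le> C * japanese_bracket \<eta> powr m" by force
  show ?thesis
    by (rule continuous_of_bounded_partials[where f'="\<lambda>b y. ddy b a y \<eta>", OF _ C]) (use a Suc in auto)
qed

lemma HS_partials_y:
  fixes a :: "real^'n::finite \<Rightarrow> real^'n \<Rightarrow> 'x::real_normed_vector"
  assumes "HS \<theta> (Suc k) m a"
  shows "partials (\<lambda>y. a y \<eta>) (\<lambda>b y. ddy b a y \<eta>)"
  by (rule partialsI[OF HS_derivative[OF assms] HS_continuous_y[OF HS_ddy[OF assms]]])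

text \<open>In \<open>mixed_partial\<close> the first variable is the one along \<eta>. The
  continuity required there is available because the second \<eta>-derivative of
  \<open>ddy b a\<close> is bounded near the given \<eta>, uniformly in the point
  \<open>y\<close>.\<close>

lemma ddy_dd:
  fixes a :: "real^'n::finite \<Rightarrow> real^'n \<Rightarrow> 'x::real_normed_vector"
  assumes a: "HS \<theta> (Suc k) m a" and b: "b \<in> Basis" and c: "c \<in> Basis"
  shows "((\<lambda>t. dd c (a (y + t *\<^sub>R b)) \<eta>) has_vector_derivative dd c (ddy b a y) \<eta>) (at 0)"
proof -
  have sa: "symb UNIV (\<lambda>_. 1) m a" and sa': "symb UNIV (\<lambda>_. 1) m (ddy b a)"
    using HS_symb[OF a] HS_symb[OF HS_ddy[OF a b]] by auto
  define H where "H s t = dd c (ddy b a (y + t *\<^sub>R b)) (\<eta> + s *\<^sub>R c)" for s t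
  have "((\<lambda>t. dd c (a (y + t *\<^sub>R b)) \<eta>) has_vector_derivative H 0 0) (at 0)"
  proof (rule mixed_partial[where e=1 and F="\<lambda>s t. a (y + t *\<^sub>R b) (\<eta> + s *\<^sub>R c)" and Ft="\<lambda>s t. ddy b a (y + t *\<^sub>R b) (\<eta> + s *\<^sub>R c)" and H=H])
    show "((\<lambda>s. a (y + t *\<^sub>R b) (\<eta> + s *\<^sub>R c)) has_vector_derivative dd c (a (y + t *\<^sub>R b)) \<eta>) (at 0)" for t
      using symb_const_dd[OF sa UNIV_I c, of _ \<eta> 0] by simp
    show "((\<lambda>t. a (y + t *\<^sub>R b) (\<eta> + s *\<^sub>R c)) has_vector_derivative ddy b a (y + t *\<^sub>R b) (\<eta> + s *\<^sub>R c)) (at t)" for s t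
      by (rule has_vector_derivative_line_zero[where F="\<lambda>y. a y (\<eta> + s *\<^sub>R c)", OF HS_derivative[OF a b]])
    show "((\<lambda>s. ddy b a (y + t *\<^sub>R b) (\<eta> + s *\<^sub>R c)) has_vector_derivative H s t) (at s)" for s t
      unfolding H_def by (rule symb_const_dd[OF sa' UNIV_I c])
    have s2: "symb UNIV (\<lambda>_. 1) (m - 1 - 1) (\<lambda>y. dd c (dd c (ddy b a y)))"
      by (intro symb_dd sa' c)
    have s1: "symb UNIV (\<lambda>_. 1) (m - 1) (\<lambda>y. dd c (ddy b a y))" by (intro symb_dd sa' c)
    obtain C where C: "C \<ge> 0" "\<And>y \<eta>. norm (dd c (dd c (ddy b a y)) \<eta>) \<le> C * japanese_bracket \<eta> powr (m - 1 - 1)"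
      using symb_boundE[OF s2] by (metis UNIV_I mult_1)
    \<comment> \<open>A Lipschitz constant for \<open>H\<close> along \<eta>, valid for increments
      below \<open>1\<close>, where the bracket is at most \<open>2 + norm \<eta>\<close>; the
      summand \<open>1\<close> makes it positive, so that one can divide by it.\<close>
    define M where "M = C * (2 + norm \<eta>) ^ nat \<lceil>m - 1 - 1\<rceil> + 1"
    have M: "M > 0" using C(1) by (simp add: M_def add_nonneg_pos)
    have HM: "norm (H s t - H 0 t) \<le> M * \<bar>s\<bar>" if s: "\<bar>s\<bar> < 1" for s t
    proof -
      have "norm (H s t - H 0 t) \<le> M * \<bar>s - 0\<bar>"
      proof (rule norm_diff_le_of_derivative[where g="\<lambda>s. H s t" and g'="\<lambda>s. dd c (dd c (ddy b a (y + t *\<^sub>R b))) (\<eta> + s *\<^sub>R c)"])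
        fix r assume "r \<in> closed_segment 0 s"
        then have r: "\<bar>r\<bar> < 1" using s by (auto simp: closed_segment_eq_real_ivl split: if_splits)
        show "((\<lambda>s. H s t) has_vector_derivative dd c (dd c (ddy b a (y + t *\<^sub>R b))) (\<eta> + r *\<^sub>R c)) (at r)"
          unfolding H_def by (rule symb_const_dd[OF s1 UNIV_I c])
        have "norm (r *\<^sub>R c) \<le> 1" using r c by (simp add: norm_Basis)
        then have "1 + norm (\<eta> + r *\<^sub>R c) \<le> 2 + norm \<eta>" using norm_triangle_ineq[of \<eta> "r *\<^sub>R c"] by simp
        then have "japanese_bracket (\<eta> + r *\<^sub>R c) powr (m - 1 - 1) \<le> (2 + norm \<eta>) ^ nat \<lceil>m - 1 - 1\<rceil>"
          using order_trans[OF jb_powr_le power_mono] by (meson add_nonneg_nonneg norm_ge_zero zero_le_one)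
        then have "C * japanese_bracket (\<eta> + r *\<^sub>R c) powr (m - 1 - 1) \<le> M"
          using mult_left_mono[OF _ C(1)] by (fastforce simp: M_def)
        then show "norm (dd c (dd c (ddy b a (y + t *\<^sub>R b))) (\<eta> + r *\<^sub>R c)) \<le> M"
          using C(2) order_trans by blast
      qed
      then show ?thesis by simp
    qed
    fix \<epsilon> :: real assume "\<epsilon> > 0"
    show "\<exists>d>0. \<forall>s t. \<bar>s\<bar> < d \<longrightarrow> \<bar>t\<bar> < 1 \<longrightarrow> norm (H s t - H 0 t) \<le> \<epsilon>"
    proof (intro exI[of _ "min 1 (\<epsilon> / M)"] conjI allI impI)
      show "min 1 (\<epsilon> / M) > 0" using \<open>\<epsilon> > 0\<close> M by simp
      fix s t :: real assume "\<bar>s\<bar> < min 1 (\<epsilon> / M)"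
      then have "\<bar>s\<bar> < 1" "M * \<bar>s\<bar> \<le> \<epsilon>" using M by (auto simp: field_simps)
      then show "norm (H s t - H 0 t) \<le> \<epsilon>" using HM order_trans by blast
    qed
  qed simp
  then show ?thesis by (simp add: H_def)
qed

lemma HS_dd:
  fixes a :: "real^'n::finite \<Rightarrow> real^'n \<Rightarrow> 'x::real_normed_vector"
  assumes c: "c \<in> Basis"
  shows "HS \<theta> k m a \<Longrightarrow> HS \<theta> k (m - 1) (\<lambda>y. dd c (a y))"
proof (induction k arbitrary: a)
  case 0
  have "dd c (\<lambda>\<eta>. a y \<eta> - a y' \<eta>) = (\<lambda>\<eta>. dd c (a y) \<eta> - dd c (a y') \<eta>)" for y y'
    using symb_const_dd[OF HS_symb[OF 0] UNIV_I c, of _ _ 0]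
    by (intro ext ddI has_vector_derivative_diff) simp_all
  with 0 symb_dd[OF _ c, of UNIV _ m "\<lambda>q \<eta>. a (fst q) \<eta> - a (snd q) \<eta>"] show ?case
    by (auto intro: symb_dd[OF _ c])
next
  case (Suc k)
  show ?case
    by (rule HS_SucI[OF symb_dd[OF HS_symb[OF Suc.prems] c] ddy_dd[OF Suc.prems _ c] Suc.IH[OF HS_ddy[OF Suc.prems]]])
qed

text \<open>Bounded first derivatives in \<open>y\<close> give a Lipschitz and hence a Hoelder
  estimate. It has to be proved for values only: an \<eta>-derivative of a difference is again a
  difference of that form, so \<open>symb_of_values\<close> applies.\<close>

lemma HS_Suc_0:
  fixes a :: "real^'n::finite \<Rightarrow> real^'n \<Rightarrow> 'x::real_normed_vector"
  assumes a: "HS \<theta> (Suc k) m a"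
  shows "HS \<theta> 0 m a"
proof -
  have "symb UNIV (\<lambda>q. norm (fst q - snd q) powr \<theta>) m (\<lambda>q \<eta>. a (fst q) \<eta> - a (snd q) \<eta>)"
  proof (rule symb_of_values[where A="HS \<theta> (Suc k)" and F="\<lambda>a q \<eta>. a (fst q) \<eta> - a (snd q) \<eta>" and I="{()}" and \<Phi>="\<lambda>_ b a y. dd b (a y)", OF _ _ _ _ a])
    fix m and a :: "real^'n \<Rightarrow> real^'n \<Rightarrow> 'x" assume a: "HS \<theta> (Suc k) m a"
    have "\<exists>C\<ge>0. \<forall>b\<in>Basis. \<forall>p\<in>UNIV. norm (ddy b a (fst p) (snd p)) \<le> C * japanese_bracket (snd p) powr m"
    proof (rule finite_uniform_bound[OF finite_Basis])
      fix b :: "real^'n" assume "b \<in> Basis"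
      from symb_boundE[OF HS_symb[OF HS_ddy[OF a this]]]
      show "\<exists>C\<ge>0. \<forall>p\<in>UNIV. norm (ddy b a (fst p) (snd p)) \<le> C * japanese_bracket (snd p) powr m"
        by (metis UNIV_I mult_1)
    qed simp
    then obtain C1 where C1: "C1 \<ge> 0" "\<And>b y \<eta>. b \<in> Basis \<Longrightarrow> norm (ddy b a y \<eta>) \<le> C1 * japanese_bracket \<eta> powr m" by force
    obtain C2 where C2: "C2 \<ge> 0" "\<And>y \<eta>. norm (a y \<eta>) \<le> C2 * japanese_bracket \<eta> powr m"
      using symb_boundE[OF HS_symb[OF a]] by (metis UNIV_I mult_1)
    define C where "C = max (real DIM(real^'n) * C1) C2"
    have "norm (a (fst q) \<eta> - a (snd q) \<eta>) \<le> 2 * C * (norm (fst q - snd q) powr \<theta> * japanese_bracket \<eta> powr m)" for q \<eta>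
    proof -
      let ?J = "japanese_bracket \<eta> powr m"
      have "norm (a (fst q) \<eta> - a (snd q) \<eta>) \<le> real DIM(real^'n) * (C1 * ?J) * norm (fst q - snd q)"
        by (rule lipschitz_of_partials[OF HS_partials_y[OF a] C1(2)])
      also have "\<dots> \<le> (C * ?J) * norm (fst q - snd q)"
        by (intro mult_right_mono) (auto simp: C_def mult.assoc[symmetric] intro!: mult_right_mono)
      finally have "norm (a (fst q) \<eta> - a (snd q) \<eta>) \<le> 2 * (C * ?J) * norm (fst q - snd q) powr \<theta>"
        by (rule holder_of_lipschitz[OF th]) (auto simp: C_def intro!: order_trans[OF C2(2)] mult_right_mono)
      then show ?thesis by (simp add: mult_ac)
    qed
    moreover have "C \<ge> 0" using C2(1) by (simp add: C_def)
    ultimately show "\<exists>C\<ge>0. \<forall>q\<in>UNIV. \<forall>\<xi>. norm (a (fst q) \<xi> - a (snd q) \<xi>) \<le> C * (norm (fst q - snd q) powr \<theta> * japanese_bracket \<xi> powr m)"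
      by (intro exI[of _ "2 * C"]) auto
    fix b :: "real^'n" assume b: "b \<in> Basis"
    show "((\<lambda>t. a (fst q) (\<xi> + t *\<^sub>R b) - a (snd q) (\<xi> + t *\<^sub>R b)) has_vector_derivative
       (\<Sum>i\<in>{()}. dd b (a (fst q)) \<xi> - dd b (a (snd q)) \<xi>)) (at 0)" for q \<xi>
      using symb_const_dd[OF HS_symb[OF a] UNIV_I b, of _ \<xi> 0]
      by (auto intro!: has_vector_derivative_diff)
    show "HS \<theta> (Suc k) (m - 1) (\<lambda>y. dd b (a y))" by (rule HS_dd[OF b a])
  qed auto
  with HS_symb[OF a] show ?thesis by simp
qed

lemma HS_Suc_D: "HS \<theta> (Suc k) m a \<Longrightarrow> HS \<theta> k m a"
proof (induction k arbitrary: a)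
  case 0
  then show ?case by (rule HS_Suc_0)
next
  case (Suc k)
  show ?case
    by (rule HS_SucI[OF HS_symb[OF Suc.prems] HS_derivative[OF Suc.prems] Suc.IH[OF HS_ddy[OF Suc.prems]]])
qed

lemma HS_mult:
  fixes a :: "real^'n::finite \<Rightarrow> real^'n \<Rightarrow> 'x::real_normed_vector"
  shows "sbd (\<lambda>_. 1) g \<Longrightarrow> HS \<theta> k m a \<Longrightarrow> HS \<theta> k m (\<lambda>y \<eta>. g y *\<^sub>R a y \<eta>)"
proof (induction k arbitrary: g a)
  have b1: "symb UNIV (\<lambda>_. 1) m (\<lambda>y \<eta>. g y *\<^sub>R a y \<eta>)" if g: "sbd (\<lambda>_. 1) g" and a: "symb UNIV (\<lambda>_. 1) m a" for g and a :: "real^'n \<Rightarrow> real^'n \<Rightarrow> 'x"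
  proof -
    obtain C where C: "C \<ge> 0" "\<And>x. norm (g x) \<le> C * 1" using sbd_boundE[OF g] by metis
    show ?thesis using symb_scale[OF a, of g C "\<lambda>_. 1"] C by simp
  qed
  {
    case 0
    obtain C where C: "C \<ge> 0" "\<And>x. norm (g x) \<le> C * 1" using sbd_boundE[OF 0(1)] by metis
    obtain C1 where C1: "C1 \<ge> 0" "\<And>b x. b \<in> Basis \<Longrightarrow> norm (dd b g x) \<le> C1"
      using gradient_bound[OF sbd_dd[OF 0(1)]] by metis
    define A where "A = max C (real DIM(real^'n) * C1)"
    have g: "norm (g y - g y') \<le> 2 * A * norm (y - y') powr \<theta>" for y y'
    proof (rule holder_of_lipschitz[OF th])
      show "norm (g y - g y') \<le> A * norm (y - y')"
        using lipschitz_of_partials[OF sbd_partials[OF 0(1)] C1(2), of y y']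
          mult_right_mono[of "real DIM(real^'n) * C1" A "norm (y - y')"] by (simp add: A_def)
    qed (use C(2) in \<open>auto simp: A_def intro: order_trans[OF _ max.cobounded1]\<close>)
    let ?w = "\<lambda>q::(real^'n) \<times> (real^'n). norm (fst q - snd q) powr \<theta>"
    \<comment> \<open>\<open>g a - g' a'\<close> is split into \<open>g (a - a')\<close> and
      \<open>(g - g') a'\<close>; the factors \<open>1\<close> bring the weights into the form
      demanded by \<open>symb_scale\<close>.\<close>
    have s1: "symb UNIV (\<lambda>q. 1 * ?w q) m (\<lambda>q \<eta>. g (fst q) *\<^sub>R (a (fst q) \<eta> - a (snd q) \<eta>))"
      by (rule symb_scale[where D=C]) (use 0(2) C in auto)
    have s2: "symb UNIV (\<lambda>q. ?w q * 1) m (\<lambda>q \<eta>. (g (fst q) - g (snd q)) *\<^sub>R a (snd q) \<eta>)"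
    proof (rule symb_scale[where D="2 * A"])
      show "symb UNIV (\<lambda>_. 1) m (\<lambda>q::(real^'n) \<times> (real^'n). a (snd q))"
        using symb_reparam[OF HS_symb[OF 0(2)], where Q=UNIV and \<phi>=snd] by simp
    qed (use g C(1) in \<open>auto simp: A_def\<close>)
    have "symb UNIV ?w m (\<lambda>q \<eta>. g (fst q) *\<^sub>R a (fst q) \<eta> - g (snd q) *\<^sub>R a (snd q) \<eta>)"
      using symb_add[OF s1[unfolded mult_1] s2[unfolded mult_1_right]] by (simp add: scaleR_diff_left scaleR_diff_right)
    then show ?case using b1[OF 0(1) HS_symb[OF 0(2)]] by simp
  next
    case (Suc k)
    show ?case
    proof (rule HS_SucI[OF b1[OF Suc.prems(1) HS_symb[OF Suc.prems(2)]]])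
      fix b :: "real^'n" assume b: "b \<in> Basis"
      show "((\<lambda>t. g (y + t *\<^sub>R b) *\<^sub>R a (y + t *\<^sub>R b) \<eta>) has_vector_derivative g y *\<^sub>R ddy b a y \<eta> + dd b g y *\<^sub>R a y \<eta>) (at 0)" for y \<eta>
        using bounded_bilinear.has_vector_derivative[OF bounded_bilinear_scaleR sbd_derivative[OF Suc.prems(1) b] HS_derivative[OF Suc.prems(2) b], of y y \<eta>] by simp
      show "HS \<theta> k m (\<lambda>y \<eta>. g y *\<^sub>R ddy b a y \<eta> + dd b g y *\<^sub>R a y \<eta>)"
        by (intro HS_add Suc.IH Suc.prems sbd_dd b HS_Suc_D[OF Suc.prems(2)] HS_ddy[OF Suc.prems(2)])
    qed
  }
qed

lemma HS_compose:
  fixes a :: "real^'n::finite \<Rightarrow> real^'n \<Rightarrow> 'x::real_normed_vector" and g :: "real^'n \<Rightarrow> real^'n"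
  assumes g: "partials g (\<lambda>b. dd b g)" "\<And>b. b \<in> Basis \<Longrightarrow> sbd (\<lambda>_. 1) (dd b g)"
  shows "HS \<theta> k m a \<Longrightarrow> HS \<theta> k m (\<lambda>x. a (g x))"
proof (induction k arbitrary: a)
  have b1: "symb UNIV (\<lambda>_. 1) m (\<lambda>x. a (g x))" if a: "symb UNIV (\<lambda>_. 1) m a" for a :: "real^'n \<Rightarrow> real^'n \<Rightarrow> 'x"
    using symb_reparam[OF a, where Q=UNIV and \<phi>=g] by simp
  {
    case 0
    obtain C1 where C1: "C1 \<ge> 0" "\<And>b x. b \<in> Basis \<Longrightarrow> norm (dd b g x) \<le> C1"
      using gradient_bound[OF g(2)] by metis
    define A where "A = real DIM(real^'n) * C1"
    have A: "A \<ge> 0" using C1(1) by (simp add: A_def)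
    have "symb UNIV (\<lambda>q::(real^'n) \<times> (real^'n). norm (g (fst q) - g (snd q)) powr \<theta>) m (\<lambda>q \<eta>. a (g (fst q)) \<eta> - a (g (snd q)) \<eta>)"
      using symb_reparam[OF 0[unfolded HS.simps, THEN conjunct2], where Q=UNIV and \<phi>="\<lambda>q. (g (fst q), g (snd q))"] by simp
    then have "symb UNIV (\<lambda>q::(real^'n) \<times> (real^'n). norm (fst q - snd q) powr \<theta>) m (\<lambda>q \<eta>. a (g (fst q)) \<eta> - a (g (snd q)) \<eta>)"
    proof (rule symb_weaken[where D="A powr \<theta>"])
      fix q :: "(real^'n) \<times> (real^'n)"
      have "norm (g (fst q) - g (snd q)) powr \<theta> \<le> (A * norm (fst q - snd q)) powr \<theta>"
        using lipschitz_of_partials[OF g(1) C1(2), of "fst q" "snd q"] th by (intro powr_mono2) (auto simp: A_def)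
      then show "norm (g (fst q) - g (snd q)) powr \<theta> \<le> A powr \<theta> * norm (fst q - snd q) powr \<theta>"
        using A by (simp add: powr_mult)
    qed auto
    then show ?case using b1[OF HS_symb[OF 0]] by simp
  next
    case (Suc k)
    show ?case
    proof (rule HS_SucI[OF b1[OF HS_symb[OF Suc.prems]]])
      fix b :: "real^'n" assume b: "b \<in> Basis"
      show "((\<lambda>t. a (g (x + t *\<^sub>R b)) \<eta>) has_vector_derivative (\<Sum>c\<in>Basis. (dd b g x \<bullet> c) *\<^sub>R ddy c a (g x) \<eta>)) (at 0)" for x \<eta>
      proof -
        have 1: "((\<lambda>y. a y \<eta>) has_derivative (\<lambda>v. \<Sum>c\<in>Basis. (v \<bullet> c) *\<^sub>R ddy c a (g x) \<eta>)) (at (g (x + 0 *\<^sub>R b)))"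
          using HS_partials_y[OF Suc.prems] by (simp add: partials_def)
        have 2: "((\<lambda>t. g (x + t *\<^sub>R b)) has_derivative (\<lambda>h. h *\<^sub>R dd b g x)) (at 0)"
          using partials_Basis[OF g(1) b, of x 0] by (simp add: has_vector_derivative_def)
        from diff_chain_at[OF 2 1] show ?thesis
          by (simp add: o_def has_vector_derivative_def scaleR_sum_right)
      qed
      show "HS \<theta> k m (\<lambda>x \<eta>. \<Sum>c\<in>Basis. (dd b g x \<bullet> c) *\<^sub>R ddy c a (g x) \<eta>)"
        by (intro HS_sum HS_mult sbd_linear[OF bounded_linear_inner_left] g b Suc.IH HS_ddy[OF Suc.prems])
    qed
  }
qed

end

lemma ddy_Eop:
  fixes a :: "real^'n::finite \<Rightarrow> real^'n \<Rightarrow> 'x::real_normed_vector"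
  assumes th: "0 < \<theta>" "\<theta> < 1" and b: "b \<in> Basis"
  shows "bas L \<Longrightarrow> HS \<theta> (Suc k) m a \<Longrightarrow> ((\<lambda>t. Eop L (a (y + t *\<^sub>R b)) \<eta>) has_vector_derivative Eop L (ddy b a y) \<eta>) (at 0)"
proof (induction L arbitrary: a m)
  case Nil
  then show ?case using HS_derivative[OF Nil(2) b] by simp
next
  case (Cons x L)
  have L: "bas L" and x: "fst x \<in> Basis" using Cons.prems by auto
  have sp: "spoly (a y)" "spoly (ddy b a y)" for y
    using symb_spoly[OF HS_symb[OF Cons.prems(2)] UNIV_I] symb_spoly[OF HS_symb[OF HS_ddy[OF Cons.prems(2) b]] UNIV_I] by auto
  have dd: "ddy b (\<lambda>y. dd (fst x) (a y)) y = dd (fst x) (ddy b a y)" for y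
    by (rule fun_cong[OF ddy_eq[where a="\<lambda>y. dd (fst x) (a y)" and a'="\<lambda>y. dd (fst x) (ddy b a y)", OF ddy_dd[OF th Cons.prems(2) b x]]])
  have "((\<lambda>t. Eop L (a (y + t *\<^sub>R b)) \<eta> + snd x *\<^sub>R Eop L (dd (fst x) (a (y + t *\<^sub>R b))) \<eta>) has_vector_derivative
      Eop L (ddy b a y) \<eta> + snd x *\<^sub>R Eop L (dd (fst x) (ddy b a y)) \<eta>) (at 0)"
    using Cons.IH[OF L HS_dd[OF th x Cons.prems(2)]]
    by (intro has_vector_derivative_add Cons.IH[OF L Cons.prems(2)] bounded_linear.has_vector_derivative[OF bounded_linear_scaleR_right])
      (simp add: dd)
  then show ?case by (simp add: Eop_dd[OF sp(1) L x] Eop_dd[OF sp(2) L x])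
qed

lemma Eop_symb_poly_bound:
  fixes a :: "'p \<Rightarrow> real^'n::finite \<Rightarrow> 'x::real_normed_vector"
  assumes a: "symb P (\<lambda>_. 1) m a"
  obtains A M where "\<And>p \<eta>. p \<in> P \<Longrightarrow> norm (Eop (L4 1) (a p) \<eta>) \<le> A * (1 + norm \<eta>) ^ M" "A \<ge> 0"
proof -
  \<comment> \<open>\<open>Eop_symb_bound\<close> needs an order at least the number of operators.
    Raising the order is harmless here, where any polynomial bound will do.\<close>
  define m' where "m' = max m (real (length (bs4 :: (real^'n) list)))"
  have "symb P (\<lambda>_. 1) m' a" by (rule symb_weaken[OF a, of _ 1]) (auto simp: m'_def)
  from Eop_symb_bound[OF bs4_subset this] obtain C where C: "C \<ge> 0"
    "\<And>p R \<eta>. p \<in> P \<Longrightarrow> R \<ge> 1 \<Longrightarrow> norm (Eop (L4 R) (a p) \<eta>) \<le> C * 1 * (R + norm \<eta>) powr m'"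
    unfolding L4_def[symmetric] by (auto simp: m'_def)
  have "norm (Eop (L4 1) (a p) \<eta>) \<le> C * (1 + norm \<eta>) ^ nat \<lceil>m'\<rceil>" if p: "p \<in> P" for p \<eta>
  proof -
    have "(1 + norm \<eta>) powr m' \<le> (1 + norm \<eta>) powr real (nat \<lceil>m'\<rceil>)"
      by (intro powr_mono) (auto simp: of_nat_ceiling)
    also have "\<dots> = (1 + norm \<eta>) ^ nat \<lceil>m'\<rceil>" by (rule powr_realpow) (simp add: add_pos_nonneg)
    finally show ?thesis using C(2)[OF p, of 1 \<eta>] mult_left_mono[OF _ C(1)] by (fastforce intro: order_trans)
  qed
  then show ?thesis using C(1) that by blast
qed

section \<open>Derivatives and Hoelder regularity of the oscillatory integral in \<open>y\<close>
  and \<xi>\<close>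

context symcalc begin

lemma hadamard_k: "\<kappa> (y + w) - \<kappa> y = (\<Sum>c\<in>Basis. (w \<bullet> c) *\<^sub>R segint 0 (dd c \<kappa>) (y, w))"
  by (rule hadamard[OF partials_k sbd_continuous[OF sbd_k]])

text \<open>The \<xi>-derivative brings down a component of
  \<open>\<kappa> (y + w) - \<kappa> y\<close>, which is a combination of the \<open>w_c\<close> by
  Hadamard's lemma. The result is a sum of integrals of the same kind for the symbols
  \<open>dd c a\<close>, which is how one order is gained.\<close>

lemma bval_xi_derivative:
  assumes a: "spoly a" and \<rho>: "amp \<rho>" and b: "b \<in> Basis"
  shows "((\<lambda>t. bval a \<rho> y (\<xi> + t *\<^sub>R b)) has_vector_derivative
    (\<Sum>c\<in>Basis. bval (dd c a) (\<lambda>z. of_real (segint 0 (dd c \<kappa>) z \<bullet> b) * \<rho> z) y \<xi>)) (at 0)"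
proof -
  obtain M where M: "sbd (\<lambda>\<eta>. (1 + norm \<eta>) ^ M) (Eop (L4 1) a)" using spoly_Eop[OF a bas_L4] unfolding spoly_def by auto
  obtain A where A: "A \<ge> 0" "\<And>\<eta>. norm (Eop (L4 1) a \<eta>) \<le> A * (1 + norm \<eta>) ^ M" using sbd_boundE[OF M] by metis
  have sp0: "spoly (\<lambda>\<eta>. 0 :: 'x)" unfolding spoly_def by (intro exI[of _ 0] sbd_const[of 0]) auto
  have z: "bval (\<lambda>\<eta>. 0) \<rho> y \<xi> = 0" "bval a (\<lambda>z. 0) y \<xi> = 0"
    by (simp_all add: bval_def pair_def Eop_zero[OF bas_L4] zero_left osc_def scaleC.zero_right fourier_def zero_right)
  have "((\<lambda>t. bval a \<rho> (y + t *\<^sub>R 0) (\<xi> + t *\<^sub>R b)) has_vector_derivative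
     bval (\<lambda>\<eta>. 0) \<rho> y \<xi> + (bval a (\<lambda>z. 0) y \<xi> + (\<Sum>c\<in>Basis. bval (dd c a) (\<lambda>z. of_real (segint 0 (dd c \<kappa>) z \<bullet> b) * \<rho> z) y \<xi>))) (at 0)"
  proof (rule bval_has_vector_derivative[where a="\<lambda>_. a" and a'="\<lambda>_ _. 0" and A=A and M=M, OF a sp0])
    show "((\<lambda>s. Eop (L4 1) a \<eta>) has_vector_derivative Eop (L4 1) (\<lambda>_. 0) \<eta>) (at s)" for s \<eta>
      by (simp add: Eop_zero[OF bas_L4])
    show "norm (Eop (L4 1) a \<eta>) \<le> A * (1 + norm \<eta>) ^ M" for \<eta> by (rule A)
    show "norm (Eop (L4 1) (\<lambda>_. 0 :: 'x) \<eta>) \<le> A * (1 + norm \<eta>) ^ M" for \<eta> using A(1) by (simp add: Eop_zero[OF bas_L4])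
    show "norm b \<le> 1" using b by (simp add: norm_Basis)
    show "amp (\<lambda>z. 0)" by (rule sbd_const[of 0]) auto
    show "amp (\<lambda>z. of_real (segint 0 (dd c \<kappa>) z \<bullet> b) * \<rho> z)" if "c \<in> Basis" for c
      by (intro amp_mult amp_inner sbd_segint sbd_k that \<rho>)
    fix s :: real and w :: "real^'n"
    have "((\<lambda>s. phase y (\<xi> + s *\<^sub>R b) w) has_vector_derivative (\<kappa> (y + w) - \<kappa> y) \<bullet> b) (at s)"
      unfolding phase_def inner_add_right by (auto intro!: derivative_eq_intros)
    from has_vector_derivative_mult_right[OF has_vector_derivative_cis[OF this], of "\<rho> (y, w)"]
    show "((\<lambda>s. osc \<rho> (y + s *\<^sub>R 0) (\<xi> + s *\<^sub>R b) w) has_vector_derivative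
       osc (\<lambda>z. 0) (y + s *\<^sub>R 0) (\<xi> + s *\<^sub>R b) w +
       (\<Sum>c\<in>Basis. \<i> * of_real (w \<bullet> c) * osc (\<lambda>z. of_real (segint 0 (dd c \<kappa>) z \<bullet> b) * \<rho> z) (y + s *\<^sub>R 0) (\<xi> + s *\<^sub>R b) w)) (at s)"
      unfolding osc_def hadamard_k
      by (simp add: inner_sum_left sum_distrib_left sum_distrib_right mult_ac)
  qed (rule \<rho>)
  then show ?thesis by (simp add: z)
qed

text \<open>The phase contributes
  \<open>(dd b \<kappa> (y + w) - dd b \<kappa> y) \<bullet> \<xi>\<close>. Hadamard's lemma for
  \<open>dd b \<kappa>\<close> extracts \<open>w_c\<close>, and the derivative of the symbol that it
  becomes makes up for the factor \<xi>.\<close>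

lemma bval_y_derivative:
  assumes a: "\<And>s. \<bar>s\<bar> < 1 \<Longrightarrow> spoly (a s)" "\<And>s. \<bar>s\<bar> < 1 \<Longrightarrow> spoly (a' s)"
    and da: "\<And>s \<eta>. \<bar>s\<bar> < 1 \<Longrightarrow> ((\<lambda>s. Eop (L4 1) (a s) \<eta>) has_vector_derivative Eop (L4 1) (a' s) \<eta>) (at s)"
    and ba: "\<And>s \<eta>. \<bar>s\<bar> < 1 \<Longrightarrow> norm (Eop (L4 1) (a s) \<eta>) \<le> A * (1 + norm \<eta>) ^ M"
      "\<And>s \<eta>. \<bar>s\<bar> < 1 \<Longrightarrow> norm (Eop (L4 1) (a' s) \<eta>) \<le> A * (1 + norm \<eta>) ^ M"
    and \<rho>: "amp \<rho>" and b: "b \<in> Basis"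
  shows "((\<lambda>s. bval (a s) \<rho> (y + s *\<^sub>R b) \<xi>) has_vector_derivative
    bval (a' 0) \<rho> y \<xi> + (bval (a 0) (dd (b, 0) \<rho>) y \<xi> +
    (\<Sum>c\<in>Basis. \<Sum>d\<in>Basis. (\<xi> \<bullet> d) *\<^sub>R bval (dd c (a 0)) (\<lambda>z. of_real (segint 0 (dd c (dd b \<kappa>)) z \<bullet> d) * \<rho> z) y \<xi>))) (at 0)"
proof -
  have sb: "sbd (\<lambda>_. 1) (dd b \<kappa>)" by (rule sbd_k[OF b])
  have am: "amp (\<lambda>z. of_real (segint 0 (dd c (dd b \<kappa>)) z \<bullet> v) * \<rho> z)" if "c \<in> Basis" for c v
    by (intro amp_mult amp_inner sbd_segint sbd_dd[OF sb] that \<rho>)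
  have "((\<lambda>s. bval (a s) \<rho> (y + s *\<^sub>R b) (\<xi> + s *\<^sub>R 0)) has_vector_derivative
    bval (a' 0) \<rho> y \<xi> + (bval (a 0) (dd (b, 0) \<rho>) y \<xi> +
    (\<Sum>c\<in>Basis. bval (dd c (a 0)) (\<lambda>z. of_real (segint 0 (dd c (dd b \<kappa>)) z \<bullet> \<xi>) * \<rho> z) y \<xi>))) (at 0)"
  proof (rule bval_has_vector_derivative[OF a da ba])
    show "amp (dd (b, 0) \<rho>)" by (rule sbd_dd[OF \<rho> Basis_prodI(1)[OF b]])
    show "amp (\<lambda>z. of_real (segint 0 (dd c (dd b \<kappa>)) z \<bullet> \<xi>) * \<rho> z)" if "c \<in> Basis" for c by (rule am[OF that])
    fix s :: real and w :: "real^'n"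
    have "((\<lambda>s. \<kappa> ((y + w) + s *\<^sub>R b) - \<kappa> (y + s *\<^sub>R b)) has_vector_derivative dd b \<kappa> ((y + w) + s *\<^sub>R b) - dd b \<kappa> (y + s *\<^sub>R b)) (at s)"
      by (intro has_vector_derivative_diff k_derivative b)
    from bounded_linear.has_vector_derivative[OF bounded_linear_inner_left this, of \<xi>]
    have p: "((\<lambda>s. phase (y + s *\<^sub>R b) \<xi> w) has_vector_derivative (dd b \<kappa> ((y + s *\<^sub>R b) + w) - dd b \<kappa> (y + s *\<^sub>R b)) \<bullet> \<xi>) (at s)"
      by (simp add: phase_def algebra_simps)
    have r: "((\<lambda>s. \<rho> (y + s *\<^sub>R b, w)) has_vector_derivative dd (b, 0) \<rho> (y + s *\<^sub>R b, w)) (at s)"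
      using has_vector_derivative_line_zero[OF sbd_derivative[OF \<rho> Basis_prodI(1)[OF b]], of "(y, w)" s] by simp
    have h: "dd b \<kappa> (y' + w) - dd b \<kappa> y' = (\<Sum>c\<in>Basis. (w \<bullet> c) *\<^sub>R segint 0 (dd c (dd b \<kappa>)) (y', w))" for y'
      by (rule hadamard[OF sbd_partials[OF sb] sbd_continuous[OF sbd_dd[OF sb]]])
    from has_vector_derivative_mult[OF r has_vector_derivative_cis[OF p]]
    show "((\<lambda>s. osc \<rho> (y + s *\<^sub>R b) (\<xi> + s *\<^sub>R 0) w) has_vector_derivative
       osc (dd (b, 0) \<rho>) (y + s *\<^sub>R b) (\<xi> + s *\<^sub>R 0) w +
       (\<Sum>c\<in>Basis. \<i> * of_real (w \<bullet> c) * osc (\<lambda>z. of_real (segint 0 (dd c (dd b \<kappa>)) z \<bullet> \<xi>) * \<rho> z) (y + s *\<^sub>R b) (\<xi> + s *\<^sub>R 0) w)) (at s)"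
      unfolding osc_def h
      by (simp add: inner_sum_left sum_distrib_left sum_distrib_right mult_ac add.commute)
  qed (use \<rho> in auto)
  \<comment> \<open>The amplitude coming from the phase still contains \<xi>; linearity pulls its
    coordinates out, leaving amplitudes that depend on \<open>(y, w)\<close> alone.\<close>
  moreover have "bval (dd c (a 0)) (\<lambda>z. of_real (segint 0 (dd c (dd b \<kappa>)) z \<bullet> \<xi>) * \<rho> z) y \<xi> =
     (\<Sum>d\<in>Basis. (\<xi> \<bullet> d) *\<^sub>R bval (dd c (a 0)) (\<lambda>z. of_real (segint 0 (dd c (dd b \<kappa>)) z \<bullet> d) * \<rho> z) y \<xi>)"
    if c: "c \<in> Basis" for c
  proof -
    let ?\<sigma> = "\<lambda>d z. of_real (segint 0 (dd c (dd b \<kappa>)) z \<bullet> d) * \<rho> z"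
    have "osc (?\<sigma> \<xi>) y \<xi> w = (\<Sum>d\<in>Basis. (\<xi> \<bullet> d) *\<^sub>R osc (?\<sigma> d) y \<xi> w)" for w
    proof -
      have "segint 0 (dd c (dd b \<kappa>)) (y, w) \<bullet> \<xi> = (\<Sum>d\<in>Basis. (\<xi> \<bullet> d) * (segint 0 (dd c (dd b \<kappa>)) (y, w) \<bullet> d))"
        by (subst euclidean_inner) (simp add: mult.commute)
      then show ?thesis
        by (simp add: osc_def scaleR_conv_of_real sum_distrib_left sum_distrib_right mult_ac)
    qed
    then have "bval (dd c (a 0)) (?\<sigma> \<xi>) y \<xi> = pair (L4 1) (dd c (a 0)) (\<lambda>w. \<Sum>d\<in>Basis. (\<xi> \<bullet> d) *\<^sub>R osc (?\<sigma> d) y \<xi> w)"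
      unfolding bval_def by presburger
    also have "\<dots> = (\<Sum>d\<in>Basis. (\<xi> \<bullet> d) *\<^sub>R bval (dd c (a 0)) (?\<sigma> d) y \<xi>)"
      unfolding bval_def
    proof (subst pair_sum_right[OF spoly_dd[OF a(1) c] bas_L4])
      show "sbd wt (\<lambda>w. Wt (L4 1) w *\<^sub>C (\<xi> \<bullet> d) *\<^sub>R osc (?\<sigma> d) y \<xi> w)" for d
        unfolding scaleC_scaleR by (rule sbd_linear[OF bounded_linear_scaleR_right sbd_Wt_osc'[OF am[OF c]]])
    qed (auto intro!: sum.cong pair_scaleR_right sbd_Wt_osc' am c)
    finally show ?thesis .
  qed
  ultimately show ?thesis by simp
qed

text \<open>A \<xi>-derivative changes the symbol and the amplitude together, so
  \<open>symb_of_values\<close> is run over pairs of both.\<close>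

lemma bval_symb:
  assumes "symb P c m a" "amp \<rho>"
  shows "symb (P \<times> UNIV) (\<lambda>q. c (fst q)) m (\<lambda>q. bval (a (fst q)) \<rho> (snd q))"
proof (rule symb_of_values[where A="\<lambda>m (a, \<rho>). symb P c m a \<and> amp \<rho>" and a="(a, \<rho>)" and F="\<lambda>(a, \<rho>) q. bval (a (fst q)) \<rho> (snd q)"
      and I=Basis and \<Phi>="\<lambda>k b (a, \<rho>). (\<lambda>p. dd k (a p), \<lambda>z. of_real (segint 0 (dd k \<kappa>) z \<bullet> b) * \<rho> z)", unfolded prod.case])
  show "0 \<le> c (fst q)" if "q \<in> P \<times> (UNIV :: (real^'n) set)" for q using symb_nonneg[OF assms(1)] that by auto
  show "\<exists>C\<ge>0. \<forall>q\<in>P \<times> UNIV. \<forall>\<xi>. norm ((case aa of (a, \<rho>) \<Rightarrow> \<lambda>q. bval (a (fst q)) \<rho> (snd q)) q \<xi>) \<le> C * (c (fst q) * japanese_bracket \<xi> powr m)"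
    if "case aa of (a, \<rho>) \<Rightarrow> symb P c m a \<and> amp \<rho>" for m aa
    using bval_bound[of P c m "fst aa" "snd aa"] that by (force simp: case_prod_unfold)
  show "((\<lambda>t. (case aa of (a, \<rho>) \<Rightarrow> \<lambda>q. bval (a (fst q)) \<rho> (snd q)) q (\<xi> + t *\<^sub>R b)) has_vector_derivative
      (\<Sum>k\<in>Basis. (case case aa of (a, \<rho>) \<Rightarrow> (\<lambda>p. dd k (a p), \<lambda>z. of_real (segint 0 (dd k \<kappa>) z \<bullet> b) * \<rho> z) of (a, \<rho>) \<Rightarrow> \<lambda>q. bval (a (fst q)) \<rho> (snd q)) q \<xi>)) (at 0)"
    if "case aa of (a, \<rho>) \<Rightarrow> symb P c m a \<and> amp \<rho>" "b \<in> Basis" "q \<in> P \<times> UNIV" for m aa b q \<xi>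
    using that by (auto simp: case_prod_unfold intro!: bval_xi_derivative symb_spoly)
  show "case case aa of (a, \<rho>) \<Rightarrow> (\<lambda>p. dd k (a p), \<lambda>z. of_real (segint 0 (dd k \<kappa>) z \<bullet> b) * \<rho> z) of (a, \<rho>) \<Rightarrow> symb P c (m - 1) a \<and> amp \<rho>"
    if "case aa of (a, \<rho>) \<Rightarrow> symb P c m a \<and> amp \<rho>" "b \<in> Basis" "k \<in> Basis" for m aa b k
    using that by (auto simp: case_prod_unfold intro!: symb_dd amp_mult amp_inner sbd_segint sbd_k)
qed (use assms in simp)

text \<open>The part of the \<open>y\<close>-derivative that comes from amplitude and phase, with
  the symbol held fixed. Its order is that of \<open>a\<close>: the factor
  \<open>\<xi> \<bullet> d\<close> is offset by the derivative \<open>dd c a\<close>.\<close>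

definition bval_dy where
  "bval_dy b a \<rho> y \<xi> = bval a (dd (b, 0) \<rho>) y \<xi> +
    (\<Sum>c\<in>Basis. \<Sum>d\<in>Basis. (\<xi> \<bullet> d) *\<^sub>R bval (dd c a) (\<lambda>z. of_real (segint 0 (dd c (dd b \<kappa>)) z \<bullet> d) * \<rho> z) y \<xi>)"

lemma bval_frozen_derivative:
  assumes a: "spoly a" and \<rho>: "amp \<rho>" and b: "b \<in> Basis"
  shows "((\<lambda>s. bval a \<rho> (y + s *\<^sub>R b) \<xi>) has_vector_derivative bval_dy b a \<rho> y \<xi>) (at 0)"
proof -
  obtain M where M: "sbd (\<lambda>\<eta>. (1 + norm \<eta>) ^ M) (Eop (L4 1) a)" using spoly_Eop[OF a bas_L4] unfolding spoly_def by auto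
  obtain A where A: "A \<ge> 0" "\<And>\<eta>. norm (Eop (L4 1) a \<eta>) \<le> A * (1 + norm \<eta>) ^ M" using sbd_boundE[OF M] by metis
  have sp0: "spoly (\<lambda>\<eta>. 0 :: 'x)" unfolding spoly_def by (intro exI[of _ 0] sbd_const[of 0]) auto
  have z: "bval (\<lambda>\<eta>. 0) \<rho> y \<xi> = 0"
    by (simp add: bval_def pair_def Eop_zero[OF bas_L4] zero_left)
  show ?thesis
    using bval_y_derivative[where a="\<lambda>_. a" and a'="\<lambda>_ _. 0" and A=A and M=M, OF a sp0 _ _ _ \<rho> b, of y \<xi>] A
    by (simp add: Eop_zero[OF bas_L4] z bval_dy_def)
qed

lemma bval_dy_bound:
  assumes a: "symb P c m a" and \<rho>: "amp \<rho>" and b: "b \<in> Basis"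
  shows "\<exists>C\<ge>0. \<forall>q\<in>P \<times> UNIV \<times> UNIV. norm (case q of (p, y, \<xi>) \<Rightarrow> bval_dy b (a p) \<rho> y \<xi>)
    \<le> C * (case q of (p, y, \<xi>) \<Rightarrow> c p * japanese_bracket \<xi> powr m)"
proof -
  have sb: "sbd (\<lambda>_. 1) (dd b \<kappa>)" by (rule sbd_k[OF b])
  have am: "amp (\<lambda>z. of_real (segint 0 (dd c (dd b \<kappa>)) z \<bullet> v) * \<rho> z)" if "c \<in> Basis" for c v
    by (intro amp_mult amp_inner sbd_segint sbd_dd[OF sb] that \<rho>)
  have 1: "\<exists>C\<ge>0. \<forall>q\<in>P \<times> UNIV \<times> UNIV. norm ((snd (snd q) \<bullet> d) *\<^sub>R (case q of (p, y, \<xi>) \<Rightarrow> bval (dd k (a p)) (\<lambda>z. of_real (segint 0 (dd k (dd b \<kappa>)) z \<bullet> d) * \<rho> z) y \<xi>))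
    \<le> C * (case q of (p, y, \<xi>) \<Rightarrow> c p * japanese_bracket \<xi> powr m)" if k: "k \<in> Basis" and d: "d \<in> Basis" for k d
  proof -
    obtain C where C: "C \<ge> 0" "\<forall>q\<in>P \<times> UNIV \<times> UNIV. norm (case q of (p, y, \<xi>) \<Rightarrow> bval (dd k (a p)) (\<lambda>z. of_real (segint 0 (dd k (dd b \<kappa>)) z \<bullet> d) * \<rho> z) y \<xi>)
      \<le> C * (case q of (p, y, \<xi>) \<Rightarrow> c p * japanese_bracket \<xi> powr (m - 1))"
      using bval_bound[OF symb_dd[OF a k] am[OF k]] by blast
    have "norm ((\<xi> \<bullet> d) *\<^sub>R bval (dd k (a p)) (\<lambda>z. of_real (segint 0 (dd k (dd b \<kappa>)) z \<bullet> d) * \<rho> z) y \<xi>) \<le> C * (c p * japanese_bracket \<xi> powr m)"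
      if p: "p \<in> P" for p y \<xi>
    proof -
      have "\<bar>\<xi> \<bullet> d\<bar> * norm (bval (dd k (a p)) (\<lambda>z. of_real (segint 0 (dd k (dd b \<kappa>)) z \<bullet> d) * \<rho> z) y \<xi>) \<le> japanese_bracket \<xi> * (C * (c p * japanese_bracket \<xi> powr (m - 1)))"
        using C(2) p order_trans[OF Basis_le_norm[OF d] norm_le_jb] by (intro mult_mono) auto
      also have "\<dots> = C * (c p * (japanese_bracket \<xi> * japanese_bracket \<xi> powr (m - 1)))" by simp
      also have "japanese_bracket \<xi> * japanese_bracket \<xi> powr (m - 1) = japanese_bracket \<xi> powr m"
        using powr_add[of "japanese_bracket \<xi>" 1 "m - 1"] by simp
      finally show ?thesis by simp
    qed
    then show ?thesis using C(1) by auto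
  qed
  have "\<exists>C\<ge>0. \<forall>q\<in>P \<times> UNIV \<times> UNIV. norm ((case q of (p, y, \<xi>) \<Rightarrow> bval (a p) (dd (b, 0) \<rho>) y \<xi>) + (\<Sum>k\<in>Basis. \<Sum>d\<in>Basis.
     (snd (snd q) \<bullet> d) *\<^sub>R (case q of (p, y, \<xi>) \<Rightarrow> bval (dd k (a p)) (\<lambda>z. of_real (segint 0 (dd k (dd b \<kappa>)) z \<bullet> d) * \<rho> z) y \<xi>)))
    \<le> C * (case q of (p, y, \<xi>) \<Rightarrow> c p * japanese_bracket \<xi> powr m)"
    by (intro bounded_family_add bounded_family_sum bval_bound a sbd_dd[OF \<rho> Basis_prodI(1)[OF b]] 1)
  then show ?thesis by (simp add: bval_dy_def case_prod_unfold)
qed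

lemma bval_continuous_y:
  assumes a: "spoly a" "symb {()} c m (\<lambda>_. a)" and \<rho>: "amp \<rho>"
  shows "continuous_on UNIV (\<lambda>y. bval a \<rho> y \<xi>)"
proof -
  have "\<exists>C\<ge>0. \<forall>b\<in>Basis. \<forall>y\<in>UNIV. norm (bval_dy b a \<rho> y \<xi>) \<le> C * (c () * japanese_bracket \<xi> powr m)"
  proof (rule finite_uniform_bound[OF finite_Basis])
    fix b :: "real^'n" assume "b \<in> Basis"
    from bval_dy_bound[OF a(2) \<rho> this]
    show "\<exists>C\<ge>0. \<forall>y\<in>UNIV. norm (bval_dy b a \<rho> y \<xi>) \<le> C * (c () * japanese_bracket \<xi> powr m)" by force
  qed (use symb_nonneg[OF a(2)] in simp)
  then obtain C where C: "\<And>b y. b \<in> Basis \<Longrightarrow> norm (bval_dy b a \<rho> y \<xi>) \<le> C * (c () * japanese_bracket \<xi> powr m)" by auto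
  show ?thesis
    by (rule continuous_of_bounded_partials[OF bval_frozen_derivative[OF a(1) \<rho>] C]) simp_all
qed

lemma bval_dy_continuous:
  assumes a: "symb {()} c m (\<lambda>_. a)" and \<rho>: "amp \<rho>" and b: "b \<in> Basis"
  shows "continuous_on UNIV (\<lambda>y. bval_dy b a \<rho> y \<xi>)"
proof -
  have sb: "sbd (\<lambda>_. 1) (dd b \<kappa>)" by (rule sbd_k[OF b])
  have am: "amp (\<lambda>z. of_real (segint 0 (dd c (dd b \<kappa>)) z \<bullet> v) * \<rho> z)" if "c \<in> Basis" for c v
    by (intro amp_mult amp_inner sbd_segint sbd_dd[OF sb] that \<rho>)
  note dka = symb_dd[OF a]
  show ?thesis
    unfolding bval_dy_def
    by (intro continuous_on_add continuous_on_sum continuous_on_scaleR continuous_on_const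
        bval_continuous_y[OF symb_spoly[OF a] a] bval_continuous_y[OF symb_spoly[OF dka] dka]
        sbd_dd[OF \<rho> Basis_prodI(1)[OF b]] am) auto
qed

text \<open>With the symbol fixed the integral is differentiable in \<open>y\<close>, with value and
  derivative of the same order, so a Lipschitz estimate is available even for a symbol that is not
  differentiable in its point.\<close>

lemma bval_diff_bound:
  assumes a: "symb P c m a" and \<rho>: "amp \<rho>" and th: "0 < \<theta>" "\<theta> < 1"
  shows "\<exists>C\<ge>0. \<forall>q\<in>P \<times> UNIV \<times> UNIV. \<forall>\<xi>. norm (bval (a (fst q)) \<rho> (fst (snd q)) \<xi> - bval (a (fst q)) \<rho> (snd (snd q)) \<xi>)
    \<le> C * (c (fst q) * norm (fst (snd q) - snd (snd q)) powr \<theta> * japanese_bracket \<xi> powr m)"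
proof -
  have "\<exists>C\<ge>0. \<forall>b\<in>Basis. \<forall>q\<in>P \<times> UNIV \<times> UNIV. norm (case q of (p, y, \<xi>) \<Rightarrow> bval_dy b (a p) \<rho> y \<xi>)
    \<le> C * (case q of (p, y, \<xi>) \<Rightarrow> c p * japanese_bracket \<xi> powr m)"
    by (rule finite_uniform_bound[OF finite_Basis bval_dy_bound[OF a \<rho>]]) (use symb_nonneg[OF a] in \<open>auto intro!: mult_nonneg_nonneg\<close>)
  then obtain C1 where C1: "C1 \<ge> 0" "\<And>b p y \<xi>. b \<in> Basis \<Longrightarrow> p \<in> P \<Longrightarrow> norm (bval_dy b (a p) \<rho> y \<xi>) \<le> C1 * (c p * japanese_bracket \<xi> powr m)"
    by fastforce
  obtain C2 where C2: "C2 \<ge> 0" "\<And>p y \<xi>. p \<in> P \<Longrightarrow> norm (bval (a p) \<rho> y \<xi>) \<le> C2 * (c p * japanese_bracket \<xi> powr m)"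
    using bval_bound[OF a \<rho>] by fastforce
  define C where "C = max (real DIM(real^'n) * C1) C2"
  have "norm (bval (a p) \<rho> y \<xi> - bval (a p) \<rho> y' \<xi>) \<le> 2 * C * (c p * norm (y - y') powr \<theta> * japanese_bracket \<xi> powr m)" if p: "p \<in> P" for p y y' \<xi>
  proof -
    let ?J = "c p * japanese_bracket \<xi> powr m"
    have ap: "symb {()} (\<lambda>_. c p) m (\<lambda>_. a p)"
      using symb_reparam[OF a, where Q="{()}" and \<phi>="\<lambda>_. p"] p by simp
    have pt: "partials (\<lambda>y. bval (a p) \<rho> y \<xi>) (\<lambda>b y. bval_dy b (a p) \<rho> y \<xi>)"
      by (rule partialsI[OF bval_frozen_derivative[OF symb_spoly[OF a p] \<rho>] bval_dy_continuous[OF ap \<rho>]])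
    have "norm (bval (a p) \<rho> y \<xi> - bval (a p) \<rho> y' \<xi>) \<le> real DIM(real^'n) * (C1 * ?J) * norm (y - y')"
      by (rule lipschitz_of_partials[OF pt C1(2)[OF _ p]])
    also have "\<dots> \<le> (C * ?J) * norm (y - y')"
      using symb_nonneg[OF a p] by (intro mult_right_mono) (auto simp: C_def mult.assoc[symmetric] intro!: mult_right_mono)
    finally have "norm (bval (a p) \<rho> y \<xi> - bval (a p) \<rho> y' \<xi>) \<le> 2 * (C * ?J) * norm (y - y') powr \<theta>"
      using symb_nonneg[OF a p] by (intro holder_of_lipschitz[OF th]) (auto simp: C_def intro!: order_trans[OF C2(2)[OF p]] mult_right_mono)
    then show ?thesis by (simp add: mult_ac)
  qed
  moreover have "C \<ge> 0" using C2(1) by (simp add: C_def)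
  ultimately show ?thesis by (intro exI[of _ "2 * C"]) auto
qed

lemma bval_diff_symb:
  assumes "symb P c m a" "amp \<rho>" and th: "0 < \<theta>" "\<theta> < 1"
  shows "symb (P \<times> UNIV \<times> UNIV) (\<lambda>q. c (fst q) * norm (fst (snd q) - snd (snd q)) powr \<theta>) m
    (\<lambda>q \<xi>. bval (a (fst q)) \<rho> (fst (snd q)) \<xi> - bval (a (fst q)) \<rho> (snd (snd q)) \<xi>)"
proof (rule symb_of_values[where A="\<lambda>m (a, \<rho>). symb P c m a \<and> amp \<rho>" and a="(a, \<rho>)" and F="\<lambda>(a, \<rho>) q \<xi>. bval (a (fst q)) \<rho> (fst (snd q)) \<xi> - bval (a (fst q)) \<rho> (snd (snd q)) \<xi>"
      and I=Basis and \<Phi>="\<lambda>k b (a, \<rho>). (\<lambda>p. dd k (a p), \<lambda>z. of_real (segint 0 (dd k \<kappa>) z \<bullet> b) * \<rho> z)", unfolded prod.case])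
  show "0 \<le> c (fst q) * norm (fst (snd q) - snd (snd q)) powr \<theta>" if "q \<in> P \<times> (UNIV :: (real^'n) set) \<times> (UNIV :: (real^'n) set)" for q
    using symb_nonneg[OF assms(1)] that by auto
  show "\<exists>C\<ge>0. \<forall>q\<in>P \<times> UNIV \<times> UNIV. \<forall>\<xi>. norm ((case aa of (a, \<rho>) \<Rightarrow> \<lambda>q \<xi>. bval (a (fst q)) \<rho> (fst (snd q)) \<xi> - bval (a (fst q)) \<rho> (snd (snd q)) \<xi>) q \<xi>)
      \<le> C * (c (fst q) * norm (fst (snd q) - snd (snd q)) powr \<theta> * japanese_bracket \<xi> powr m)"
    if "case aa of (a, \<rho>) \<Rightarrow> symb P c m a \<and> amp \<rho>" for m aa
    using bval_diff_bound[of P c m "fst aa" "snd aa", OF _ _ th] that by (simp add: case_prod_unfold)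
  show "((\<lambda>t. (case aa of (a, \<rho>) \<Rightarrow> \<lambda>q \<xi>. bval (a (fst q)) \<rho> (fst (snd q)) \<xi> - bval (a (fst q)) \<rho> (snd (snd q)) \<xi>) q (\<xi> + t *\<^sub>R b)) has_vector_derivative
      (\<Sum>k\<in>Basis. (case case aa of (a, \<rho>) \<Rightarrow> (\<lambda>p. dd k (a p), \<lambda>z. of_real (segint 0 (dd k \<kappa>) z \<bullet> b) * \<rho> z) of (a, \<rho>) \<Rightarrow> \<lambda>q \<xi>. bval (a (fst q)) \<rho> (fst (snd q)) \<xi> - bval (a (fst q)) \<rho> (snd (snd q)) \<xi>) q \<xi>)) (at 0)"
    if "case aa of (a, \<rho>) \<Rightarrow> symb P c m a \<and> amp \<rho>" "b \<in> Basis" "q \<in> P \<times> UNIV \<times> UNIV" for m aa b q \<xi>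
    using that by (auto simp: case_prod_unfold sum_subtractf intro!: has_vector_derivative_diff bval_xi_derivative symb_spoly)
  show "case case aa of (a, \<rho>) \<Rightarrow> (\<lambda>p. dd k (a p), \<lambda>z. of_real (segint 0 (dd k \<kappa>) z \<bullet> b) * \<rho> z) of (a, \<rho>) \<Rightarrow> symb P c (m - 1) a \<and> amp \<rho>"
    if "case aa of (a, \<rho>) \<Rightarrow> symb P c m a \<and> amp \<rho>" "b \<in> Basis" "k \<in> Basis" for m aa b k
    using that by (auto simp: case_prod_unfold intro!: symb_dd amp_mult amp_inner sbd_segint sbd_k)
qed (use assms in simp)

lemma bval_diff_left:
  assumes "spoly a" "spoly a'" "amp \<rho>"
  shows "bval (\<lambda>\<eta>. a \<eta> - a' \<eta>) \<rho> y \<xi> = bval a \<rho> y \<xi> - bval a' \<rho> y \<xi>"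
proof -
  have "bval (\<lambda>\<eta>. a \<eta> + (- 1) *\<^sub>R a' \<eta>) \<rho> y \<xi> = bval a \<rho> y \<xi> + (- 1) *\<^sub>R bval a' \<rho> y \<xi>"
    unfolding bval_def using assms
    by (subst pair_add_left[OF _ spoly_scaleR bas_L4 sbd_Wt_osc']) (simp_all only: pair_scaleR_left bas_L4)
  then show ?thesis by simp
qed

text \<open>At level \<open>0\<close> the difference between two points splits into the difference
  of the symbols at one base point, controlled by the Hoelder hypothesis, and the difference of base
  points for one symbol, controlled by \<open>bval_diff_symb\<close>. At higher levels the
  \<open>y\<close>-derivative consists of integrals of the same kind with other symbols and
  amplitudes, hence the induction varies both.\<close>

lemma bval_HS:
  assumes th: "0 < \<theta>" "\<theta> < 1"
  shows "HS \<theta> k m a \<Longrightarrow> amp \<rho> \<Longrightarrow> HS \<theta> k m (\<lambda>y. bval (a y) \<rho> y)"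
proof (induction k arbitrary: m a \<rho>)
  have b1: "symb UNIV (\<lambda>_. 1) m (\<lambda>y. bval (a y) \<rho> y)" if "symb UNIV (\<lambda>_. 1) m a" "amp \<rho>" for m a \<rho>
    using symb_reparam[OF bval_symb[OF that], where Q=UNIV and \<phi>="\<lambda>y. (y, y)"] by simp
  {
    case 0
    let ?w = "\<lambda>q::(real^'n) \<times> (real^'n). norm (fst q - snd q) powr \<theta>"
    have "symb UNIV ?w m (\<lambda>q \<xi>. bval (\<lambda>\<eta>. a (fst q) \<eta> - a (snd q) \<eta>) \<rho> (fst q) \<xi>)"
      using symb_reparam[OF bval_symb[OF 0(1)[unfolded HS.simps, THEN conjunct2] 0(2)], where Q=UNIV and \<phi>="\<lambda>q. (q, fst q)"] by simp
    moreover have "symb UNIV ?w m (\<lambda>q \<xi>. bval (a (snd q)) \<rho> (fst q) \<xi> - bval (a (snd q)) \<rho> (snd q) \<xi>)"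
      using symb_reparam[OF bval_diff_symb[OF HS_symb[OF 0(1)] 0(2) th], where Q=UNIV and \<phi>="\<lambda>q. (snd q, q)"] by simp
    ultimately have "symb UNIV ?w m (\<lambda>q \<xi>. bval (\<lambda>\<eta>. a (fst q) \<eta> - a (snd q) \<eta>) \<rho> (fst q) \<xi> + (bval (a (snd q)) \<rho> (fst q) \<xi> - bval (a (snd q)) \<rho> (snd q) \<xi>))"
      by (rule symb_add)
    moreover have "bval (\<lambda>\<eta>. a (fst q) \<eta> - a (snd q) \<eta>) \<rho> (fst q) \<xi> + (bval (a (snd q)) \<rho> (fst q) \<xi> - bval (a (snd q)) \<rho> (snd q) \<xi>)
        = bval (a (fst q)) \<rho> (fst q) \<xi> - bval (a (snd q)) \<rho> (snd q) \<xi>" for q \<xi>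
      by (simp add: bval_diff_left[OF symb_spoly[OF HS_symb[OF 0(1)] UNIV_I] symb_spoly[OF HS_symb[OF 0(1)] UNIV_I] 0(2)])
    ultimately show ?case using b1[OF HS_symb[OF 0(1)] 0(2)] by simp
  next
    case (Suc k)
    note sa = HS_symb[OF Suc.prems(1)]
    show ?case
    proof (rule HS_SucI[OF b1[OF sa Suc.prems(2)]])
      fix b :: "real^'n" assume b: "b \<in> Basis"
      note sa' = HS_symb[OF HS_ddy[OF Suc.prems(1) b]]
      show "((\<lambda>t. bval (a (y + t *\<^sub>R b)) \<rho> (y + t *\<^sub>R b) \<eta>) has_vector_derivative bval (ddy b a y) \<rho> y \<eta> + bval_dy b (a y) \<rho> y \<eta>) (at 0)" for y \<eta>
      proof -
        obtain A1 M1 where A1: "\<And>p \<eta>. p \<in> UNIV \<Longrightarrow> norm (Eop (L4 1) (a p) \<eta>) \<le> A1 * (1 + norm \<eta>) ^ M1" "A1 \<ge> 0"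
          using Eop_symb_poly_bound[OF sa] by metis
        obtain A2 M2 where A2: "\<And>p \<eta>. p \<in> UNIV \<Longrightarrow> norm (Eop (L4 1) (ddy b a p) \<eta>) \<le> A2 * (1 + norm \<eta>) ^ M2" "A2 \<ge> 0"
          using Eop_symb_poly_bound[OF sa'] by metis
        have mono: "A' * (1 + norm \<eta>) ^ M' \<le> max A1 A2 * (1 + norm \<eta>) ^ max M1 M2" if "0 \<le> A'" "A' \<le> max A1 A2" "M' \<le> max M1 M2" for A' M' and \<eta> :: "real^'n"
          using that by (intro mult_mono power_increasing) auto
        have "((\<lambda>t. bval (a (y + t *\<^sub>R b)) \<rho> (y + t *\<^sub>R b) \<eta>) has_vector_derivative
           bval (ddy b a (y + 0 *\<^sub>R b)) \<rho> y \<eta> + (bval (a (y + 0 *\<^sub>R b)) (dd (b, 0) \<rho>) y \<eta> +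
    (\<Sum>c\<in>Basis. \<Sum>d\<in>Basis. (\<eta> \<bullet> d) *\<^sub>R bval (dd c (a (y + 0 *\<^sub>R b))) (\<lambda>z. of_real (segint 0 (dd c (dd b \<kappa>)) z \<bullet> d) * \<rho> z) y \<eta>))) (at 0)"
        proof (rule bval_y_derivative[where A="max A1 A2" and M="max M1 M2"])
          show "((\<lambda>s. Eop (L4 1) (a (y + s *\<^sub>R b)) \<eta>) has_vector_derivative Eop (L4 1) (ddy b a (y + s *\<^sub>R b)) \<eta>) (at s)" for s \<eta>
            by (rule has_vector_derivative_line_zero[where F="\<lambda>y. Eop (L4 1) (a y) \<eta>", OF ddy_Eop[OF th b bas_L4 Suc.prems(1)]])
          show "norm (Eop (L4 1) (a (y + s *\<^sub>R b)) \<eta>) \<le> max A1 A2 * (1 + norm \<eta>) ^ max M1 M2" for s \<eta>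
            by (rule order_trans[OF A1(1)[OF UNIV_I] mono]) (use A1(2) in auto)
          show "norm (Eop (L4 1) (ddy b a (y + s *\<^sub>R b)) \<eta>) \<le> max A1 A2 * (1 + norm \<eta>) ^ max M1 M2" for s \<eta>
            by (rule order_trans[OF A2(1)[OF UNIV_I] mono]) (use A2(2) in auto)
        qed (auto intro: symb_spoly[OF sa] symb_spoly[OF sa'] Suc.prems b)
        then show ?thesis by (simp add: bval_dy_def)
      qed
      have sb: "sbd (\<lambda>_. 1) (dd b \<kappa>)" by (rule sbd_k[OF b])
      have am: "amp (\<lambda>z. of_real (segint 0 (dd c (dd b \<kappa>)) z \<bullet> v) * \<rho> z)" if "c \<in> Basis" for c v
        by (intro amp_mult amp_inner sbd_segint sbd_dd[OF sb] that Suc.prems)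
      have a: "HS \<theta> k m a" by (rule HS_Suc_D[OF th Suc.prems(1)])
      have "HS \<theta> k (m - 1 + 1) (\<lambda>y \<eta>. (\<eta> \<bullet> d) *\<^sub>R bval (dd c (a y)) (\<lambda>z. of_real (segint 0 (dd c (dd b \<kappa>)) z \<bullet> d) * \<rho> z) y \<eta>)"
        if "c \<in> Basis" "d \<in> Basis" for c d
        by (rule HS_coord[OF that(2) Suc.IH[OF HS_dd[OF th that(1) a] am[OF that(1)]]])
      then show "HS \<theta> k m (\<lambda>y \<eta>. bval (ddy b a y) \<rho> y \<eta> + bval_dy b (a y) \<rho> y \<eta>)"
        unfolding bval_dy_def
        by (intro HS_add HS_sum Suc.IH HS_ddy[OF Suc.prems(1) b] a Suc.prems(2) sbd_dd[OF Suc.prems(2) Basis_prodI(1)[OF b]]) simp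
    qed
  }
qed

end

section \<open>Fourier inversion\<close>

lemma gauss_has_integral:
  "((\<lambda>w::'e::euclidean_space. exp (- (norm w)\<^sup>2 / 2)) has_integral sqrt (2 * pi) ^ DIM('e)) UNIV"
proof -
  let ?c = "sqrt (2 * pi)"
  have c: "?c > 0" by simp
  have nn: "(\<integral>\<^sup>+t. ennreal (std_normal_density t) \<partial>lborel) = 1"
    by (subst nn_integral_eq_integral) auto
  have eq: "(\<Prod>b\<in>Basis. std_normal_density (w \<bullet> b)) = inverse (?c ^ DIM('e)) * exp (- (norm w)\<^sup>2 / 2)" for w :: 'e
  proof -
    have "(norm w)\<^sup>2 = (\<Sum>b\<in>Basis. (w \<bullet> b)\<^sup>2)"
      unfolding power2_norm_eq_inner by (subst euclidean_inner) (simp add: power2_eq_square)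
    then have "- (norm w)\<^sup>2 / 2 = (\<Sum>b\<in>Basis. - (w \<bullet> b)\<^sup>2 / 2)"
      by (simp add: sum_negf sum_divide_distrib[symmetric])
    then have "exp (- (norm w)\<^sup>2 / 2) = (\<Prod>b\<in>Basis. exp (- (w \<bullet> b)\<^sup>2 / 2))"
      by (simp only: exp_sum[OF finite_Basis])
    then show ?thesis
      unfolding std_normal_density_def prod.distrib by (simp only: prod_constant power_one_over inverse_eq_divide)
  qed
  have "((\<lambda>w::'e. \<Prod>b\<in>Basis. std_normal_density (w \<bullet> b)) has_integral 1) UNIV"
  proof (rule nn_integral_has_integral)
    have "(\<integral>\<^sup>+w. ennreal (\<Prod>b\<in>Basis. std_normal_density (w \<bullet> b)) \<partial>(lborel :: 'e measure)) = (\<Prod>b\<in>(Basis::'e set). (\<integral>\<^sup>+x. ennreal (std_normal_density x) \<partial>lborel))"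
      by (subst nn_integral_lborel_prod[symmetric]) (auto simp: prod_ennreal)
    then show "(\<integral>\<^sup>+w. ennreal (\<Prod>b\<in>Basis. std_normal_density (w \<bullet> b)) \<partial>(lborel :: 'e measure)) = ennreal 1"
      by (simp add: nn)
  qed (auto intro!: prod_nonneg borel_measurable_prod measurable_compose[OF _ borel_measurable_normal_density])
  from has_integral_mult_right[OF this, of "?c ^ DIM('e)"] show ?thesis
    using c unfolding eq by (simp add: mult.assoc[symmetric])
qed

lemma gauss_decay:
  obtains C where "C \<ge> 0" "\<And>w::'e::euclidean_space. (1 + norm w) ^ N * exp (- (norm w)\<^sup>2 / 2) \<le> C * (wt w)\<^sup>2"
proof -
  \<comment> \<open>The exponent contains \<open>2 * DIM('e)\<close> powers for each of the two
    factors \<open>wt w\<close>, by \<open>wt_ge\<close>. The factor \<open>fact M\<close> below is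
    the coefficient in the exponential series.\<close>
  define M where "M = N + 2 * (2 * DIM('e))"
  have "(1 + norm w) ^ N * exp (- (norm w)\<^sup>2 / 2) \<le> fact M * exp (3/2) * (wt w)\<^sup>2" for w :: 'e
  proof -
    define r where "r = 1 + norm w"
    have "r ^ M / fact M \<le> exp r"
    proof -
      have "(\<Sum>i\<in>{M}. r ^ i /\<^sub>R fact i) \<le> (\<Sum>i. r ^ i /\<^sub>R fact i)"
        by (rule sum_le_suminf) (auto simp: r_def summable_exp)
      then show ?thesis by (simp add: exp_def divide_inverse mult.commute)
    qed
    \<comment> \<open>\<open>1 + t \<le> 3/2 + t^2 / 2\<close>, from the square of
      \<open>t - 1\<close>.\<close>
    also have "\<dots> \<le> exp (3/2 + (norm w)\<^sup>2 / 2)"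
      using zero_le_power2[of "norm w - 1"] by (simp add: r_def power2_eq_square algebra_simps)
    finally have "r ^ M / fact M \<le> exp (3/2) * exp ((norm w)\<^sup>2 / 2)" by (simp only: exp_add)
    then have "r ^ M \<le> fact M * exp (3/2) * exp ((norm w)\<^sup>2 / 2)" by (simp add: field_simps)
    then have 1: "r ^ M * exp (- (norm w)\<^sup>2 / 2) \<le> fact M * exp (3/2)"
      by (simp add: exp_minus field_simps)
    have "1 \<le> (wt w * r ^ (2 * DIM('e)))\<^sup>2"
      using wt_ge[of w] by (simp add: r_def one_le_power)
    also have "\<dots> = (wt w)\<^sup>2 * r ^ (2 * (2 * DIM('e)))" by (simp add: power_mult_distrib power_mult[symmetric] mult.commute)
    finally have "1 * (r ^ N * exp (- (norm w)\<^sup>2 / 2)) \<le> ((wt w)\<^sup>2 * r ^ (2 * (2 * DIM('e)))) * (r ^ N * exp (- (norm w)\<^sup>2 / 2))"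
      by (rule mult_right_mono) (simp add: r_def)
    also have "\<dots> = (wt w)\<^sup>2 * (r ^ M * exp (- (norm w)\<^sup>2 / 2))" by (simp add: M_def power_add)
    also have "\<dots> \<le> (wt w)\<^sup>2 * (fact M * exp (3/2))" using 1 by (intro mult_left_mono) auto
    finally show ?thesis by (simp add: r_def mult.commute)
  qed
  then show ?thesis by (intro that[of "fact M * exp (3/2)"]) auto
qed

definition gauss :: "'e::euclidean_space \<Rightarrow> complex"
  where "gauss w = of_real (exp (- (norm w)\<^sup>2 / 2))"

lemma gauss_derivative:
  assumes b: "b \<in> Basis"
  shows "((\<lambda>t. gauss (x + t *\<^sub>R b)) has_vector_derivative - ((x \<bullet> b) *\<^sub>R gauss x)) (at 0)"
proof -
  have "((\<lambda>t. - ((norm (x + t *\<^sub>R b))\<^sup>2) / 2) has_real_derivative - (x \<bullet> b)) (at 0)"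
    unfolding power2_norm_eq_inner inner_add_left inner_add_right
    by (auto intro!: derivative_eq_intros simp: inner_commute[of b x])
  from DERIV_chain2[OF DERIV_exp this]
  have "((\<lambda>t. exp (- ((norm (x + t *\<^sub>R b))\<^sup>2) / 2)) has_real_derivative exp (- (norm x)\<^sup>2 / 2) * - (x \<bullet> b)) (at 0)"
    by simp
  from has_vector_derivative_of_real[OF this] show ?thesis
    by (simp add: gauss_def scaleR_conv_of_real mult.commute)
qed

text \<open>The products of polynomially growing functions with the Gaussian are stable under
  derivatives: \<open>f\<close> is replaced by \<open>dd b f - x_b f\<close>. So only the values
  have to be estimated.\<close>

lemma sbd_gauss_mult:
  fixes f :: "'e::euclidean_space \<Rightarrow> complex"
  assumes "spoly f"
  shows "sbd (\<lambda>w. (wt w)\<^sup>2) (\<lambda>w. f w * gauss w)"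
proof -
  have bd: "\<exists>C\<ge>0. \<forall>p\<in>(UNIV::unit set). \<forall>x. norm (f x * gauss x) \<le> C * (wt x)\<^sup>2" if f: "spoly f" for f :: "'e \<Rightarrow> complex"
  proof -
    obtain M where M: "sbd (\<lambda>\<eta>. (1 + norm \<eta>) ^ M) f" using f unfolding spoly_def by auto
    obtain A where A: "A \<ge> 0" "\<And>\<eta>. norm (f \<eta>) \<le> A * (1 + norm \<eta>) ^ M" using sbd_boundE[OF M] by metis
    obtain C where C: "C \<ge> 0" "\<And>w::'e. (1 + norm w) ^ M * exp (- (norm w)\<^sup>2 / 2) \<le> C * (wt w)\<^sup>2" using gauss_decay by metis
    have "norm (f x * gauss x) \<le> A * C * (wt x)\<^sup>2" for x
    proof -
      have "norm (f x * gauss x) \<le> (A * (1 + norm x) ^ M) * exp (- (norm x)\<^sup>2 / 2)"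
        unfolding norm_mult gauss_def by (intro mult_mono A(2)) (auto intro!: mult_nonneg_nonneg A(1))
      also have "\<dots> \<le> A * (C * (wt x)\<^sup>2)" using mult_left_mono[OF C(2) A(1)] by (simp add: mult_ac)
      finally show ?thesis by (simp add: mult_ac)
    qed
    then show ?thesis using A(1) C(1) by (intro exI[of _ "A * C"]) auto
  qed
  have pd: "((\<lambda>t. f (x + t *\<^sub>R b) * gauss (x + t *\<^sub>R b)) has_vector_derivative (dd b f x - (x \<bullet> b) *\<^sub>R f x) * gauss x) (at 0)"
    if f: "spoly f" and b: "b \<in> Basis" for f :: "'e \<Rightarrow> complex" and b x
  proof -
    obtain M where M: "sbd (\<lambda>\<eta>. (1 + norm \<eta>) ^ M) f" using f unfolding spoly_def by auto
    from has_vector_derivative_mult[OF sbd_derivative[OF M b, of x] gauss_derivative[OF b, of x]]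
    show ?thesis by (simp add: algebra_simps)
  qed
  have sp: "spoly (\<lambda>x. dd b f x - (x \<bullet> b) *\<^sub>R f x)" if "spoly f" "b \<in> Basis" for f :: "'e \<Rightarrow> complex" and b
    using spoly_add[OF spoly_dd[OF that] spoly_scaleR[OF spoly_coord[OF that], of "- 1"]] by simp
  have "bdiff k (UNIV::unit set) (\<lambda>_ _ w. (wt w)\<^sup>2) (\<lambda>_ w. f w * gauss w)" if "spoly f" for k and f :: "'e \<Rightarrow> complex"
    using that
  proof (induction k arbitrary: f)
    case 0
    have "continuous_on UNIV f" using 0 sbd_continuous unfolding spoly_def by blast
    then have "continuous_on UNIV (\<lambda>w. f w * gauss w)" unfolding gauss_def by (intro continuous_intros) auto
    then show ?case using bd[OF 0] by simp
  next
    case (Suc k)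
    show ?case
    proof (rule bdiff_SucI[where f'="\<lambda>b _ x. (dd b f x - (x \<bullet> b) *\<^sub>R f x) * gauss x"])
      show "\<exists>C\<ge>0. \<forall>p\<in>(UNIV::unit set). \<forall>x. norm (f x * gauss x) \<le> C * (wt x)\<^sup>2" by (rule bd[OF Suc.prems])
      show "bdiff k (UNIV::unit set) (\<lambda>_ _ w. (wt w)\<^sup>2) (\<lambda>_ x. (dd b f x - (x \<bullet> b) *\<^sub>R f x) * gauss x)" if "b \<in> Basis" for b
        by (rule Suc.IH[OF sp[OF Suc.prems that]])
    qed (rule pd[OF Suc.prems])
  qed
  then show ?thesis using assms unfolding sbd_def by simp
qed

lemma sbd_gauss: "sbd (\<lambda>w. (wt w)\<^sup>2) (gauss :: 'e::euclidean_space \<Rightarrow> complex)"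
proof -
  have "spoly (\<lambda>w::'e. 1 :: complex)" unfolding spoly_def by (intro exI[of _ 0] sbd_const[of 1]) auto
  from sbd_gauss_mult[OF this] show ?thesis by simp
qed

text \<open>The Gaussian and its transform solve the same system
  \<open>\<partial>_b u = - \<eta>_b u\<close>. Hence the transform divided by the Gaussian has
  vanishing partial derivatives and equals its value at \<open>0\<close>, the Gaussian
  integral.\<close>

lemma fourier_gauss:
  "fourier (gauss :: real^'n::finite \<Rightarrow> complex) \<eta> = of_real (sqrt (2 * pi) ^ CARD('n)) * gauss \<eta>"
proof -
  let ?g = "gauss :: real^'n \<Rightarrow> complex" and ?F = "fourier (gauss :: real^'n \<Rightarrow> complex)"
  have d: "((\<lambda>t. ?F (\<eta> + t *\<^sub>R b)) has_vector_derivative - ((\<eta> \<bullet> b) *\<^sub>R ?F \<eta>)) (at 0)" if b: "b \<in> Basis" for b \<eta>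
  proof -
    have w: "sbd wt (\<lambda>w. (w \<bullet> b) *\<^sub>R ?g w)" by (rule sbd_coord_mult[OF b sbd_gauss])
    have "dd b ?g = (\<lambda>w. (- \<i>) *\<^sub>C (\<i> *\<^sub>C (w \<bullet> b) *\<^sub>R ?g w) *\<^sub>C 1 * (-1))"
      by (rule ext, subst ddI[OF gauss_derivative[OF b]]) (simp add: scaleC_complex_def)
    then have "dd b ?g = (\<lambda>w. \<i> *\<^sub>C (\<i> *\<^sub>C (w \<bullet> b) *\<^sub>R ?g w))" by (simp add: scaleC_complex_def fun_eq_iff)
    then have "\<i> *\<^sub>C fourier (\<lambda>w. \<i> *\<^sub>C (w \<bullet> b) *\<^sub>R ?g w) \<eta> = (\<i> * of_real (b \<bullet> \<eta>)) *\<^sub>C ?F \<eta>"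
      using fourier_dd[OF sbd_wt_sq[OF sbd_gauss] b, of \<eta>] fourier_scaleC[OF sbd_linear[OF scaleC.bounded_linear_right w], of \<i> \<i> \<eta>] by simp
    then have "fourier (\<lambda>w. \<i> *\<^sub>C (w \<bullet> b) *\<^sub>R ?g w) \<eta> = (\<eta> \<bullet> b) *\<^sub>R ?F \<eta>"
      by (simp add: scaleC_complex_def scaleR_conv_of_real inner_commute mult.assoc)
    with fourier_derivative[OF sbd_wt_sq[OF sbd_gauss] w, of \<eta>] show ?thesis by simp
  qed
  define G where "G \<eta> = ?F \<eta> * of_real (exp ((norm \<eta>)\<^sup>2 / 2))" for \<eta>
  have dG: "((\<lambda>t. G (\<eta> + t *\<^sub>R b)) has_vector_derivative 0) (at 0)" if b: "b \<in> Basis" for b \<eta>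
  proof -
    have "((\<lambda>t. (norm (\<eta> + t *\<^sub>R b))\<^sup>2 / 2) has_real_derivative \<eta> \<bullet> b) (at 0)"
      unfolding power2_norm_eq_inner inner_add_left inner_add_right
      by (auto intro!: derivative_eq_intros simp: inner_commute[of b \<eta>])
    from DERIV_chain2[OF DERIV_exp this]
    have "((\<lambda>t. exp ((norm (\<eta> + t *\<^sub>R b))\<^sup>2 / 2)) has_real_derivative exp ((norm \<eta>)\<^sup>2 / 2) * (\<eta> \<bullet> b)) (at 0)"
      by simp
    from has_vector_derivative_mult[OF d[OF b, of \<eta>] has_vector_derivative_of_real[OF this]]
    show ?thesis by (simp add: G_def scaleR_conv_of_real)
  qed
  have "partials G (\<lambda>_ _. 0)" by (rule partialsI[OF dG]) auto
  from lipschitz_of_partials[OF this, of 0 \<eta> 0] have "G \<eta> = G 0" by simp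
  moreover have "G 0 = of_real (sqrt (2 * pi) ^ CARD('n))"
  proof -
    have "((\<lambda>w::real^'n. complex_of_real (exp (- (norm w)\<^sup>2 / 2))) has_integral of_real (sqrt (2 * pi) ^ DIM(real^'n))) UNIV"
      using has_integral_linear[OF gauss_has_integral bounded_linear_of_real] unfolding o_def .
    from integral_unique[OF this] show ?thesis
      by (simp add: G_def fourier_def gauss_def[abs_def] cis_zero)
  qed
  ultimately show ?thesis by (simp add: G_def gauss_def exp_minus field_simps)
qed

lemma dd_const: "dd b (\<lambda>x. c) = (\<lambda>x. 0)"
  by (intro ext ddI) simp

lemma Eop_const: "Eop L (\<lambda>x. c) = (\<lambda>x. c)"
  by (induction L) (simp_all add: dd_const)

lemma spoly_const: "spoly (\<lambda>x. c)"
  unfolding spoly_def by (intro exI[of _ 0] sbd_const[of "norm c"]) auto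

text \<open>Integration by parts against the constant symbol \<open>1\<close>, whose derivative is
  zero.\<close>

lemma integral_fourier_coord:
  fixes h :: "real^'n::finite \<Rightarrow> 'x::complex_banach"
  assumes h: "sbd (\<lambda>w. (wt w)\<^sup>2) h" and b: "b \<in> Basis"
  shows "integral UNIV (fourier (\<lambda>w. (w \<bullet> b) *\<^sub>R h w)) = 0"
proof -
  interpret fpairing "scaleR :: real \<Rightarrow> 'x \<Rightarrow> 'x" by (rule fpairing.intro[OF bounded_bilinear_scaleR])
  have h': "sbd (\<lambda>w. (wt w)\<^sup>2) (\<lambda>w. (- \<i>) *\<^sub>C h w)" by (rule sbd_linear[OF scaleC.bounded_linear_right h])
  have "\<i> *\<^sub>C (w \<bullet> b) *\<^sub>R (- \<i>) *\<^sub>C h w = (w \<bullet> b) *\<^sub>R h w" for w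
    by (simp add: scaleC_scaleR[symmetric] scaleC_scaleC)
  with fourier_by_parts[OF spoly_const[of 1] sbd_wt_sq[OF h'] sbd_coord_mult[OF b h'] b] show ?thesis
    by (simp add: dd_const)
qed

text \<open>By Hadamard's lemma \<open>h - h(0)\<close> is a combination of the functions \<open>w\<^sub>b g\<^sub>b(w)\<close>, whose Fourier transforms are
  derivatives and integrate to \<open>0\<close>. The constant is then found with the Gaussian function.\<close>

lemma integral_fourier:
  fixes h :: "real^'n::finite \<Rightarrow> 'x::complex_banach"
  assumes h: "sbd (\<lambda>w. (wt w)\<^sup>2) h"
  shows "integral UNIV (fourier h) = integral UNIV (fourier (Wt (L4 1) :: real^'n \<Rightarrow> complex)) *\<^sub>C h 0"
proof -
  interpret fpairing "scaleR :: real \<Rightarrow> 'x \<Rightarrow> 'x" by (rule fpairing.intro[OF bounded_bilinear_scaleR])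
  let ?L = "L4 1 :: ((real^'n) \<times> real) list" and ?c = "\<lambda>_::real^'n. 1::real"
  have h1: "sbd (\<lambda>_. 1) h"
    by (rule sbd_weaken[OF h, of 1]) (simp_all add: power_le_one)
  \<comment> \<open>These coefficients and the constant \<open>h 0\<close> do not decay. The
    decomposition is therefore used inside the regularised pairing with the constant symbol, which
    the operators leave unchanged.\<close>
  define g where "g b w = segint 0 (dd b h) (0, w)" for b w
  have sg: "sbd (\<lambda>_. 1) (g b)" if "b \<in> Basis" for b
  proof -
    have "bounded_linear (\<lambda>w::real^'n. (0::real^'n, w))" by (intro bounded_linear_Pair bounded_linear_zero bounded_linear_ident)
    from sbd_compose_affine[OF sbd_segint[OF sbd_dd[OF h1 that]] this, of 0 0] show ?thesis by (simp add: g_def[abs_def])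
  qed
  have hg: "h w = h 0 + (\<Sum>b\<in>Basis. (w \<bullet> b) *\<^sub>R g b w)" for w
    using hadamard[OF sbd_partials[OF h1] sbd_continuous[OF sbd_dd[OF h1]], of 0 w] by (simp add: g_def algebra_simps)
  have comm: "Wt ?L w *\<^sub>C (w \<bullet> b) *\<^sub>R g b w = (w \<bullet> b) *\<^sub>R Wt ?L w *\<^sub>C g b w" for w b
    by (simp add: scaleC_scaleR)
  have sw: "sbd wt (\<lambda>w. Wt ?L w *\<^sub>C (w \<bullet> b) *\<^sub>R g b w)" if "b \<in> Basis" for b
    unfolding comm by (rule sbd_coord_mult[OF that sbd_Wt_L4[OF sg[OF that]]]) simp
  have "sbd wt (\<lambda>w. \<Sum>b\<in>Basis. Wt ?L w *\<^sub>C (w \<bullet> b) *\<^sub>R g b w)" by (intro sbd_sum sw)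
  then have sws: "sbd wt (\<lambda>w. Wt ?L w *\<^sub>C (\<Sum>b\<in>Basis. (w \<bullet> b) *\<^sub>R g b w))" by (simp add: scaleC.sum_right)
  have z: "pair ?L ?c (\<lambda>w. (w \<bullet> b) *\<^sub>R g b w) = 0" if "b \<in> Basis" for b
    using integral_fourier_coord[OF sbd_Wt_L4[OF sg[OF that], of 1] that] by (simp add: pair_def Eop_const comm)
  have sc: "sbd wt (\<lambda>w. Wt ?L w *\<^sub>C h 0)" by (rule sbd_wt_sq[OF sbd_Wt_L4[OF sbd_1_const]]) simp
  have sW: "sbd wt (Wt ?L)" using sbd_wt_sq[OF sbd_Wt_L4[OF sbd_1_const, of 1 "1::complex"]] by (simp add: scaleC_complex_def)
  have "integral UNIV (fourier h) = pair [] ?c h" by (simp add: pair_def)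
  also have "\<dots> = pair (?L @ []) ?c h"
    using h by (intro pair_append[symmetric] spoly_const bas_L4) simp_all
  also have "\<dots> = pair ?L ?c (\<lambda>w. h 0 + (\<Sum>b\<in>Basis. (w \<bullet> b) *\<^sub>R g b w))" unfolding append_Nil2 hg[symmetric] ..
  also have "\<dots> = pair ?L ?c (\<lambda>w. h 0) + pair ?L ?c (\<lambda>w. \<Sum>b\<in>Basis. (w \<bullet> b) *\<^sub>R g b w)"
    by (rule pair_add_right[OF spoly_const bas_L4 sc sws])
  also have "pair ?L ?c (\<lambda>w. \<Sum>b\<in>Basis. (w \<bullet> b) *\<^sub>R g b w) = 0"
    by (subst pair_sum_right[OF spoly_const bas_L4 sw]) (simp_all add: z)
  also have "pair ?L ?c (\<lambda>w. h 0) = integral UNIV (\<lambda>\<eta>. fourier (Wt ?L) \<eta> *\<^sub>C h 0)"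
    using fourier_linear[OF sW scaleC.bounded_linear_left, of "h 0"] by (simp add: pair_def Eop_const scaleC_complex_def scaleC_scaleC)
  also have "\<dots> = integral UNIV (fourier (Wt ?L)) *\<^sub>C h 0"
  proof -
    obtain C where C: "\<And>\<eta>. (1 + norm \<eta>) ^ 0 * norm (fourier (Wt ?L) \<eta>) \<le> C * wt \<eta>" using fourier_decay[OF sW] by metis
    have "fourier (Wt ?L) integrable_on UNIV"
      by (rule integrable_dominated[OF fourier_continuous[OF sW] _ integrable_cmult_wt[of C]]) (use C in simp)
    from integral_linear[OF this scaleC.bounded_linear_left, of "h 0"] show ?thesis by (simp add: o_def)
  qed
  finally show ?thesis by simp
qed

theorem integral_fourier_eq:
  fixes h :: "real^'n::finite \<Rightarrow> 'x::complex_banach"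
  assumes h: "sbd (\<lambda>w. (wt w)\<^sup>2) h"
  shows "integral UNIV (fourier h) = (2 * pi) ^ CARD('n) *\<^sub>R h 0"
proof -
  let ?s = "sqrt (2 * pi) ^ CARD('n)"
  have gauss0: "gauss (0 :: real^'n) = 1" by (simp add: gauss_def)
  have "((\<lambda>w::real^'n. of_real ?s * gauss w) has_integral of_real ?s * of_real (sqrt (2 * pi) ^ DIM(real^'n))) UNIV"
    using has_integral_mult_right[OF has_integral_linear[OF gauss_has_integral bounded_linear_of_real], of "complex_of_real ?s"]
    unfolding o_def gauss_def .
  moreover have "fourier (gauss :: real^'n \<Rightarrow> complex) = (\<lambda>\<eta>. of_real ?s * gauss \<eta>)" by (rule ext) (rule fourier_gauss)
  moreover have "DIM(real^'n) = CARD('n)" by simp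
  ultimately have "integral UNIV (fourier (gauss :: real^'n \<Rightarrow> complex)) = of_real (?s * ?s)"
    by (simp only: integral_unique of_real_mult)
  also have "?s * ?s = (sqrt (2 * pi) * sqrt (2 * pi)) ^ CARD('n)" by (rule power_mult_distrib[symmetric])
  also have "sqrt (2 * pi) * sqrt (2 * pi) = 2 * pi" by (rule real_sqrt_mult_self[THEN trans]) simp
  finally have "integral UNIV (fourier (Wt (L4 1) :: real^'n \<Rightarrow> complex)) = of_real ((2 * pi) ^ CARD('n))"
    using integral_fourier[OF sbd_gauss, where 'n='n] gauss0 by (simp add: scaleC_complex_def del: of_real_power of_real_mult)
  then show ?thesis using integral_fourier[OF h] by (simp only: scaleC_of_real)
qed

section \<open>Rapidly decreasing functions and the inversion formula\<close>

definition rapid :: "('e::euclidean_space \<Rightarrow> 'x::real_normed_vector) \<Rightarrow> bool"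
  where "rapid f \<longleftrightarrow> (\<forall>N. sbd (\<lambda>z. inverse ((1 + norm z) ^ N)) f)"

lemma rapid_wt_sq: "rapid f \<Longrightarrow> sbd (\<lambda>w. (wt w)\<^sup>2) f"
proof (rule sbd_weaken[where D=1])
  show "sbd (\<lambda>z. inverse ((1 + norm z) ^ (2 * DIM('a) * 2))) f" if "rapid f" using that unfolding rapid_def by blast
  show "inverse ((1 + norm x) ^ (2 * DIM('a) * 2)) \<le> 1 * (wt x)\<^sup>2" for x :: 'a
  proof -
    have "1 \<le> (wt x * (1 + norm x) ^ (2 * DIM('a)))\<^sup>2" using wt_ge[of x] by (simp add: one_le_power)
    then have "1 \<le> (wt x)\<^sup>2 * (1 + norm x) ^ (2 * DIM('a) * 2)" by (simp only: power_mult_distrib power_mult)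
    then show ?thesis by (simp add: inverse_eq_divide field_simps add_pos_nonneg)
  qed
qed auto

text \<open>The hypothesis \<open>w\<close> bounds \<open>x\<close> linearly by \<open>g x\<close>,
  so that decay in \<open>g x\<close> is decay in \<open>x\<close>.\<close>

lemma rapid_compose:
  fixes f :: "'f::euclidean_space \<Rightarrow> 'x::real_normed_vector" and g :: "'e::euclidean_space \<Rightarrow> 'f"
  assumes f: "rapid f" and g: "partials g (\<lambda>b. dd b g)" "\<And>b. b \<in> Basis \<Longrightarrow> sbd (\<lambda>_. 1) (dd b g)"
    and w: "\<And>x. norm x \<le> A + B * norm (g x)" "A \<ge> 0" "B \<ge> 0"
  shows "rapid (\<lambda>x. f (g x))"
  unfolding rapid_def
proof
  fix N
  show "sbd (\<lambda>z. inverse ((1 + norm z) ^ N)) (\<lambda>x. f (g x))"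
  proof (rule sbd_compose[OF _ g, where D="(1 + A + B) ^ N"])
    show "sbd (\<lambda>z. inverse ((1 + norm z) ^ N)) f" using f unfolding rapid_def by blast
    fix x
    have "1 + norm x \<le> (1 + A + B) * (1 + norm (g x))"
      using w(1)[of x] w(2,3) mult_nonneg_nonneg[OF w(2) norm_ge_zero[of "g x"]] norm_ge_zero[of "g x"]
      unfolding distrib_left distrib_right by linarith
    then have "(1 + norm x) ^ N \<le> (1 + A + B) ^ N * (1 + norm (g x)) ^ N"
      unfolding power_mult_distrib[symmetric] by (rule power_mono) simp
    then show "inverse ((1 + norm (g x)) ^ N) \<le> (1 + A + B) ^ N * inverse ((1 + norm x) ^ N)"
      by (simp add: inverse_eq_divide field_simps add_pos_nonneg)
  qed (use w in simp_all)
qed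

lemma fourier_translate:
  fixes h :: "real^'n::finite \<Rightarrow> 'x::complex_banach"
  assumes h: "sbd wt h"
  shows "fourier (\<lambda>w. h (y + w)) \<eta> = cis (y \<bullet> \<eta>) *\<^sub>C fourier h \<eta>"
proof -
  have i: "(\<lambda>w. cis (- (w \<bullet> \<eta>)) *\<^sub>C h w) integrable_on UNIV" by (rule fourier_integrable[OF h])
  have "fourier (\<lambda>w. h (y + w)) \<eta> = integral UNIV (\<lambda>w. cis (y \<bullet> \<eta>) *\<^sub>C cis (- ((w + y) \<bullet> \<eta>)) *\<^sub>C h (w + y))"
    unfolding fourier_def by (simp add: scaleC_scaleC cis_mult inner_add_left add.commute)
  also have "\<dots> = cis (y \<bullet> \<eta>) *\<^sub>C integral UNIV (\<lambda>w. cis (- ((w + y) \<bullet> \<eta>)) *\<^sub>C h (w + y))"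
    using integral_linear[OF integral_translate(1)[OF i, of y] scaleC.bounded_linear_right[of "cis (y \<bullet> \<eta>)"]] by (simp add: o_def)
  also have "\<dots> = cis (y \<bullet> \<eta>) *\<^sub>C fourier h \<eta>"
    unfolding fourier_def by (subst integral_translate(2)[OF i]) simp
  finally show ?thesis .
qed

lemma rapid_translate:
  fixes f :: "'e::euclidean_space \<Rightarrow> 'x::real_normed_vector"
  assumes "rapid f"
  shows "rapid (\<lambda>w. f (y + w))"
proof (rule rapid_compose[OF assms])
  have pa: "partials (\<lambda>w. y + w) (\<lambda>b. dd b (\<lambda>w. y + w))" "dd b (\<lambda>w. y + w) = (\<lambda>_. b)" for b
    using partials_affine[OF bounded_linear_ident, of "\<lambda>w. y + w" y] by auto
  show "partials (\<lambda>w. y + w) (\<lambda>b. dd b (\<lambda>w. y + w))" by (rule pa)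
  show "sbd (\<lambda>_. 1) (dd b (\<lambda>w. y + w))" for b unfolding pa(2) by (rule sbd_1_const)
  show "norm x \<le> norm y + 1 * norm (y + x)" for x
    using norm_triangle_ineq4[of "y + x" y] by simp
qed auto

text \<open>The value at \<open>x\<close> is the value at \<open>0\<close> of the translate
  \<open>w \<mapsto> f (x + w)\<close>, whose transform carries the factor
  \<open>exp (i x \<cdot> \<xi>)\<close>.\<close>

theorem fourier_inversion:
  fixes f :: "real^'n::finite \<Rightarrow> 'x::complex_banach"
  assumes "rapid f"
  shows "integral UNIV (\<lambda>\<xi>. cis (x \<bullet> \<xi>) *\<^sub>C fourier f \<xi>) = (2 * pi) ^ CARD('n) *\<^sub>R f x"
  using integral_fourier_eq[OF rapid_wt_sq[OF rapid_translate[OF assms]], of x]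
  by (simp add: fourier_translate[OF sbd_wt_sq[OF rapid_wt_sq[OF assms]], abs_def])

section \<open>Conjugation of a pseudodifferential operator\<close>

text \<open>For complex-linear \<open>T\<close> this is \<open>c T\<close>. It makes sense, and is
  real bilinear, on the whole real Banach space of real-linear operators on which the symbol
  calculus is carried out.\<close>

definition opC :: "('a::complex_banach \<Rightarrow>\<^sub>L 'b::complex_banach) \<Rightarrow> complex \<Rightarrow> ('a \<Rightarrow>\<^sub>L 'b)"
  where "opC T c = Blinfun (\<lambda>v. blinfun_apply T (c *\<^sub>C v))"

lemma opC_apply: "blinfun_apply (opC T c) v = blinfun_apply T (c *\<^sub>C v)"
  unfolding opC_def
  by (subst bounded_linear_Blinfun_apply[OF bounded_linear_compose[OF blinfun.bounded_linear_right scaleC.bounded_linear_right]]) simp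

lemma bounded_bilinear_opC: "bounded_bilinear (opC :: ('a::complex_banach \<Rightarrow>\<^sub>L 'b::complex_banach) \<Rightarrow> _)"
proof (rule bounded_bilinear.intro)
  show "\<exists>K. \<forall>(T :: 'a \<Rightarrow>\<^sub>L 'b) c. norm (opC T c) \<le> norm T * norm c * K"
  proof (intro exI[of _ 1] allI)
    fix T :: "'a \<Rightarrow>\<^sub>L 'b" and c
    show "norm (opC T c) \<le> norm T * norm c * 1"
    proof (rule norm_blinfun_bound)
      show "norm (blinfun_apply (opC T c) v) \<le> norm T * norm c * 1 * norm v" for v
        using norm_blinfun[of T "c *\<^sub>C v"] by (simp add: opC_apply norm_scaleC mult.assoc)
    qed simp
  qed
qed (auto intro!: blinfun_eqI simp: opC_apply blinfun.add_left blinfun.add_right blinfun.scaleR_left blinfun.scaleR_right scaleC.add_left scaleC.scaleR_left)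

text \<open>The complex-linear operators are the joint kernel of these bounded real-linear maps, and
  thus stable under the derivatives and integrals that are formed.\<close>

definition cdefect :: "complex \<Rightarrow> 'a \<Rightarrow> ('a::complex_banach \<Rightarrow>\<^sub>L 'b::complex_banach) \<Rightarrow> 'b"
  where "cdefect c v T = blinfun_apply T (c *\<^sub>C v) - c *\<^sub>C blinfun_apply T v"

lemma clinear_ops_iff: "T \<in> clinear_ops \<longleftrightarrow> (\<forall>c v. cdefect c v T = 0)"
  by (auto simp: clinear_ops_def cdefect_def)

lemma bounded_linear_cdefect: "bounded_linear (cdefect c v)"
  unfolding cdefect_def[abs_def]
  by (intro bounded_linear_sub blinfun.bounded_linear_left bounded_linear_compose[OF scaleC.bounded_linear_right])

lemma clinear_ops_apply: "T \<in> clinear_ops \<Longrightarrow> blinfun_apply T (c *\<^sub>C v) = c *\<^sub>C blinfun_apply T v"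
  by (simp add: clinear_ops_def)

lemma Eop_clinear:
  assumes a: "spoly a" "\<And>\<eta>. a \<eta> \<in> clinear_ops" and L: "bas L"
  shows "Eop L a \<eta> \<in> clinear_ops"
  unfolding clinear_ops_iff
proof (intro allI)
  fix c v
  have "cdefect c v (Eop L a \<eta>) = Eop L (\<lambda>x. cdefect c v (a x)) \<eta>"
    by (simp add: Eop_linear[OF bounded_linear_cdefect a(1) L])
  also have "(\<lambda>x. cdefect c v (a x)) = (\<lambda>x. 0)" using a(2) by (simp add: clinear_ops_iff)
  finally show "cdefect c v (Eop L a \<eta>) = 0" by (simp add: Eop_const)
qed

section \<open>The transformed symbol and the conjugation identity\<close>

context diffeo begin

lemma symcalc_opC: "symcalc \<kappa> \<kappa>' opC"
  by (rule symcalc.intro[OF diffeo_axioms fpairing.intro[OF bounded_bilinear_opC]])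

text \<open>The transformed symbol in terms of \<open>y\<close> instead of
  \<open>x = \<kappa> y\<close>, and still without the factor \<open>(2\<pi>)^-n\<close>.\<close>

definition transf :: "(real^'n \<Rightarrow> 'a::complex_banach \<Rightarrow>\<^sub>L 'b::complex_banach) \<Rightarrow> real^'n \<Rightarrow> real^'n \<Rightarrow> 'a \<Rightarrow>\<^sub>L 'b"
  where "transf a y \<xi> = symcalc.bval \<kappa> opC a (\<lambda>_. 1) y \<xi>"

abbreviation kfourier :: "real^'n \<Rightarrow> real^'n \<Rightarrow> real^'n \<Rightarrow> complex"
  where "kfourier y \<xi> \<equiv> fourier (\<lambda>w. Wt (L4 1) w *\<^sub>C osc (\<lambda>_. 1) y \<xi> w)"

lemma transf_apply:
  assumes a: "spoly a"
  shows "(\<lambda>\<eta>. opC (Eop (L4 1) a \<eta>) (kfourier y \<xi> \<eta>)) integrable_on UNIV"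
    and "transf a y \<xi> = integral UNIV (\<lambda>\<eta>. opC (Eop (L4 1) a \<eta>) (kfourier y \<xi> \<eta>))"
proof -
  interpret symcalc \<kappa> \<kappa>' opC by (rule symcalc_opC)
  show "(\<lambda>\<eta>. opC (Eop (L4 1) a \<eta>) (kfourier y \<xi> \<eta>)) integrable_on UNIV"
    by (rule pr_fourier_integrable[OF spoly_Eop[OF a bas_L4] sbd_Wt_osc'[OF sbd_1_const]])
  show "transf a y \<xi> = integral UNIV (\<lambda>\<eta>. opC (Eop (L4 1) a \<eta>) (kfourier y \<xi> \<eta>))"
    by (simp add: transf_def bval_def pair_def)
qed

lemma transf_clinear:
  assumes a: "spoly a" "\<And>\<eta>. a \<eta> \<in> clinear_ops"
  shows "transf a y \<xi> \<in> clinear_ops"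
  unfolding clinear_ops_iff
proof (intro allI)
  fix c v
  have "cdefect c v (opC (Eop (L4 1) a \<eta>) z) = 0" for \<eta> z
    using clinear_ops_apply[OF Eop_clinear[OF a bas_L4]] by (simp add: cdefect_def opC_apply scaleC_scaleC mult.commute)
  then show "cdefect c v (transf a y \<xi>) = 0"
    using integral_linear[OF transf_apply(1)[OF a(1)] bounded_linear_cdefect, of c v y \<xi>] unfolding transf_apply(2)[OF a(1)] by (simp add: o_def)
qed

text \<open>The inverse map is Lipschitz, hence \<open>norm z\<close> is at most
  \<open>norm (\<kappa>' 0) + B * norm (\<kappa> z)\<close>.\<close>

lemma rapid_k:
  fixes f :: "real^'n \<Rightarrow> 'x::real_normed_vector"
  assumes f: "rapid f"
  shows "rapid (\<lambda>z. f (\<kappa> z))"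
proof -
  obtain C where C: "C \<ge> 0" "\<And>b x. b \<in> Basis \<Longrightarrow> norm (dd b \<kappa>' x) \<le> C"
    using gradient_bound[OF sbd_k'] by metis
  define B where "B = real DIM(real^'n) * C"
  show ?thesis
  proof (rule rapid_compose[OF f partials_k sbd_k])
    fix z
    have "norm (\<kappa>' (\<kappa> z) - \<kappa>' 0) \<le> B * norm (\<kappa> z - 0)"
      unfolding B_def by (rule lipschitz_of_partials[OF partials_k' C(2)])
    then show "norm z \<le> norm (\<kappa>' 0) + B * norm (\<kappa> z)"
      using norm_triangle_sub[of z "\<kappa>' 0"] by (simp add: inv1)
  qed (use C(1) in \<open>auto simp: B_def\<close>)
qed

lemma continuous_on_kappa: "continuous_on S \<kappa>"
  by (rule partials_continuous[OF partials_k])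

text \<open>At the fixed scale \<open>1\<close> each power of decay in \<eta> costs a power of the
  bracket of \<xi>. That is affordable where the rapidly decreasing transform of \<open>f\<close> is
  present.\<close>

lemma kfourier_bound:
  obtains C where "C \<ge> 0" "\<And>\<xi> \<eta>. (1 + norm \<eta>) ^ N * norm (kfourier y \<xi> \<eta>) \<le> C * japanese_bracket \<xi> ^ N"
proof -
  have w: "bdiff k UNIV (\<lambda>_ \<xi> w. (wt w)\<^sup>2) (\<lambda>(\<xi>::real^'n) (w::real^'n). Wt (L4 1) w)" for k
    using bdiff_reparam[OF bdiff_Wt_L4, where Q=UNIV and \<phi>="\<lambda>_::real^'n. 1"] by simp
  have o: "bdiff k UNIV (\<lambda>j \<xi> w. japanese_bracket \<xi> ^ j) (\<lambda>\<xi> w. osc (\<lambda>_. 1) y \<xi> w)" for k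
    using bdiff_reparam[OF bdiff_osc[OF sbd_1_const], where Q=UNIV and \<phi>="\<lambda>\<xi>. (y, \<xi>)"] by simp
  have "bdiff k UNIV (\<lambda>j \<xi> w. japanese_bracket \<xi> ^ j * wt w) (\<lambda>\<xi> w. Wt (L4 1) w *\<^sub>C osc (\<lambda>_. 1) y \<xi> w)" for k
  proof (rule bdiff_bilinear[OF bounded_bilinear_scaleC w o])
    fix i j and \<xi> w :: "real^'n"
    have "japanese_bracket \<xi> ^ j \<le> japanese_bracket \<xi> ^ (i + j)" by (rule power_increasing) auto
    moreover have "(wt w)\<^sup>2 \<le> wt w" by (simp add: power2_eq_square mult_left_le)
    ultimately show "(wt w)\<^sup>2 * japanese_bracket \<xi> ^ j \<le> japanese_bracket \<xi> ^ (i + j) * wt w"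
      by (subst mult.commute) (intro mult_mono; simp)
  qed
  from fourier_decay_family[OF this, where D="\<lambda>_. 1" and N=N] integrable_wt
  obtain C where C: "C \<ge> 0" "\<And>\<xi> \<eta>. (japanese_bracket \<xi> + norm \<eta>) ^ N * norm (kfourier y \<xi> \<eta>) \<le> C * japanese_bracket \<xi> ^ N * integral UNIV (wt :: real^'n \<Rightarrow> real)"
    by auto
  have I: "integral UNIV (wt :: real^'n \<Rightarrow> real) \<ge> 0" by (rule integral_nonneg[OF integrable_wt]) simp
  show ?thesis
  proof (rule that[of "C * integral UNIV (wt :: real^'n \<Rightarrow> real)"])
    show "(1 + norm \<eta>) ^ N * norm (kfourier y \<xi> \<eta>) \<le> C * integral UNIV (wt :: real^'n \<Rightarrow> real) * japanese_bracket \<xi> ^ N" for \<xi> \<eta>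
    proof -
      have "(1 + norm \<eta>) ^ N \<le> (japanese_bracket \<xi> + norm \<eta>) ^ N" by (rule power_mono) auto
      from order_trans[OF mult_right_mono[OF this norm_ge_zero] C(2)] show ?thesis by (simp add: mult_ac)
    qed
  qed (use C(1) I in auto)
qed

lemma osc_1: "osc (\<lambda>_. 1) y \<xi> w = cis (\<kappa> (y + w) \<bullet> \<xi>) * cis (- (\<kappa> y \<bullet> \<xi>))"
  by (simp add: osc_def phase_def cis_mult inner_diff_left)

lemma Wt_bound:
  obtains C where "C \<ge> 0" "\<And>w::real^'n. norm (Wt (L4 1) w) \<le> C * wt w"
proof -
  have "sbd wt (Wt (L4 1) :: real^'n \<Rightarrow> complex)" using sbd_wt_sq[OF sbd_Wt_L4[OF sbd_1_const, of 1 "1::complex"]] by (simp add: scaleC_complex_def)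
  then show ?thesis using sbd_boundE that by blast
qed

lemma continuous_on_Wt: "continuous_on S (Wt (L4 1) :: real^'n \<Rightarrow> complex)"
proof -
  have "sbd wt (Wt (L4 1) :: real^'n \<Rightarrow> complex)" using sbd_wt_sq[OF sbd_Wt_L4[OF sbd_1_const, of 1 "1::complex"]] by (simp add: scaleC_complex_def)
  then show ?thesis by (rule sbd_continuous)
qed

lemma continuous_on_osc:
  "continuous_on S f \<Longrightarrow> continuous_on S g \<Longrightarrow> continuous_on S (\<lambda>x. osc (\<lambda>_. 1) y (f x) (g x))"
  unfolding osc_1 by (intro continuous_intros continuous_on_compose2[OF continuous_on_kappa]) auto

lemma kfourier_continuous: "continuous_on UNIV (\<lambda>(\<xi>, \<eta>). kfourier y \<xi> \<eta>)"
proof -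
  obtain C where C: "\<And>w::real^'n. norm (Wt (L4 1) w) \<le> C * wt w" using Wt_bound by metis
  have "continuous_on UNIV (\<lambda>s. integral UNIV (\<lambda>w. cis (- (w \<bullet> snd s)) *\<^sub>C Wt (L4 1) w *\<^sub>C osc (\<lambda>_. 1) y (fst s) w))"
  proof (rule continuous_on_integral_param[where g="\<lambda>w. C * wt w"])
    show "norm (cis (- (w \<bullet> snd s)) *\<^sub>C Wt (L4 1) w *\<^sub>C osc (\<lambda>_. 1) y (fst s) w) \<le> C * wt w" for s :: "(real^'n) \<times> (real^'n)" and w
      using C by (simp add: norm_scaleC osc_1 norm_mult)
  qed (intro continuous_intros continuous_on_Wt continuous_on_osc integrable_cmult_wt)+
  then show ?thesis by (simp add: fourier_def case_prod_unfold)
qed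

text \<open>After interchanging the integrals over \<xi> and \<open>w\<close> the exponentials of
  \<open>\<kappa> y \<bullet> \<xi>\<close> cancel, and the integral over \<xi> is Fourier inversion
  for \<open>f\<close> at the point \<open>\<kappa> (y + w)\<close>.\<close>

lemma integral_kfourier:
  fixes f :: "real^'n \<Rightarrow> 'x::complex_banach"
  assumes f: "rapid f"
  shows "integral UNIV (\<lambda>\<xi>. (cis (\<kappa> y \<bullet> \<xi>) * kfourier y \<xi> \<eta>) *\<^sub>C fourier f \<xi>) =
    (2 * pi) ^ CARD('n) *\<^sub>R fourier (\<lambda>w. Wt (L4 1) w *\<^sub>C f (\<kappa> (y + w))) \<eta>"
proof -
  note sf = sbd_wt_sq[OF rapid_wt_sq[OF f]]
  obtain C where C: "C \<ge> 0" "\<And>w::real^'n. norm (Wt (L4 1) w) \<le> C * wt w" using Wt_bound by metis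
  obtain D where D: "D \<ge> 0" "\<And>\<xi>. (1 + norm \<xi>) ^ 0 * norm (fourier f \<xi>) \<le> D * wt \<xi>" using fourier_decay[OF sf] by metis
  define K where "K \<xi> w = (cis (- (w \<bullet> \<eta>)) * Wt (L4 1) w * cis (\<kappa> (y + w) \<bullet> \<xi>)) *\<^sub>C fourier f \<xi>" for \<xi> w
  have "(cis (\<kappa> y \<bullet> \<xi>) * kfourier y \<xi> \<eta>) *\<^sub>C fourier f \<xi> = integral UNIV (K \<xi>)" for \<xi>
  proof -
    interpret symcalc \<kappa> \<kappa>' opC by (rule symcalc_opC)
    have i: "(\<lambda>w. cis (- (w \<bullet> \<eta>)) *\<^sub>C Wt (L4 1) w *\<^sub>C osc (\<lambda>_. 1) y \<xi> w) integrable_on UNIV"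
      by (rule fourier_integrable[OF sbd_Wt_osc'[OF sbd_1_const]])
    have bl: "bounded_linear (\<lambda>z. (cis (\<kappa> y \<bullet> \<xi>) * z) *\<^sub>C fourier f \<xi>)"
      by (intro bounded_linear_compose[OF scaleC.bounded_linear_left] bounded_linear_mult_right)
    have "(\<lambda>w. (cis (\<kappa> y \<bullet> \<xi>) * (cis (- (w \<bullet> \<eta>)) *\<^sub>C Wt (L4 1) w *\<^sub>C osc (\<lambda>_. 1) y \<xi> w)) *\<^sub>C fourier f \<xi>) = K \<xi>"
    proof
      fix w
      have "cis (\<kappa> y \<bullet> \<xi>) * cis (- (\<kappa> y \<bullet> \<xi>)) = 1" by (simp add: cis_mult)
      then have "cis (\<kappa> y \<bullet> \<xi>) * (a * (b * (c * cis (- (\<kappa> y \<bullet> \<xi>))))) = a * b * c" for a b c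
        by (metis mult.assoc mult.left_commute mult.right_neutral)
      then show "(cis (\<kappa> y \<bullet> \<xi>) * (cis (- (w \<bullet> \<eta>)) *\<^sub>C Wt (L4 1) w *\<^sub>C osc (\<lambda>_. 1) y \<xi> w)) *\<^sub>C fourier f \<xi> = K \<xi> w"
        by (simp only: K_def osc_1 scaleC_complex_def)
    qed
    with integral_linear[OF i bl] show ?thesis by (simp add: fourier_def o_def)
  qed
  then have "integral UNIV (\<lambda>\<xi>. (cis (\<kappa> y \<bullet> \<xi>) * kfourier y \<xi> \<eta>) *\<^sub>C fourier f \<xi>) = integral UNIV (\<lambda>\<xi>. integral UNIV (K \<xi>))" by simp
  also have "\<dots> = integral UNIV (\<lambda>w. integral UNIV (\<lambda>\<xi>. K \<xi> w))"
  proof (rule integral_swap_UNIV[where C="D * C"])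
    show "continuous_on UNIV (\<lambda>(\<xi>, w). K \<xi> w)"
      unfolding K_def case_prod_unfold
      by (intro continuous_intros continuous_on_compose2[OF continuous_on_kappa] continuous_on_compose2[OF continuous_on_Wt]
          continuous_on_compose2[OF fourier_continuous[OF sf]]) auto
    show "norm (K \<xi> w) \<le> D * C * wt \<xi> * wt w" for \<xi> w
    proof -
      have "norm (K \<xi> w) \<le> (C * wt w) * (D * wt \<xi>)"
        unfolding K_def norm_scaleC norm_mult using C D by (auto intro!: mult_mono)
      then show ?thesis by (simp add: mult_ac)
    qed
  qed
  also have "(\<lambda>w. integral UNIV (\<lambda>\<xi>. K \<xi> w)) = (\<lambda>w. (2 * pi) ^ CARD('n) *\<^sub>R (cis (- (w \<bullet> \<eta>)) *\<^sub>C Wt (L4 1) w *\<^sub>C f (\<kappa> (y + w))))"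
  proof
    fix w
    have i: "(\<lambda>\<xi>. cis (\<kappa> (y + w) \<bullet> \<xi>) *\<^sub>C fourier f \<xi>) integrable_on UNIV"
      by (rule integrable_dominated[OF _ _ integrable_cmult_wt[of D]])
        (use D in \<open>auto simp: norm_scaleC intro!: continuous_intros fourier_continuous[OF sf]\<close>)
    have "K \<xi> w = (cis (- (w \<bullet> \<eta>)) * Wt (L4 1) w) *\<^sub>C (cis (\<kappa> (y + w) \<bullet> \<xi>) *\<^sub>C fourier f \<xi>)" for \<xi>
      by (simp add: K_def scaleC_scaleC)
    then have "integral UNIV (\<lambda>\<xi>. K \<xi> w) = (cis (- (w \<bullet> \<eta>)) * Wt (L4 1) w) *\<^sub>C integral UNIV (\<lambda>\<xi>. cis (\<kappa> (y + w) \<bullet> \<xi>) *\<^sub>C fourier f \<xi>)"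
      using integral_linear[OF i scaleC.bounded_linear_right] by (simp add: o_def)
    then show "integral UNIV (\<lambda>\<xi>. K \<xi> w) = (2 * pi) ^ CARD('n) *\<^sub>R (cis (- (w \<bullet> \<eta>)) *\<^sub>C Wt (L4 1) w *\<^sub>C f (\<kappa> (y + w)))"
      by (simp only: fourier_inversion[OF f] scaleC_scaleR scaleC_scaleC)
  qed
  also have "integral UNIV \<dots> = (2 * pi) ^ CARD('n) *\<^sub>R fourier (\<lambda>w. Wt (L4 1) w *\<^sub>C f (\<kappa> (y + w))) \<eta>"
    unfolding fourier_def by (rule integral_cmul)
  finally show ?thesis .
qed

text \<open>The transform of \<open>f\<close> pays for the interchange of the integrals over \<xi>
  and \<eta>. The inner integral then gives the regularised transform of
  \<open>w \<mapsto> f (\<kappa> (y + w))\<close>; this function decays by itself, so that the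
  regularisation can be removed. Complex linearity of the symbol lets the scalar amplitudes pass
  through the operators.\<close>

theorem transf_identity:
  fixes f :: "real^'n \<Rightarrow> 'a::complex_banach" and a :: "real^'n \<Rightarrow> 'a \<Rightarrow>\<^sub>L 'b::complex_banach"
  assumes a: "spoly a" "\<And>\<eta>. a \<eta> \<in> clinear_ops" and f: "rapid f"
  shows "integral UNIV (\<lambda>\<xi>. cis (\<kappa> y \<bullet> \<xi>) *\<^sub>C blinfun_apply (transf a y \<xi>) (fourier f \<xi>)) =
    (2 * pi) ^ CARD('n) *\<^sub>R integral UNIV (\<lambda>\<eta>. cis (y \<bullet> \<eta>) *\<^sub>C blinfun_apply (a \<eta>) (fourier (\<lambda>z. f (\<kappa> z)) \<eta>))"
proof -
  note sf = sbd_wt_sq[OF rapid_wt_sq[OF f]]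
  interpret A: fpairing "blinfun_apply :: ('a \<Rightarrow>\<^sub>L 'b) \<Rightarrow> 'a \<Rightarrow> 'b"
    by (rule fpairing.intro[OF bounded_bilinear_blinfun_apply])
  define T where "T = Eop (L4 1) a"
  have Tc: "T \<eta> \<in> clinear_ops" for \<eta> unfolding T_def by (rule Eop_clinear[OF a bas_L4])
  have sT: "spoly T" unfolding T_def by (rule spoly_Eop[OF a(1) bas_L4])
  obtain M where M: "sbd (\<lambda>\<eta>. (1 + norm \<eta>) ^ M) T" using sT unfolding spoly_def by auto
  obtain A where A: "A \<ge> 0" "\<And>\<eta>. norm (T \<eta>) \<le> A * (1 + norm \<eta>) ^ M" using sbd_boundE[OF M] by metis
  \<comment> \<open>\<open>M\<close> powers compensate the growth of \<open>T\<close>, the others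
    yield \<open>wt \<eta>\<close>; the price in \<xi> is the \<open>N\<close>-th power of the
    bracket, absorbed by the transform of \<open>f\<close>.\<close>
  define N where "N = M + 2 * DIM(real^'n)"
  obtain C where C: "C \<ge> 0" "\<And>\<xi> \<eta>. (1 + norm \<eta>) ^ N * norm (kfourier y \<xi> \<eta>) \<le> C * japanese_bracket \<xi> ^ N" using kfourier_bound by metis
  obtain D where D: "D \<ge> 0" "\<And>\<xi>. (1 + norm \<xi>) ^ N * norm (fourier f \<xi>) \<le> D * wt \<xi>" using fourier_decay[OF sf] by metis
  define u where "u \<xi> \<eta> = (cis (\<kappa> y \<bullet> \<xi>) * kfourier y \<xi> \<eta>) *\<^sub>C fourier f \<xi>" for \<xi> \<eta>
  define G where "G \<xi> \<eta> = blinfun_apply (T \<eta>) (u \<xi> \<eta>)" for \<xi> \<eta>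
  have cu: "continuous_on UNIV (\<lambda>(\<xi>, \<eta>). u \<xi> \<eta>)"
    unfolding u_def case_prod_unfold
    by (intro continuous_intros kfourier_continuous[unfolded case_prod_unfold] continuous_on_compose2[OF fourier_continuous[OF sf]]) auto
  have bu: "(1 + norm \<eta>) ^ N * norm (u \<xi> \<eta>) \<le> C * D * wt \<xi>" for \<xi> \<eta>
  proof -
    have "(1 + norm \<eta>) ^ N * norm (u \<xi> \<eta>) \<le> (C * japanese_bracket \<xi> ^ N) * norm (fourier f \<xi>)"
      using mult_right_mono[OF C(2) norm_ge_zero] by (simp add: u_def norm_scaleC norm_mult mult.assoc)
    also have "\<dots> \<le> (C * (1 + norm \<xi>) ^ N) * norm (fourier f \<xi>)"
      using C(1) by (intro mult_right_mono mult_left_mono power_mono jb_le) auto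
    also have "\<dots> \<le> C * (D * wt \<xi>)" unfolding mult.assoc using C(1) D(2) by (intro mult_left_mono)
    finally show ?thesis by (simp add: mult.assoc)
  qed
  have "cis (\<kappa> y \<bullet> \<xi>) *\<^sub>C blinfun_apply (transf a y \<xi>) (fourier f \<xi>) = integral UNIV (G \<xi>)" for \<xi>
  proof -
    have "bounded_linear (\<lambda>S. cis (\<kappa> y \<bullet> \<xi>) *\<^sub>C blinfun_apply S (fourier f \<xi>))"
      by (intro bounded_linear_compose[OF scaleC.bounded_linear_right] blinfun.bounded_linear_left)
    from integral_linear[OF transf_apply(1)[OF a(1)] this, of y \<xi>] show ?thesis
      unfolding transf_apply(2)[OF a(1)] T_def[symmetric] G_def u_def
      by (simp add: o_def opC_apply scaleC_scaleC[symmetric] clinear_ops_apply[OF Tc])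
  qed
  then have "integral UNIV (\<lambda>\<xi>. cis (\<kappa> y \<bullet> \<xi>) *\<^sub>C blinfun_apply (transf a y \<xi>) (fourier f \<xi>)) = integral UNIV (\<lambda>\<xi>. integral UNIV (G \<xi>))" by simp
  also have "\<dots> = integral UNIV (\<lambda>\<eta>. integral UNIV (\<lambda>\<xi>. G \<xi> \<eta>))"
  proof (rule integral_swap_UNIV[where C="A * (C * D)"])
    show "continuous_on UNIV (\<lambda>(\<xi>, \<eta>). G \<xi> \<eta>)"
      unfolding G_def case_prod_unfold
      by (intro bounded_bilinear.continuous_on[OF bounded_bilinear_blinfun_apply] cu[unfolded case_prod_unfold]
          continuous_on_compose2[OF A.spoly_continuous[OF sT]] continuous_intros) auto
    show "norm (G \<xi> \<eta>) \<le> A * (C * D) * wt \<xi> * wt \<eta>" for \<xi> \<eta>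
    proof -
      have "norm (G \<xi> \<eta>) \<le> norm (T \<eta>) * norm (u \<xi> \<eta>)" unfolding G_def by (rule norm_blinfun)
      also have "\<dots> \<le> (A * (1 + norm \<eta>) ^ M) * norm (u \<xi> \<eta>) * 1" using A(2) by (simp add: mult_right_mono)
      also have "\<dots> \<le> (A * (1 + norm \<eta>) ^ M) * norm (u \<xi> \<eta>) * (wt \<eta> * (1 + norm \<eta>) ^ (2 * DIM(real^'n)))"
        using A(1) by (intro mult_left_mono wt_ge) auto
      also have "\<dots> = A * wt \<eta> * ((1 + norm \<eta>) ^ N * norm (u \<xi> \<eta>))" by (simp add: N_def power_add)
      also have "\<dots> \<le> A * wt \<eta> * (C * D * wt \<xi>)" using A(1) bu by (intro mult_left_mono) auto
      finally show ?thesis by (simp add: mult_ac)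
    qed
  qed
  also have "(\<lambda>\<eta>. integral UNIV (\<lambda>\<xi>. G \<xi> \<eta>)) = (\<lambda>\<eta>. (2 * pi) ^ CARD('n) *\<^sub>R blinfun_apply (T \<eta>) (fourier (\<lambda>w. Wt (L4 1) w *\<^sub>C f (\<kappa> (y + w))) \<eta>))"
  proof
    fix \<eta>
    have "(\<lambda>\<xi>. u \<xi> \<eta>) integrable_on UNIV"
    proof (rule integrable_dominated[OF _ _ integrable_cmult_wt[of "C * D"]])
      show "continuous_on UNIV (\<lambda>\<xi>. u \<xi> \<eta>)"
        using continuous_on_compose2[OF cu, of UNIV "\<lambda>\<xi>. (\<xi>, \<eta>)"] by (simp add: continuous_on_Pair)
      show "norm (u \<xi> \<eta>) \<le> C * D * wt \<xi>" for \<xi>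
      proof -
        have "1 * norm (u \<xi> \<eta>) \<le> (1 + norm \<eta>) ^ N * norm (u \<xi> \<eta>)" by (intro mult_right_mono one_le_power) auto
        with bu[of \<eta> \<xi>] show ?thesis by simp
      qed
    qed
    from integral_linear[OF this blinfun.bounded_linear_right]
    show "integral UNIV (\<lambda>\<xi>. G \<xi> \<eta>) = (2 * pi) ^ CARD('n) *\<^sub>R blinfun_apply (T \<eta>) (fourier (\<lambda>w. Wt (L4 1) w *\<^sub>C f (\<kappa> (y + w))) \<eta>)"
      unfolding G_def u_def integral_kfourier[OF f] o_def blinfun.scaleR_right .
  qed
  also have "integral UNIV \<dots> = (2 * pi) ^ CARD('n) *\<^sub>R A.pair (L4 1) a (\<lambda>w. f (\<kappa> (y + w)))"
    unfolding A.pair_def T_def by (rule integral_cmul)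
  \<comment> \<open>The empty list is admissible since the composition of \<open>f\<close> with
    \<kappa> is rapidly decreasing; independence of the regularisation does the rest.\<close>
  also have "A.pair (L4 1 @ []) a (\<lambda>w. f (\<kappa> (y + w))) = A.pair [] a (\<lambda>w. f (\<kappa> (y + w)))"
    by (rule A.pair_append[OF a(1)]) (use rapid_wt_sq[OF rapid_translate[OF rapid_k[OF f], of y]] in \<open>simp_all add: bas_L4\<close>)
  then have "A.pair (L4 1) a (\<lambda>w. f (\<kappa> (y + w))) = A.pair [] a (\<lambda>w. f (\<kappa> (y + w)))" by (simp only: append_Nil2)
  also have "\<dots> = integral UNIV (\<lambda>\<eta>. cis (y \<bullet> \<eta>) *\<^sub>C blinfun_apply (a \<eta>) (fourier (\<lambda>z. f (\<kappa> z)) \<eta>))"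
    by (simp add: A.pair_def fourier_translate[OF sbd_wt_sq[OF rapid_wt_sq[OF rapid_k[OF f]]]] clinear_ops_apply[OF a(2)])
  finally show ?thesis .
qed

end

section \<open>Multi-indices\<close>

lemma partial_deriv_dd: "partial_deriv i = dd (axis i 1)"
  by (intro ext) (simp add: partial_deriv_def dd_def)

lemma axis_Basis: "axis i (1::real) \<in> Basis"
  by (auto simp: Basis_vec_def)

definition idx :: "real^'n::finite \<Rightarrow> 'n"
  where "idx b = (SOME i. b = axis i 1)"

lemma axis_idx: "b \<in> Basis \<Longrightarrow> axis (idx b) 1 = b"
  using someI_ex[of "\<lambda>i. b = axis i 1"] unfolding idx_def by (auto simp: Basis_vec_def)

lemma C_k_derivative:
  "C_k k f \<Longrightarrow> length is < k \<Longrightarrow> ((\<lambda>t. iter_partial is f (x + t *\<^sub>R axis i 1)) has_vector_derivative iter_partial (i # is) f x) (at 0)"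
  by (simp add: C_k_def partial_deriv_def vector_derivative_works[symmetric])

lemma C_k_continuous: "C_k k f \<Longrightarrow> length is \<le> k \<Longrightarrow> continuous_on UNIV (iter_partial is f)"
  by (simp add: C_k_def)

lemma C_k_I:
  assumes "\<And>is i x. length is < k \<Longrightarrow> ((\<lambda>t. iter_partial is f (x + t *\<^sub>R axis i 1)) has_vector_derivative D is i x) (at 0)"
    and "\<And>is. length is \<le> k \<Longrightarrow> continuous_on UNIV (iter_partial is f)"
  shows "C_k k f"
  unfolding C_k_def using assms(2) differentiableI_vector[OF assms(1)] by simp

lemma C_k_swap:
  assumes f: "C_k k f" and l: "length is + 2 \<le> k"
  shows "iter_partial (i # j # is) f = iter_partial (j # i # is) f"
proof
  fix x
  have "((\<lambda>t. iter_partial (i # is) f (x + t *\<^sub>R axis j 1)) has_vector_derivative iter_partial (i # j # is) f x) (at 0)"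
    by (rule mixed_directional[OF C_k_derivative[OF f] C_k_derivative[OF f] C_k_derivative[OF f] C_k_continuous[OF f]]) (use l in auto)
  from ddI[OF this] show "iter_partial (i # j # is) f x = iter_partial (j # i # is) f x"
    by (simp add: partial_deriv_dd)
qed

lemma C_k_move:
  assumes f: "C_k k f"
  shows "length (us @ x # vs) \<le> k \<Longrightarrow> iter_partial (us @ x # vs) f = iter_partial (x # us @ vs) f"
proof (induction us)
  case (Cons u us)
  have "iter_partial ((u # us) @ x # vs) f = partial_deriv u (iter_partial (x # us @ vs) f)"
    using Cons by simp
  also have "\<dots> = iter_partial (u # x # us @ vs) f" by simp
  also have "\<dots> = iter_partial (x # u # us @ vs) f" by (rule C_k_swap[OF f]) (use Cons.prems in simp)
  finally show ?case by simp
qed simp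

text \<open>The head of the first list is moved to the front of the second by transpositions of
  neighbouring derivatives, and the tails are treated by induction.\<close>

lemma C_k_perm:
  assumes f: "C_k k f"
  shows "mset xs = mset ys \<Longrightarrow> length xs \<le> k \<Longrightarrow> iter_partial xs f = iter_partial ys f"
proof (induction xs arbitrary: ys)
  case (Cons x xs)
  have l: "length ys \<le> k" using Cons.prems mset_eq_length by metis
  have "x \<in> set ys" using Cons.prems(1) by (metis list.set_intros(1) mset_eq_setD)
  then obtain us vs where ys: "ys = us @ x # vs" by (meson split_list)
  have "iter_partial xs f = iter_partial (us @ vs) f"
    by (rule Cons.IH) (use Cons.prems ys in auto)
  with C_k_move[OF f, of us x vs] l show ?case by (simp add: ys)
qed simp

text \<open>Eliminates the choice in \<open>mderiv\<close>: two lists with the same counts are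
  permutations of each other, and within the class \<open>C_k\<close> the derivatives
  commute.\<close>

lemma mderiv_eq:
  assumes f: "C_k k f" and l: "length is \<le> k"
  shows "mderiv (count_list is) f = iter_partial is f"
proof -
  define js where "js = (SOME js. \<forall>i. count_list js i = count_list is i)"
  have "\<forall>i. count_list js i = count_list is i"
    unfolding js_def by (rule someI_ex[of "\<lambda>js. \<forall>i. count_list js i = count_list is i"]) auto
  then have m: "mset is = mset js" by (intro multiset_eqI) (simp add: count_mset)
  show ?thesis using C_k_perm[OF f m l] by (simp add: mderiv_def js_def)
qed

lemma mi_order_count_list: "mi_order (count_list is) = length is"
  unfolding mi_order_def by (rule sum_count_set) auto

lemma multi_index_list:
  obtains "is" where "count_list is = \<beta>" "length is = mi_order \<beta>"
proof -
  obtain "is" where "\<forall>i. count_list is i = \<beta> i" using ex_list_of_multi_index by blast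
  then have "count_list is = \<beta>" by auto
  then show ?thesis using that mi_order_count_list by metis
qed

lemma iter_partial_append: "iter_partial (js @ is) f = iter_partial js (iter_partial is f)"
  by (induction js) simp_all

lemma smooth_iter_partial:
  assumes "smooth f"
  shows "smooth (iter_partial is f)"
  unfolding smooth_def
proof
  fix k
  have f: "C_k (k + length is) f" using assms by (simp add: smooth_def)
  show "C_k k (iter_partial is f)"
    by (rule C_k_I[where D="\<lambda>js i. iter_partial (i # js @ is) f"])
      (use C_k_derivative[OF f, of "_ @ is"] C_k_continuous[OF f, of "_ @ is"] in \<open>simp_all add: iter_partial_append\<close>)
qed

lemma smooth_derivative:
  "smooth f \<Longrightarrow> ((\<lambda>t. iter_partial is f (x + t *\<^sub>R axis i 1)) has_vector_derivative iter_partial (i # is) f x) (at 0)"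
  by (rule C_k_derivative[of "Suc (length is)"]) (simp_all add: smooth_def)

lemma smooth_continuous: "smooth f \<Longrightarrow> continuous_on UNIV (iter_partial is f)"
  by (rule C_k_continuous[of "length is"]) (simp_all add: smooth_def)

lemma smooth_mderiv_eq: "smooth f \<Longrightarrow> mderiv (count_list is) f = iter_partial is f"
  by (rule mderiv_eq[of "length is"]) (simp_all add: smooth_def)

lemma smooth_partials:
  assumes "smooth f"
  shows "partials f (\<lambda>b. dd b f)"
proof (rule partialsI)
  fix b :: "real^'a" and x assume b: "b \<in> Basis"
  show "((\<lambda>t. f (x + t *\<^sub>R b)) has_vector_derivative dd b f x) (at 0)"
    using smooth_derivative[OF assms, of "[]" x "idx b"] b by (simp add: axis_idx partial_deriv_dd)
  show "continuous_on UNIV (dd b f)"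
    using smooth_continuous[OF assms, of "[idx b]"] b by (simp add: axis_idx partial_deriv_dd)
qed

lemma sbd_of_smooth:
  fixes f :: "real^'n::finite \<Rightarrow> 'x::real_normed_vector"
  assumes f: "smooth f" and c: "continuous_on UNIV \<omega>"
    and bd: "\<And>is. \<exists>C\<ge>0. \<forall>x. norm (iter_partial is f x) \<le> C * \<omega> x"
  shows "sbd \<omega> f"
  unfolding sbd_def
proof
  fix k
  show "bdiff k (UNIV::unit set) (\<lambda>_ _. \<omega>) (\<lambda>_. f)"
  proof (rule bdiff_tower[where G="\<lambda>bs _. iter_partial (map idx bs) f" and \<omega>="\<lambda>_ _. \<omega>" and bs="[]", simplified])
    fix b :: "real^'n" and bs x assume "b \<in> Basis"
    then show "((\<lambda>t. iter_partial (map idx bs) f (x + t *\<^sub>R b)) has_vector_derivative partial_deriv (idx b) (iter_partial (map idx bs) f) x) (at 0)"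
      using smooth_derivative[OF f, of "map idx bs" x "idx b"] by (simp add: axis_idx)
  qed (use c bd in auto)
qed

lemma diffeo_of_bounded_smooth_diffeo:
  assumes "bounded_smooth_diffeo \<kappa>"
  shows "diffeo \<kappa> (inv \<kappa>)"
proof -
  have b: "bij \<kappa>" and s: "smooth \<kappa>" "smooth (inv \<kappa>)"
    and bd: "\<And>\<beta>. mi_order \<beta> \<ge> 1 \<Longrightarrow> bounded (range (mderiv \<beta> \<kappa>))" "\<And>\<beta>. mi_order \<beta> \<ge> 1 \<Longrightarrow> bounded (range (mderiv \<beta> (inv \<kappa>)))"
    using assms by (auto simp: bounded_smooth_diffeo_def)
  have sb: "sbd (\<lambda>_. 1) (dd b f)" if f: "smooth f" and B: "\<And>\<beta>. mi_order \<beta> \<ge> 1 \<Longrightarrow> bounded (range (mderiv \<beta> f))" and b: "b \<in> Basis"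
    for f :: "real^'a \<Rightarrow> real^'a" and b
  proof -
    have "dd b f = iter_partial [idx b] f" using b by (simp add: partial_deriv_dd axis_idx)
    moreover have "sbd (\<lambda>_. 1) (iter_partial [idx b] f)"
    proof (rule sbd_of_smooth[OF smooth_iter_partial[OF f]])
      fix "is"
      \<comment> \<open>The last entry acts first, so the list describes derivatives of
        \<open>dd b f\<close>; its length is at least one, which is where boundedness is
        assumed.\<close>
      have "bounded (range (iter_partial (is @ [idx b]) f))"
        using B[of "count_list (is @ [idx b])"] by (simp only: mi_order_count_list smooth_mderiv_eq[OF f]) simp
      then obtain C where "\<And>x. norm (iter_partial (is @ [idx b]) f x) \<le> C" by (auto simp: bounded_iff)
      then show "\<exists>C\<ge>0. \<forall>x. norm (iter_partial is (iter_partial [idx b] f) x) \<le> C * 1"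
        unfolding iter_partial_append by (intro exI[of _ C]) (auto intro: order_trans[OF norm_ge_zero])
    qed simp
    ultimately show ?thesis by simp
  qed
  show ?thesis
    by (rule diffeo.intro) (use b s sb[OF s(1) bd(1)] sb[OF s(2) bd(2)] in \<open>auto simp: bij_def surj_f_inv_f intro: smooth_partials\<close>)
qed

lemma rapid_schwartz:
  fixes f :: "real^'n::finite \<Rightarrow> 'x::real_normed_vector"
  assumes "f \<in> schwartz_space"
  shows "rapid f"
  unfolding rapid_def
proof
  fix N
  have f: "smooth f" and B: "\<And>k \<beta>. bounded (range (\<lambda>x. japanese_bracket x ^ k *\<^sub>R mderiv \<beta> f x))"
    using assms by (auto simp: schwartz_space_def)
  show "sbd (\<lambda>z. inverse ((1 + norm z) ^ N)) f"
  proof (rule sbd_of_smooth[OF f])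
    show "continuous_on UNIV (\<lambda>z::real^'n. inverse ((1 + norm z) ^ N))"
      by (intro continuous_intros) (auto simp: add_nonneg_eq_0_iff)
    fix "is"
    obtain C where C: "\<And>x. norm (japanese_bracket x ^ N *\<^sub>R mderiv (count_list is) f x) \<le> C"
      using B[of N "count_list is"] by (auto simp: bounded_iff)
    have "norm (iter_partial is f x) \<le> 2 ^ N * C * inverse ((1 + norm x) ^ N)" for x
    proof -
      have "1 + norm x \<le> 2 * japanese_bracket x" using one_le_jb[of x] norm_le_jb[of x] by linarith
      then have "(1 + norm x) ^ N \<le> 2 ^ N * japanese_bracket x ^ N"
        unfolding power_mult_distrib[symmetric] by (rule power_mono) simp
      then have "(1 + norm x) ^ N * norm (iter_partial is f x) \<le> 2 ^ N * (japanese_bracket x ^ N * norm (iter_partial is f x))"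
        using mult_right_mono[OF _ norm_ge_zero] by (fastforce simp: mult.assoc)
      also have "\<dots> \<le> 2 ^ N * C" using C[of x] by (simp add: smooth_mderiv_eq[OF f])
      finally show ?thesis by (simp add: field_simps add_pos_nonneg)
    qed
    moreover have "C \<ge> 0" using C order_trans[OF norm_ge_zero] by blast
    ultimately show "\<exists>C\<ge>0. \<forall>x. norm (iter_partial is f x) \<le> C * inverse ((1 + norm x) ^ N)"
      by (intro exI[of _ "2 ^ N * C"]) auto
  qed
qed

section \<open>Hoelder norms in terms of iterated partial derivatives\<close>

lemma holder_normD:
  fixes f :: "real^'n::finite \<Rightarrow> 'x::real_normed_vector" and \<tau> :: real
  assumes f: "C_k (nat \<lfloor>\<tau>\<rfloor>) f" and K: "holder_norm \<tau> f \<le> ennreal K" "K \<ge> 0"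
  shows "length is \<le> nat \<lfloor>\<tau>\<rfloor> \<Longrightarrow> norm (iter_partial is f x) \<le> K"
    and "length is = nat \<lfloor>\<tau>\<rfloor> \<Longrightarrow> norm (iter_partial is f z - iter_partial is f y) \<le> K * norm (z - y) powr (\<tau> - \<lfloor>\<tau>\<rfloor>)"
proof -
  assume l: "length is \<le> nat \<lfloor>\<tau>\<rfloor>"
  let ?S = "\<lambda>\<beta>. SUP x. ennreal (norm (mderiv \<beta> f x))"
  have "ennreal (norm (iter_partial is f x)) \<le> ?S (count_list is)"
    by (rule SUP_upper2[of x]) (simp_all add: mderiv_eq[OF f l])
  also have "\<dots> \<le> (\<Sum>\<beta> | mi_order \<beta> \<le> nat \<lfloor>\<tau>\<rfloor>. ?S \<beta>)"
    by (rule member_le_sum) (use l finite_multi_indices in \<open>auto simp: mi_order_count_list\<close>)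
  also have "\<dots> \<le> holder_norm \<tau> f" unfolding holder_norm_def by simp
  also note K(1)
  finally show "norm (iter_partial is f x) \<le> K" using K(2) by (simp add: ennreal_le_iff)
next
  assume l: "length is = nat \<lfloor>\<tau>\<rfloor>"
  let ?S = "\<lambda>\<beta>. SUP (z, y) \<in> {(z, y). z \<noteq> y}. ennreal (norm (mderiv \<beta> f z - mderiv \<beta> f y) / norm (z - y) powr (\<tau> - \<lfloor>\<tau>\<rfloor>))"
  show "norm (iter_partial is f z - iter_partial is f y) \<le> K * norm (z - y) powr (\<tau> - \<lfloor>\<tau>\<rfloor>)"
  proof (cases "z = y")
    case False
    have "finite {\<beta> :: 'n multi_index. mi_order \<beta> = nat \<lfloor>\<tau>\<rfloor>}"
      by (rule finite_subset[OF _ finite_multi_indices[of "nat \<lfloor>\<tau>\<rfloor>"]]) auto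
    note fin = this
    have "ennreal (norm (iter_partial is f z - iter_partial is f y) / norm (z - y) powr (\<tau> - \<lfloor>\<tau>\<rfloor>)) \<le> ?S (count_list is)"
      by (rule SUP_upper2[of "(z, y)"]) (use False l in \<open>simp_all add: mderiv_eq[OF f]\<close>)
    also have "\<dots> \<le> (\<Sum>\<beta> | mi_order \<beta> = nat \<lfloor>\<tau>\<rfloor>. ?S \<beta>)"
      by (rule member_le_sum) (use l fin in \<open>auto simp: mi_order_count_list\<close>)
    also have "\<dots> \<le> holder_norm \<tau> f" unfolding holder_norm_def by simp
    also note K(1)
    finally show ?thesis using K(2) False by (simp add: ennreal_le_iff field_simps)
  qed simp
qed

lemma holder_normI:
  fixes f :: "real^'n::finite \<Rightarrow> 'x::real_normed_vector" and \<tau> :: real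
  assumes f: "C_k (nat \<lfloor>\<tau>\<rfloor>) f" and K: "K \<ge> 0"
    and b: "\<And>is x. length is \<le> nat \<lfloor>\<tau>\<rfloor> \<Longrightarrow> norm (iter_partial is f x) \<le> K"
      "\<And>is z y. length is \<le> nat \<lfloor>\<tau>\<rfloor> \<Longrightarrow> norm (iter_partial is f z - iter_partial is f y) \<le> K * norm (z - y) powr (\<tau> - \<lfloor>\<tau>\<rfloor>)"
  shows "holder_norm \<tau> f \<le> ennreal (real (card {\<beta> :: 'n multi_index. mi_order \<beta> \<le> nat \<lfloor>\<tau>\<rfloor>} + card {\<beta> :: 'n multi_index. mi_order \<beta> = nat \<lfloor>\<tau>\<rfloor>}) * K)"
    (is "_ \<le> ennreal (real (?a + ?b) * K)")
proof -
  have m: "\<exists>is. length is = mi_order \<beta> \<and> mderiv \<beta> f = iter_partial is f" if "mi_order \<beta> \<le> nat \<lfloor>\<tau>\<rfloor>" for \<beta> :: "'n multi_index"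
  proof -
    obtain "is" where "is": "count_list is = \<beta>" "length is = mi_order \<beta>" using multi_index_list by blast
    then show ?thesis using mderiv_eq[OF f, of "is"] that by metis
  qed
  have 1: "(SUP x. ennreal (norm (mderiv \<beta> f x))) \<le> ennreal K" if "mi_order \<beta> \<le> nat \<lfloor>\<tau>\<rfloor>" for \<beta>
  proof (rule SUP_least)
    fix x
    obtain "is" where "is": "length is = mi_order \<beta>" "mderiv \<beta> f = iter_partial is f" using m[OF \<open>mi_order \<beta> \<le> _\<close>] by blast
    show "ennreal (norm (mderiv \<beta> f x)) \<le> ennreal K" unfolding "is"(2) using b(1)[of "is" x] "is"(1) that by (intro ennreal_leI) simp
  qed
  have 2: "(SUP (z, y) \<in> {(z, y). z \<noteq> y}. ennreal (norm (mderiv \<beta> f z - mderiv \<beta> f y) / norm (z - y) powr (\<tau> - \<lfloor>\<tau>\<rfloor>))) \<le> ennreal K"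
    if "mi_order \<beta> \<le> nat \<lfloor>\<tau>\<rfloor>" for \<beta>
  proof (rule SUP_least)
    fix q :: "(real^'n) \<times> (real^'n)" assume q: "q \<in> {(z, y). z \<noteq> y}"
    obtain "is" where "is": "length is = mi_order \<beta>" "mderiv \<beta> f = iter_partial is f" using m[OF \<open>mi_order \<beta> \<le> _\<close>] by blast
    have "norm (mderiv \<beta> f (fst q) - mderiv \<beta> f (snd q)) / norm (fst q - snd q) powr (\<tau> - \<lfloor>\<tau>\<rfloor>) \<le> K"
      unfolding "is"(2) using b(2)[of "is" "fst q" "snd q"] "is"(1) that q by (simp add: field_simps case_prod_unfold)
    then show "(case q of (z, y) \<Rightarrow> ennreal (norm (mderiv \<beta> f z - mderiv \<beta> f y) / norm (z - y) powr (\<tau> - \<lfloor>\<tau>\<rfloor>))) \<le> ennreal K"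
      by (simp add: case_prod_unfold ennreal_leI)
  qed
  have "holder_norm \<tau> f \<le> of_nat ?a * ennreal K + of_nat ?b * ennreal K"
    unfolding holder_norm_def by (intro add_mono sum_bounded_above 1 2; drule CollectD; simp only: order_refl)
  also have "\<dots> = ennreal (real (?a + ?b) * K)"
    using K by (simp add: ennreal_of_nat_eq_real_of_nat ennreal_mult[symmetric] ennreal_plus[symmetric] distrib_right del: ennreal_plus)
  finally show ?thesis .
qed

section \<open>Translation between the Hoelder symbol classes and the classes
  \<open>HS\<close>\<close>

locale holder_symbol =
  fixes \<tau> m \<theta> :: real and k :: nat and p :: "real^'n::finite \<Rightarrow> real^'n \<Rightarrow> 'x::real_normed_vector" and X
  assumes p: "p \<in> holder_symbols \<tau> m X" and th: "0 < \<theta>" "\<theta> < 1"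
    and \<theta>: "\<theta> = \<tau> - \<lfloor>\<tau>\<rfloor>" and k: "k = nat \<lfloor>\<tau>\<rfloor>"
begin

text \<open>Derivatives in \<xi> first, then in \<open>x\<close>: the order in which the definition
  of the symbol class provides existence and bounds.\<close>

definition B :: "'n list \<Rightarrow> 'n list \<Rightarrow> real^'n \<Rightarrow> real^'n \<Rightarrow> 'x"
  where "B is js x \<xi> = iter_partial is (\<lambda>x. iter_partial js (p x) \<xi>) x"

lemma smooth_p: "smooth (p x)" using p by (simp add: holder_symbols_def)

lemma holder_p:
  "(\<lambda>x. iter_partial js (p x) \<xi>) \<in> holder_space \<tau>"
  "\<exists>C. \<forall>\<xi>. holder_norm \<tau> (\<lambda>x. iter_partial js (p x) \<xi>) \<le> ennreal (C * japanese_bracket \<xi> powr (m - real (length js)))"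
proof -
  have "(\<lambda>x. mderiv \<alpha> (p x) \<xi>) \<in> holder_space \<tau>"
    "\<exists>C. \<forall>\<xi>. holder_norm \<tau> (\<lambda>x. mderiv \<alpha> (p x) \<xi>) \<le> ennreal (C * japanese_bracket \<xi> powr (m - mi_order \<alpha>))" for \<alpha>
    using p by (simp_all add: holder_symbols_def)
  from this[of "count_list js"]
  show "(\<lambda>x. iter_partial js (p x) \<xi>) \<in> holder_space \<tau>"
    "\<exists>C. \<forall>\<xi>. holder_norm \<tau> (\<lambda>x. iter_partial js (p x) \<xi>) \<le> ennreal (C * japanese_bracket \<xi> powr (m - real (length js)))"
    unfolding smooth_mderiv_eq[OF smooth_p] mi_order_count_list by simp_all
qed

lemma C_k_p: "C_k k (\<lambda>x. iter_partial js (p x) \<xi>)"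
  using holder_p(1) by (simp add: holder_space_def k)

lemma B_bounds:
  obtains C where "C \<ge> 0" "\<And>is x \<xi>. length is \<le> k \<Longrightarrow> norm (B is js x \<xi>) \<le> C * japanese_bracket \<xi> powr (m - real (length js))"
    "\<And>is x y \<xi>. length is = k \<Longrightarrow> norm (B is js x \<xi> - B is js y \<xi>) \<le> C * japanese_bracket \<xi> powr (m - real (length js)) * norm (x - y) powr \<theta>"
proof -
  let ?J = "\<lambda>\<xi>. japanese_bracket \<xi> powr (m - real (length js))"
  obtain C where C: "\<And>\<xi>. holder_norm \<tau> (\<lambda>x. iter_partial js (p x) \<xi>) \<le> ennreal (C * ?J \<xi>)" using holder_p(2) by metis
  have D: "holder_norm \<tau> (\<lambda>x. iter_partial js (p x) \<xi>) \<le> ennreal (max C 0 * ?J \<xi>)" for \<xi>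
    by (rule order_trans[OF C ennreal_leI]) (intro mult_right_mono; simp)
  show ?thesis
    by (rule that[of "max C 0"])
      (use holder_normD[OF C_k_p[unfolded k] D] in \<open>auto simp: B_def k \<theta>\<close>)
qed

lemma B_derivative_x:
  "length is < k \<Longrightarrow> ((\<lambda>t. B is js (x + t *\<^sub>R axis i 1) \<xi>) has_vector_derivative B (i # is) js x \<xi>) (at 0)"
  unfolding B_def by (rule C_k_derivative[OF C_k_p])

lemma B_continuous_x: "length is \<le> k \<Longrightarrow> continuous_on UNIV (\<lambda>x. B is js x \<xi>)"
  using C_k_continuous[OF C_k_p] by (simp add: B_def[abs_def])

text \<open>The norm contains Hoelder quotients of the top order only. Below it the bound on one
  further derivative gives a Lipschitz estimate, and with it a Hoelder estimate uniform in
  \<xi>.\<close>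

lemma B_holder:
  assumes l: "length is \<le> k"
  obtains C where "C \<ge> 0" "\<And>x y \<xi>. norm (B is js x \<xi> - B is js y \<xi>) \<le> C * (norm (x - y) powr \<theta> * japanese_bracket \<xi> powr (m - real (length js)))"
proof (cases "length is = k")
  case True
  obtain C where "C \<ge> 0" "\<And>is x y \<xi>. length is = k \<Longrightarrow> norm (B is js x \<xi> - B is js y \<xi>) \<le> C * japanese_bracket \<xi> powr (m - real (length js)) * norm (x - y) powr \<theta>"
    using B_bounds[of js] by metis
  then show ?thesis using that[of C] True by (simp add: mult_ac)
next
  case False
  then have l': "length is < k" using l by simp
  let ?J = "\<lambda>\<xi>. japanese_bracket \<xi> powr (m - real (length js))"
  obtain C where C: "C \<ge> 0" "\<And>is x \<xi>. length is \<le> k \<Longrightarrow> norm (B is js x \<xi>) \<le> C * ?J \<xi>"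
    using B_bounds[of js] by metis
  define A where "A = max (real DIM(real^'n) * C) C"
  have A: "A \<ge> 0" using C(1) by (simp add: A_def)
  have "norm (B is js x \<xi> - B is js y \<xi>) \<le> 2 * A * (norm (x - y) powr \<theta> * ?J \<xi>)" for x y \<xi>
  proof -
    have "partials (\<lambda>x. B is js x \<xi>) (\<lambda>b x. B (idx b # is) js x \<xi>)"
    proof (rule partialsI)
      show "((\<lambda>t. B is js (x + t *\<^sub>R b) \<xi>) has_vector_derivative B (idx b # is) js x \<xi>) (at 0)" if "b \<in> Basis" for b x
        using B_derivative_x[OF l', of js x "idx b" \<xi>] by (simp add: axis_idx[OF that])
    qed (use l' in \<open>simp add: B_continuous_x\<close>)
    then have "norm (B is js x \<xi> - B is js y \<xi>) \<le> real DIM(real^'n) * (C * ?J \<xi>) * norm (x - y)"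
      by (rule lipschitz_of_partials) (use C(2) l' in simp)
    also have "\<dots> \<le> (A * ?J \<xi>) * norm (x - y)"
      by (intro mult_right_mono) (auto simp: A_def mult.assoc[symmetric] intro!: mult_right_mono)
    finally have "norm (B is js x \<xi> - B is js y \<xi>) \<le> 2 * (A * ?J \<xi>) * norm (x - y) powr \<theta>"
      by (rule holder_of_lipschitz[OF th]) (auto simp: A_def intro!: order_trans[OF C(2)[OF l]] mult_right_mono)
    then show ?thesis by (simp add: mult_ac)
  qed
  then show ?thesis using that[of "2 * A"] A by simp
qed

text \<open>Differentiability in \<xi> of the \<open>x\<close>-derivatives is not part of the
  definition of the class. It follows by induction on the number of \<open>x\<close>-derivatives:
  each step interchanges one of them with the \<xi>-derivative, where the mixed derivative is
  Hoelder in \<open>x\<close>, locally uniformly in \<xi>.\<close>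

lemma B_derivative_xi:
  "length is \<le> k \<Longrightarrow> ((\<lambda>t. B is js x (\<xi> + t *\<^sub>R axis j 1)) has_vector_derivative B is (j # js) x \<xi>) (at 0)"
proof (induction "is" arbitrary: x \<xi>)
  case Nil
  show ?case using smooth_derivative[OF smooth_p] by (simp add: B_def)
next
  case (Cons i "is")
  have l: "length is < k" "length is \<le> k" using Cons.prems by auto
  let ?ei = "axis i 1 :: real^'n" and ?ej = "axis j 1 :: real^'n"
  let ?m = "m - real (length (j # js))"
  define H where "H s t = B (i # is) (j # js) (x + s *\<^sub>R ?ei) (\<xi> + t *\<^sub>R ?ej)" for s t
  have "((\<lambda>t. B (i # is) js x (\<xi> + t *\<^sub>R ?ej)) has_vector_derivative H 0 0) (at 0)"
  proof (rule mixed_partial[where e=1 and F="\<lambda>s t. B is js (x + s *\<^sub>R ?ei) (\<xi> + t *\<^sub>R ?ej)"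
        and Ft="\<lambda>s t. B is (j # js) (x + s *\<^sub>R ?ei) (\<xi> + t *\<^sub>R ?ej)" and H=H])
    show "((\<lambda>s. B is js (x + s *\<^sub>R ?ei) (\<xi> + t *\<^sub>R ?ej)) has_vector_derivative B (i # is) js x (\<xi> + t *\<^sub>R ?ej)) (at 0)" for t
      by (rule B_derivative_x[OF l(1)])
    show "((\<lambda>t. B is js (x + s *\<^sub>R ?ei) (\<xi> + t *\<^sub>R ?ej)) has_vector_derivative B is (j # js) (x + s *\<^sub>R ?ei) (\<xi> + t *\<^sub>R ?ej)) (at t)" for s t
      by (rule has_vector_derivative_line_zero[where F="\<lambda>\<xi>. B is js (x + s *\<^sub>R ?ei) \<xi>", OF Cons.IH[OF l(2)]])
    show "((\<lambda>s. B is (j # js) (x + s *\<^sub>R ?ei) (\<xi> + t *\<^sub>R ?ej)) has_vector_derivative H s t) (at s)" for s t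
      unfolding H_def
      by (rule has_vector_derivative_line_zero[where F="\<lambda>x. B is (j # js) x (\<xi> + t *\<^sub>R ?ej)", OF B_derivative_x[OF l(1)]])
    obtain C where C: "C \<ge> 0" "\<And>x y \<xi>. norm (B (i # is) (j # js) x \<xi> - B (i # is) (j # js) y \<xi>) \<le> C * (norm (x - y) powr \<theta> * japanese_bracket \<xi> powr ?m)"
      using B_holder[OF Cons.prems] by metis
    define M where "M = C * (2 + norm \<xi>) ^ nat \<lceil>?m\<rceil> + 1"
    have M: "M > 0" using C(1) by (simp add: M_def add_nonneg_pos)
    have HM: "norm (H s t - H 0 t) \<le> M * \<bar>s\<bar> powr \<theta>" if t: "\<bar>t\<bar> < 1" for s t
    proof -
      have "norm (t *\<^sub>R ?ej) \<le> 1" using t by simp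
      then have "1 + norm (\<xi> + t *\<^sub>R ?ej) \<le> 2 + norm \<xi>" using norm_triangle_ineq[of \<xi> "t *\<^sub>R ?ej"] by simp
      then have "japanese_bracket (\<xi> + t *\<^sub>R ?ej) powr ?m \<le> (2 + norm \<xi>) ^ nat \<lceil>?m\<rceil>"
        using order_trans[OF jb_powr_le power_mono] by (meson add_nonneg_nonneg norm_ge_zero zero_le_one)
      then have J: "C * japanese_bracket (\<xi> + t *\<^sub>R ?ej) powr ?m \<le> M"
        using mult_left_mono[OF _ C(1)] by (fastforce simp: M_def)
      have "norm (H s t - H 0 t) \<le> (C * japanese_bracket (\<xi> + t *\<^sub>R ?ej) powr ?m) * \<bar>s\<bar> powr \<theta>"
        using C(2)[of "x + s *\<^sub>R ?ei" "\<xi> + t *\<^sub>R ?ej" x] by (simp add: H_def mult_ac)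
      also have "\<dots> \<le> M * \<bar>s\<bar> powr \<theta>" by (rule mult_right_mono[OF J]) simp
      finally show ?thesis .
    qed
    fix \<epsilon> :: real assume e: "\<epsilon> > 0"
    show "\<exists>d>0. \<forall>s t. \<bar>s\<bar> < d \<longrightarrow> \<bar>t\<bar> < 1 \<longrightarrow> norm (H s t - H 0 t) \<le> \<epsilon>"
    \<comment> \<open>The solution of \<open>M * d powr \<theta> = \<epsilon>\<close>.\<close>
    proof (intro exI[of _ "(\<epsilon> / M) powr (1 / \<theta>)"] conjI allI impI)
      show "(\<epsilon> / M) powr (1 / \<theta>) > 0" using e M by simp
      fix s t :: real assume s: "\<bar>s\<bar> < (\<epsilon> / M) powr (1 / \<theta>)" and t: "\<bar>t\<bar> < 1"
      have "\<bar>s\<bar> powr \<theta> \<le> ((\<epsilon> / M) powr (1 / \<theta>)) powr \<theta>" using s th by (intro powr_mono2) auto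
      also have "\<dots> = \<epsilon> / M" using e M th by (simp add: powr_powr)
      finally have "M * \<bar>s\<bar> powr \<theta> \<le> \<epsilon>" using M by (simp add: field_simps)
      with HM[OF t] show "norm (H s t - H 0 t) \<le> \<epsilon>" using order_trans by blast
    qed
  qed simp
  then show ?case by (simp add: H_def)
qed

lemma B_symb:
  assumes l: "length is \<le> k"
  shows "symb UNIV (\<lambda>_. 1) m (B is [])"
    and "symb UNIV (\<lambda>q. norm (fst q - snd q) powr \<theta>) m (\<lambda>q \<eta>. B is [] (fst q) \<eta> - B is [] (snd q) \<eta>)"
proof -
  have d: "((\<lambda>t. B is (map idx bs) x (\<eta> + t *\<^sub>R b)) has_vector_derivative B is (map idx (b # bs)) x \<eta>) (at 0)" if "b \<in> Basis" for b bs x \<eta>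
    using B_derivative_xi[OF l, of "map idx bs" x \<eta> "idx b"] by (simp add: axis_idx[OF that])
  show "symb UNIV (\<lambda>_. 1) m (B is [])"
  proof (rule symbI)
    fix j
    show "bdiff j UNIV (\<lambda>j p \<eta>. 1 * japanese_bracket \<eta> powr (m - real j)) (B is [])"
    proof (rule bdiff_tower[where G="\<lambda>bs. B is (map idx bs)" and \<omega>="\<lambda>j p \<eta>. 1 * japanese_bracket \<eta> powr (m - real j)" and bs="[]", unfolded list.map list.size add_0_right])
      fix bs
      obtain C where "C \<ge> 0" "\<And>is x \<xi>. length is \<le> k \<Longrightarrow> norm (B is (map idx bs) x \<xi>) \<le> C * japanese_bracket \<xi> powr (m - real (length (map idx bs)))"
        using B_bounds[of "map idx bs"] by metis
      then show "\<exists>C\<ge>0. \<forall>p\<in>UNIV. \<forall>x. norm (B is (map idx bs) p x) \<le> C * (1 * japanese_bracket x powr (m - real (length bs)))"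
        using l by (intro exI[of _ C]) simp
    next
      show "continuous_on UNIV (\<lambda>\<eta>::real^'n. 1 * japanese_bracket \<eta> powr (m - real j))" for j
        by (intro continuous_intros continuous_on_powr') auto
    qed (use d in simp_all)
  qed simp
  show "symb UNIV (\<lambda>q. norm (fst q - snd q) powr \<theta>) m (\<lambda>q \<eta>. B is [] (fst q) \<eta> - B is [] (snd q) \<eta>)"
  proof (rule symbI)
    fix j
    let ?\<omega> = "\<lambda>j (q::(real^'n) \<times> (real^'n)) (\<eta>::real^'n). norm (fst q - snd q) powr \<theta> * japanese_bracket \<eta> powr (m - real j)"
    show "bdiff j UNIV ?\<omega> (\<lambda>q \<eta>. B is [] (fst q) \<eta> - B is [] (snd q) \<eta>)"
    proof (rule bdiff_tower[where G="\<lambda>bs q \<eta>. B is (map idx bs) (fst q) \<eta> - B is (map idx bs) (snd q) \<eta>" and \<omega>="?\<omega>" and bs="[]", unfolded list.map list.size add_0_right])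
      fix bs
      obtain C where "C \<ge> 0" "\<And>x y \<xi>. norm (B is (map idx bs) x \<xi> - B is (map idx bs) y \<xi>) \<le> C * (norm (x - y) powr \<theta> * japanese_bracket \<xi> powr (m - real (length (map idx bs))))"
        using B_holder[OF l, of "map idx bs"] by metis
      then show "\<exists>C\<ge>0. \<forall>q\<in>UNIV. \<forall>x. norm (B is (map idx bs) (fst q) x - B is (map idx bs) (snd q) x) \<le> C * ?\<omega> (length bs) q x"
        by (intro exI[of _ C]) simp
    next
      show "continuous_on UNIV (?\<omega> j q)" for j q
        by (intro continuous_intros continuous_on_powr') auto
    next
      fix b :: "real^'n" and bs and q :: "(real^'n) \<times> (real^'n)" and x assume "b \<in> Basis"
      from has_vector_derivative_diff[OF d[OF this, of bs "fst q" x] d[OF this, of bs "snd q" x]]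
      show "((\<lambda>t. B is (map idx bs) (fst q) (x + t *\<^sub>R b) - B is (map idx bs) (snd q) (x + t *\<^sub>R b)) has_vector_derivative
          B is (idx b # map idx bs) (fst q) x - B is (idx b # map idx bs) (snd q) x) (at 0)" by simp
    qed simp
  qed simp
qed

lemma B_HS: "length is + j = k \<Longrightarrow> HS \<theta> j m (B is [])"
proof (induction j arbitrary: "is")
  case 0
  then show ?case using B_symb[of "is"] by simp
next
  case (Suc j)
  show ?case
  proof (rule HS_SucI[where a'="\<lambda>b. B (idx b # is) []"])
    show "((\<lambda>t. B is [] (y + t *\<^sub>R b) \<eta>) has_vector_derivative B (idx b # is) [] y \<eta>) (at 0)" if "b \<in> Basis" for b y \<eta>
      using B_derivative_x[of "is" "[]" y "idx b" \<eta>] Suc.prems by (simp add: axis_idx[OF that])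
  qed (use Suc B_symb(1)[of "is"] in auto)
qed

lemma HS_p: "HS \<theta> k m p"
proof -
  have "B [] [] = p" by (simp add: B_def fun_eq_iff)
  then show ?thesis using B_HS[of "[]" k] by simp
qed

end

primrec iter_ddy :: "'n::finite list \<Rightarrow> (real^'n \<Rightarrow> real^'n \<Rightarrow> 'x::real_normed_vector) \<Rightarrow> real^'n \<Rightarrow> real^'n \<Rightarrow> 'x" where
  "iter_ddy [] a = a"
| "iter_ddy (i # is) a = ddy (axis i 1) (iter_ddy is a)"

lemma iter_partial_ddy: "iter_partial is (\<lambda>x. a x \<xi>) = (\<lambda>x. iter_ddy is a x \<xi>)"
  by (induction "is") (simp_all add: ddy_def[abs_def] partial_deriv_dd)

lemma HS_iter_ddy: "HS \<theta> (length is + j) m a \<Longrightarrow> HS \<theta> j m (iter_ddy is a)"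
proof (induction "is" arbitrary: j)
  case (Cons i "is")
  have "HS \<theta> (Suc j) m (iter_ddy is a)" by (rule Cons.IH) (use Cons.prems in simp)
  then show ?case by (simp add: HS_ddy axis_Basis)
qed simp

lemma HS_0:
  assumes th: "0 < \<theta>" "\<theta> < 1"
  shows "HS \<theta> j m a \<Longrightarrow> HS \<theta> 0 m a"
  by (induction j) (auto dest: HS_Suc_D[OF th] simp del: HS.simps)

lemma C_k_HS:
  assumes th: "0 < \<theta>" "\<theta> < 1" and a: "HS \<theta> k m a"
  shows "C_k k (\<lambda>x. a x \<xi>)"
proof (rule C_k_I)
  fix "is" :: "'a list" and i x assume l: "length is < k"
  have "HS \<theta> (Suc (k - Suc (length is))) m (iter_ddy is a)"
    by (rule HS_iter_ddy) (use a l in simp)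
  from HS_derivative[OF this axis_Basis]
  show "((\<lambda>t. iter_partial is (\<lambda>x. a x \<xi>) (x + t *\<^sub>R axis i 1)) has_vector_derivative ddy (axis i 1) (iter_ddy is a) x \<xi>) (at 0)"
    by (simp add: iter_partial_ddy)
next
  fix "is" :: "'a list" assume l: "length is \<le> k"
  have "HS \<theta> (k - length is) m (iter_ddy is a)"
    by (rule HS_iter_ddy) (use a l in simp)
  from HS_continuous_y[OF th this]
  show "continuous_on UNIV (iter_partial is (\<lambda>x. a x \<xi>))" by (simp add: iter_partial_ddy)
qed

text \<open>Finitely many derivatives occur, so one constant serves for all of them; their Hoelder
  estimates are obtained by descending in \<open>HS\<close> to level \<open>0\<close>.\<close>

lemma HS_holder_space:
  fixes a :: "real^'n::finite \<Rightarrow> real^'n \<Rightarrow> 'x::real_normed_vector" and \<tau> :: real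
  assumes th: "0 < \<theta>" "\<theta> < 1" and \<theta>: "\<theta> = \<tau> - \<lfloor>\<tau>\<rfloor>" and a: "HS \<theta> (nat \<lfloor>\<tau>\<rfloor>) m a"
  shows "\<exists>C. \<forall>\<xi>. holder_norm \<tau> (\<lambda>x. a x \<xi>) \<le> ennreal (C * japanese_bracket \<xi> powr m)"
    and "(\<lambda>x. a x \<xi>) \<in> holder_space \<tau>"
proof -
  let ?k = "nat \<lfloor>\<tau>\<rfloor>" and ?J = "\<lambda>\<xi>. japanese_bracket \<xi> powr m"
  let ?I = "{is :: 'n list. length is \<le> ?k}"
  have D: "HS \<theta> (?k - length is) m (iter_ddy is a)" if "length is \<le> ?k" for "is"
    by (rule HS_iter_ddy) (use a that in simp)
  have fin: "finite ?I" using finite_lists_length_le[of "UNIV :: 'n set" ?k] by simp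
  have "\<exists>C\<ge>0. \<forall>is\<in>?I. \<forall>q\<in>UNIV. norm (iter_ddy is a (fst q) (snd q)) \<le> C * ?J (snd q)"
  proof (rule finite_uniform_bound[OF fin])
    fix "is" :: "'n list" assume "is \<in> ?I"
    then have l: "length is \<le> ?k" by simp
    obtain C where "C \<ge> 0" "\<And>p \<eta>. p \<in> UNIV \<Longrightarrow> norm (iter_ddy is a p \<eta>) \<le> C * (1 * ?J \<eta>)"
      using symb_boundE[OF HS_symb[OF D[OF l]]] by metis
    then show "\<exists>C\<ge>0. \<forall>q\<in>UNIV. norm (iter_ddy is a (fst q) (snd q)) \<le> C * ?J (snd q)"
      by (intro exI[of _ C]) simp
  qed simp
  then obtain C1 where C1: "C1 \<ge> 0" "\<And>is x \<xi>. length is \<le> ?k \<Longrightarrow> norm (iter_ddy is a x \<xi>) \<le> C1 * ?J \<xi>"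
    by auto
  have "\<exists>C\<ge>0. \<forall>is\<in>?I. \<forall>q\<in>UNIV. norm (iter_ddy is a (fst q) (snd (snd q)) - iter_ddy is a (fst (snd q)) (snd (snd q)))
      \<le> C * (norm (fst q - fst (snd q)) powr \<theta> * ?J (snd (snd q)))"
  proof (rule finite_uniform_bound[OF fin])
    fix "is" :: "'n list" assume "is \<in> ?I"
    then have l: "length is \<le> ?k" by simp
    obtain C where "C \<ge> 0" "\<And>y y' \<eta>. norm (iter_ddy is a y \<eta> - iter_ddy is a y' \<eta>) \<le> C * (norm (y - y') powr \<theta> * ?J \<eta>)"
      using HS_pair_bound[OF HS_0[OF th D[OF l]]] by metis
    then show "\<exists>C\<ge>0. \<forall>q\<in>UNIV. norm (iter_ddy is a (fst q) (snd (snd q)) - iter_ddy is a (fst (snd q)) (snd (snd q)))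
      \<le> C * (norm (fst q - fst (snd q)) powr \<theta> * ?J (snd (snd q)))"
      by (intro exI[of _ C]) simp
  qed simp
  then obtain C2 where C2: "C2 \<ge> 0" "\<And>is x y \<xi>. length is \<le> ?k \<Longrightarrow>
      norm (iter_ddy is a x \<xi> - iter_ddy is a y \<xi>) \<le> C2 * (norm (x - y) powr \<theta> * ?J \<xi>)"
    by auto
  define C where "C = max C1 C2"
  have C: "C \<ge> 0" "C1 * r \<le> C * r" "C2 * r \<le> C * r" if "r \<ge> 0" for r
    using C1(1) that by (auto simp: C_def intro!: mult_right_mono)
  have b1: "norm (iter_partial is (\<lambda>x. a x \<xi>) x) \<le> C * ?J \<xi>" if "length is \<le> ?k" for "is" x \<xi>
    unfolding iter_partial_ddy by (rule order_trans[OF C1(2)[OF that] C(2)]) simp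
  have b2: "norm (iter_partial is (\<lambda>x. a x \<xi>) z - iter_partial is (\<lambda>x. a x \<xi>) y) \<le> C * ?J \<xi> * norm (z - y) powr \<theta>"
    if "length is \<le> ?k" for "is" z y \<xi>
    unfolding iter_partial_ddy using order_trans[OF C2(2)[OF that] C(3)] by (simp add: mult_ac)
  note Ck = C_k_HS[OF th a]
  let ?c = "real (card {\<beta> :: 'n multi_index. mi_order \<beta> \<le> ?k} + card {\<beta> :: 'n multi_index. mi_order \<beta> = ?k})"
  have n: "holder_norm \<tau> (\<lambda>x. a x \<xi>) \<le> ennreal (?c * (C * ?J \<xi>))" for \<xi>
    by (rule holder_normI[OF Ck _ b1 b2[unfolded \<theta>]]) (use C(1)[of 0] in simp)
  then show "\<exists>C. \<forall>\<xi>. holder_norm \<tau> (\<lambda>x. a x \<xi>) \<le> ennreal (C * ?J \<xi>)"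
    by (intro exI[of _ "?c * C"]) (simp add: mult.assoc)
  have h: "holder_continuous (\<tau> - \<lfloor>\<tau>\<rfloor>) (mderiv \<beta> (\<lambda>x. a x \<xi>))" if \<beta>: "mi_order \<beta> \<le> ?k" for \<beta>
  proof -
    obtain "is" where "is": "count_list is = \<beta>" "length is = mi_order \<beta>" using multi_index_list by blast
    then have "mderiv \<beta> (\<lambda>x. a x \<xi>) = iter_partial is (\<lambda>x. a x \<xi>)" using mderiv_eq[OF Ck, of "is" \<xi>] \<beta> by simp
    then show ?thesis
      unfolding holder_continuous_def \<theta>[symmetric] using b2[of "is" \<xi>] "is"(2) \<beta> by (intro exI[of _ "C * ?J \<xi>"]) simp
  qed
  have "holder_norm \<tau> (\<lambda>x. a x \<xi>) < \<infinity>" by (rule le_less_trans[OF n]) simp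
  then show "(\<lambda>x. a x \<xi>) \<in> holder_space \<tau>"
    using Ck h by (simp add: holder_space_def)
qed

lemma HS_iter_partial:
  assumes th: "0 < \<theta>" "\<theta> < 1" and a: "HS \<theta> k m a"
  shows "HS \<theta> k (m - real (length js)) (\<lambda>y. iter_partial js (a y))"
proof (induction js)
  case (Cons j js)
  from HS_dd[OF th axis_Basis Cons] show ?case by (simp add: partial_deriv_dd algebra_simps)
qed (use a in simp)

lemma smooth_symb:
  assumes th: "0 < \<theta>" "\<theta> < 1" and a: "HS \<theta> k m a"
  shows "smooth (a y)"
  unfolding smooth_def
proof
  fix r
  note s = HS_symb[OF HS_iter_partial[OF th a]]
  show "C_k r (a y)"
  proof (rule C_k_I)
    fix js i \<eta>
    show "((\<lambda>t. iter_partial js (a y) (\<eta> + t *\<^sub>R axis i 1)) has_vector_derivative dd (axis i 1) (iter_partial js (a y)) \<eta>) (at 0)"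
      using symb_const_dd[OF s UNIV_I axis_Basis, of js y \<eta> i 0] by simp
    show "continuous_on UNIV (iter_partial js (a y))"
      by (rule bdiff_continuous[OF symb_bdiff[OF s, of 0] UNIV_I])
  qed
qed

lemma HS_holder_symbols:
  fixes a :: "real^'n::finite \<Rightarrow> real^'n \<Rightarrow> 'x::real_normed_vector" and \<tau> :: real
  assumes th: "0 < \<theta>" "\<theta> < 1" and \<theta>: "\<theta> = \<tau> - \<lfloor>\<tau>\<rfloor>" and a: "HS \<theta> (nat \<lfloor>\<tau>\<rfloor>) m a" and X: "\<And>x \<xi>. a x \<xi> \<in> X"
  shows "a \<in> holder_symbols \<tau> m X"
proof -
  note sm = smooth_symb[OF th a]
  have 1: "(\<lambda>x. mderiv \<alpha> (a x) \<xi>) \<in> holder_space \<tau>"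
    and 2: "\<exists>C. \<forall>\<xi>. holder_norm \<tau> (\<lambda>x. mderiv \<alpha> (a x) \<xi>) \<le> ennreal (C * japanese_bracket \<xi> powr (m - real (mi_order \<alpha>)))" for \<alpha> \<xi>
  proof -
    obtain js where js: "count_list js = \<alpha>" "length js = mi_order \<alpha>" using multi_index_list by blast
    have eq: "mderiv \<alpha> (a x) = iter_partial js (a x)" for x using smooth_mderiv_eq[OF sm, of js x] js(1) by simp
    note h = HS_holder_space[OF th \<theta> HS_iter_partial[OF th a, of js]]
    show "(\<lambda>x. mderiv \<alpha> (a x) \<xi>) \<in> holder_space \<tau>" unfolding eq by (rule h(2))
    show "\<exists>C. \<forall>\<xi>. holder_norm \<tau> (\<lambda>x. mderiv \<alpha> (a x) \<xi>) \<le> ennreal (C * japanese_bracket \<xi> powr (m - real (mi_order \<alpha>)))"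
      unfolding eq using h(1) js(2) by simp
  qed
  show ?thesis unfolding holder_symbols_def using X sm 1 2 by blast
qed

theorem theorem3p1:
  fixes \<kappa> :: "real^'n::finite \<Rightarrow> real^'n"
    and m \<tau> :: real
    and p :: "real^'n \<Rightarrow> real^'n \<Rightarrow> 'a::complex_banach \<Rightarrow>\<^sub>L 'b::complex_banach"
  assumes "bounded_smooth_diffeo \<kappa>"
    and "\<tau> > 0" and "\<tau> \<notin> \<nat>"
    and "p \<in> holder_symbols \<tau> m clinear_ops"
  shows "\<exists>q \<in> holder_symbols \<tau> m (clinear_ops :: ('a \<Rightarrow>\<^sub>L 'b) set).
    \<forall>f \<in> schwartz_space. \<forall>x.
      pdo q f x = (pullback (inv \<kappa>) \<circ> pdo p \<circ> pullback \<kappa>) f x"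
proof -
  interpret diffeo \<kappa> "inv \<kappa>" by (rule diffeo_of_bounded_smooth_diffeo[OF assms(1)])
  interpret symcalc \<kappa> "inv \<kappa>" "opC :: ('a \<Rightarrow>\<^sub>L 'b) \<Rightarrow> complex \<Rightarrow> _" by (rule symcalc_opC)
  define \<theta> where "\<theta> = \<tau> - \<lfloor>\<tau>\<rfloor>"
  define k where "k = nat \<lfloor>\<tau>\<rfloor>"
  have "\<tau> \<noteq> of_int \<lfloor>\<tau>\<rfloor>"
  proof
    assume "\<tau> = of_int \<lfloor>\<tau>\<rfloor>"
    then have "\<tau> = of_nat (nat \<lfloor>\<tau>\<rfloor>)" using assms(2) by simp
    then show False using assms(3) Nats_def by blast
  qed
  then have th: "0 < \<theta>" "\<theta> < 1" unfolding \<theta>_def by linarith+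
  interpret holder_symbol \<tau> m \<theta> k p clinear_ops
    by (rule holder_symbol.intro[OF assms(4) th \<theta>_def k_def])
  have sp: "spoly (p y)" for y by (rule symb_spoly[OF HS_symb[OF HS_p] UNIV_I])
  have cp: "p y \<eta> \<in> clinear_ops" for y \<eta> using assms(4) by (simp add: holder_symbols_def)
  let ?c = "inverse ((2 * pi) ^ CARD('n))"
  \<comment> \<open>The oscillatory integral is formed at \<open>y = inv \<kappa> x\<close>;
    \<open>?c\<close> is the normalisation of Fourier inversion. Regularity is established in
    \<open>y\<close> and carried over to \<open>x\<close> by composition with the inverse
    diffeomorphism.\<close>
  define q where "q x \<xi> = ?c *\<^sub>R transf (p (inv \<kappa> x)) (inv \<kappa> x) \<xi>" for x \<xi>
  have "HS \<theta> k m (\<lambda>y. transf (p y) y)"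
    unfolding transf_def[abs_def] by (rule bval_HS[OF th HS_p sbd_1_const])
  then have "HS \<theta> k m (\<lambda>x. transf (p (inv \<kappa> x)) (inv \<kappa> x))"
    by (rule HS_compose[OF th partials_k' sbd_k', rotated])
  from HS_linear[OF bounded_linear_scaleR_right this, of ?c] have "HS \<theta> k m q" by (simp add: q_def[abs_def])
  moreover have "q x \<xi> \<in> clinear_ops" for x \<xi>
    using transf_clinear[OF sp cp, of "inv \<kappa> x" "inv \<kappa> x" \<xi>] by (simp add: q_def clinear_ops_def blinfun.scaleR_left scaleC_scaleR)
  ultimately have q: "q \<in> holder_symbols \<tau> m clinear_ops"
    using HS_holder_symbols[OF th \<theta>_def] unfolding k_def by blast
  have "pdo q f x = (pullback (inv \<kappa>) \<circ> pdo p \<circ> pullback \<kappa>) f x" if "f \<in> schwartz_space" for f x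
  proof -
    let ?y = "inv \<kappa> x"
    have "pdo q f x = ?c *\<^sub>R integral UNIV (\<lambda>\<xi>. ?c *\<^sub>R (cis (\<kappa> ?y \<bullet> \<xi>) *\<^sub>C blinfun_apply (transf (p ?y) ?y \<xi>) (fourier f \<xi>)))"
      by (simp only: pdo_def q_def inv2 blinfun.scaleR_left scaleC_scaleR)
    \<comment> \<open>One factor \<open>?c\<close> belongs to \<open>pdo\<close>, the other to
      \<open>q\<close>; the latter cancels the power of \<open>2 * pi\<close> from the conjugation
      identity.\<close>
    also have "\<dots> = ?c *\<^sub>R ?c *\<^sub>R (2 * pi) ^ CARD('n) *\<^sub>R integral UNIV (\<lambda>\<eta>. cis (?y \<bullet> \<eta>) *\<^sub>C blinfun_apply (p ?y \<eta>) (fourier (\<lambda>z. f (\<kappa> z)) \<eta>))"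
      by (simp only: integral_cmul transf_identity[OF sp cp rapid_schwartz[OF that]])
    also have "\<dots> = pdo p (\<lambda>z. f (\<kappa> z)) ?y"
    proof -
      have "(2 * pi) ^ CARD('n) \<noteq> 0" by simp
      from left_inverse[OF this] show ?thesis by (simp only: pdo_def scaleR_scaleR mult.assoc mult_1_right)
    qed
    finally show ?thesis by (simp add: pullback_def comp_def)
  qed
  with q show ?thesis by blast
qed

end
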